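(* Let $d\ge3$ and let $\varphi:\mathbb{P}^1\to\mathbb{P}^2$ be a maximally inflected plane curve of degree $d$ with $\kappa$ (real) cusps and $\iota=3(d-2)-2\kappa$ (real) flexes, whose remaining singularities are nodes. Let $\delta$, $\eta$, and $c$ be the numbers of solitary points, of real nodes, and of complex conjugate pairs of complex nodes of $\varphi$, respectively, which satisfy $\delta+\eta+2c=\binom{d-1}{2}-\kappa=:g_\kappa$. If $\kappa\le d-2$, then these additionally satisfy $$d-2-\kappa\ \le\ \delta\ \le\ g_\kappa,\qquad 0\ \le\ \eta+2c\ \le\ \binom{d-2}{2}.$$ If $d-2\le\kappa$ (and $\kappa$ is at most $3(d-2)/2$), then they satisfy $$0\ \le\ \delta\ \le\ \binom{2d-4-\kappa}{2},\qquad g_\kappa-\binom{2d-4-\kappa}{2}\ \le\ \eta+2c\ \le\ g_\kappa .$$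
   Context: A rational plane curve of degree $d>2$ is a morphism $\varphi=[\varphi_0,\varphi_1,\varphi_2]:\mathbb{P}^1\to\mathbb{P}^2$ given by three coprime, linearly independent binary forms of degree $d$ (over $\mathbb{C}$), up to projective transformations of $\mathbb{P}^2$. The ramification sequence of $\varphi$ at $s\in\mathbb{P}^1$ is $\alpha=(0,\alpha_1,\alpha_2)$, $0<\alpha_1<\alpha_2$, such that in suitable coordinates of $\mathbb{P}^2$ the components of $\varphi$ vanish at $s$ to orders exactly $0,\alpha_1,\alpha_2$. The point $s$ is a ramification point if $\alpha\neq(0,1,2)$; it is a flex if $\alpha=(0,1,3)$ and a cusp if $\alpha=(0,2,3)$. The curve is maximally inflected if $\varphi$ is real (given by real forms) and all of its ramification points lie in $\mathbb{RP}^1$. Always $\sum_s(\alpha_1(s)-1+\alpha_2(s)-2)=3(d-2)$, so here the cusps and flexes are all the ramification points. A node is an ordinary double point of the image curve. A real node is a node in $\mathbb{RP}^2$ with two real tangents; a solitary point is a node in $\mathbb{RP}^2$ with complex conjugate tangents; a complex node is a node not in $\mathbb{RP}^2$ (these occur in complex conjugate pairs). *)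

theory Defs
  imports "HOL-Analysis.Analysis"
begin

section \<open>Forms over the complex numbers\<close>

text \<open>Forms (homogeneous polynomials) in the variables indexed by \<open>'n\<close> are treated as
  polynomial functions; over the infinite field of complex numbers nothing is lost. The degree of
  the zero form is not determined. Exponent vectors are functions \<open>a :: 'n \<Rightarrow> nat\<close>.\<close>

definition form_of :: "nat \<Rightarrow> (('n::finite \<Rightarrow> nat) \<Rightarrow> complex) \<Rightarrow> complex ^ 'n \<Rightarrow> complex" where
  "form_of n c x = (\<Sum>a | (\<Sum>i\<in>UNIV. a i) = n. c a * (\<Prod>i\<in>UNIV. (x $ i) ^ a i))"

definition is_form :: "nat \<Rightarrow> (complex ^ 'n::finite \<Rightarrow> complex) \<Rightarrow> bool" where
  "is_form n G \<longleftrightarrow> (\<exists>c. G = form_of n c)"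

definition is_real_form :: "nat \<Rightarrow> (complex ^ 'n::finite \<Rightarrow> complex) \<Rightarrow> bool" where
  "is_real_form n G \<longleftrightarrow> (\<exists>c. (\<forall>a. c a \<in> \<real>) \<and> G = form_of n c)"

text \<open>The \<open>k\<close>-th derivative at \<open>v\<close> in direction \<open>w\<close>.\<close>

definition dir_deriv :: "nat \<Rightarrow> (complex ^ 'n::finite \<Rightarrow> complex) \<Rightarrow> complex ^ 'n \<Rightarrow> complex ^ 'n \<Rightarrow> complex"
  where "dir_deriv k G v w = (deriv ^^ k) (\<lambda>t. G (v + t *s w)) 0"

text \<open>For a form \<open>G\<close> and \<open>v \<noteq> 0\<close>, homogeneity makes this the order of vanishing of \<open>G\<close> at the
  point \<open>[v]\<close> of projective space: if \<open>G v = 0\<close>, then all derivatives in the direction \<open>v\<close> itself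
  are zero.\<close>

definition vanishes_to_order :: "(complex ^ 'n::finite \<Rightarrow> complex) \<Rightarrow> complex ^ 'n \<Rightarrow> nat \<Rightarrow> bool" where
  "vanishes_to_order G v k \<longleftrightarrow>
     (\<forall>j<k. \<forall>w. dir_deriv j G v w = 0) \<and> (\<exists>w. dir_deriv k G v w \<noteq> 0)"


section \<open>Projective spaces\<close>

text \<open>Points of projective space are one-dimensional subspaces of \<open>\<complex>\<^sup>n\<close>, lines are two-dimensional
  ones.\<close>

definition proj_pt :: "complex ^ 'n::finite \<Rightarrow> (complex ^ 'n) set" where
  "proj_pt v = vec.span {v}"

text \<open>A real subspace is the complexification of a subspace of \<open>\<real>\<^sup>n\<close>; in dimension one these are
  the points of real projective space.\<close>

definition real_subspace :: "(complex ^ 'n::finite) set \<Rightarrow> bool" where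
  "real_subspace L \<longleftrightarrow> (\<exists>B. (\<forall>v\<in>B. \<forall>i. v $ i \<in> \<real>) \<and> L = vec.span B)"

definition conj_subspace :: "(complex ^ 'n::finite) set \<Rightarrow> (complex ^ 'n) set" where
  "conj_subspace L = (\<lambda>v. \<chi> i. cnj (v $ i)) ` L"


section \<open>Rational plane curves and their ramification\<close>

text \<open>The third condition is coprimality of the components: every divisor of a nonzero form is a
  form, so it says that all common divisors are constant.\<close>

definition rational_plane_curve :: "nat \<Rightarrow> (complex ^ 2 \<Rightarrow> complex ^ 3) \<Rightarrow> bool" where
  "rational_plane_curve d \<phi> \<longleftrightarrow>
     d > 2 \<and>
     (\<forall>i. is_form d (\<lambda>x. \<phi> x $ i)) \<and>
     (\<forall>m h. is_form m h \<and> (\<forall>i. \<exists>n g. is_form n g \<and> (\<forall>x. \<phi> x $ i = h x * g x)) \<longrightarrow> m = 0) \<and>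
     (\<forall>b::complex ^ 3. (\<forall>x. (\<Sum>i\<in>UNIV. b $ i * \<phi> x $ i) = 0) \<longrightarrow> b = 0)"

definition has_ramification :: "(complex ^ 2 \<Rightarrow> complex ^ 3) \<Rightarrow> complex ^ 2 \<Rightarrow> nat \<Rightarrow> nat \<Rightarrow> bool" where
  "has_ramification \<phi> x \<alpha>1 \<alpha>2 \<longleftrightarrow>
     0 < \<alpha>1 \<and> \<alpha>1 < \<alpha>2 \<and>
     (\<exists>A::complex ^ 3 ^ 3. invertible A \<and>
        vanishes_to_order (\<lambda>z. (A *v \<phi> z) $ 1) x 0 \<and>
        vanishes_to_order (\<lambda>z. (A *v \<phi> z) $ 2) x \<alpha>1 \<and>
        vanishes_to_order (\<lambda>z. (A *v \<phi> z) $ 3) x \<alpha>2)"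

definition ramification_points :: "(complex ^ 2 \<Rightarrow> complex ^ 3) \<Rightarrow> (complex ^ 2) set set" where
  "ramification_points \<phi> =
     {proj_pt x |x. x \<noteq> 0 \<and> (\<exists>\<alpha>1 \<alpha>2. has_ramification \<phi> x \<alpha>1 \<alpha>2 \<and> (\<alpha>1, \<alpha>2) \<noteq> (1, 2))}"

definition flexes :: "(complex ^ 2 \<Rightarrow> complex ^ 3) \<Rightarrow> (complex ^ 2) set set" where
  "flexes \<phi> = {proj_pt x |x. x \<noteq> 0 \<and> has_ramification \<phi> x 1 3}"

definition cusps :: "(complex ^ 2 \<Rightarrow> complex ^ 3) \<Rightarrow> (complex ^ 2) set set" where
  "cusps \<phi> = {proj_pt x |x. x \<noteq> 0 \<and> has_ramification \<phi> x 2 3}"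

definition maximally_inflected :: "nat \<Rightarrow> (complex ^ 2 \<Rightarrow> complex ^ 3) \<Rightarrow> bool" where
  "maximally_inflected d \<phi> \<longleftrightarrow>
     rational_plane_curve d \<phi> \<and>
     (\<forall>i. is_real_form d (\<lambda>x. \<phi> x $ i)) \<and>
     (\<forall>s\<in>ramification_points \<phi>. real_subspace s)"


section \<open>Singularities of the image curve\<close>

definition image_curve :: "(complex ^ 2 \<Rightarrow> complex ^ 3) \<Rightarrow> (complex ^ 3) set set" where
  "image_curve \<phi> = {proj_pt (\<phi> x) |x. x \<noteq> 0}"

definition vanishing_forms :: "(complex ^ 3) set set \<Rightarrow> (complex ^ 3 \<Rightarrow> complex) set" where
  "vanishing_forms X = {G. (\<exists>n. is_form n G) \<and> (\<forall>p\<in>X. \<forall>v\<in>p. G v = 0)}"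

text \<open>The homogeneous ideal of a plane curve \<open>X\<close> is generated by the reduced equation \<open>F\<close> of \<open>X\<close>.
  The minimal order at \<open>[v]\<close> of the elements of the ideal is therefore the order of \<open>F\<close>, which is
  the multiplicity of \<open>X\<close> at \<open>[v]\<close>, and the common zeros of their terms of that order are the
  zeros of the leading form of \<open>F\<close>, that is, the tangents of \<open>X\<close> at \<open>[v]\<close>.\<close>

definition curve_mult :: "(complex ^ 3) set set \<Rightarrow> complex ^ 3 \<Rightarrow> nat" where
  "curve_mult X v = (LEAST m. \<exists>G\<in>vanishing_forms X. \<exists>w. dir_deriv m G v w \<noteq> 0)"

definition tangent_lines :: "(complex ^ 3) set set \<Rightarrow> complex ^ 3 \<Rightarrow> (complex ^ 3) set set" where
  "tangent_lines X v =
     {vec.span {v, w} |w. w \<notin> vec.span {v} \<and>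
        (\<forall>G\<in>vanishing_forms X. dir_deriv (curve_mult X v) G v w = 0)}"

definition singular_points :: "(complex ^ 3) set set \<Rightarrow> (complex ^ 3) set set" where
  "singular_points X = {proj_pt v |v. v \<noteq> 0 \<and> proj_pt v \<in> X \<and> curve_mult X v \<ge> 2}"

definition ordinary_double_point :: "(complex ^ 3) set set \<Rightarrow> complex ^ 3 \<Rightarrow> bool" where
  "ordinary_double_point X v \<longleftrightarrow>
     v \<noteq> 0 \<and> proj_pt v \<in> X \<and> curve_mult X v = 2 \<and> card (tangent_lines X v) = 2"

definition nodes :: "(complex ^ 3) set set \<Rightarrow> (complex ^ 3) set set" where
  "nodes X = {proj_pt v |v. ordinary_double_point X v}"

definition real_nodes :: "(complex ^ 3) set set \<Rightarrow> (complex ^ 3) set set" where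
  "real_nodes X =
     {proj_pt v |v. ordinary_double_point X v \<and> real_subspace (proj_pt v) \<and>
        (\<forall>T\<in>tangent_lines X v. real_subspace T)}"

definition solitary_points :: "(complex ^ 3) set set \<Rightarrow> (complex ^ 3) set set" where
  "solitary_points X =
     {proj_pt v |v. ordinary_double_point X v \<and> real_subspace (proj_pt v) \<and>
        (\<exists>T. T \<noteq> conj_subspace T \<and> tangent_lines X v = {T, conj_subspace T})}"

definition complex_nodes :: "(complex ^ 3) set set \<Rightarrow> (complex ^ 3) set set" where
  "complex_nodes X = {p \<in> nodes X. \<not> real_subspace p}"

definition complex_node_pairs :: "(complex ^ 3) set set \<Rightarrow> (complex ^ 3) set set set" where
  "complex_node_pairs X = {{p, conj_subspace p} |p. p \<in> complex_nodes X}"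

text \<open>A cusp of \<open>\<phi>\<close> is a condition on one branch of the image curve. A point of the plane is a
  cusp of the image curve only if no other branch passes through it.\<close>

definition image_cusps :: "(complex ^ 2 \<Rightarrow> complex ^ 3) \<Rightarrow> (complex ^ 3) set set" where
  "image_cusps \<phi> =
     {proj_pt (\<phi> x) |x. x \<noteq> 0 \<and> proj_pt x \<in> cusps \<phi> \<and>
        (\<forall>y. y \<noteq> 0 \<and> proj_pt (\<phi> y) = proj_pt (\<phi> x) \<longrightarrow> proj_pt y = proj_pt x)}"

end

theory Submission
 imports Defs "HOL-Complex_Analysis.Complex_Analysis" "HOL-Computational_Algebra.Computational_Algebra"
  "HOL-Combinatorics.Permutations"
begin

text \<open>
  In a real affine chart of the line, \<open>\<phi>\<close> is a vector \<open>P\<close> of three real polynomials. Three counts are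
  combined. First, for a generic projection \<open>x = g/f\<close>, \<open>y = h/f\<close> of degree \<open>d\<close>, the product of the
  differences \<open>(y(t\<^sub>i) - y(t\<^sub>j)) / (t\<^sub>i - t\<^sub>j)\<close> over the fibre of \<open>x\<close> is a polynomial in \<open>x\<close> of degree
  \<open>(d - 1) (d - 2)\<close>, with a simple zero for every parameter of a node and a double zero for every
  cusp. Second, the same count, as an inequality, for the dual curve \<open>P \<times> P'\<close>, divided by its zeros
  at the cusps, bounds the number of bitangents. Third, Klein's formula: the zeros of
  \<open>det (P s, P' s, P (cnj s)) / (cnj s - s)\<^sup>2\<close> on the Riemann sphere, counted with their local
  winding numbers, compare flexes, cusps, solitary points and bitangents with conjugate contacts.
  Finally the double points of the parametrization are the nodes: a single smooth
  branch is cut out by an explicit equation with nonzero differential, and at a node two branches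
  with a common tangent, or a cusp, would force infinitely many double points.
\<close>

section \<open>Vectors of polynomials\<close>

text \<open>Let m = 2 (d - 1) - \<kappa> be the degree of the dual curve and \<tau> the number of
  conjugate pairs of parameters with a common tangent. Klein's formula becomes \<delta> = \<tau> + d
  - 2 - \<kappa>. So \<tau> >= 0 is the lower bound for \<delta>, the dual bound 2 \<tau> + 2
  \<iota> <= (m - 1) (m - 2) becomes the upper bound, and the genus count turns both into bounds for
  \<eta> + 2 c. Nothing is assumed about the dual curve: its branches may meet in any number and
  with any contact. Hence the dual count is only an inequality, and it says something only if the
  product polynomial is not zero. This requires that only finitely many pairs of parameters share a
  tangent line, which is extracted from the fact that flexes and cusps exhaust the total
  ramification. A second obstacle is that nodes and their tangents are defined through the forms
  vanishing on the image, while the counts concern pairs of parameters; the passage between the two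
  needs explicit equations. Finally, the chart is chosen so that the parameter at infinity is
  neither ramified nor over a double point.\<close>

definition vcross :: "'a::comm_ring_1 ^ 3 => 'a ^ 3 => 'a ^ 3" where
 "vcross u v = vector [u$2 * v$3 - u$3 * v$2, u$3 * v$1 - u$1 * v$3, u$1 * v$2 - u$2 * v$1]"

definition vdot :: "'a::comm_ring_1 ^ 3 => 'a ^ 3 => 'a" where
 "vdot u v = u$1 * v$1 + u$2 * v$2 + u$3 * v$3"

definition vdet :: "'a::comm_ring_1 ^ 3 => 'a ^ 3 => 'a ^ 3 => 'a" where
 "vdet u v w = vdot u (vcross v w)"

lemma vcross_nth [simp]:
 "vcross u v $ 1 = u$2 * v$3 - u$3 * v$2"
 "vcross u v $ 2 = u$3 * v$1 - u$1 * v$3"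
 "vcross u v $ 3 = u$1 * v$2 - u$2 * v$1"
 by (simp_all add: vcross_def)

lemmas v3_simps = vec_eq_iff forall_3 vdot_def vdet_def

lemma vcross_simps [simp]: "vcross 0 v = 0" "vcross v 0 = 0" "vcross v v = 0"
 by (simp_all add: v3_simps algebra_simps)

lemma vcross_bilinear:
 "vcross (u + u') v = vcross u v + vcross u' v" "vcross u (v + v') = vcross u v + vcross u v'"
 "vcross (u - u') v = vcross u v - vcross u' v" "vcross u (v - v') = vcross u v - vcross u v'"
 "vcross (c *s u) v = c *s vcross u v" "vcross u (c *s v) = c *s vcross u v"
 by (simp_all add: v3_simps algebra_simps)

lemma vcross_skew: "vcross u v = - vcross v u"
 by (simp add: v3_simps algebra_simps)

lemma vcross_eq_0_commute: "vcross u v = 0 \<longleftrightarrow> vcross v u = 0"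
 by (metis vcross_skew neg_equal_0_iff_equal)

lemma vdot_bilinear:
 "vdot (u + u') v = vdot u v + vdot u' v" "vdot u (v + v') = vdot u v + vdot u v'"
 "vdot (u - u') v = vdot u v - vdot u' v" "vdot u (v - v') = vdot u v - vdot u v'"
 "vdot (c *s u) v = c * vdot u v" "vdot u (c *s v) = c * vdot u v"
 "vdot 0 v = 0" "vdot u 0 = 0"
 by (simp_all add: v3_simps algebra_simps)

lemma vdot_commute: "vdot u v = vdot v u"
 by (simp add: v3_simps algebra_simps)

lemma vdot_vcross_self [simp]:
 "vdot u (vcross u v) = 0" "vdot v (vcross u v) = 0" "vdot (vcross u v) u = 0" "vdot (vcross u v) v = 0"
 by (simp_all add: v3_simps algebra_simps)

lemma vdet_simps [simp]: "vdet u u v = 0" "vdet u v u = 0" "vdet v u u = 0"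
 by (simp_all add: v3_simps algebra_simps)

lemma vdet_scale:
 "vdet (c *s u) v w = c * vdet u v w" "vdet u (c *s v) w = c * vdet u v w"
 "vdet u v (c *s w) = c * vdet u v w"
 by (simp_all add: v3_simps algebra_simps)

lemma vdet_add:
 "vdet (u + u') v w = vdet u v w + vdet u' v w" "vdet u (v + v') w = vdet u v w + vdet u v' w"
 "vdet u v (w + w') = vdet u v w + vdet u v w'"
 by (simp_all add: v3_simps algebra_simps)

lemma vcross_vcross: "vcross (vcross u v) (vcross u w) = vdet u v w *s u"
 by (simp add: v3_simps algebra_simps)

lemma vcross_vcross_left: "vcross (vcross u v) w = vdot u w *s v - vdot v w *s u"
 by (simp add: v3_simps algebra_simps)

lemma vdot_vcross_vcross:
 "vdot (vcross a b) (vcross u v) = vdot a u * vdot b v - vdot a v * vdot b u"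
 by (simp add: v3_simps algebra_simps)

lemma vcramer: "vdet u v w *s x = vdet x v w *s u + vdet u x w *s v + vdet u v x *s w"
 by (simp add: v3_simps algebra_simps)

text \<open>Cramer's rule in the dual basis: up to the factor \<open>vdet u v w\<close>, that basis
  consists of the cross products.\<close>

lemma vcramer': "vdet u v w *s x = vdot u x *s vcross v w + vdot v x *s vcross w u + vdot w x *s vcross u v"
 by (simp add: v3_simps algebra_simps)

lemma vcross_eq_0_iff:
 fixes u v :: "'a::field ^ 3"
 assumes "u ~= 0"
 shows "vcross u v = 0 \<longleftrightarrow> (\<exists>c. v = c *s u)"
proof
 assume *: "vcross u v = 0"
 from assms obtain i where i: "u $ i ~= 0" by (auto simp: vec_eq_iff)
 have "u $ i *s v = v $ i *s u"
  using * by (cases i rule: exhaust_3[THEN disjE]) (auto simp: v3_simps algebra_simps)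
 hence "v = (v $ i / u $ i) *s u"
  using i by (simp add: vec_eq_iff field_simps)
 thus "\<exists>c. v = c *s u" ..
qed (auto simp: vcross_bilinear)

lemma vcross_eq_0_trans:
 fixes u v w :: "'a::field ^ 3"
 assumes "u ~= 0" "vcross u v = 0" "vcross u w = 0"
 shows "vcross v w = 0"
 using assms by (auto simp: vcross_eq_0_iff vcross_bilinear)

lemma vdot_all_eq_0:
 fixes u v w x :: "'a::field ^ 3"
 assumes "vdet u v w ~= 0" "vdot u x = 0" "vdot v x = 0" "vdot w x = 0"
 shows "x = 0"
 using vcramer'[of u v w x] assms by simp

lemma vperp2:
 fixes u v x :: "'a::field ^ 3"
 assumes "vcross u v ~= 0" "vdot u x = 0" "vdot v x = 0"
 shows "vcross (vcross u v) x = 0"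
 using assms by (simp add: vcross_vcross_left)

lemma vdet_eq_0_span:
 fixes u v w :: "'a::field ^ 3"
 assumes "vcross u v ~= 0" "vdet u v w = 0"
 shows "\<exists>a b. w = a *s u + b *s v"
proof -
 obtain x where x: "vdet u v x ~= 0"
 proof -
  from assms(1) obtain i where "vcross u v $ i ~= 0" by (auto simp: vec_eq_iff)
  hence "vdet u v (axis i 1) ~= 0"
   by (cases i rule: exhaust_3[THEN disjE]) (auto simp: v3_simps axis_def algebra_simps)
  thus ?thesis using that by blast
 qed
 have "vdet u v x *s w = vdet w v x *s u + vdet u w x *s v"
  using vcramer[of u v x w] assms(2) by simp
 hence "w = (1 / vdet u v x) *s (vdet w v x *s u + vdet u w x *s v)"
  using x by (metis (no_types, lifting) divide_self_if mult.commute times_divide_eq_left vector_smult_assoc vector_smult_lid mult_1)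
 hence "w = (vdet w v x / vdet u v x) *s u + (vdet u w x / vdet u v x) *s v"
  by (simp add: vector_add_ldistrib vector_smult_assoc)
 thus ?thesis by blast
qed

section \<open>Evaluation, derivatives and divided differences\<close>

definition pev :: "complex poly ^ 3 => complex => complex ^ 3" where
 "pev p s = (\<chi> i. poly (p $ i) s)"

definition pd :: "complex poly ^ 3 => complex poly ^ 3" where
 "pd p = (\<chi> i. pderiv (p $ i))"

text \<open>Homogeneous vectors are compared through their cross product, so that equality of image
  points is a polynomial condition and needs no normalisation.\<close>

abbreviation meet :: "complex poly ^ 3 \<Rightarrow> complex \<Rightarrow> complex \<Rightarrow> bool" where
  "meet p s t \<equiv> vcross (pev p s) (pev p t) = 0"

text \<open>With W the Wronskian of \<open>p\<close>, \<open>osc_det\<close> is W and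
  \<open>flex_det\<close> is W'; where P' is proportional to P, \<open>cusp_det\<close> is W''.
  Their nonvanishing makes a flex a simple and a cusp a double zero of W.\<close>

abbreviation osc_det :: "complex poly ^ 3 \<Rightarrow> complex \<Rightarrow> complex" where
  "osc_det p s \<equiv> vdet (pev p s) (pev (pd p) s) (pev (pd (pd p)) s)"

abbreviation flex_det :: "complex poly ^ 3 \<Rightarrow> complex \<Rightarrow> complex" where
  "flex_det p s \<equiv> vdet (pev p s) (pev (pd p) s) (pev (pd (pd (pd p))) s)"

abbreviation cusp_det :: "complex poly ^ 3 \<Rightarrow> complex \<Rightarrow> complex" where
  "cusp_det p s \<equiv> vdet (pev p s) (pev (pd (pd p)) s) (pev (pd (pd (pd p))) s)"

text \<open>For two parameters with the same image point, a nonzero value says that both branches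
  are immersed and have different tangents.\<close>

abbreviation tangent_det :: "complex poly ^ 3 \<Rightarrow> complex \<Rightarrow> complex \<Rightarrow> complex" where
  "tangent_det p s t \<equiv> vdet (pev p s) (pev (pd p) s) (pev (pd p) t)"

definition lincomb :: "complex ^ 3 => complex poly ^ 3 => complex poly" where
 "lincomb \<alpha> p = smult (\<alpha>$1) (p$1) + smult (\<alpha>$2) (p$2) + smult (\<alpha>$3) (p$3)"

lemma pev_nth [simp]: "pev p s $ i = poly (p $ i) s"
 by (simp add: pev_def)

lemma pd_nth [simp]: "pd p $ i = pderiv (p $ i)"
 by (simp add: pd_def)

lemma pev_vcross [simp]: "pev (vcross p q) s = vcross (pev p s) (pev q s)"
 by (simp add: v3_simps)

lemma poly_vdot [simp]: "poly (vdot p q) s = vdot (pev p s) (pev q s)"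
 by (simp add: v3_simps)

lemma poly_vdet [simp]: "poly (vdet p q r) s = vdet (pev p s) (pev q s) (pev r s)"
 by (simp add: v3_simps)

lemma pev_smult [simp]: "pev (c *s p) s = poly c s *s pev p s"
 by (simp add: vec_eq_iff)

lemma pev_add [simp]: "pev (p + q) s = pev p s + pev q s"
 by (simp add: vec_eq_iff)

lemma poly_lincomb [simp]: "poly (lincomb \<alpha> p) s = vdot \<alpha> (pev p s)"
 by (simp add: lincomb_def vdot_def)

lemma pderiv_lincomb [simp]: "pderiv (lincomb \<alpha> p) = lincomb \<alpha> (pd p)"
 by (simp add: lincomb_def pderiv_add pderiv_smult)

lemma pd_vcross: "pd (vcross p q) = vcross (pd p) q + vcross p (pd q)"
 by (simp add: v3_simps pderiv_add pderiv_diff pderiv_mult algebra_simps)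

lemma pd_smult: "pd (c *s p) = pderiv c *s p + c *s pd p"
 by (simp add: vec_eq_iff pderiv_mult algebra_simps)

lemma pderiv_vdot: "pderiv (vdot p q) = vdot (pd p) q + vdot p (pd q)"
 by (simp add: v3_simps pderiv_add pderiv_mult algebra_simps)

lemma pderiv_vdet: "pderiv (vdet p q r) = vdet (pd p) q r + vdet p (pd q) r + vdet p q (pd r)"
 by (simp add: v3_simps pderiv_add pderiv_diff pderiv_mult algebra_simps)

lemma pev_eqI:
 assumes "\<And>s. pev p s = pev q s" shows "p = q"
proof -
 have "p $ i = q $ i" for i
  using assms by (auto simp: vec_eq_iff fun_eq_iff simp flip: poly_eq_poly_eq_iff)
 thus ?thesis by (simp add: vec_eq_iff)
qed

text \<open>The divided difference of \<open>q\<close>. Synthetic division makes it polynomial in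
  both arguments, hence defined on the diagonal, where it is the derivative.\<close>

definition dd :: "complex poly => complex => complex => complex" where
 "dd q s t = poly (synthetic_div q s) t"

lemma dd_pCons: "dd (pCons a p) s t = poly p s + t * dd p s t"
 by (simp add: dd_def)

lemma dd_0 [simp]: "dd 0 s t = 0" by (simp add: dd_def)

lemma dd_eq: "poly q t = poly q s + (t - s) * dd q s t"
proof -
 have "poly ([:-s, 1:] * synthetic_div q s + [:poly q s:]) t = poly q t"
  by (simp only: synthetic_div_correct')
 thus ?thesis by (simp add: dd_def algebra_simps)
qed

lemma dd_self [simp]: "dd q s s = poly (pderiv q) s"
 by (induction q) (simp_all add: dd_pCons pderiv_pCons)

lemma tendsto_dd [tendsto_intros]:
 assumes "(f \<longlongrightarrow> a) F" "(g \<longlongrightarrow> b) F"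
 shows "((%x. dd q (f x) (g x)) \<longlongrightarrow> dd q a b) F"
 by (induction q) (simp_all add: dd_pCons, intro tendsto_intros assms)

text \<open>The derivatives at \<open>s\<close> are, up to factorials, the coefficients of the
  translate of \<open>q\<close> by \<open>s\<close>; if the first \<open>k\<close> vanish, a power
  of the variable splits off.\<close>

lemma poly_eq_power_mult:
 fixes q :: "complex poly"
 assumes "\<And>j. j < k ==> poly ((pderiv ^^ j) q) s = 0"
 obtains r where "q = [:-s, 1:] ^ k * r" "poly ((pderiv ^^ k) q) s = fact k * poly r s"
proof -
 have *: "poly ((pderiv ^^ j) q) s = fact j * coeff (q \<circ>\<^sub>p [:s, 1:]) j" for j
 proof -
  have "(pderiv ^^ j) (q \<circ>\<^sub>p [:s, 1:]) = (pderiv ^^ j) q \<circ>\<^sub>p [:s, 1:]" for q :: "complex poly"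
   by (induction j arbitrary: q) (simp_all add: pderiv_pcompose pderiv_pCons funpow_swap1)
  hence "poly ((pderiv ^^ j) q) s = poly ((pderiv ^^ j) (q \<circ>\<^sub>p [:s, 1:])) 0"
   by (simp add: poly_pcompose)
  also have "\<dots> = fact j * coeff (q \<circ>\<^sub>p [:s, 1:]) j"
   by (simp add: poly_0_coeff_0 coeff_higher_pderiv pochhammer_fact)
  finally show ?thesis .
 qed
 define q' where "q' = q \<circ>\<^sub>p [:s, 1:]"
 have "coeff q' j = 0" if "j < k" for j
  using assms[OF that] * by (simp add: q'_def)
 hence "monom 1 k dvd q'" by (simp add: monom_1_dvd_iff')
 then obtain r' where r': "q' = monom 1 k * r'" by (elim dvdE)
 define r where "r = r' \<circ>\<^sub>p [:-s, 1:]"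
 have "poly q x = poly ([:-s, 1:] ^ k * r) x" for x
 proof -
  have "poly q x = poly q' (x - s)" by (simp add: q'_def poly_pcompose)
  also have "\<dots> = poly ([:-s, 1:] ^ k * r) x"
   by (simp add: r' r_def poly_pcompose poly_monom)
  finally show ?thesis .
 qed
 hence 1: "q = [:-s, 1:] ^ k * r" by (simp add: fun_eq_iff flip: poly_eq_poly_eq_iff)
 have "coeff q' k = coeff r' 0" by (simp add: r' coeff_monom_mult)
 also have "\<dots> = poly r s" by (simp add: r_def poly_pcompose poly_0_coeff_0)
 finally show ?thesis using that[OF 1] *[of k] by (simp add: q'_def)
qed

section \<open>Counting zeros by local winding numbers\<close>

text \<open>Along \<open>F\<close> the argument of \<open>h\<close> stays within a fixed angle less than \<open>\<pi>/2\<close> of that of a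
 constant multiple of \<open>w ^ k\<close>.\<close>

definition winds :: "(complex => complex) => (complex => complex) => int => complex filter => bool" where
 "winds h w k F \<longleftrightarrow> (\<exists>c e. c ~= 0 \<and> 0 < e \<and>
   (\<forall>\<^sub>F z in F. h z ~= 0 \<and> e * norm (h z) \<le> Re (h z * cnj (c * sgn (w z) powi k))))"

lemma norm_sgn_powi_le: "norm (sgn (z::complex) powi k) \<le> 1"
 by (cases "z = 0") (auto simp: norm_power_int norm_sgn power_int_0_left_if)

text \<open>A factor with nonzero limit turns the argument by an almost constant angle. The constant
  \<open>c\<close> absorbs the angle, and the slack \<open>e\<close> of the cone absorbs the
  error.\<close>

lemma winds_mult:
 assumes h: "winds h w k F" and E: "(E \<longlongrightarrow> E0) F" "E0 ~= 0"
 shows "winds (%z. h z * E z) w k F"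
proof -
 from h obtain c e where ce: "c ~= 0" "0 < e" and
  ev: "\<forall>\<^sub>F z in F. h z ~= 0 \<and> e * norm (h z) \<le> Re (h z * cnj (c * sgn (w z) powi k))"
  by (auto simp: winds_def)
 define N where "N = norm E0"
 have N: "N > 0" using E by (simp add: N_def)
 have "((%z. E z * cnj E0) \<longlongrightarrow> E0 * cnj E0) F" by (intro tendsto_intros E)
 hence lim: "((%z. E z * cnj E0) \<longlongrightarrow> of_real (N\<^sup>2)) F"
  by (simp only: N_def complex_norm_square)
 \<comment> \<open>This tolerance makes the error term at most half of the main term
   \<open>e * norm (h z) * N\<^sup>2\<close>.\<close>
 have "e * N\<^sup>2 / (2 * norm c) > 0" using ce N by simp
 from tendstoD[OF lim this]
 have ev1: "\<forall>\<^sub>F z in F. norm (E z * cnj E0 - of_real (N\<^sup>2)) < e * N\<^sup>2 / (2 * norm c)"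
  by (simp add: dist_norm)
 have ev2: "\<forall>\<^sub>F z in F. norm (E z) < 2 * N"
  by (rule order_tendstoD[OF tendsto_norm[OF E(1)]]) (use N in \<open>simp add: N_def\<close>)
 have ev3: "\<forall>\<^sub>F z in F. E z ~= 0" by (rule tendsto_imp_eventually_ne[OF E])
 have "\<forall>\<^sub>F z in F. h z * E z ~= 0 \<and>
     (e * N / 4) * norm (h z * E z) \<le> Re (h z * E z * cnj ((c * E0) * sgn (w z) powi k))"
  using ev ev1 ev2 ev3
 proof eventually_elim
  case (elim z)
  define X where "X = h z * cnj (c * sgn (w z) powi k)"
  define d where "d = E z * cnj E0 - of_real (N\<^sup>2)"
  have X: "norm X \<le> norm (h z) * norm c"
   using mult_left_mono[OF norm_sgn_powi_le[of "w z" k], of "norm (h z) * norm c"]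
   by (simp only: X_def norm_mult complex_mod_cnj mult.assoc mult_1_right mult_nonneg_nonneg norm_ge_zero)
  have "h z * E z * cnj ((c * E0) * sgn (w z) powi k) = X * of_real (N\<^sup>2) + X * d"
   by (simp add: X_def d_def algebra_simps)
  hence "Re (h z * E z * cnj ((c * E0) * sgn (w z) powi k)) = Re X * N\<^sup>2 + Re (X * d)"
   by simp
  moreover have "Re (X * d) \<ge> - norm (X * d)" using abs_Re_le_cmod[of "X * d"] by linarith
  moreover have "norm (X * d) \<le> norm (h z) * norm c * (e * N\<^sup>2 / (2 * norm c))"
   unfolding norm_mult by (intro mult_mono X) (use elim ce in \<open>auto simp: d_def\<close>)
  moreover have "norm (h z) * norm c * (e * N\<^sup>2 / (2 * norm c)) = norm (h z) * e * N\<^sup>2 / 2"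
   using ce by simp
  moreover have "e * norm (h z) * N\<^sup>2 \<le> Re X * N\<^sup>2"
   using elim by (intro mult_right_mono) (auto simp: X_def)
  moreover have "(e * N / 4) * norm (h z * E z) \<le> (e * N / 4) * (norm (h z) * (2 * N))"
   using elim ce N by (intro mult_left_mono) (auto simp: norm_mult intro!: mult_left_mono)
  moreover have "(e * N / 4) * (norm (h z) * (2 * N)) = norm (h z) * e * N\<^sup>2 / 2"
   by (simp add: power2_eq_square)
  moreover have "e * norm (h z) * N\<^sup>2 = norm (h z) * e * N\<^sup>2" by (simp only: mult_ac)
  ultimately have "(e * N / 4) * norm (h z * E z) \<le> Re (h z * E z * cnj ((c * E0) * sgn (w z) powi k))"
   by linarith
  thus ?case using elim by auto
 qed
 moreover have "e * N / 4 > 0" "c * E0 ~= 0" using ce N E by auto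
 ultimately show ?thesis unfolding winds_def by blast
qed

text \<open>Used with \<open>j = - k\<close> to cancel the winding at a zero before the zero is
  removed. As \<open>sgn (w z)\<close> has norm one, the opening of the cone does not
  change.\<close>

lemma winds_shift:
 assumes h: "winds h w k F" and nz: "\<forall>\<^sub>F z in F. w z ~= 0"
 shows "winds (%z. h z * sgn (w z) powi j) w (k + j) F"
proof -
 from h obtain c e where ce: "c ~= 0" "0 < e" and
  ev: "\<forall>\<^sub>F z in F. h z ~= 0 \<and> e * norm (h z) \<le> Re (h z * cnj (c * sgn (w z) powi k))"
  by (auto simp: winds_def)
 have "\<forall>\<^sub>F z in F. h z * sgn (w z) powi j ~= 0 \<and> e * norm (h z * sgn (w z) powi j)
      \<le> Re (h z * sgn (w z) powi j * cnj (c * sgn (w z) powi (k + j)))"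
  using ev nz
 proof eventually_elim
  case (elim z)
  define u where "u = sgn (w z)"
  have u: "u ~= 0" "norm u = 1" using elim by (auto simp: u_def norm_sgn sgn_eq_0_iff)
  have nu: "norm (u powi j) = 1" using u by (simp add: norm_power_int)
  have "u powi j * cnj (u powi j) = 1"
   using nu by (metis complex_norm_square of_real_1 power_one)
  moreover have "h z * u powi j * cnj (c * u powi (k + j))
    = h z * cnj (c * u powi k) * (u powi j * cnj (u powi j))"
   using u by (simp add: power_int_add mult_ac)
  ultimately have "h z * u powi j * cnj (c * u powi (k + j)) = h z * cnj (c * u powi k)" by simp
  moreover have "norm (h z * u powi j) = norm (h z)" using nu by (simp add: norm_mult)
  moreover have "h z * u powi j ~= 0" using elim u by simp
  ultimately show ?case using elim unfolding u_def by metis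
 qed
 thus ?thesis using ce unfolding winds_def by blast
qed

lemma winds_sgn:
 assumes "winds h w k F" shows "winds (%z. sgn (h z)) w k F"
proof -
 from assms obtain c e where ce: "c ~= 0" "0 < e" and
  ev: "\<forall>\<^sub>F z in F. h z ~= 0 \<and> e * norm (h z) \<le> Re (h z * cnj (c * sgn (w z) powi k))"
  by (auto simp: winds_def)
 have "\<forall>\<^sub>F z in F. sgn (h z) ~= 0 \<and> e * norm (sgn (h z)) \<le> Re (sgn (h z) * cnj (c * sgn (w z) powi k))"
  using ev
 proof eventually_elim
  case (elim z)
  have "sgn (h z) * cnj (c * sgn (w z) powi k) = of_real (1 / norm (h z)) * (h z * cnj (c * sgn (w z) powi k))"
   by (simp add: sgn_eq)
  hence "Re (sgn (h z) * cnj (c * sgn (w z) powi k)) = (1 / norm (h z)) * Re (h z * cnj (c * sgn (w z) powi k))"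
   by (simp only: Re_complex_of_real times_complex.sel Im_complex_of_real)
  moreover have "e \<le> (1 / norm (h z)) * Re (h z * cnj (c * sgn (w z) powi k))"
   using elim by (simp add: field_simps)
  ultimately show ?case using elim by (simp add: norm_sgn sgn_eq_0_iff)
 qed
 thus ?thesis using ce unfolding winds_def by blast
qed

lemma winds_cong:
 assumes "winds h w k F" "\<forall>\<^sub>F z in F. h z = h' z" shows "winds h' w k F"
proof -
 from assms(1) obtain c e where ce: "c ~= 0" "0 < e" and
  ev: "\<forall>\<^sub>F z in F. h z ~= 0 \<and> e * norm (h z) \<le> Re (h z * cnj (c * sgn (w z) powi k))"
  by (auto simp: winds_def)
 have "\<forall>\<^sub>F z in F. h' z ~= 0 \<and> e * norm (h' z) \<le> Re (h' z * cnj (c * sgn (w z) powi k))"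
  using ev assms(2) by eventually_elim simp
 thus ?thesis using ce unfolding winds_def by blast
qed

lemma tendsto_sgn_ratio_infinity:
 "((%z. sgn (z - a) / sgn z) \<longlongrightarrow> (1::complex)) at_infinity"
proof -
 have inv: "((%z::complex. inverse z) \<longlongrightarrow> 0) at_infinity" by (rule tendsto_inverse_0)
 have "((%z. sgn (1 - a * inverse z)) \<longlongrightarrow> sgn (1 - a * 0)) at_infinity"
  by (intro tendsto_intros inv) auto
 moreover have "\<forall>\<^sub>F z in at_infinity. sgn (1 - a * inverse z) = sgn (z - a) / sgn z"
  using eventually_not_equal_at_infinity[of 0]
 proof eventually_elim
  case (elim z)
  have "1 - a * inverse z = (z - a) * inverse z" using elim by (simp add: field_simps)
  thus ?case by (simp add: sgn_mult sgn_inverse divide_inverse)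
 qed
 ultimately show ?thesis by (auto intro: Lim_transform_eventually)
qed

lemma winds_shift_infinity:
 assumes "winds h (%z. z) n at_infinity"
 shows "winds (%z. h z * sgn (z - a) powi j) (%z. z) (n + j) at_infinity"
proof -
 have "winds (%z. h z * sgn z powi j) (%z. z) (n + j) at_infinity"
  using winds_shift[OF assms eventually_not_equal_at_infinity[of 0]] .
 moreover have "((%z. (sgn (z - a) / sgn z) powi j) \<longlongrightarrow> 1 powi j) at_infinity"
  by (intro tendsto_intros tendsto_sgn_ratio_infinity) auto
 ultimately have "winds (%z. h z * sgn z powi j * (sgn (z - a) / sgn z) powi j) (%z. z) (n + j) at_infinity"
  by (rule winds_mult) auto
 thus ?thesis
 proof (rule winds_cong)
  show "\<forall>\<^sub>F z in at_infinity. h z * sgn z powi j * (sgn (z - a) / sgn z) powi j = h z * sgn (z - a) powi j"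
   using eventually_not_equal_at_infinity[of 0]
   by eventually_elim (simp add: power_int_divide_distrib sgn_eq_0_iff)
 qed
qed

text \<open>A zero-free continuous function on the plane has a continuous logarithm. Winding
  \<open>n\<close> times at infinity would make this logarithm jump by 2 \<pi> i n around a large
  circle.\<close>

lemma winding_eq_0:
 assumes cont: "continuous_on UNIV h" and nz: "\<And>z. h z ~= 0"
  and inf: "winds h (%z. z) n at_infinity"
 shows "n = 0"
proof -
 from inf obtain c e where ce: "c ~= 0" "0 < e" and
  ev: "\<forall>\<^sub>F z in at_infinity. h z ~= 0 \<and> e * norm (h z) \<le> Re (h z * cnj (c * sgn z powi n))"
  by (auto simp: winds_def)
 then obtain R0 where R0: "\<And>z. R0 \<le> norm z ==> h z ~= 0 \<and> e * norm (h z) \<le> Re (h z * cnj (c * sgn z powi n))"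
  by (auto simp: eventually_at_infinity)
 define R where "R = max R0 1"
 have R: "R > 0" "R \<ge> R0" by (auto simp: R_def)
 obtain lg where lg: "continuous_on UNIV lg" "\<And>z. h z = exp (lg z)"
  using continuous_logarithm_on_contractible[OF cont contractible_UNIV] nz by auto
 \<comment> \<open>A logarithm of \<open>h\<close> along the circle, with the expected rotation by
   \<open>n \<theta>\<close> and the angle of \<open>c\<close> removed; its exponential stays in the
   right half plane.\<close>
 define F where "F = (%\<theta>::real. lg (of_real R * cis \<theta>) - \<i> * of_real (of_int n * \<theta>) + Ln (cnj c))"
 have contF: "continuous_on S F" for S
  unfolding F_def
  by (intro continuous_intros continuous_on_compose2[OF lg(1)]) auto
 have expF: "exp (F \<theta>) = h (of_real R * cis \<theta>) * cnj (c * cis \<theta> powi n)" for \<theta>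
 proof -
  have "cnj (cis \<theta> powi n) = exp (- (\<i> * of_real (of_int n * \<theta>)))"
  proof -
   have "cnj (cis \<theta> powi n) = cis (- (of_int n * \<theta>))"
    by (simp only: cis_power_int cis_cnj)
   thus ?thesis by (simp add: cis_conv_exp)
  qed
  thus ?thesis
   using ce by (simp add: F_def exp_add exp_diff exp_minus lg(2) divide_inverse mult_ac)
 qed
 have pos: "Re (exp (F \<theta>)) > 0" for \<theta>
 proof -
  have "sgn (of_real R * cis \<theta>) = cis \<theta>" using R by (simp add: sgn_mult sgn_of_real)
  moreover have "R0 \<le> norm (of_real R * cis \<theta>)" using R by (simp add: norm_mult)
  ultimately have "e * norm (h (of_real R * cis \<theta>)) \<le> Re (exp (F \<theta>))"
   using R0[of "of_real R * cis \<theta>"] by (simp add: expF)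
  moreover have "e * norm (h (of_real R * cis \<theta>)) > 0" using ce nz by simp
  ultimately show ?thesis by linarith
 qed
 \<comment> \<open>The difference to the principal logarithm is a multiple of 2 \<pi> i, and
   continuous, hence constant; so \<open>F\<close> returns to its initial value although
   \<open>n \<theta>\<close> has grown by 2 \<pi> n.\<close>
 define D where "D = (%\<theta>. F \<theta> - Ln (exp (F \<theta>)))"
 have contD: "continuous_on S D" for S
  unfolding D_def
  by (intro continuous_intros contF continuous_on_compose2[OF continuous_on_Ln])
    (use pos in \<open>auto simp: complex_nonpos_Reals_iff not_le\<close>)
 have "exp (D \<theta>) = 1" for \<theta> by (simp add: D_def exp_diff)
 hence Dint: "\<exists>m::int. D \<theta> = of_real (of_int (2 * m) * pi) * \<i>" for \<theta>
  by (metis complex_exp_exists complex_eq_iff exp_eq_1 Re_complex_of_real add_0 Im_complex_of_real mult.commute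
    Re_i_times Im_i_times neg_0_equal_iff_equal)
 have "D constant_on {0..2*pi}"
 proof (rule continuous_discrete_range_constant[OF _ contD])
  fix x assume "x \<in> {0..2*pi}"
  show "\<exists>e>0. \<forall>y. y \<in> {0..2*pi} \<and> D y ~= D x --> e \<le> norm (D y - D x)"
  proof (intro exI[of _ 1] conjI allI impI)
   fix y assume *: "y \<in> {0..2*pi} \<and> D y ~= D x"
   obtain a b :: int where ab: "D y = of_real (of_int (2 * a) * pi) * \<i>" "D x = of_real (of_int (2 * b) * pi) * \<i>"
    using Dint by meson
   have "D y - D x = of_real (of_int (2 * (a - b)) * pi) * \<i>" by (simp add: ab algebra_simps)
   hence "norm (D y - D x) = \<bar>of_int (2 * (a - b)) * pi\<bar>" by (simp only: norm_mult norm_of_real) simp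
   moreover have "a - b ~= 0" using * ab by auto
   hence "1 \<le> \<bar>2 * (a - b)\<bar>" by presburger
   hence "\<bar>of_int (2 * (a - b))::real\<bar> \<ge> 1" by (metis of_int_abs of_int_1_le_iff)
   hence "\<bar>of_int (2 * (a - b))\<bar> * pi \<ge> 1 * (1::real)"
    using pi_ge_two by (intro mult_mono) auto
   ultimately show "1 \<le> norm (D y - D x)" by (simp add: abs_mult)
  qed auto
 qed auto
 hence "D (2*pi) = D 0" by (auto simp: constant_on_def)
 moreover have "exp (F (2*pi)) = exp (F 0)" by (simp add: expF cis_2pi)
 ultimately have "F (2*pi) = F 0" by (simp add: D_def)
 thus ?thesis by (simp add: F_def cis_2pi)
qed

text \<open>An argument principle for continuous functions. The zeros are removed one at a time:
  divide by the winding at \<open>a\<close>, then fill in a nonzero constant near \<open>a\<close>.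
  Only the direction of \<open>h\<close> matters, so it may be replaced by its sign.\<close>

theorem sum_winding:
 assumes "finite Z" "continuous_on (- Z) h" "\<And>z. z \<notin> Z ==> h z ~= 0"
  and "\<And>a. a \<in> Z ==> winds h (%z. z - a) (k a) (at a)"
  and "winds h (%z. z) n at_infinity"
 shows "n = (\<Sum>a\<in>Z. k a)"
 using assms
proof (induction Z arbitrary: h n rule: finite_induct)
 case empty
 thus ?case using winding_eq_0[of h n] by simp
next
 case (insert a Z)
 define g where "g = (%z. h z * sgn (z - a) powi (- k a))"
 have nea: "\<forall>\<^sub>F z in at a. z - a ~= 0"
  using eventually_neq_at_within[of a a UNIV] by (simp add: eventually_mono)
 have "winds g (%z. z - a) (k a + - k a) (at a)"
  unfolding g_def by (intro winds_shift insert.prems nea) auto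
 then obtain c e where ce: "c ~= 0" "0 < e" and
  ev: "\<forall>\<^sub>F z in at a. g z ~= 0 \<and> e * norm (g z) \<le> Re (g z * cnj c)"
  by (auto simp: winds_def)
 have openZ: "open (- Z)" using insert.hyps by (simp add: finite_imp_closed open_Compl)
 have "\<forall>\<^sub>F z in at a. z \<in> - Z"
  using openZ insert.hyps by (intro eventually_at_topological[THEN iffD2] exI[of _ "-Z"]) auto
 with ev have "\<forall>\<^sub>F z in at a. g z ~= 0 \<and> e * norm (g z) \<le> Re (g z * cnj c) \<and> z \<notin> Z"
  by eventually_elim auto
 then obtain r where r: "r > 0" and
  rr: "\<And>z. z ~= a ==> dist z a < r ==> g z ~= 0 \<and> e * norm (g z) \<le> Re (g z * cnj c) \<and> z \<notin> Z"
  by (auto simp: eventually_at)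
 \<comment> \<open>The weight runs from 0 at \<open>a\<close> to 1 at distance r/2, so
   \<open>h1\<close> leads from the constant \<open>c\<close> to \<open>sgn (g z)\<close>. Both lie
   in a common open half plane near \<open>a\<close>, so the interpolation has no zero.\<close>
 define l where "l = (%z. min 1 (2 * norm (z - a) / r))"
 define h1 where "h1 = (%z. of_real (l z) * sgn (g z) + of_real (1 - l z) * c)"
 have l1: "l z = 1" if "dist z a \<ge> r / 2" for z
  using that r by (simp add: l_def dist_norm field_simps)
 have l01: "0 \<le> l z" "l z \<le> 1" for z using r by (auto simp: l_def)
 have h1g: "h1 z = sgn (g z)" if "dist z a \<ge> r / 2" for z using l1[OF that] by (simp add: h1_def)
 have gnz: "g z ~= 0" if "z ~= a" "z \<notin> Z" for z
  using insert.prems(2)[of z] that by (auto simp: g_def sgn_eq_0_iff)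
 have far: "\<forall>\<^sub>F z in F. sgn (g z) = h1 z" if "\<forall>\<^sub>F z in F. dist z a \<ge> r / 2" for F
  using that by eventually_elim (simp add: h1g)
 have "n + - k a = (\<Sum>b\<in>Z. k b)"
 proof (rule insert.IH)
  show "continuous_on (- Z) h1"
   unfolding continuous_on_eq_continuous_at[OF openZ]
  proof
   fix z assume z: "z \<in> - Z"
   show "isCont h1 z"
   proof (cases "z = a")
    case True
    have "(l \<longlongrightarrow> l a) (at a)" unfolding l_def
     by (intro tendsto_intros) (use r in auto)
    hence la: "(l \<longlongrightarrow> 0) (at a)" by (simp add: l_def)
    have "((%z. of_real (l z) * sgn (g z)) \<longlongrightarrow> 0) (at a)"
    proof (rule Lim_null_comparison[OF _ la])
     show "\<forall>\<^sub>F z in at a. norm (of_real (l z) * sgn (g z)) \<le> l z"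
      using l01 by (intro always_eventually) (auto simp: norm_mult norm_sgn)
    qed
    moreover have "((%z. of_real (1 - l z) * c) \<longlongrightarrow> of_real (1 - 0) * c) (at a)"
     by (intro tendsto_intros la)
    ultimately have "(h1 \<longlongrightarrow> 0 + of_real (1 - 0) * c) (at a)"
     unfolding h1_def by (intro tendsto_add)
    moreover have "h1 a = c" by (simp add: h1_def l_def)
    ultimately show ?thesis unfolding isCont_def True by simp
   next
    case False
    have "open (- insert a Z)" using insert.hyps by (intro open_Compl finite_imp_closed) auto
    hence "isCont h z"
     using insert.prems(1) z False continuous_on_eq_continuous_at[of "- insert a Z" h] by auto
    hence "isCont g z" unfolding g_def using False
     by (intro continuous_intros) (auto simp: sgn_eq_0_iff)
    moreover have "isCont l z" unfolding l_def using r by (intro continuous_intros) auto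
    ultimately show ?thesis unfolding h1_def using gnz[of z] z False
     by (intro continuous_intros) auto
   qed
  qed
 next
  fix z assume z: "z \<notin> Z"
  consider "z = a" | "z ~= a" "dist z a < r" | "dist z a \<ge> r" by linarith
  thus "h1 z ~= 0"
  proof cases
   case 1 thus ?thesis using ce by (simp add: h1_def l_def)
  next
   case 2
   from rr[OF this] have g: "g z ~= 0" "e * norm (g z) \<le> Re (g z * cnj c)" by auto
   have "h1 z * cnj c = of_real (l z / norm (g z)) * (g z * cnj c) + of_real (1 - l z) * (c * cnj c)"
    by (simp add: h1_def sgn_eq algebra_simps)
   also have "c * cnj c = of_real ((norm c)\<^sup>2)" by (rule complex_norm_square[symmetric])
   finally have "Re (h1 z * cnj c) = (l z / norm (g z)) * Re (g z * cnj c) + (1 - l z) * (norm c)\<^sup>2"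
    by (simp only: Re_complex_of_real plus_complex.sel flip: of_real_mult) (simp del: of_real_divide)
   moreover have "(l z / norm (g z)) * Re (g z * cnj c) \<ge> (l z / norm (g z)) * (e * norm (g z))"
    using g l01[of z] by (intro mult_left_mono) auto
   moreover have "(l z / norm (g z)) * (e * norm (g z)) = l z * e" using g by simp
   moreover have "l z * e + (1 - l z) * (norm c)\<^sup>2 > 0"
   proof (cases "l z = 1")
    case False
    hence "(1 - l z) * (norm c)\<^sup>2 > 0" using l01[of z] ce by (intro mult_pos_pos) auto
    moreover have "l z * e \<ge> 0" using l01[of z] ce by simp
    ultimately show ?thesis by linarith
   qed (use ce in auto)
   ultimately have "Re (h1 z * cnj c) > 0" by linarith
   thus ?thesis by auto
  next
   case 3
   thus ?thesis using h1g[of z] r gnz[of z] z by (cases "z = a") (auto simp: sgn_eq_0_iff)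
  qed
 next
  fix b assume b: "b \<in> Z"
  hence ab: "b ~= a" using insert.hyps by auto
  have "((%z. sgn (z - a) powi (- k a)) \<longlongrightarrow> sgn (b - a) powi (- k a)) (at b)"
   using ab by (intro tendsto_intros) (auto simp: sgn_eq_0_iff)
  hence "winds g (%z. z - b) (k b) (at b)"
   unfolding g_def using ab b by (intro winds_mult insert.prems) (auto simp: sgn_eq_0_iff)
  hence "winds (%z. sgn (g z)) (%z. z - b) (k b) (at b)" by (rule winds_sgn)
  thus "winds h1 (%z. z - b) (k b) (at b)"
  proof (rule winds_cong, intro far)
   have "dist b a \<ge> r" using rr[of b] b ab by force
   thus "\<forall>\<^sub>F z in at b. r / 2 \<le> dist z a"
    using r by (intro eventually_mono[OF order_tendstoD(1)[of "%z. dist z a" "dist b a" "at b" "r/2"]] tendsto_intros) auto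
  qed
 next
  have "winds g (%z. z) (n + - k a) at_infinity"
   unfolding g_def by (intro winds_shift_infinity insert.prems)
  hence "winds (%z. sgn (g z)) (%z. z) (n + - k a) at_infinity" by (rule winds_sgn)
  thus "winds h1 (%z. z) (n + - k a) at_infinity"
  proof (rule winds_cong, intro far)
   show "\<forall>\<^sub>F z::complex in at_infinity. r / 2 \<le> dist z a"
    unfolding eventually_at_infinity
   proof (intro exI[of _ "norm a + r / 2"] allI impI)
    fix z :: complex assume "norm a + r / 2 \<le> norm z"
    thus "r / 2 \<le> dist z a" using norm_triangle_ineq2[of z a] by (simp add: dist_norm)
   qed
  qed
 qed
 thus ?case using insert.hyps by simp
qed

section \<open>Roots as functions of the coefficients\<close>

lemma poly_root_list:
 fixes p :: "complex poly"
 assumes "mset rs = proots p"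
 shows "p = smult (lead_coeff p) (\<Prod>r\<leftarrow>rs. [:-r, 1:])" "length rs = degree p"
proof -
 have "(\<Prod>r\<leftarrow>rs. [:-r, 1:]) = (\<Prod>r\<in>#proots p. [:-r, 1:])"
  by (simp add: assms[symmetric] flip: prod_mset_prod_list)
 thus "p = smult (lead_coeff p) (\<Prod>r\<leftarrow>rs. [:-r, 1:])"
  by (simp only: complex_poly_decompose_multiset)
 show "length rs = degree p"
  using assms size_proots_complex[of p] by (metis size_mset)
qed

lemma poly_prod_list: "poly (\<Prod>r\<leftarrow>rs. q r) x = (\<Prod>r\<leftarrow>rs. poly (q r) x)"
 by (induction rs) auto

lemma prod_list_norm_ge:
 assumes "\<And>x. x \<in> set xs ==> d \<le> norm (f x :: complex)" "0 \<le> d"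
 shows "d ^ length xs \<le> norm (\<Prod>x\<leftarrow>xs. f x)"
 using assms(1)
proof (induction xs)
 case (Cons x xs)
 have "d * d ^ length xs \<le> norm (f x) * norm (\<Prod>x\<leftarrow>xs. f x)"
  using Cons assms(2) by (intro mult_mono) auto
 thus ?case by (simp add: norm_mult)
qed auto

lemma finite_pos_lower:
 fixes D :: "real set"
 assumes "finite D" "\<forall>d\<in>D. d > 0"
 shows "\<exists>e>0. \<forall>d\<in>D. e < d"
 using assms
proof (induction rule: finite_induct)
 case (insert d D)
 then obtain e where e: "e > 0" "\<forall>d\<in>D. e < d" by auto
 thus ?case using insert.prems by (intro exI[of _ "min e (d / 2)"]) auto
qed (auto intro: exI[of _ 1])

text \<open>For the root nearest to \<open>t\<close>, every linear factor of \<open>poly p t\<close>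
  is at least \<open>norm (t - r)\<close>.\<close>

lemma near_root:
 fixes p :: "complex poly"
 assumes "degree p > 0"
 obtains r where "poly p r = 0" "norm (lead_coeff p) * norm (t - r) ^ degree p \<le> norm (poly p t)"
proof -
 obtain rs where rs: "mset rs = proots p" using ex_mset by blast
 note l = poly_root_list[OF rs]
 have p0: "p ~= 0" using assms by auto
 have ne: "rs ~= []" using l assms by auto
 define r where "r = arg_min_list (%r. norm (t - r)) rs"
 have r: "r \<in> set rs" "\<And>r'. r' \<in> set rs ==> norm (t - r) \<le> norm (t - r')"
  using ne f_arg_min_list_f[OF ne, of "%r. norm (t - r)"] arg_min_list_in[OF ne]
  by (auto simp: r_def)
 have "poly p r = 0"
  using r(1) set_count_proots[OF p0] by (simp flip: rs set_mset_mset)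
 moreover have "poly p t = lead_coeff p * (\<Prod>r\<leftarrow>rs. t - r)"
  by (subst l(1)) (simp add: poly_prod_list del: poly_smult add: poly_smult)
 moreover have "norm (t - r) ^ length rs \<le> norm (\<Prod>r\<leftarrow>rs. t - r)"
  using r by (intro prod_list_norm_ge) auto
 ultimately show ?thesis
  by (intro that[of r]) (auto simp: norm_mult l(2) intro: mult_left_mono)
qed

lemma coeff_synthetic_div: "coeff (synthetic_div p c) i = coeff p (Suc i) + c * coeff (synthetic_div p c) (Suc i)"
 using synthetic_div_correct[of p c] by (metis coeff_add coeff_pCons_Suc coeff_smult)

lemma tendsto_coeff_synthetic_div:
 fixes qs :: "nat => complex poly"
 assumes d: "\<And>k. degree (qs k) \<le> n" "degree q \<le> n"
  and lim: "\<And>i. (%k. coeff (qs k) i) \<longlonglongrightarrow> coeff q i" "rs \<longlonglongrightarrow> r"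
 shows "(%k. coeff (synthetic_div (qs k) (rs k)) i) \<longlonglongrightarrow> coeff (synthetic_div q r) i"
proof -
 have big: "coeff (synthetic_div p c) i = 0" if "degree p \<le> n" "n \<le> i" for p :: "complex poly" and c i
 proof (cases "degree p = 0")
  case True thus ?thesis using synthetic_div_eq_0_iff[of p c] by simp
 next
  case False
  thus ?thesis using that by (intro coeff_eq_0) (simp add: degree_synthetic_div)
 qed
 \<comment> \<open>Synthetic division produces coefficients from the top, so the induction descends
   from index \<open>n\<close>, where the quotient has coefficient zero.\<close>
 have "(%k. coeff (synthetic_div (qs k) (rs k)) (n - j)) \<longlonglongrightarrow> coeff (synthetic_div q r) (n - j)" if "j \<le> n" for j
  using that
 proof (induction j)
  case 0 thus ?case by (simp add: big d)
 next
  case (Suc j)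
  have e: "coeff (synthetic_div p c) (n - Suc j) = coeff p (n - j) + c * coeff (synthetic_div p c) (n - j)" for p c
   using Suc.prems coeff_synthetic_div[of p c "n - Suc j"] by (simp add: Suc_diff_Suc)
  show ?case unfolding e using Suc by (intro tendsto_intros lim) auto
 qed
 from this[of "n - i"] show ?thesis
  by (cases "i \<le> n") (simp_all add: big d)
qed

lemma tendsto_poly_coeffs:
 fixes qs :: "nat => complex poly"
 assumes d: "\<And>k. degree (qs k) \<le> n" "degree q \<le> n"
  and lim: "\<And>i. (%k. coeff (qs k) i) \<longlonglongrightarrow> coeff q i"
 shows "(%k. poly (qs k) t) \<longlonglongrightarrow> poly q t"
proof -
 have e: "poly p t = (\<Sum>i\<le>n. coeff p i * t ^ i)" if "degree p \<le> n" for p :: "complex poly"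
  unfolding poly_altdef using that by (intro sum.mono_neutral_left) (auto simp: coeff_eq_0)
 show ?thesis unfolding e[OF d(1)] e[OF d(2)] by (intro tendsto_intros lim)
qed

text \<open>Continuity of roots with multiplicity, for which lists are used: near each root of the
  limit lies a root of the approximating polynomials, and dividing both out lowers the degree while
  keeping the coefficients convergent.\<close>

lemma roots_tendsto:
 fixes qs :: "nat => complex poly"
 assumes "\<And>k. degree (qs k) = n" "degree q = n"
  and "\<And>i. (%k. coeff (qs k) i) \<longlonglongrightarrow> coeff q i" "q ~= 0" "mset ts = proots q"
 shows "\<exists>rs. (\<forall>k. mset (rs k) = proots (qs k)) \<and> (\<forall>i<n. (%k. rs k ! i) \<longlonglongrightarrow> ts ! i)"
 using assms
proof (induction ts arbitrary: n q qs)
 case Nil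
 hence "n = 0" using size_proots_complex[of q] by simp
 hence "proots (qs k) = {#}" for k
  using size_proots_complex[of "qs k"] Nil.prems(1)[of k] by simp
 thus ?case using \<open>n = 0\<close> by (intro exI[of _ "%_. []"]) auto
next
 case (Cons t ts)
 have len: "length (t # ts) = n" using poly_root_list(2)[OF Cons.prems(5)] Cons.prems by simp
 then obtain m where n: "n = Suc m" by auto
 have t: "poly q t = 0"
  using set_count_proots[OF Cons.prems(4)] by (auto simp flip: Cons.prems(5))
 have qk0: "qs k ~= 0" for k using Cons.prems(1)[of k] n by auto
 have "\<exists>r. poly (qs k) r = 0 \<and> norm (lead_coeff (qs k)) * norm (t - r) ^ n \<le> norm (poly (qs k) t)" for k
  using near_root[of "qs k" t] Cons.prems(1)[of k] n by (metis zero_less_Suc)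
 then obtain \<rho> where \<rho>: "\<And>k. poly (qs k) (\<rho> k) = 0"
  "\<And>k. norm (lead_coeff (qs k)) * norm (t - \<rho> k) ^ n \<le> norm (poly (qs k) t)"
  by metis
 have lq: "coeff q n ~= 0" using Cons.prems(2,4) by auto
 have lim0: "(%k. norm (poly (qs k) t) / norm (coeff (qs k) n)) \<longlonglongrightarrow> norm (poly q t) / norm (coeff q n)"
  using lq by (intro tendsto_intros tendsto_poly_coeffs[of qs n q] Cons.prems) (use Cons.prems(1,2) in auto)
 have limp: "(%k. norm (t - \<rho> k) ^ n) \<longlonglongrightarrow> 0"
 proof (rule Lim_null_comparison)
  show "\<forall>\<^sub>F k in sequentially. norm (norm (t - \<rho> k) ^ n) \<le> norm (poly (qs k) t) / norm (coeff (qs k) n)"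
  proof (intro always_eventually allI)
   fix k
   have "norm (coeff (qs k) n) > 0" using qk0[of k] Cons.prems(1)[of k] by auto
   thus "norm (norm (t - \<rho> k) ^ n) \<le> norm (poly (qs k) t) / norm (coeff (qs k) n)"
    using \<rho>(2)[of k] Cons.prems(1)[of k] by (simp add: field_simps)
  qed
  show "(%k. norm (poly (qs k) t) / norm (coeff (qs k) n)) \<longlonglongrightarrow> 0"
   using lim0 t by simp
 qed
 have lim\<rho>: "\<rho> \<longlonglongrightarrow> t"
 proof (rule tendstoI)
  fix e :: real assume e: "e > 0"
  hence "\<forall>\<^sub>F k in sequentially. norm (t - \<rho> k) ^ n < e ^ n"
   using order_tendstoD(2)[OF limp] by simp
  thus "\<forall>\<^sub>F k in sequentially. dist (\<rho> k) t < e"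
  proof eventually_elim
   case (elim k)
   thus ?case using power_less_imp_less_base[OF elim] e by (simp add: dist_norm norm_minus_commute)
  qed
 qed
 define q' where "q' = synthetic_div q t"
 define qs' where "qs' = (%k. synthetic_div (qs k) (\<rho> k))"
 have q: "q = [:-t, 1:] * q'" using synthetic_div_correct'[of t q] t by (simp add: q'_def)
 have qs: "qs k = [:-\<rho> k, 1:] * qs' k" for k
  using synthetic_div_correct'[of "\<rho> k" "qs k"] \<rho>(1)[of k] by (simp add: qs'_def)
 have "q' ~= 0" using q Cons.prems(4) by auto
 have "qs' k ~= 0" for k using qs[of k] qk0 by auto
 have prq: "proots q = add_mset t (proots q')"
  using \<open>q' ~= 0\<close> by (subst q, subst proots_mult) auto
 have prqs: "proots (qs k) = add_mset (\<rho> k) (proots (qs' k))" for k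
  using \<open>qs' k ~= 0\<close> by (subst qs, subst proots_mult) auto
 have "\<exists>rs. (\<forall>k. mset (rs k) = proots (qs' k)) \<and> (\<forall>i<m. (%k. rs k ! i) \<longlonglongrightarrow> ts ! i)"
 proof (rule Cons.IH)
  show "degree (qs' k) = m" for k using Cons.prems(1)[of k] n by (simp add: qs'_def degree_synthetic_div)
  show "degree q' = m" using Cons.prems(2) n by (simp add: q'_def degree_synthetic_div)
  show "(%k. coeff (qs' k) i) \<longlonglongrightarrow> coeff q' i" for i
   unfolding qs'_def q'_def
   by (rule tendsto_coeff_synthetic_div[of _ n]) (use Cons.prems(1,2,3) lim\<rho> in auto)
  show "q' ~= 0" by fact
  show "mset ts = proots q'" using Cons.prems(5) prq by simp
 qed
 then obtain rs where rs: "\<And>k. mset (rs k) = proots (qs' k)" "\<And>i. i < m ==> (%k. rs k ! i) \<longlonglongrightarrow> ts ! i"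
  by auto
 show ?case
 proof (intro exI[of _ "%k. \<rho> k # rs k"] conjI allI impI)
  show "mset (\<rho> k # rs k) = proots (qs k)" for k using rs(1)[of k] prqs[of k] by simp
  fix i assume "i < n"
  thus "(%k. (\<rho> k # rs k) ! i) \<longlonglongrightarrow> (t # ts) ! i"
   using lim\<rho> rs(2) n by (cases i) auto
 qed
qed

section \<open>Symmetric functions on the fibres of a rational function\<close>

text \<open>The map \<open>x = g / f\<close> of degree \<open>n\<close>. Because \<open>f\<close>
  has smaller degree, the parameter at infinity lies over x at infinity, and every finite fibre
  consists of exactly \<open>n\<close> finite parameters counted with multiplicity.\<close>

locale fibration =
 fixes f g :: "complex poly" and n :: nat
 assumes deg_g: "degree g = n" and deg_f: "degree f < n"
  and no_common_root: "\<And>t. poly f t = 0 ==> poly g t ~= 0"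
begin

definition fibre_poly :: "complex => complex poly" where
 "fibre_poly x = g - smult x f"

definition fibre :: "complex => complex list" where
 "fibre x = (SOME rs. mset rs = proots (fibre_poly x))"

definition wronski :: "complex poly" where
 "wronski = f * pderiv g - g * pderiv f"

lemma n_pos: "n > 0" using deg_f by simp

lemma poly_fibre_poly: "poly (fibre_poly x) t = poly g t - x * poly f t"
 by (simp add: fibre_poly_def)

lemma degree_fibre_poly [simp]: "degree (fibre_poly x) = n"
 unfolding fibre_poly_def diff_conv_add_uminus using deg_f deg_g
 by (subst degree_add_eq_left) (auto intro: le_less_trans[OF degree_smult_le])

lemma fibre_poly_nz [simp]: "fibre_poly x ~= 0"
 using degree_fibre_poly[of x] n_pos by (metis degree_0 less_irrefl)

lemma mset_fibre: "mset (fibre x) = proots (fibre_poly x)"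
 unfolding fibre_def by (rule someI_ex) (metis ex_mset)

lemma length_fibre [simp]: "length (fibre x) = n"
 using poly_root_list(2)[OF mset_fibre] by simp

lemma set_fibre: "set (fibre x) = {t. poly g t = x * poly f t}"
proof -
 have "set (fibre x) = set_mset (proots (fibre_poly x))" by (simp flip: mset_fibre)
 also have "\<dots> = {t. poly (fibre_poly x) t = 0}" by (rule set_count_proots) simp
 finally show ?thesis by (simp add: poly_fibre_poly)
qed

lemma f_nz_fibre: "poly g t = x * poly f t ==> poly f t ~= 0"
 using no_common_root[of t] by auto

lemma f_nz: "f ~= 0"
proof
 assume "f = 0"
 hence "\<And>t. poly g t ~= 0" using no_common_root by simp
 hence "degree g = 0" using fundamental_theorem_of_algebra[of g] constant_degree[of g] by blast
 thus False using deg_g n_pos by simp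
qed

text \<open>The leading terms of \<open>f g'\<close> and \<open>g f'\<close> carry the factors
  \<open>n\<close> and \<open>degree f\<close>, which are different and so cannot cancel.\<close>

lemma wronski_nz: "wronski ~= 0"
proof (cases "degree f = 0")
 case True
 hence "pderiv f = 0" by (simp add: pderiv_eq_0_iff)
 moreover have "pderiv g ~= 0" using deg_g n_pos by (simp add: pderiv_eq_0_iff)
 ultimately show ?thesis using f_nz by (simp add: wronski_def)
next
 case False
 have lg: "coeff (pderiv g) (n - 1) = of_nat n * lead_coeff g"
  using n_pos deg_g by (simp add: coeff_pderiv)
 have lf: "coeff (pderiv f) (degree f - 1) = of_nat (degree f) * lead_coeff f"
  using False by (simp add: coeff_pderiv)
 have "coeff (f * pderiv g) (degree f + (n - 1)) = lead_coeff f * (of_nat n * lead_coeff g)"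
  using coeff_mult_degree_sum[of f "pderiv g"] lg deg_g by (simp add: degree_pderiv)
 moreover have "coeff (g * pderiv f) (n + (degree f - 1)) = lead_coeff g * (of_nat (degree f) * lead_coeff f)"
  using coeff_mult_degree_sum[of g "pderiv f"] lf deg_g by (simp add: degree_pderiv)
 moreover have "degree f + (n - 1) = n + (degree f - 1)" using False n_pos by simp
 ultimately have "coeff wronski (degree f + (n - 1)) = (of_nat n - of_nat (degree f)) * (lead_coeff f * lead_coeff g)"
  unfolding wronski_def by (simp add: algebra_simps)
 moreover have "\<dots> ~= 0" using deg_f f_nz deg_g by (auto simp flip: of_nat_diff)
 ultimately show ?thesis by auto
qed

lemma fibre_tendsto:
 assumes "xs \<longlonglongrightarrow> x" "mset ts = proots (fibre_poly x)"
 obtains rs where "\<And>k. mset (rs k) = proots (fibre_poly (xs k))" "\<And>i. i < n ==> (%k. rs k ! i) \<longlonglongrightarrow> ts ! i"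
proof -
 have "\<exists>rs. (\<forall>k. mset (rs k) = proots (fibre_poly (xs k))) \<and> (\<forall>i<n. (%k. rs k ! i) \<longlonglongrightarrow> ts ! i)"
 proof (rule roots_tendsto[of _ n "fibre_poly x"])
  show "(%k. coeff (fibre_poly (xs k)) i) \<longlonglongrightarrow> coeff (fibre_poly x) i" for i
   unfolding fibre_poly_def coeff_diff coeff_smult by (intro tendsto_intros assms)
 qed (use assms in auto)
 thus ?thesis using that by blast
qed

text \<open>The leading coefficient of \<open>g - x f\<close> does not depend on \<open>x\<close>
  and the others are affine in \<open>x\<close>, so the roots grow at most linearly.\<close>

lemma fibre_bound: "\<exists>C. \<forall>x t. poly g t = x * poly f t --> norm t \<le> C * (1 + norm x)"
proof -
 define A where "A = (\<Sum>i<n. norm (coeff g i))"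
 define B where "B = (\<Sum>i<n. norm (coeff f i))"
 define l where "l = norm (lead_coeff g)"
 have l: "l > 0" using deg_g n_pos unfolding l_def by auto
 have A0: "A \<ge> 0" "B \<ge> 0" by (auto simp: A_def B_def intro: sum_nonneg)
 have low: "norm (\<Sum>i<n. coeff p i * t ^ i) \<le> (\<Sum>i<n. norm (coeff p i)) * norm t ^ (n - 1)"
  if "norm t \<ge> 1" for p :: "complex poly" and t
 proof -
  have "norm (\<Sum>i<n. coeff p i * t ^ i) \<le> (\<Sum>i<n. norm (coeff p i) * norm t ^ (n - 1))"
   using that by (intro sum_norm_le) (auto simp: norm_mult norm_power intro!: mult_left_mono power_increasing)
  thus ?thesis by (simp add: sum_distrib_right)
 qed
 have main: "norm t \<le> (A + B) / l * (1 + norm x) + (1 + norm x)" if e: "poly g t = x * poly f t" for x t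
 proof (cases "norm t \<ge> 1")
  case False
  moreover have "(A + B) / l * (1 + norm x) \<ge> 0" using A0 l by simp
  moreover have "norm x \<ge> 0" by simp
  ultimately show ?thesis by linarith
 next
  case True
  have pf: "poly f t = (\<Sum>i<n. coeff f i * t ^ i)"
   unfolding poly_altdef using deg_f by (intro sum.mono_neutral_left) (auto simp: coeff_eq_0)
  have "{..n} = insert n {..<n}" by auto
  hence pg: "poly g t = lead_coeff g * t ^ n + (\<Sum>i<n. coeff g i * t ^ i)"
   unfolding poly_altdef deg_g by (simp add: deg_g)
  have "lead_coeff g * t ^ n = x * (\<Sum>i<n. coeff f i * t ^ i) - (\<Sum>i<n. coeff g i * t ^ i)"
   using e pf pg by (simp add: algebra_simps)
  hence "l * norm t ^ n = norm (x * (\<Sum>i<n. coeff f i * t ^ i) - (\<Sum>i<n. coeff g i * t ^ i))"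
   unfolding l_def by (metis norm_mult norm_power)
  also have "\<dots> \<le> norm x * norm (\<Sum>i<n. coeff f i * t ^ i) + norm (\<Sum>i<n. coeff g i * t ^ i)"
   by (rule order_trans[OF norm_triangle_ineq4]) (simp add: norm_mult)
  also have "\<dots> \<le> norm x * (B * norm t ^ (n - 1)) + A * norm t ^ (n - 1)"
   using low[OF True] unfolding A_def B_def by (intro add_mono mult_left_mono) auto
  finally have "l * norm t ^ n \<le> (norm x * B + A) * norm t ^ (n - 1)" by (simp add: algebra_simps)
  moreover have "norm t ^ n = norm t * norm t ^ (n - 1)" using n_pos by (cases n) auto
  ultimately have "(l * norm t) * norm t ^ (n - 1) \<le> (norm x * B + A) * norm t ^ (n - 1)" by (simp add: mult_ac)
  hence "l * norm t \<le> norm x * B + A"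
   by (rule mult_right_le_imp_le) (rule zero_less_power, use True in linarith)
  also have "\<dots> \<le> (A + B) * (1 + norm x)" using A0 by (simp add: algebra_simps)
  finally have "norm t \<le> (A + B) / l * (1 + norm x)" using l by (simp add: field_simps)
  moreover have "norm x \<ge> 0" by simp
  ultimately show ?thesis by linarith
 qed
 show ?thesis
 proof (intro exI[of _ "(A + B) / l + 1"] allI impI)
  fix x t assume "poly g t = x * poly f t"
  from main[OF this] show "norm t \<le> ((A + B) / l + 1) * (1 + norm x)" by (simp add: algebra_simps)
 qed
qed

lemma finite_branch: "finite {x. \<exists>t. poly g t = x * poly f t \<and> poly wronski t = 0}"
proof (rule finite_subset)
 show "finite ((%t. poly g t / poly f t) ` {t. poly wronski t = 0})"
  using poly_roots_finite[OF wronski_nz] by blast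
 show "{x. \<exists>t. poly g t = x * poly f t \<and> poly wronski t = 0} \<subseteq> (%t. poly g t / poly f t) ` {t. poly wronski t = 0}"
 proof
  fix x assume "x \<in> {x. \<exists>t. poly g t = x * poly f t \<and> poly wronski t = 0}"
  then obtain t where t: "poly g t = x * poly f t" "poly wronski t = 0" by auto
  hence "x = poly g t / poly f t" using f_nz_fibre[OF t(1)] by simp
  thus "x \<in> (%t. poly g t / poly f t) ` {t. poly wronski t = 0}" using t by blast
 qed
qed

lemma simple_root_local:
 assumes "poly g t = x * poly f t" "poly wronski t ~= 0" "0 < r"
 shows "\<exists>U \<tau>. open U \<and> x \<in> U \<and> \<tau> holomorphic_on U \<and>
  (\<forall>y\<in>U. poly g (\<tau> y) = y * poly f (\<tau> y) \<and> \<tau> y \<in> ball t r)"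
proof -
 define S where "S = ball t r \<inter> {s. poly f s ~= 0}"
 define \<phi> where "\<phi> = (%s. poly g s / poly f s)"
 have S: "open S" unfolding S_def
  by (intro open_Int open_ball open_Collect_neq continuous_intros)
 have ft: "poly f t ~= 0" using f_nz_fibre[OF assms(1)] .
 have tS: "t \<in> S" using ft assms by (simp add: S_def)
 have hol: "\<phi> holomorphic_on S" unfolding \<phi>_def
  by (intro holomorphic_intros) (auto simp: S_def)
 have "(\<phi> has_field_derivative (poly (pderiv g) t * poly f t - poly g t * poly (pderiv f) t) / (poly f t * poly f t)) (at t)"
  unfolding \<phi>_def by (rule DERIV_divide[OF poly_DERIV poly_DERIV ft])
 hence "deriv \<phi> t = poly wronski t / (poly f t * poly f t)"
  by (simp add: DERIV_imp_deriv wronski_def algebra_simps)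
 hence "deriv \<phi> t ~= 0" using assms(2) ft by simp
 from has_complex_derivative_locally_injective[OF hol tS S this]
 obtain e where e: "e > 0" "ball t e \<subseteq> S" "inj_on \<phi> (ball t e)" by blast
 have hol': "\<phi> holomorphic_on ball t e" using hol e holomorphic_on_subset by blast
 obtain \<tau> where \<tau>: "\<tau> holomorphic_on (\<phi> ` ball t e)" "\<And>z. z \<in> ball t e ==> \<tau> (\<phi> z) = z"
  using holomorphic_has_inverse[OF hol' open_ball e(3)] by metis
 show ?thesis
 proof (intro exI[of _ "\<phi> ` ball t e"] exI[of _ \<tau>] conjI ballI)
  show "open (\<phi> ` ball t e)" by (rule open_mapping_thm3[OF hol' open_ball e(3)])
  have "x = \<phi> t" using assms(1) ft by (simp add: \<phi>_def)
  thus "x \<in> \<phi> ` ball t e" using e(1) by auto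
  show "\<tau> holomorphic_on \<phi> ` ball t e" by fact
  fix y assume "y \<in> \<phi> ` ball t e"
  then obtain z where z: "z \<in> ball t e" "y = \<phi> z" by auto
  hence "z \<in> S" using e by auto
  thus "poly g (\<tau> y) = y * poly f (\<tau> y)" using z \<tau>(2)[OF z(1)] by (simp add: \<phi>_def S_def)
  show "\<tau> y \<in> ball t r" using z \<tau>(2)[OF z(1)] \<open>z \<in> S\<close> by (simp add: S_def)
 qed
qed

lemma distinct_fibre:
 assumes "\<And>t. poly g t = x * poly f t ==> poly wronski t ~= 0"
 shows "distinct (fibre x)"
proof -
 have "count (mset (fibre x)) t \<le> 1" for t
 proof -
  have "order t (fibre_poly x) \<le> 1"
  proof (rule ccontr)
   assume "\<not> order t (fibre_poly x) \<le> 1"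
   hence o: "order t (fibre_poly x) > 1" by simp
   hence 0: "poly (fibre_poly x) t = 0" by (metis order_0I not_less_zero)
   have "[:-t, 1:] ^ 2 dvd fibre_poly x" using o by (simp add: order_divides)
   then obtain q where "fibre_poly x = [:-t, 1:] ^ 2 * q" by (elim dvdE)
   moreover define l where "l = [:-t, 1:]"
   ultimately have "fibre_poly x = l * l * q" "poly l t = 0" by (simp_all add: power2_eq_square)
   hence "poly (pderiv (fibre_poly x)) t = 0" by (simp add: pderiv_mult)
   hence "poly (pderiv g) t = x * poly (pderiv f) t"
    by (simp add: fibre_poly_def pderiv_diff pderiv_smult)
   moreover have 1: "poly g t = x * poly f t" using 0 by (simp add: poly_fibre_poly)
   ultimately have "poly wronski t = 0" by (simp add: wronski_def)
   thus False using assms[OF 1] by simp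
  qed
  thus ?thesis by (simp add: mset_fibre)
 qed
 moreover have "count (mset (fibre x)) t > 0 \<longleftrightarrow> t \<in> set (fibre x)" for t
  by (simp only: count_greater_zero_iff set_mset_mset)
 ultimately have "count (mset (fibre x)) t = (if t \<in> set (fibre x) then 1 else 0)" for t
  by (metis One_nat_def Suc_leI le_antisym neq0_conv)
 thus ?thesis by (simp add: distinct_count_atmost_1)
qed

text \<open>A symmetric function of the fibre is continuous in \<open>x\<close> and, away from the
  finitely many branch values, holomorphic along local sections. The branch values are removable, so
  the function is entire, and its growth makes it a polynomial by Liouville.\<close>

theorem symmetric_polynomial:
 assumes sym: "\<And>xs ys. mset xs = mset ys ==> length xs = n ==> \<Phi> xs = \<Phi> ys"
  and cont: "\<And>xss xs. (\<And>k. length (xss k) = n) ==> length xs = n ==> (\<And>i. i < n ==> (%k. xss k ! i) \<longlonglongrightarrow> xs ! i) ==>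
    (%k::nat. \<Phi> (xss k)) \<longlonglongrightarrow> \<Phi> xs"
  and hol: "\<And>U \<tau>. open U ==> (\<And>i. i < n ==> \<tau> i holomorphic_on U) ==> (%x. \<Phi> (map (%i. \<tau> i x) [0..<n])) holomorphic_on U"
  and growth: "\<And>xs R. length xs = n ==> 1 \<le> R ==> (\<And>x. x \<in> set xs ==> norm x \<le> R) ==> norm (\<Phi> xs) \<le> C * R ^ N"
 shows "\<exists>q. degree q \<le> N \<and> (\<forall>x. \<Phi> (fibre x) = poly q x)"
proof -
 define F where "F = (%x. \<Phi> (fibre x))"
 define K where "K = {x. \<exists>t. poly g t = x * poly f t \<and> poly wronski t = 0}"
 have contF: "continuous_on UNIV F"
  unfolding continuous_on_sequentially
 proof (intro ballI allI impI)
  fix a and xs :: "nat => complex" assume "(\<forall>n. xs n \<in> UNIV) \<and> xs \<longlonglongrightarrow> a"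
  hence xs: "xs \<longlonglongrightarrow> a" by simp
  obtain rs where rs: "\<And>k. mset (rs k) = proots (fibre_poly (xs k))" "\<And>i. i < n ==> (%k. rs k ! i) \<longlonglongrightarrow> fibre a ! i"
   using fibre_tendsto[OF xs mset_fibre] by blast
  have len: "length (rs k) = n" for k using poly_root_list(2)[OF rs(1)] by simp
  have "(%k. \<Phi> (rs k)) \<longlonglongrightarrow> F a" unfolding F_def by (rule cont) (use rs len in auto)
  moreover have "F (xs k) = \<Phi> (rs k)" for k
   unfolding F_def by (rule sym) (use rs mset_fibre in auto)
  ultimately show "(F \<circ> xs) \<longlonglongrightarrow> F a" by (simp add: o_def)
 qed
 have holK: "F holomorphic_on (UNIV - K)"
 proof -
  have "F field_differentiable at x" if x: "x \<notin> K" for x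
  proof -
   have nw: "poly wronski t ~= 0" if "poly g t = x * poly f t" for t using x that by (auto simp: K_def)
   hence dist: "distinct (fibre x)" by (rule distinct_fibre)
   \<comment> \<open>Balls of this radius around the entries are disjoint, so local sections through
     different entries stay different.\<close>
   have "\<exists>r>0. \<forall>s\<in>set (fibre x). \<forall>t\<in>set (fibre x). s ~= t --> 2 * r < dist s t"
   proof -
    have "finite {(s,t). s \<in> set (fibre x) \<and> t \<in> set (fibre x) \<and> s ~= t}"
     by (rule finite_subset[of _ "set (fibre x) \<times> set (fibre x)"]) auto
    hence "finite ((%(s,t). dist s t) ` {(s,t). s \<in> set (fibre x) \<and> t \<in> set (fibre x) \<and> s ~= t})" (is "finite ?D")
     by (rule finite_imageI)
    moreover have "\<forall>d\<in>?D. d > 0" by auto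
    ultimately obtain e where "e > 0" "\<forall>d\<in>?D. e < d"
     using finite_pos_lower[of ?D] by blast
    hence "e / 2 > 0" "\<forall>s\<in>set (fibre x). \<forall>t\<in>set (fibre x). s ~= t --> 2 * (e / 2) < dist s t"
     by auto
    thus ?thesis by blast
   qed
   then obtain r where r: "r > 0" "\<And>s t. s \<in> set (fibre x) ==> t \<in> set (fibre x) ==> s ~= t ==> 2 * r < dist s t"
    by blast
   have "\<exists>U \<tau>. open U \<and> x \<in> U \<and> \<tau> holomorphic_on U \<and> (\<forall>y\<in>U. poly g (\<tau> y) = y * poly f (\<tau> y) \<and> \<tau> y \<in> ball (fibre x ! i) r)"
    if "i < n" for i
   proof -
    have "fibre x ! i \<in> set (fibre x)" using that by simp
    hence "poly g (fibre x ! i) = x * poly f (fibre x ! i)" by (simp add: set_fibre)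
    from simple_root_local[OF this nw[OF this] r(1)] show ?thesis .
   qed
   then obtain U \<tau> where U: "\<And>i. i < n ==> open (U i)" "\<And>i. i < n ==> x \<in> U i" "\<And>i. i < n ==> \<tau> i holomorphic_on U i"
    "\<And>i y. i < n ==> y \<in> U i ==> poly g (\<tau> i y) = y * poly f (\<tau> i y) \<and> \<tau> i y \<in> ball (fibre x ! i) r"
    by metis
   define V where "V = (\<Inter>i<n. U i)"
   have V: "open V" "x \<in> V" unfolding V_def using U by auto
   have "(%y. \<Phi> (map (%i. \<tau> i y) [0..<n])) holomorphic_on V"
    by (rule hol[OF V(1)]) (use U in \<open>auto simp: V_def intro: holomorphic_on_subset\<close>)
   moreover have "\<Phi> (map (%i. \<tau> i y) [0..<n]) = F y" if y: "y \<in> V" for y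
    unfolding F_def
   proof (rule sym)
    let ?l = "map (%i. \<tau> i y) [0..<n]"
    have inj: "inj_on (%i. \<tau> i y) {0..<n}"
    proof (rule inj_onI, rule ccontr)
     fix i j assume ij: "i \<in> {0..<n}" "j \<in> {0..<n}" "\<tau> i y = \<tau> j y" "i ~= j"
     hence "fibre x ! i ~= fibre x ! j" using dist by (simp add: nth_eq_iff_index_eq)
     hence "2 * r < dist (fibre x ! i) (fibre x ! j)" using ij by (intro r) auto
     moreover have "dist (fibre x ! i) (\<tau> i y) < r" "dist (fibre x ! j) (\<tau> i y) < r"
      using U(4)[of i y] U(4)[of j y] ij y by (auto simp: V_def)
     ultimately show False using dist_triangle2[of "fibre x ! i" "fibre x ! j" "\<tau> i y"] by linarith
    qed
    have dl: "distinct ?l" using inj by (simp add: distinct_map)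
    \<comment> \<open>The sections give \<open>n\<close> different elements of a fibre with
      \<open>n\<close> entries, hence all of it.\<close>
    have "set ?l \<subseteq> set (fibre y)" using U(4) y by (auto simp: set_fibre V_def)
    hence sub: "mset ?l \<subseteq># mset (fibre y)"
     using dl by (intro mset_subset_eqI) (auto simp: distinct_count_atmost_1 count_greater_eq_one_iff)
    thus "mset ?l = mset (fibre y)"
    proof -
     from sub obtain D where D: "mset (fibre y) = mset ?l + D" by (auto simp: mset_subset_eq_exists_conv)
     hence "size (mset (fibre y)) = size (mset ?l) + size D" by (metis size_union)
     hence "D = {#}" by simp
     thus ?thesis using D by simp
    qed
   qed auto
   ultimately have "F holomorphic_on V" by (simp cong: holomorphic_cong)
   thus ?thesis using V holomorphic_on_imp_differentiable_at by blast
  qed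
  thus ?thesis by (simp add: field_differentiable_at_within holomorphic_on_def)
 qed
 have hF: "F holomorphic_on UNIV"
  by (rule no_isolated_singularity[OF contF holK]) (use finite_branch in \<open>auto simp: K_def\<close>)
 obtain B where B: "\<And>x t. poly g t = x * poly f t ==> norm t \<le> B * (1 + norm x)"
  using fibre_bound by blast
 \<comment> \<open>For \<open>1 \<le> norm x\<close> one has 1 + |x| <= 2 |x|; the maximum with 1
   keeps the radius at least 1, as \<open>growth\<close> demands.\<close>
 define B' where "B' = 2 * max B 1"
 have C0: "C \<ge> 0" using growth[of "replicate n 0" 1] by (auto intro: order_trans[OF norm_ge_zero])
 have gr: "norm (F z) \<le> (C * B' ^ N) * norm z ^ N" if "1 \<le> norm z" for z
 proof -
  have "norm (F z) \<le> C * (B' * norm z) ^ N"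
   unfolding F_def
  proof (rule growth)
   have "1 * 1 \<le> B' * norm z" using that by (intro mult_mono) (auto simp: B'_def)
   thus "1 \<le> B' * norm z" by simp
   fix t assume "t \<in> set (fibre z)"
   hence "norm t \<le> B * (1 + norm z)" using B by (simp add: set_fibre)
   also have "\<dots> \<le> max B 1 * (2 * norm z)" using that by (intro mult_mono) auto
   finally show "norm t \<le> B' * norm z" by (simp add: B'_def)
  qed auto
  thus ?thesis by (simp add: power_mult_distrib mult_ac)
 qed
 define q where "q = (\<Sum>k\<le>N. monom ((deriv ^^ k) F 0 / fact k) k)"
 have "F x = poly q x" for x
  using Liouville_polynomial[OF hF gr] by (simp add: q_def poly_sum poly_monom)
 moreover have "degree q \<le> N" unfolding q_def
  by (intro degree_sum_le) (auto intro: order_trans[OF degree_monom_le])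
 ultimately show ?thesis unfolding F_def by blast
qed

end

section \<open>Counting double points and cusps through a projection\<close>

lemma dd_add: "dd (p + q) s t = dd p s t + dd q s t"
 by (induction p q rule: poly_induct2) (simp_all add: dd_pCons algebra_simps)

lemma dd_smult: "dd (smult c p) s t = c * dd p s t"
 by (induction p) (simp_all add: dd_pCons algebra_simps)

lemma dd_diff: "dd (p - q) s t = dd p s t - dd q s t"
 using dd_add[of p "- q" s t] dd_smult[of "-1" q s t] by simp

lemma dd_mult: "dd (p * q) s t = dd p s t * poly q t + poly p s * dd q s t"
proof (induction p)
 case (pCons a p)
 have "dd (pCons a p * q) s t = a * dd q s t + (poly (p * q) s + t * dd (p * q) s t)"
  by (simp add: dd_add dd_smult dd_pCons)
 also have "\<dots> = dd (pCons a p) s t * poly q t + poly (pCons a p) s * dd q s t"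
  using arg_cong[OF dd_eq[of q t s], of "%z. poly p s * z"] by (simp add: pCons dd_pCons algebra_simps)
 finally show ?case .
qed simp

lemma dd_linear: "dd [:a, 1:] s t = 1"
 by (simp add: dd_pCons)

lemma count_mset_eq_card: "count (mset xs) a = card {i. i < length xs \<and> xs ! i = a}"
 by (simp add: count_mset count_list_eq_length_filter length_filter_conv_card eq_commute)

lemma set_root_list:
 assumes "mset rs = proots p" "p ~= 0"
 shows "set rs = {x. poly p x = 0}"
proof -
 have "set rs = set_mset (proots p)" by (simp flip: assms(1))
 also have "\<dots> = {x. poly p x = 0}" by (rule set_count_proots[OF assms(2)])
 finally show ?thesis .
qed

text \<open>Here the indices are different, not the values: at a repeated root the divided
  difference is the derivative, which vanishes as well.\<close>

lemma dd_roots: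
 assumes rs: "mset rs = proots p" and ij: "i < length rs" "j < length rs" "i ~= j" and p0: "p ~= 0"
 shows "dd p (rs ! i) (rs ! j) = 0"
proof -
 have root: "poly p (rs ! k) = 0" if "k < length rs" for k
  using nth_mem[OF that] unfolding set_root_list[OF rs p0] by simp
 show ?thesis
 proof (cases "rs ! i = rs ! j")
  case False
  thus ?thesis using dd_eq[of p "rs ! j" "rs ! i"] root[OF ij(1)] root[OF ij(2)] by simp
 next
  case True
  have "card {i, j} \<le> card {k. k < length rs \<and> rs ! k = rs ! i}"
   using ij True by (intro card_mono) auto
  hence "2 \<le> order (rs ! i) p" using ij(3) p0 by (simp flip: count_mset_eq_card add: rs numeral_2_eq_2)
  hence "[:- (rs ! i), 1:] ^ 2 dvd p" by (simp add: order_divides)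
  then obtain q where "p = [:- (rs ! i), 1:] ^ 2 * q" by (elim dvdE)
  moreover define l where "l = [:- (rs ! i), 1:]"
  ultimately have "p = l * l * q" "poly l (rs ! i) = 0" by (simp_all add: power2_eq_square)
  thus ?thesis using True by (simp add: pderiv_mult)
 qed
qed

lemma dd_growth:
 "\<exists>C N. 0 \<le> C \<and> (\<forall>R s t. 1 \<le> R --> norm s \<le> R --> norm t \<le> R -->
   norm (poly p s) \<le> C * R ^ N \<and> norm (dd p s t) \<le> C * R ^ N)"
proof (induction p)
 case (pCons a p)
 then obtain C N where C: "0 \<le> C" and
  B: "\<And>R s t. 1 \<le> R ==> norm s \<le> R ==> norm t \<le> R ==>
   norm (poly p s) \<le> C * R ^ N \<and> norm (dd p s t) \<le> C * R ^ N" by blast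
 show ?case
 proof (intro exI[of _ "norm a + 2 * C"] exI[of _ "Suc N"] conjI allI impI)
  show "0 \<le> norm a + 2 * C" using C by simp
  fix R :: real and s t :: complex assume R: "1 \<le> R" "norm s \<le> R" "norm t \<le> R"
  have RN: "1 \<le> R ^ Suc N" "R ^ N \<le> R ^ Suc N"
   using R(1) by (simp_all add: one_le_power power_increasing del: power_Suc)
  have b: "norm (poly p s) \<le> C * R ^ N" "norm (dd p s t) \<le> C * R ^ N" using B[OF R] by auto
  have CN: "C * R ^ N \<le> C * R ^ Suc N" using C RN by (intro mult_left_mono)
  have "norm s * norm (poly p s) \<le> R * (C * R ^ N)" using R b by (intro mult_mono) auto
  moreover have "norm a * 1 \<le> norm a * R ^ Suc N" using RN by (intro mult_left_mono) auto
  moreover have "norm (poly (pCons a p) s) \<le> norm a + norm s * norm (poly p s)"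
   using norm_triangle_ineq[of a "s * poly p s"] by (simp add: norm_mult)
  moreover have "0 \<le> C * R ^ Suc N" using C R by simp
  ultimately show "norm (poly (pCons a p) s) \<le> (norm a + 2 * C) * R ^ Suc N"
   by (simp add: algebra_simps)
  have "norm t * norm (dd p s t) \<le> R * (C * R ^ N)" using R b by (intro mult_mono) auto
  moreover have "norm (dd (pCons a p) s t) \<le> norm (poly p s) + norm t * norm (dd p s t)"
   using norm_triangle_ineq[of "poly p s" "t * dd p s t"] by (simp add: dd_pCons norm_mult)
  moreover have "0 \<le> norm a * R ^ Suc N" using R by simp
  ultimately show "norm (dd (pCons a p) s t) \<le> (norm a + 2 * C) * R ^ Suc N"
   using b(1) CN by (simp add: algebra_simps)
 qed
qed (auto intro!: exI[of _ 0])

text \<open>Reversal with respect to the formal degree \<open>n\<close>: a component of lower degree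
  acquires a zero at 0. This is the polynomial in the chart at infinity.\<close>

definition rv :: "nat => complex poly => complex poly" where
 "rv n q = monom 1 (n - degree q) * reflect_poly q"

lemma poly_rv:
 assumes "degree q \<le> n" "s ~= 0"
 shows "poly (rv n q) s = s ^ n * poly q (1 / s)"
 using assms by (simp add: rv_def poly_monom poly_reflect_poly_nz field_simps flip: power_add)

lemma coeff_rv:
 assumes "degree q \<le> n" "i \<le> n"
 shows "coeff (rv n q) i = coeff q (n - i)"
 using assms by (auto simp: rv_def coeff_monom_mult coeff_reflect_poly coeff_eq_0)

lemma degree_rv:
 assumes "degree q \<le> n" shows "degree (rv n q) \<le> n"
 unfolding rv_def using assms degree_reflect_poly_le[of q]
 by (intro order_trans[OF degree_mult_le]) (auto simp: degree_monom_eq)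

lemma poly_rv_0: "degree q \<le> n ==> poly (rv n q) 0 = coeff q n"
 by (simp add: poly_0_coeff_0 coeff_rv)

lemma rv_linear:
 assumes "degree p \<le> n" "degree q \<le> n"
 shows "rv n (p - smult c q) = rv n p - smult c (rv n q)"
proof (rule poly_eqI)
 fix i
 have d: "degree (p - smult c q) \<le> n" using assms by (intro degree_diff_le) (auto intro: order_trans[OF degree_smult_le])
 show "coeff (rv n (p - smult c q)) i = coeff (rv n p - smult c (rv n q)) i"
 proof (cases "i \<le> n")
  case True thus ?thesis using assms d by (simp add: coeff_rv)
 next
  case False
  thus ?thesis using degree_rv[OF d] degree_rv[OF assms(1)] degree_rv[OF assms(2)]
   by (simp add: coeff_eq_0)
 qed
qed

lemma proots_reflect_poly:
 fixes p :: "complex poly"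
 assumes "poly p 0 ~= 0"
 shows "proots (reflect_poly p) = image_mset inverse (proots p)"
proof -
 obtain rs where rs: "mset rs = proots p" using ex_mset by blast
 have p0: "p ~= 0" using assms by auto
 have nz: "0 \<notin> set rs" using assms unfolding set_root_list[OF rs p0] by simp
 have "proots (\<Prod>r\<leftarrow>rs. reflect_poly [:-r, 1:]) = image_mset inverse (mset rs) \<and> (\<Prod>r\<leftarrow>rs. reflect_poly [:-r, 1:]) ~= 0"
  using nz
 proof (induction rs)
  case (Cons r rs)
  have e: "reflect_poly [:-r, 1:] = smult (-r) [:-inverse r, 1:]"
   using Cons.prems by (simp add: reflect_poly_pCons)
  have "proots (reflect_poly [:-r, 1:]) = {#inverse r#}"
   unfolding e using Cons.prems by (subst proots_smult) auto
  moreover have "reflect_poly [:-r, 1:] ~= 0" by simp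
  ultimately show ?case using Cons by (simp add: proots_mult del: reflect_poly_pCons)
 qed auto
 moreover have "reflect_poly p = smult (lead_coeff p) (\<Prod>r\<leftarrow>rs. reflect_poly [:-r, 1:])"
  by (subst poly_root_list(1)[OF rs]) (simp add: reflect_poly_smult reflect_poly_prod_list o_def)
 ultimately show ?thesis using p0 by (simp add: rs)
qed

lemma reflect_eq_rv: "reflect_poly p = rv (degree p) p"
 by (simp add: rv_def)

text \<open>Along any sequence tending to \<open>a\<close>, a polynomial behaves like a power of
  \<open>xs k - a\<close> with exponent its order there; comparing exponents identifies it.\<close>

lemma order_via_limit:
 fixes q :: "complex poly"
 assumes "q ~= 0" "xs \<longlonglongrightarrow> a" "\<And>k. xs k ~= a" "(%k. poly q (xs k) / (xs k - a) ^ r) \<longlonglongrightarrow> L"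
 shows "r \<le> order a q" "L ~= 0 ==> r = order a q"
proof -
 define m where "m = order a q"
 obtain q1 where q1: "q = [:-a, 1:] ^ m * q1" "\<not> [:-a, 1:] dvd q1"
  using order_decomp[OF assms(1)] unfolding m_def by blast
 hence q1a: "poly q1 a ~= 0" by (simp add: poly_eq_0_iff_dvd)
 have lim1: "(%k. poly q1 (xs k)) \<longlonglongrightarrow> poly q1 a" by (intro tendsto_intros assms)
 have lim0: "(%k. xs k - a) \<longlonglongrightarrow> 0" using assms(2) by (simp add: LIM_zero_iff)
 have e: "poly q (xs k) = (xs k - a) ^ m * poly q1 (xs k)" for k by (simp add: q1)
 show "r \<le> order a q"
 proof (rule ccontr)
  assume "\<not> ?thesis"
  then obtain d where d: "r = m + Suc d" unfolding m_def by (metis less_imp_Suc_add not_le add_Suc_right)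
  have "poly q1 (xs k) = poly q (xs k) / (xs k - a) ^ r * (xs k - a) ^ Suc d" for k
   using assms(3)[of k] by (simp add: e d power_add)
  moreover have "(%k. poly q (xs k) / (xs k - a) ^ r * (xs k - a) ^ Suc d) \<longlonglongrightarrow> L * 0 ^ Suc d"
   by (intro tendsto_intros assms lim0)
  ultimately have "(%k. poly q1 (xs k)) \<longlonglongrightarrow> 0" by simp
  thus False using lim1 q1a LIMSEQ_unique by blast
 qed
 hence rm: "r \<le> m" by (simp add: m_def)
 assume L: "L ~= 0"
 show "r = order a q"
 proof (rule ccontr)
  assume "\<not> ?thesis"
  then obtain d where d: "m = r + Suc d" using rm unfolding m_def by (metis less_imp_Suc_add le_neq_implies_less add_Suc_right)
  have "poly q (xs k) / (xs k - a) ^ r = (xs k - a) ^ Suc d * poly q1 (xs k)" for k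
   using assms(3)[of k] by (simp add: e d power_add)
  moreover have "(%k. (xs k - a) ^ Suc d * poly q1 (xs k)) \<longlonglongrightarrow> 0 ^ Suc d * poly q1 a"
   by (intro tendsto_intros lim1 lim0)
  ultimately have "(%k. poly q (xs k) / (xs k - a) ^ r) \<longlonglongrightarrow> 0" by simp
  thus False using assms(4) L LIMSEQ_unique by blast
 qed
qed

lemma degree_via_limit:
 fixes q :: "complex poly"
 assumes "filterlim xs at_infinity sequentially" "\<And>k. xs k ~= 0" "(%k. poly q (xs k) / xs k ^ r) \<longlonglongrightarrow> L"
 shows "degree q \<le> r" "L ~= 0 ==> degree q = r"
proof -
 define m where "m = degree q"
 have lim0: "(%k. inverse (xs k)) \<longlonglongrightarrow> 0" by (rule filterlim_compose[OF tendsto_inverse_0 assms(1)])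
 have "(%k. poly (reflect_poly q) (inverse (xs k))) \<longlonglongrightarrow> poly (reflect_poly q) 0"
  by (intro tendsto_intros lim0)
 hence lim1: "(%k. poly q (xs k) / xs k ^ m) \<longlonglongrightarrow> lead_coeff q"
  using assms(2) by (simp add: poly_reflect_poly_nz m_def divide_simps power_inverse)
 show "degree q \<le> r"
 proof (rule ccontr)
  assume n: "\<not> ?thesis"
  then obtain d where d: "m = r + Suc d" unfolding m_def by (metis less_imp_Suc_add not_le add_Suc_right)
  have "poly q (xs k) / xs k ^ m = poly q (xs k) / xs k ^ r * inverse (xs k) ^ Suc d" for k
   using assms(2)[of k] by (simp add: d power_add field_simps)
  moreover have "(%k. poly q (xs k) / xs k ^ r * inverse (xs k) ^ Suc d) \<longlonglongrightarrow> L * 0 ^ Suc d"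
   by (intro tendsto_intros assms lim0)
  ultimately have "(%k. poly q (xs k) / xs k ^ m) \<longlonglongrightarrow> L * 0 ^ Suc d" by (simp only:)
  hence "lead_coeff q = L * 0 ^ Suc d" using lim1 LIMSEQ_unique by blast
  thus False using n by simp
 qed
 hence rm: "m \<le> r" by (simp add: m_def)
 assume L: "L ~= 0"
 show "degree q = r"
 proof (rule ccontr)
  assume "\<not> ?thesis"
  then obtain d where d: "r = m + Suc d" using rm unfolding m_def by (metis less_imp_Suc_add le_neq_implies_less add_Suc_right)
  have "poly q (xs k) / xs k ^ r = poly q (xs k) / xs k ^ m * inverse (xs k) ^ Suc d" for k
   using assms(2)[of k] by (simp add: d power_add field_simps)
  moreover have "(%k. poly q (xs k) / xs k ^ m * inverse (xs k) ^ Suc d) \<longlonglongrightarrow> lead_coeff q * 0 ^ Suc d"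
   by (intro tendsto_intros lim1 lim0)
  ultimately show False using assms(3) L LIMSEQ_unique by fastforce
 qed
qed

text \<open>\<open>bdd a b s t\<close> is \<open>(a(s) b(t) - b(s) a(t)) / (t - s)\<close>, extended to the diagonal.\<close>

definition bdd :: "complex poly => complex poly => complex => complex => complex" where
 "bdd a b s t = poly a s * dd b s t - poly b s * dd a s t"

lemma bdd_refl [simp]: "bdd a a s t = 0"
 by (simp add: bdd_def)

lemma bdd_eq: "(t - s) * bdd a b s t = poly a s * poly b t - poly b s * poly a t"
 unfolding dd_eq[of b t s] dd_eq[of a t s] by (simp add: bdd_def algebra_simps)

lemma bdd_self: "bdd a b s s = poly (a * pderiv b - b * pderiv a) s"
 by (simp add: bdd_def)

lemma tendsto_bdd [tendsto_intros]:
 assumes "(u \<longlongrightarrow> s) F" "(v \<longlongrightarrow> t) F"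
 shows "((%x. bdd a b (u x) (v x)) \<longlongrightarrow> bdd a b s t) F"
 unfolding bdd_def by (intro tendsto_intros assms)

lemma bdd_diff_smult: "bdd a (b - smult c a') s t = bdd a b s t - c * bdd a a' s t"
 by (simp add: bdd_def dd_diff dd_smult algebra_simps)

text \<open>Both values contribute a power \<open>n\<close>; the identity 1/v - 1/u = - (v - u) / (u
  v) costs one power of u v and produces the sign.\<close>

lemma bdd_rv:
 assumes "degree a \<le> n" "degree b \<le> n" "n > 0" "u ~= 0" "v ~= 0"
 shows "bdd (rv n a) (rv n b) u v = - ((u * v) ^ (n - 1) * bdd a b (1 / u) (1 / v))"
proof -
 have ne: "bdd (rv n a) (rv n b) u v = - ((u * v) ^ (n - 1) * bdd a b (1 / u) (1 / v))"
  if v: "u ~= v" "v ~= 0" for v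
 proof -
  have "(v - u) * bdd (rv n a) (rv n b) u v = (u * v) ^ n * (poly a (1/u) * poly b (1/v) - poly b (1/u) * poly a (1/v))"
   unfolding bdd_eq using assms v by (simp add: poly_rv algebra_simps power_mult_distrib)
  also have "poly a (1/u) * poly b (1/v) - poly b (1/u) * poly a (1/v) = (1 / v - 1 / u) * bdd a b (1/u) (1/v)"
   by (simp add: bdd_eq)
  also have "1 / v - 1 / u = - (v - u) / (u * v)" using assms v by (simp add: field_simps)
  also have "(u * v) ^ n = (u * v) ^ (n - 1) * (u * v)" using assms(3) by (cases n) auto
  also have "K * (u * v) * (- (v - u) / (u * v) * Y) = (v - u) * (- (K * Y))" for K Y
   using assms v by (simp add: field_simps)
  finally have "(v - u) * bdd (rv n a) (rv n b) u v = (v - u) * (- ((u * v) ^ (n - 1) * bdd a b (1 / u) (1 / v)))" .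
  moreover have "v - u ~= 0" using v by simp
  ultimately show ?thesis using mult_left_cancel by blast
 qed
 show ?thesis
 proof (cases "u = v")
  case True
  \<comment> \<open>Both sides are continuous, so the diagonal follows from nearby pairs of
    different points.\<close>
  have l1: "((%w. bdd (rv n a) (rv n b) u w) \<longlongrightarrow> bdd (rv n a) (rv n b) u u) (at u)"
   by (intro tendsto_intros)
  have l2: "((%w. - ((u * w) ^ (n - 1) * bdd a b (1 / u) (1 / w))) \<longlongrightarrow> - ((u * u) ^ (n - 1) * bdd a b (1 / u) (1 / u))) (at u)"
   by (intro tendsto_intros) (use assms in auto)
  have l3: "\<forall>\<^sub>F w in at u. bdd (rv n a) (rv n b) u w = - ((u * w) ^ (n - 1) * bdd a b (1 / u) (1 / w))"
  proof -
   have "\<forall>\<^sub>F w in at u. w ~= u" by (rule eventually_neq_at_within)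
   moreover have "\<forall>\<^sub>F w in at u. w ~= 0" using assms(4) by (intro tendsto_imp_eventually_ne[OF tendsto_ident_at])
   ultimately show ?thesis by eventually_elim (rule ne; simp)
  qed
  have "bdd (rv n a) (rv n b) u u = - ((u * u) ^ (n - 1) * bdd a b (1 / u) (1 / u))"
   using tendsto_unique[OF trivial_limit_at l1 tendsto_cong[OF l3, THEN iffD2, OF l2]] .
  thus ?thesis using True by simp
 qed (use ne assms in auto)
qed

text \<open>As \<open>f\<close> and \<open>h\<close> have degree below \<open>n\<close>, the
  parameter at infinity goes to [0 : 1 : 0], and \<open>no_common_root\<close> keeps the curve off
  the centre [0 : 0 : 1] of the projection to \<open>x\<close>. By \<open>f0\<close> the reversal of
  \<open>f\<close> has full degree.\<close>

locale plane_fibration = fibration +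
 fixes h :: "complex poly"
 assumes deg_h: "degree h < n" and f0: "poly f 0 ~= 0"
begin

definition wronskh :: "complex poly" where
 "wronskh = f * pderiv h - h * pderiv f"

definition same_image :: "complex => complex => bool" where
 "same_image s t \<longleftrightarrow> poly f s ~= 0 \<and> poly f t ~= 0 \<and>
   poly f s * poly g t = poly g s * poly f t \<and> poly f s * poly h t = poly h s * poly f t"

definition ramified :: "complex => bool" where
 "ramified s \<longleftrightarrow> poly f s ~= 0 \<and> poly wronski s = 0 \<and> poly wronskh s = 0"

text \<open>The product is over ordered pairs, so each coincidence is counted once for each of its
  two parameters.\<close>

definition pair_prod :: "(complex => complex => complex) => complex list => complex" where
 "pair_prod b xs = (\<Prod>i<n. \<Prod>j\<in>{..<n} - {i}. b (xs ! i) (xs ! j))"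

text \<open>On a fibre, \<open>g\<close> equals \<open>x f\<close> as far as divided differences can
  see. The first equation trades a factor \<open>x\<close> for \<open>f\<close> near infinity; the
  second links the two parameters close to a cusp.\<close>

lemma bdd_fibre:
 assumes "mset rs = proots (fibre_poly x)" "i < n" "j < n" "i ~= j"
 shows "bdd g h (rs ! i) (rs ! j) = x * bdd f h (rs ! i) (rs ! j)"
  "bdd f (fibre_poly y) (rs ! i) (rs ! j) = 0"
proof -
 have len: "length rs = n" using poly_root_list(2)[OF assms(1)] by simp
 have 0: "dd (fibre_poly x) (rs ! i) (rs ! j) = 0"
  using dd_roots[OF assms(1)] assms len by simp
 have "rs ! i \<in> set rs" using assms len by simp
 hence 1: "poly (fibre_poly x) (rs ! i) = 0"
  unfolding set_root_list[OF assms(1) fibre_poly_nz] by simp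
 show "bdd g h (rs ! i) (rs ! j) = x * bdd f h (rs ! i) (rs ! j)"
  using 0 1 unfolding bdd_def fibre_poly_def dd_diff dd_smult by (simp add: algebra_simps)
 have "fibre_poly y = fibre_poly x - smult (y - x) f"
  by (simp add: fibre_poly_def smult_diff_left)
 thus "bdd f (fibre_poly y) (rs ! i) (rs ! j) = 0"
  using 0 1 by (simp add: bdd_diff_smult) (simp add: bdd_def)
qed

lemma pair_prod_symmetric:
 assumes "mset xs = mset ys" "length xs = n"
 shows "pair_prod b xs = pair_prod b ys"
proof -
 obtain p where p: "p permutes {..<length ys}" "permute_list p ys = xs"
  using mset_eq_permutation[OF assms(1)] by blast
 have len: "length ys = n" using assms by (metis size_mset)
 have p': "p permutes {..<n}" using p len by simp
 have nth: "xs ! i = ys ! p i" if "i < n" for i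
  using permute_list_nth[OF p(1), of i] p(2) that len by simp
 have "pair_prod b xs = (\<Prod>i<n. \<Prod>j\<in>{..<n} - {i}. b (ys ! p i) (ys ! p j))"
  unfolding pair_prod_def by (intro prod.cong refl) (auto simp: nth)
 also have "\<dots> = (\<Prod>i<n. \<Prod>j\<in>{..<n} - {p i}. b (ys ! p i) (ys ! j))"
 proof (rule prod.cong[OF refl])
  fix i assume "i \<in> {..<n}"
  have "bij_betw p ({..<n} - {i}) ({..<n} - {p i})"
   using permutes_imp_bij[OF p'] \<open>i \<in> {..<n}\<close>
   by (intro bij_betw_DiffI) (auto simp: bij_betw_def permutes_in_image[OF p'])
  from prod.reindex_bij_betw[OF this, of "%j. b (ys ! p i) (ys ! j)"]
  show "(\<Prod>j\<in>{..<n} - {i}. b (ys ! p i) (ys ! p j)) = (\<Prod>j\<in>{..<n} - {p i}. b (ys ! p i) (ys ! j))" .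
 qed
 also have "\<dots> = pair_prod b ys" unfolding pair_prod_def
  using prod.reindex_bij_betw[OF permutes_imp_bij[OF p'], of "%i. \<Prod>j\<in>{..<n} - {i}. b (ys ! i) (ys ! j)"] .
 finally show ?thesis .
qed

lemma pair_prod_polynomial: "\<exists>q. \<forall>x. pair_prod (bdd f h) (fibre x) = poly q x"
proof -
 obtain C1 N1 where C1: "0 \<le> C1" and B1: "\<And>R s t. 1 \<le> R ==> norm s \<le> R ==> norm t \<le> R ==>
   norm (poly f s) \<le> C1 * R ^ N1 \<and> norm (dd f s t) \<le> C1 * R ^ N1" using dd_growth[of f] by blast
 obtain C2 N2 where C2: "0 \<le> C2" and B2: "\<And>R s t. 1 \<le> R ==> norm s \<le> R ==> norm t \<le> R ==>
   norm (poly h s) \<le> C2 * R ^ N2 \<and> norm (dd h s t) \<le> C2 * R ^ N2" using dd_growth[of h] by blast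
 define C where "C = 2 * C1 * C2"
 define N where "N = N1 + N2"
 have B: "norm (bdd f h s t) \<le> C * R ^ N" if R: "1 \<le> R" "norm s \<le> R" "norm t \<le> R" for R s t
 proof -
  have "norm (bdd f h s t) \<le> norm (poly f s) * norm (dd h s t) + norm (poly h s) * norm (dd f s t)"
   unfolding bdd_def by (metis norm_mult norm_triangle_ineq4)
  also have "\<dots> \<le> (C1 * R ^ N1) * (C2 * R ^ N2) + (C2 * R ^ N2) * (C1 * R ^ N1)"
   using B1[OF R] B2[OF R] C1 C2 R(1) by (intro add_mono mult_mono) auto
  finally show ?thesis by (simp add: C_def N_def power_add mult_ac)
 qed
 have "\<exists>q. degree q \<le> N * (n * (n - 1)) \<and> (\<forall>x. pair_prod (bdd f h) (fibre x) = poly q x)"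
 proof (rule symmetric_polynomial[where C = "C ^ (n * (n - 1))"])
  fix xss :: "nat => complex list" and xs
  assume "\<And>i. i < n ==> (%k. xss k ! i) \<longlonglongrightarrow> xs ! i"
  thus "(%k. pair_prod (bdd f h) (xss k)) \<longlonglongrightarrow> pair_prod (bdd f h) xs"
   unfolding pair_prod_def by (intro tendsto_prod tendsto_bdd) auto
 next
  fix U and \<tau> :: "nat => complex => complex" assume U: "\<And>i. i < n ==> \<tau> i holomorphic_on U"
  have "(%x. dd q (\<tau> i x) (\<tau> j x)) holomorphic_on U" if "i < n" "j < n" for q i j
   by (induction q) (simp_all add: dd_pCons, intro holomorphic_intros U that)
  hence "(%x. \<Prod>i<n. \<Prod>j\<in>{..<n} - {i}. bdd f h (\<tau> i x) (\<tau> j x)) holomorphic_on U"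
   unfolding bdd_def by (intro holomorphic_intros U) auto
  thus "(%x. pair_prod (bdd f h) (map (%i. \<tau> i x) [0..<n])) holomorphic_on U"
   by (rule holomorphic_transform) (auto simp: pair_prod_def intro!: prod.cong)
 next
  fix xs :: "complex list" and R :: real
  assume xs: "length xs = n" "1 \<le> R" "\<And>x. x \<in> set xs ==> norm x \<le> R"
  have "norm (pair_prod (bdd f h) xs) = (\<Prod>i<n. \<Prod>j\<in>{..<n} - {i}. norm (bdd f h (xs ! i) (xs ! j)))"
   by (simp add: pair_prod_def prod_norm)
  also have "\<dots> \<le> (\<Prod>i<n. \<Prod>j\<in>{..<n} - {i}. C * R ^ N)"
   using xs by (intro prod_mono conjI prod_nonneg B) auto
  also have "\<dots> = (C * R ^ N) ^ (n * (n - 1))" by (simp add: power_mult[symmetric] mult.commute)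
  finally show "norm (pair_prod (bdd f h) xs) \<le> C ^ (n * (n - 1)) * R ^ (N * (n * (n - 1)))"
   by (simp add: power_mult_distrib power_mult)
 qed (rule pair_prod_symmetric)
 thus ?thesis by blast
qed

definition pairpoly :: "complex poly" where
 "pairpoly = (SOME q. \<forall>x. pair_prod (bdd f h) (fibre x) = poly q x)"

lemma poly_pairpoly:
 assumes "mset rs = proots (fibre_poly x)"
 shows "poly pairpoly x = pair_prod (bdd f h) rs"
proof -
 have "\<forall>x. pair_prod (bdd f h) (fibre x) = poly pairpoly x"
  unfolding pairpoly_def by (rule someI_ex[OF pair_prod_polynomial])
 hence "poly pairpoly x = pair_prod (bdd f h) (fibre x)" by simp
 also have "\<dots> = pair_prod (bdd f h) rs"
  by (rule pair_prod_symmetric) (simp_all add: assms mset_fibre)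
 finally show ?thesis .
qed

text \<open>In the coordinate u = 1/t the fibre converges to the roots of the reversed
  \<open>f\<close>. The ordered pairs give the factor 1/x to the power n (n - 1), and the products
  u_i u_j give x to the power 2 (n - 1)^2, because the product of all u_i is of order 1/x. The
  difference of the exponents is (n - 1) (n - 2).\<close>

lemma pair_prod_infinity:
 fixes xs :: "nat => complex"
 assumes xs: "filterlim xs at_infinity sequentially" "\<And>k. xs k ~= 0" "\<And>k. poly g 0 ~= xs k * poly f 0"
  and ss: "mset ss = proots (rv n f)"
 shows "(%k. poly pairpoly (xs k) / xs k ^ ((n - 1) * (n - 2))) \<longlonglongrightarrow>
  (poly f 0 / lead_coeff g) ^ (2 * (n - 1) ^ 2) * pair_prod (bdd (rv n g) (rv n h)) ss"
proof -
 \<comment> \<open>The reversed fibre polynomial divided by - x; in this form it has a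
   limit.\<close>
 define qs where "qs = (%k. rv n f - smult (1 / xs k) (rv n g))"
 have dle: "degree f \<le> n" "degree g \<le> n" "degree h \<le> n" using deg_f deg_g deg_h by auto
 have lc: "coeff (qs k) n = poly f 0 - poly g 0 / xs k" for k
  by (simp add: qs_def coeff_rv dle poly_0_coeff_0)
 have lcnz: "coeff (qs k) n ~= 0" for k using xs(2,3)[of k] by (simp add: lc field_simps)
 have degqs: "degree (qs k) = n" for k
 proof (rule antisym)
  show "degree (qs k) \<le> n" unfolding qs_def
   by (intro degree_diff_le degree_rv dle order_trans[OF degree_smult_le])
  show "n \<le> degree (qs k)" by (rule le_degree) (rule lcnz)
 qed
 have degf: "degree (rv n f) = n"
  using f0 degree_rv[OF dle(1)] by (intro antisym le_degree) (simp_all add: coeff_rv dle poly_0_coeff_0)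
 have f0': "rv n f ~= 0" using f0 n_pos degf by (metis degree_0 less_irrefl)
 have inv0: "(%k. 1 / xs k) \<longlonglongrightarrow> 0"
  using filterlim_compose[OF tendsto_inverse_0 xs(1)] by (simp add: inverse_eq_divide)
 have lim: "(%k. coeff (qs k) i) \<longlonglongrightarrow> coeff (rv n f) i" for i
 proof -
  have "(%k. coeff (rv n f) i - 1 / xs k * coeff (rv n g) i) \<longlonglongrightarrow> coeff (rv n f) i - 0 * coeff (rv n g) i"
   by (intro tendsto_intros inv0)
  thus ?thesis by (simp add: qs_def)
 qed
 obtain us where us: "\<And>k. mset (us k) = proots (qs k)" "\<And>i. i < n ==> (%k. us k ! i) \<longlonglongrightarrow> ss ! i"
  using roots_tendsto[of qs n "rv n f", OF degqs degf lim f0' ss] by blast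
 have usn: "length (us k) = n" for k using poly_root_list(2)[OF us(1)] degqs by simp
 have qs0: "poly (qs k) 0 = - lead_coeff g / xs k" for k
  using deg_f by (simp add: qs_def poly_rv_0 dle coeff_eq_0 deg_g)
 have lg: "lead_coeff g ~= 0" using deg_g n_pos by auto
 have qsnz: "qs k ~= 0" for k using lcnz[of k] by auto
 have usnz: "us k ! i ~= 0" if "i < n" for k i
 proof -
  have "us k ! i \<in> set (us k)" using that usn by simp
  hence "poly (qs k) (us k ! i) = 0" unfolding set_root_list[OF us(1) qsnz] by simp
  thus ?thesis using qs0[of k] lg xs(2)[of k] by auto
 qed
 have fib: "mset (map inverse (us k)) = proots (fibre_poly (xs k))" for k
 proof -
  have p0: "poly (fibre_poly (xs k)) 0 ~= 0" using xs(3)[of k] by (simp add: poly_fibre_poly)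
  have "reflect_poly (fibre_poly (xs k)) = rv n (fibre_poly (xs k))" by (simp add: reflect_eq_rv)
  also have "\<dots> = rv n g - smult (xs k) (rv n f)" unfolding fibre_poly_def by (rule rv_linear[OF dle(2,1)])
  also have "\<dots> = smult (- xs k) (qs k)" using xs(2)[of k] by (simp add: qs_def smult_diff_right)
  finally have "proots (qs k) = proots (reflect_poly (fibre_poly (xs k)))" using xs(2)[of k] by simp
  also have "\<dots> = image_mset inverse (proots (fibre_poly (xs k)))" by (rule proots_reflect_poly[OF p0])
  finally have "image_mset inverse (mset (us k)) = image_mset inverse (image_mset inverse (proots (fibre_poly (xs k))))"
   by (simp add: us(1))
  thus ?thesis by (simp add: multiset.map_comp o_def)
 qed
 define A where "A = (%k. coeff (qs k) n / lead_coeff g)"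
 have main: "poly pairpoly (xs k) / xs k ^ ((n - 1) * (n - 2)) = A k ^ (2 * (n - 1) ^ 2) * pair_prod (bdd (rv n g) (rv n h)) (us k)" for k
 proof -
  let ?x = "xs k" and ?u = "us k"
  define b where "b = (%i j. bdd (rv n g) (rv n h) (?u ! i) (?u ! j))"
  have x0: "?x ~= 0" by (rule xs)
  have step: "bdd f h (map inverse ?u ! i) (map inverse ?u ! j) = - (1 / ?x) * (1 / (?u ! i * ?u ! j) ^ (n - 1)) * b i j"
   if ij: "i < n" "j < n" "i ~= j" for i j
  proof -
   have "b i j = - ((?u ! i * ?u ! j) ^ (n - 1) * bdd g h (1 / ?u ! i) (1 / ?u ! j))"
    unfolding b_def using usnz ij n_pos by (intro bdd_rv dle) auto
   also have "bdd g h (1 / ?u ! i) (1 / ?u ! j) = ?x * bdd f h (map inverse ?u ! i) (map inverse ?u ! j)"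
    using bdd_fibre(1)[OF fib ij] ij usn by (simp add: inverse_eq_divide)
   finally show ?thesis using usnz ij x0 by (simp add: field_simps)
  qed
  \<comment> \<open>The product of the roots is read off from the constant term of
    \<open>qs k\<close>, which is of order 1/x because the coefficient of \<open>f\<close> at
    \<open>n\<close> is zero.\<close>
  define pu where "pu = (\<Prod>i<n. ?u ! i)"
  have "poly (qs k) 0 = coeff (qs k) n * (\<Prod>r\<leftarrow>?u. - r)"
   by (subst poly_root_list(1)[OF us(1)[of k]]) (simp add: poly_prod_list degqs)
  also have "(\<Prod>r\<leftarrow>?u. - r) = (\<Prod>i<n. - (?u ! i))"
   by (simp add: prod.list_conv_set_nth usn atLeast0LessThan)
  also have "\<dots> = (-1) ^ n * pu" by (simp add: pu_def prod_uminus)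
  finally have pu: "coeff (qs k) n * ((-1) ^ n * pu) = - lead_coeff g / ?x" by (simp only: qs0)
  have pu0: "pu ~= 0" unfolding pu_def using usnz by (auto simp: prod_zero_iff)
  with pu have pu1: "1 / pu = (-1) ^ Suc n * ?x * A k"
   using lcnz[of k] lg x0 unfolding A_def by (cases "even n") (auto simp: field_simps)
  have "(\<Prod>i<n. \<Prod>j\<in>{..<n} - {i}. ?u ! i * ?u ! j) = (\<Prod>i<n. (?u ! i) ^ (n - 1) * (pu / ?u ! i))"
  proof (intro prod.cong refl)
   fix i assume i: "i \<in> {..<n}"
   have "pu = ?u ! i * (\<Prod>j\<in>{..<n} - {i}. ?u ! j)"
    unfolding pu_def using i by (intro prod.remove) auto
   hence "(\<Prod>j\<in>{..<n} - {i}. ?u ! j) = pu / ?u ! i" using usnz[of i k] i by simp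
   thus "(\<Prod>j\<in>{..<n} - {i}. ?u ! i * ?u ! j) = (?u ! i) ^ (n - 1) * (pu / ?u ! i)"
    using i by (simp add: prod.distrib)
  qed
  also have "\<dots> = pu ^ (n - 1) * (pu ^ n / pu)"
   by (simp add: prod.distrib prod_dividef pu_def prod_power_distrib)
  also have "pu ^ n / pu = pu ^ (n - 1)"
   using n_pos pu0 by (cases n) auto
  finally have puu: "(\<Prod>i<n. \<Prod>j\<in>{..<n} - {i}. ?u ! i * ?u ! j) = pu ^ (2 * (n - 1))"
   by (simp add: power_add[symmetric] mult_2)
  have "poly pairpoly ?x = (\<Prod>i<n. \<Prod>j\<in>{..<n} - {i}. - (1 / ?x) * (1 / (?u ! i * ?u ! j) ^ (n - 1)) * b i j)"
   unfolding poly_pairpoly[OF fib[of k]] pair_prod_def by (intro prod.cong refl step) auto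
  also have "\<dots> = (- (1 / ?x)) ^ (n * (n - 1)) * (1 / (\<Prod>i<n. \<Prod>j\<in>{..<n} - {i}. ?u ! i * ?u ! j) ^ (n - 1)) * (\<Prod>i<n. \<Prod>j\<in>{..<n} - {i}. b i j)"
  proof -
   have "(\<Prod>i<n. \<Prod>j\<in>{..<n} - {i}. - (1 / ?x)) = (- (1 / ?x)) ^ (n * (n - 1))"
    by (simp flip: power_mult add: mult.commute)
   moreover have "(\<Prod>i<n. \<Prod>j\<in>{..<n} - {i}. 1 / (?u ! i * ?u ! j) ^ (n - 1)) = 1 / (\<Prod>i<n. \<Prod>j\<in>{..<n} - {i}. ?u ! i * ?u ! j) ^ (n - 1)"
    by (simp add: prod_dividef prod_power_distrib)
   ultimately show ?thesis by (simp only: prod.distrib)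
  qed
  also have "(\<Prod>i<n. \<Prod>j\<in>{..<n} - {i}. b i j) = pair_prod (bdd (rv n g) (rv n h)) ?u"
   by (simp add: pair_prod_def b_def)
  also have "(- (1 / ?x)) ^ (n * (n - 1)) = 1 / ?x ^ (n * (n - 1))"
  proof -
   have "even (n * (n - 1))" by auto
   thus ?thesis by (simp only: power_minus_even power_one_over)
  qed
  also have "1 / (\<Prod>i<n. \<Prod>j\<in>{..<n} - {i}. ?u ! i * ?u ! j) ^ (n - 1) = (1 / pu) ^ (2 * (n - 1) ^ 2)"
   unfolding puu by (simp add: power_one_over power2_eq_square mult.assoc flip: power_mult)
  also have "(1 / pu) ^ (2 * (n - 1) ^ 2) = ?x ^ (2 * (n - 1) ^ 2) * A k ^ (2 * (n - 1) ^ 2)"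
  proof -
   have "((- 1 :: complex) ^ n)\<^sup>2 = 1" by (simp flip: power_mult)
   thus ?thesis unfolding pu1 by (simp add: power_mult_distrib power_mult)
  qed
  finally have "poly pairpoly ?x = ?x ^ (2 * (n - 1) ^ 2) / ?x ^ (n * (n - 1)) * (A k ^ (2 * (n - 1) ^ 2) * pair_prod (bdd (rv n g) (rv n h)) ?u)"
   by simp
  also have "?x ^ (2 * (n - 1) ^ 2) / ?x ^ (n * (n - 1)) = ?x ^ ((n - 1) * (n - 2))"
  proof (cases "n = 1")
   case False
   then obtain m where m: "n = Suc (Suc m)" using n_pos by (metis One_nat_def not0_implies_Suc less_numeral_extra(3))
   have "2 * (n - 1) ^ 2 = (n - 1) * (n - 2) + n * (n - 1)"
    by (simp add: m power2_eq_square algebra_simps)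
   thus ?thesis using x0 by (simp only: power_add) simp
  qed simp
  finally show ?thesis using x0 by simp
 qed
 have "A \<longlonglongrightarrow> (poly f 0 - poly g 0 * 0) / lead_coeff g"
 proof -
  have "(%k. (poly f 0 - poly g 0 * (1 / xs k)) / lead_coeff g) \<longlonglongrightarrow> (poly f 0 - poly g 0 * 0) / lead_coeff g"
   by (intro tendsto_intros inv0 lg)
  thus ?thesis by (simp add: A_def lc)
 qed
 hence "A \<longlonglongrightarrow> poly f 0 / lead_coeff g" by simp
 moreover have "(%k. pair_prod (bdd (rv n g) (rv n h)) (us k)) \<longlonglongrightarrow> pair_prod (bdd (rv n g) (rv n h)) ss"
  unfolding pair_prod_def by (intro tendsto_intros us) auto
 ultimately show ?thesis unfolding main by (intro tendsto_intros)
qed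

lemma pairpoly_degree:
 "degree pairpoly \<le> (n - 1) * (n - 2)"
 "[|mset ss = proots (rv n f); pair_prod (bdd (rv n g) (rv n h)) ss ~= 0|] ==> degree pairpoly = (n - 1) * (n - 2)"
proof -
 \<comment> \<open>Beyond this bound the fibre over \<open>xs k\<close> does not contain 0, so its
   elements can be inverted.\<close>
 define k0 where "k0 = nat \<lceil>norm (poly g 0 / poly f 0)\<rceil> + 1"
 define xs :: "nat => complex" where "xs = (%k. of_nat (k + k0))"
 have xs0: "xs k ~= 0" for k unfolding xs_def of_nat_eq_0_iff by (simp add: k0_def)
 have inf: "filterlim xs at_infinity sequentially"
  unfolding xs_def
  by (rule filterlim_compose[OF tendsto_of_nat]) (rule filterlim_add_const_nat_at_top)
 have gf: "poly g 0 ~= xs k * poly f 0" for k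
 proof
  assume "poly g 0 = xs k * poly f 0"
  hence "norm (poly g 0 / poly f 0) = norm (xs k)" using f0 by simp
  also have "norm (xs k) = real (k + k0)" unfolding xs_def by (rule norm_of_nat)
  finally show False unfolding k0_def by linarith
 qed
 show "degree pairpoly \<le> (n - 1) * (n - 2)"
 proof -
  obtain ss where "mset ss = proots (rv n f)" using ex_mset by blast
  from degree_via_limit(1)[OF inf xs0 pair_prod_infinity[OF inf xs0 gf this]] show ?thesis .
 qed
 assume ss: "mset ss = proots (rv n f)" "pair_prod (bdd (rv n g) (rv n h)) ss ~= 0"
 have "poly f 0 / lead_coeff g ~= 0" using f0 deg_g n_pos by auto
 thus "degree pairpoly = (n - 1) * (n - 2)"
  using degree_via_limit(2)[OF inf xs0 pair_prod_infinity[OF inf xs0 gf ss(1)]] ss(2) by simp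
qed

end

section \<open>Local contributions of double points and cusps\<close>

lemma poly_single_root:
 fixes q :: "complex poly"
 assumes "poly q s = 0"
 shows "\<exists>r. q = [:-s, 1:] * r \<and> poly (pderiv q) s = poly r s"
 by (rule poly_eq_power_mult[of 1 q s]) (use assms in auto)

lemma poly_double_root:
 fixes q :: "complex poly"
 assumes "poly q s = 0" "poly (pderiv q) s = 0"
 shows "\<exists>r. q = [:-s, 1:] ^ 2 * r \<and> poly (pderiv (pderiv q)) s = 2 * poly r s"
proof (rule poly_eq_power_mult[of 2 q s])
 fix j :: nat assume "j < 2"
 hence "j = 0 \<or> j = 1" by auto
 thus "poly ((pderiv ^^ j) q) s = 0" using assms by auto
next
 fix r assume a: "q = [:-s, 1:] ^ 2 * r" and b: "poly ((pderiv ^^ 2) q) s = fact 2 * poly r s"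
 have "(pderiv ^^ 2) q = pderiv (pderiv q)" by (simp add: numeral_2_eq_2)
 with b have "poly (pderiv (pderiv q)) s = 2 * poly r s" by simp
 with a show ?thesis by blast
qed

lemma poly_triple_root:
 fixes q :: "complex poly"
 assumes "poly q s = 0" "poly (pderiv q) s = 0" "poly (pderiv (pderiv q)) s = 0"
 shows "\<exists>r. q = [:-s, 1:] ^ 3 * r \<and> poly (pderiv (pderiv (pderiv q))) s = 6 * poly r s"
proof (rule poly_eq_power_mult[of 3 q s])
 fix j :: nat assume "j < 3"
 hence "j = 0 \<or> j = 1 \<or> j = 2" by auto
 thus "poly ((pderiv ^^ j) q) s = 0" using assms by (auto simp: numeral_2_eq_2)
next
 fix r assume a: "q = [:-s, 1:] ^ 3 * r" and b: "poly ((pderiv ^^ 3) q) s = fact 3 * poly r s"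
 have "(pderiv ^^ 3) q = pderiv (pderiv (pderiv q))" by (simp add: numeral_3_eq_3)
 with b have "poly (pderiv (pderiv (pderiv q))) s = 6 * poly r s" by (simp add: fact_numeral)
 with a show ?thesis by blast
qed

lemma order_eqI:
 fixes q :: "complex poly"
 assumes "p = [:-a, 1:] ^ k * q" "poly q a ~= 0"
 shows "order a p = k"
proof -
 have "q ~= 0" using assms(2) by auto
 hence "order a p = order a ([:-a, 1:] ^ k) + order a q"
  unfolding assms(1) by (intro order_mult) (auto simp del: mult_pCons_left)
 thus ?thesis using assms(2) by (simp add: order_power_n_n order_0I)
qed

lemma sum_order_le:
 assumes "finite X" "q ~= 0"
 shows "(\<Sum>x\<in>X. order x q) \<le> degree (q :: complex poly)"
proof -
 have "(\<Sum>x\<in>X. order x q) = (\<Sum>x\<in>X. count (proots q) x)" using assms(2) by simp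
 also have "\<dots> = (\<Sum>x\<in>X \<inter> set_mset (proots q). count (proots q) x)"
  using assms(1) by (intro sum.mono_neutral_right) (auto simp: not_in_iff[symmetric])
 also have "\<dots> \<le> (\<Sum>x\<in>set_mset (proots q). count (proots q) x)"
  by (intro sum_mono2) auto
 also have "\<dots> = degree q" by (simp add: size_proots_complex flip: size_multiset_overloaded_eq)
 finally show ?thesis .
qed

lemma sum_order_eq:
 assumes "finite X" "q ~= 0" "\<And>x. poly q x = 0 ==> x \<in> X"
 shows "(\<Sum>x\<in>X. order x q) = degree (q :: complex poly)"
proof -
 have "(\<Sum>x\<in>X. order x q) = (\<Sum>x\<in>X. count (proots q) x)" using assms(2) by simp
 also have "\<dots> = (\<Sum>x\<in>set_mset (proots q). count (proots q) x)"
  using assms by (intro sum.mono_neutral_right) (auto simp: not_in_iff[symmetric] order_root)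
 also have "\<dots> = degree q" by (simp add: size_proots_complex flip: size_multiset_overloaded_eq)
 finally show ?thesis .
qed

context plane_fibration
begin

lemma same_image_fibre:
 assumes "same_image s t" "poly g s = x * poly f s"
 shows "poly g t = x * poly f t"
 using assms by (auto simp: same_image_def)

lemma same_image_iff_bdd:
 assumes "poly g s = x * poly f s" "poly g t = x * poly f t" "s ~= t"
 shows "same_image s t \<longleftrightarrow> bdd f h s t = 0"
proof -
 have "poly f s ~= 0" "poly f t ~= 0" using f_nz_fibre assms by blast+
 moreover have "bdd f h s t = 0 \<longleftrightarrow> poly f s * poly h t = poly h s * poly f t"
  using bdd_eq[of t s f h] assms(3) by auto
 ultimately show ?thesis using assms by (auto simp: same_image_def)
qed

lemma fibre_step:
 assumes "poly g s = x * poly f s" "poly g u = y * poly f u"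
 shows "(u - s) * dd (fibre_poly x) s u = (y - x) * poly f u"
 using dd_eq[of "fibre_poly x" u s] assms by (simp add: poly_fibre_poly algebra_simps)

text \<open>At a point of the fibre, \<open>wronski\<close> and its derivative are \<open>f\<close>
  times the first derivative of the fibre polynomial and, where the former vanishes, times the
  second; zeros of \<open>wronski\<close> thus measure the multiplicity in the fibre.\<close>

lemma order_fibre_poly:
 assumes "poly g s = x * poly f s"
 shows "poly wronski s ~= 0 ==> order s (fibre_poly x) = 1"
  "[|poly wronski s = 0; poly (pderiv wronski) s ~= 0|] ==> order s (fibre_poly x) = 2 \<and>
   poly (pderiv (pderiv (fibre_poly x))) s ~= 0 \<and> poly (pderiv (fibre_poly x)) s = 0"
proof -
 let ?p = "fibre_poly x"
 have fs: "poly f s ~= 0" by (rule f_nz_fibre[OF assms])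
 have p0: "poly ?p s = 0" using assms by (simp add: poly_fibre_poly)
 have w: "poly wronski s = poly f s * poly (pderiv ?p) s"
  using assms by (simp add: wronski_def fibre_poly_def pderiv_diff pderiv_smult algebra_simps)
 have w': "poly (pderiv wronski) s = poly f s * poly (pderiv (pderiv ?p)) s"
  using assms by (simp add: wronski_def fibre_poly_def pderiv_diff pderiv_smult pderiv_mult algebra_simps)
 { assume "poly wronski s ~= 0"
  hence d: "poly (pderiv ?p) s ~= 0" using w by auto
  obtain q where q: "?p = [:-s, 1:] ^ 1 * q" "poly (pderiv ?p) s = poly q s"
   using poly_single_root[OF p0] by auto
  have "poly q s ~= 0" using q(2) d by simp
  thus "order s ?p = 1" using order_eqI[OF q(1)] by blast }
 { assume "poly wronski s = 0" "poly (pderiv wronski) s ~= 0"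
  hence d: "poly (pderiv ?p) s = 0" "poly (pderiv (pderiv ?p)) s ~= 0" using w w' fs by auto
  obtain q where q: "?p = [:-s, 1:] ^ 2 * q" "poly (pderiv (pderiv ?p)) s = 2 * poly q s"
   using poly_double_root[OF p0 d(1)] by blast
  have "poly q s ~= 0" using q(2) d by simp
  hence "order s ?p = 2" using order_eqI[OF q(1)] by blast
  thus "order s ?p = 2 \<and> poly (pderiv (pderiv ?p)) s ~= 0 \<and> poly (pderiv ?p) s = 0" using d by simp }
qed

text \<open>Near \<open>s\<close> and \<open>t\<close> the ordinate h/f is a function of x with
  slope \<open>wronskh / wronski\<close>. The quotient tends to a nonzero multiple of the difference
  of the two slopes.\<close>

lemma node_limit:
 assumes st: "same_image s t" "s ~= t" "poly g s = x * poly f s" "poly wronski s ~= 0" "poly wronski t ~= 0"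
  and lim: "ss \<longlonglongrightarrow> s" "ts \<longlonglongrightarrow> t" "xs \<longlonglongrightarrow> x" "\<And>k. xs k ~= x"
  and fib: "\<And>k. poly g (ss k) = xs k * poly f (ss k)" "\<And>k. poly g (ts k) = xs k * poly f (ts k)"
 shows "\<exists>L. (%k. bdd f h (ss k) (ts k) / (xs k - x)) \<longlonglongrightarrow> L \<and>
  (poly wronski s * poly wronskh t ~= poly wronski t * poly wronskh s --> L ~= 0)"
proof -
 let ?p = "fibre_poly x"
 have fs: "poly f s ~= 0" "poly f t ~= 0" using st(1) by (auto simp: same_image_def)
 define y where "y = poly h s / poly f s"
 have hs: "poly h s = y * poly f s" using fs by (simp add: y_def)
 have ht: "poly h t = y * poly f t" using st(1) fs by (simp add: same_image_def y_def field_simps)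
 have gt: "poly g t = x * poly f t" using same_image_fibre[OF st(1,3)] .
 define q where "q = h - smult y f"
 have lim1: "(%k. poly q (us k) / (xs k - x)) \<longlonglongrightarrow> poly f u * poly wronskh u / poly wronski u"
  if u: "us \<longlonglongrightarrow> u" "poly g u = x * poly f u" "poly h u = y * poly f u" "poly wronski u ~= 0"
   "\<And>k. poly g (us k) = xs k * poly f (us k)" for us u
 proof -
  have fu: "poly f u ~= 0" using f_nz_fibre u(2) by blast
  have w: "poly wronski u = poly f u * poly (pderiv ?p) u"
   using u(2) by (simp add: wronski_def fibre_poly_def pderiv_diff pderiv_smult algebra_simps)
  have wh: "poly wronskh u = poly f u * poly (pderiv q) u"
   using u(3) by (simp add: wronskh_def q_def pderiv_diff pderiv_smult algebra_simps)
  have d: "(%k. dd ?p u (us k)) \<longlonglongrightarrow> poly (pderiv ?p) u"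
   using tendsto_dd[OF tendsto_const u(1), of ?p u] by simp
  have d0: "poly (pderiv ?p) u ~= 0" using w u(4) by auto
  have ev: "\<forall>\<^sub>F k in sequentially. dd ?p u (us k) ~= 0" by (rule tendsto_imp_eventually_ne[OF d d0])
  have a: "(%k. poly f (us k) / dd ?p u (us k) * dd q u (us k)) \<longlonglongrightarrow> poly f u / poly (pderiv ?p) u * poly (pderiv q) u"
   using tendsto_dd[OF tendsto_const u(1), of q u] d0 by (intro tendsto_intros d u) auto
  have b: "poly f u / poly (pderiv ?p) u * poly (pderiv q) u = poly f u * poly wronskh u / poly wronski u"
   using fu by (simp add: w wh)
  have c: "\<forall>\<^sub>F k in sequentially. poly f (us k) / dd ?p u (us k) * dd q u (us k) = poly q (us k) / (xs k - x)"
   using ev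
  proof eventually_elim
   case (elim k)
   have "poly q (us k) = (us k - u) * dd q u (us k)"
    using dd_eq[of q "us k" u] u(3) by (simp add: q_def)
   moreover have "(us k - u) = (xs k - x) * (poly f (us k) / dd ?p u (us k))"
    using fibre_step[OF u(2) u(5)] elim by (simp add: field_simps)
   ultimately show ?case using lim(4)[of k] by simp
  qed
  from Lim_transform_eventually[OF a c] show ?thesis unfolding b .
 qed
 define L where "L = (poly f s * (poly f t * poly wronskh t / poly wronski t) - poly f s * poly wronskh s / poly wronski s * poly f t) / (t - s)"
 have "(%k. (poly f (ss k) * (poly q (ts k) / (xs k - x)) - poly q (ss k) / (xs k - x) * poly f (ts k)) / (ts k - ss k)) \<longlonglongrightarrow> L"
  unfolding L_def using st(2)
  by (intro tendsto_intros lim lim1 st hs ht gt fib) auto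
 moreover have "\<forall>\<^sub>F k in sequentially. ts k - ss k ~= 0"
  by (rule tendsto_imp_eventually_ne[of _ "t - s"]) (use st(2) in \<open>auto intro!: tendsto_intros lim\<close>)
 hence "\<forall>\<^sub>F k in sequentially. (poly f (ss k) * (poly q (ts k) / (xs k - x)) - poly q (ss k) / (xs k - x) * poly f (ts k)) / (ts k - ss k)
   = bdd f h (ss k) (ts k) / (xs k - x)"
 proof eventually_elim
  case (elim k)
  have "(ts k - ss k) * bdd f h (ss k) (ts k) = poly f (ss k) * poly q (ts k) - poly q (ss k) * poly f (ts k)"
   using bdd_eq[of "ts k" "ss k" f h] by (simp add: q_def algebra_simps)
  hence "bdd f h (ss k) (ts k) = (poly f (ss k) * poly q (ts k) - poly q (ss k) * poly f (ts k)) / (ts k - ss k)"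
   using elim by (simp add: field_simps)
  thus ?case by (simp add: diff_divide_distrib mult_ac)
 qed
 ultimately have "(%k. bdd f h (ss k) (ts k) / (xs k - x)) \<longlonglongrightarrow> L"
  by (rule Lim_transform_eventually)
 moreover have "L ~= 0" if tr: "poly wronski s * poly wronskh t ~= poly wronski t * poly wronskh s"
 proof -
  have "L = poly f s * poly f t * (poly wronski s * poly wronskh t - poly wronski t * poly wronskh s) / (poly wronski s * poly wronski t * (t - s))"
   using st by (simp add: L_def divide_simps) (simp add: algebra_simps)
  thus ?thesis using tr st fs by auto
 qed
 ultimately show ?thesis by blast
qed

text \<open>Near a cusp the two parameters over a value near x lie at e and e' with e + e' of order
  e^2, and e^2 is proportional to the change of x. A suitable combination of f, g, h vanishes to
  third order, and its divided difference e^2 + e e' + e'^2 is of order e^2. Hence each ordered pair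
  contributes a simple zero.\<close>

lemma cusp_limit:
 assumes s: "poly g s = x * poly f s" "poly wronski s = 0" "poly (pderiv wronski) s ~= 0" "poly wronskh s = 0"
  and lim: "ss \<longlonglongrightarrow> s" "ts \<longlonglongrightarrow> s" "xs \<longlonglongrightarrow> x" "\<And>k. xs k ~= x"
  and fib: "\<And>k. poly g (ss k) = xs k * poly f (ss k)"
   "\<And>k. bdd f (fibre_poly x) (ss k) (ts k) = 0"
 shows "\<exists>L. (%k. bdd f h (ss k) (ts k) / (xs k - x)) \<longlonglongrightarrow> L \<and>
  (poly (pderiv wronski) s * poly (pderiv (pderiv wronskh)) s ~=
   poly (pderiv wronskh) s * poly (pderiv (pderiv wronski)) s --> L ~= 0)"
proof -
 let ?p = "fibre_poly x"
 have fs: "poly f s ~= 0" by (rule f_nz_fibre[OF s(1)])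
 have p: "poly ?p s = 0" "poly (pderiv ?p) s = 0" "poly (pderiv (pderiv ?p)) s ~= 0"
  using order_fibre_poly(2)[OF s(1,2,3)] s(1) by (auto simp: poly_fibre_poly)
 define y where "y = poly h s / poly f s"
 have hs: "poly h s = y * poly f s" using fs by (simp add: y_def)
 define q where "q = h - smult y f"
 have q0: "poly q s = 0" using hs by (simp add: q_def)
 have wh: "poly wronskh s = poly f s * poly (pderiv q) s"
  using hs by (simp add: wronskh_def q_def pderiv_diff pderiv_smult algebra_simps)
 have q1: "poly (pderiv q) s = 0" using wh s(4) fs by simp
 have wh1: "poly (pderiv wronskh) s = poly f s * poly (pderiv (pderiv q)) s"
  using hs by (simp add: wronskh_def q_def pderiv_diff pderiv_smult pderiv_mult algebra_simps)
 have w1: "poly (pderiv wronski) s = poly f s * poly (pderiv (pderiv ?p)) s"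
  using s(1) by (simp add: wronski_def fibre_poly_def pderiv_diff pderiv_smult pderiv_mult algebra_simps)
 have wh2: "poly (pderiv (pderiv wronskh)) s = poly f s * poly (pderiv (pderiv (pderiv q))) s + poly (pderiv f) s * poly (pderiv (pderiv q)) s"
 proof -
  have "wronskh = f * pderiv q - q * pderiv f"
   by (simp add: wronskh_def q_def pderiv_diff pderiv_smult algebra_simps)
  thus ?thesis by (simp only:) (simp add: q0 q1 pderiv_diff pderiv_mult pderiv_add algebra_simps)
 qed
 have w2: "poly (pderiv (pderiv wronski)) s = poly f s * poly (pderiv (pderiv (pderiv ?p))) s + poly (pderiv f) s * poly (pderiv (pderiv ?p)) s"
 proof -
  have "wronski = f * pderiv ?p - ?p * pderiv f"
   by (simp add: wronski_def fibre_poly_def pderiv_diff pderiv_smult algebra_simps)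
  thus ?thesis by (simp only:) (simp add: p pderiv_diff pderiv_mult pderiv_add algebra_simps)
 qed
 \<comment> \<open>The multiple of the fibre polynomial that removes the quadratic term of
   \<open>q\<close>; as \<open>bdd f\<close> of the fibre polynomial is zero on the pair, the
   divided difference is unaffected.\<close>
 define m where "m = poly (pderiv (pderiv q)) s / poly (pderiv (pderiv ?p)) s"
 define r where "r = q - smult m ?p"
 have r: "poly r s = 0" "poly (pderiv r) s = 0" "poly (pderiv (pderiv r)) s = 0"
  using p q0 q1 by (simp_all add: r_def m_def pderiv_diff pderiv_smult)
 have r3: "poly (pderiv (pderiv (pderiv r))) s = poly (pderiv (pderiv (pderiv q))) s - m * poly (pderiv (pderiv (pderiv ?p))) s"
  by (simp add: r_def pderiv_diff pderiv_smult)
 obtain l where l: "?p = [:-s, 1:] ^ 2 * l" "poly (pderiv (pderiv ?p)) s = 2 * poly l s"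
  using poly_double_root[OF p(1,2)] by blast
 have l0: "poly l s ~= 0" using l(2) p(3) by simp
 obtain c where c: "r = [:-s, 1:] ^ 3 * c" "poly (pderiv (pderiv (pderiv r))) s = 6 * poly c s"
  using poly_triple_root[OF r] by blast
 note c3 = c(2)
 define e where "e = (%k. ss k - s)"
 define e' where "e' = (%k. ts k - s)"
 have sq: "dd ([:-s, 1:] ^ 2) (ss k) (ts k) = e k + e' k" for k
  by (simp only: power2_eq_square dd_mult dd_linear) (simp add: e_def e'_def)
 have cb: "dd ([:-s, 1:] ^ 3) (ss k) (ts k) = e k ^ 2 + e k * e' k + e' k ^ 2" for k
  by (simp only: power3_eq_cube dd_mult dd_linear)
    (simp add: e_def e'_def power2_eq_square algebra_simps)
 have dd2: "dd ([:-s, 1:] ^ 2 * a) (ss k) (ts k) = (e k + e' k) * poly a (ts k) + e k ^ 2 * dd a (ss k) (ts k)" for a k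
  by (simp only: dd_mult[of "[:-s, 1:] ^ 2"] sq) (simp add: e_def)
 have dd3: "dd ([:-s, 1:] ^ 3 * a) (ss k) (ts k) = (e k ^ 2 + e k * e' k + e' k ^ 2) * poly a (ts k) + e k ^ 3 * dd a (ss k) (ts k)" for a k
  by (simp only: dd_mult[of "[:-s, 1:] ^ 3"] cb) (simp add: e_def)
 have ps: "poly ?p (ss k) = e k ^ 2 * poly l (ss k)" for k
  by (subst l(1)) (simp add: e_def)
 have rs: "poly r (ss k) = e k ^ 3 * poly c (ss k)" for k
  by (subst c(1)) (simp add: e_def)
 have B: "bdd f h (ss k) (ts k) = bdd f r (ss k) (ts k)" for k
 proof -
  have "bdd f r (ss k) (ts k) = bdd f q (ss k) (ts k) - m * bdd f ?p (ss k) (ts k)"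
   unfolding r_def by (rule bdd_diff_smult)
  also have "bdd f q (ss k) (ts k) = bdd f h (ss k) (ts k)"
   unfolding q_def by (simp add: bdd_diff_smult)
  finally show ?thesis using fib(2)[of k] by simp
 qed
 \<comment> \<open>The equation \<open>bdd f (fibre_poly x) = 0\<close>, solved for e + e', reads e
   + e' = e^2 v.\<close>
 define v where "v = (%k. (poly l (ss k) * dd f (ss k) (ts k) - poly f (ss k) * dd l (ss k) (ts k)) / (poly f (ss k) * poly l (ts k)))"
 have liml: "(%k. poly l (ss k)) \<longlonglongrightarrow> poly l s" "(%k. poly l (ts k)) \<longlonglongrightarrow> poly l s"
  "(%k. poly f (ss k)) \<longlonglongrightarrow> poly f s" by (intro tendsto_intros lim)+
 have ev: "\<forall>\<^sub>F k in sequentially. poly l (ss k) ~= 0 \<and> poly l (ts k) ~= 0 \<and> poly f (ss k) ~= 0"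
  using tendsto_imp_eventually_ne[OF liml(1) l0] tendsto_imp_eventually_ne[OF liml(2) l0] tendsto_imp_eventually_ne[OF liml(3) fs]
  by eventually_elim auto
 have lime: "e \<longlonglongrightarrow> 0" unfolding e_def using lim(1) by (simp add: LIM_zero)
 define V where "V = (poly l s * dd f s s - poly f s * dd l s s) / (poly f s * poly l s)"
 have limv: "v \<longlonglongrightarrow> V" unfolding v_def V_def
  by (intro tendsto_intros lim) (use l0 fs in auto)
 have limev: "(%k. e k * v k) \<longlonglongrightarrow> 0" using tendsto_mult[OF lime limv] by simp
 define L where "L = (poly f s / poly l s) * (poly f s * (poly c s * (1 - 0 + 0 ^ 2) + 0 * dd c s s) - 0 * poly c s * dd f s s)"
 have "(%k. (poly f (ss k) / poly l (ss k)) * (poly f (ss k) * (poly c (ts k) * (1 - e k * v k + (e k * v k) ^ 2) + e k * dd c (ss k) (ts k))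
   - e k * poly c (ss k) * dd f (ss k) (ts k))) \<longlonglongrightarrow> L"
  unfolding L_def by (intro tendsto_intros lim limev lime) (use l0 in auto)
 moreover have "\<forall>\<^sub>F k in sequentially. (poly f (ss k) / poly l (ss k)) * (poly f (ss k) * (poly c (ts k) * (1 - e k * v k + (e k * v k) ^ 2) + e k * dd c (ss k) (ts k))
   - e k * poly c (ss k) * dd f (ss k) (ts k)) = bdd f h (ss k) (ts k) / (xs k - x)"
  using ev
 proof eventually_elim
  case (elim k)
  have "0 = poly f (ss k) * ((e k + e' k) * poly l (ts k) + e k ^ 2 * dd l (ss k) (ts k)) - e k ^ 2 * poly l (ss k) * dd f (ss k) (ts k)"
   using fib(2)[of k] dd2[of l k] ps[of k] l(1) by (simp add: bdd_def)
  hence "e k + e' k = e k ^ 2 * v k" unfolding v_def using elim by (simp add: field_simps)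
  hence e': "e' k = - e k + e k ^ 2 * v k" by (simp add: algebra_simps)
  have sqe: "e k ^ 2 + e k * e' k + e' k ^ 2 = e k ^ 2 * (1 - e k * v k + (e k * v k) ^ 2)"
   unfolding e' by (simp add: power2_eq_square algebra_simps)
  have "e k ^ 2 * poly l (ss k) = (xs k - x) * poly f (ss k)"
   using ps[of k] fib(1)[of k] by (simp add: poly_fibre_poly algebra_simps)
  hence ee: "e k ^ 2 = (xs k - x) * (poly f (ss k) / poly l (ss k))" using elim by (simp add: field_simps)
  have "bdd f h (ss k) (ts k) = poly f (ss k) * dd r (ss k) (ts k) - poly r (ss k) * dd f (ss k) (ts k)"
   unfolding B by (simp add: bdd_def)
  also have "dd r (ss k) (ts k) = (e k ^ 2 + e k * e' k + e' k ^ 2) * poly c (ts k) + e k ^ 3 * dd c (ss k) (ts k)"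
   by (subst c(1)) (rule dd3)
  also have "poly f (ss k) * ((e k ^ 2 + e k * e' k + e' k ^ 2) * poly c (ts k) + e k ^ 3 * dd c (ss k) (ts k)) - poly r (ss k) * dd f (ss k) (ts k)
   = e k ^ 2 * (poly f (ss k) * (poly c (ts k) * (1 - e k * v k + (e k * v k) ^ 2) + e k * dd c (ss k) (ts k))
     - e k * poly c (ss k) * dd f (ss k) (ts k))"
   unfolding sqe rs by (simp add: power2_eq_square power3_eq_cube algebra_simps)
  finally show ?case using lim(4)[of k] unfolding ee by simp
 qed
 ultimately have "(%k. bdd f h (ss k) (ts k) / (xs k - x)) \<longlonglongrightarrow> L" by (rule Lim_transform_eventually)
 moreover have "L ~= 0" if tr: "poly (pderiv wronski) s * poly (pderiv (pderiv wronskh)) s ~=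
   poly (pderiv wronskh) s * poly (pderiv (pderiv wronski)) s"
 proof -
  have "poly c s ~= 0"
  proof
   assume "poly c s = 0"
   hence "poly (pderiv (pderiv (pderiv q))) s = m * poly (pderiv (pderiv (pderiv ?p))) s" using c3 r3 by simp
   hence "poly (pderiv (pderiv (pderiv q))) s * poly (pderiv (pderiv ?p)) s = poly (pderiv (pderiv q)) s * poly (pderiv (pderiv (pderiv ?p))) s"
    using p(3) by (simp add: m_def)
   thus False using tr unfolding w1 w2 wh1 wh2 by (simp add: algebra_simps)
  qed
  thus ?thesis using fs l0 by (simp add: L_def)
 qed
 ultimately show ?thesis by blast
qed

definition transversal :: "complex => complex => bool" where
 "transversal s t \<longleftrightarrow> poly wronski s * poly wronskh t ~= poly wronski t * poly wronskh s"

definition simple_cusp :: "complex => bool" where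
 "simple_cusp s \<longleftrightarrow> poly (pderiv wronski) s * poly (pderiv (pderiv wronskh)) s ~=
   poly (pderiv wronskh) s * poly (pderiv (pderiv wronski)) s"

text \<open>The order of \<open>pairpoly\<close> at \<open>x\<close> is the number of indices in the fibre over \<open>x\<close> belonging to
 double points or cusps, as each of them contributes one factor of order one.\<close>

lemma order_pairpoly:
 assumes T: "\<And>s. s \<in> T ==> poly wronski s ~= 0 \<and> (\<exists>t\<in>T. t ~= s \<and> same_image s t)"
  and K: "\<And>s. s \<in> K ==> ramified s \<and> poly (pderiv wronski) s ~= 0"
  and nz: "pairpoly ~= 0"
 shows "card {i. i < n \<and> fibre x ! i \<in> T \<union> K} \<le> order x pairpoly"
  "[|\<And>s t. s ~= t ==> same_image s t ==> s \<in> T \<and> transversal s t;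
   \<And>s t t'. s ~= t ==> s ~= t' ==> same_image s t ==> same_image s t' ==> t = t';
   \<And>s. ramified s ==> s \<in> K \<and> simple_cusp s|] ==>
   card {i. i < n \<and> fibre x ! i \<in> T \<union> K} = order x pairpoly"
proof -
 define ts where "ts = fibre x"
 have tsm: "mset ts = proots (fibre_poly x)" by (simp add: ts_def mset_fibre)
 have len: "length ts = n" by (simp add: ts_def)
 have fibt: "poly g (ts ! i) = x * poly f (ts ! i)" if "i < n" for i
  using nth_mem[of i ts] that len unfolding ts_def set_fibre by simp
 have fnz: "poly f (ts ! i) ~= 0" if "i < n" for i using f_nz_fibre[OF fibt[OF that]] .
 define I where "I = {i. i < n \<and> ts ! i \<in> T \<union> K}"
 \<comment> \<open>The additional hypotheses of the second claim in one proposition, so that a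
   single computation of the limit serves the inequality and the equality.\<close>
 define full where "full \<longleftrightarrow> (\<forall>s t. s ~= t --> same_image s t --> s \<in> T \<and> transversal s t) \<and>
   (\<forall>s t t'. s ~= t --> s ~= t' --> same_image s t --> same_image s t' --> t = t') \<and> (\<forall>s. ramified s --> s \<in> K \<and> simple_cusp s)"
 have fD: "s \<in> T" "transversal s t" if full "s ~= t" "same_image s t" for s t
  using that unfolding full_def by blast+
 have fD': "t = t'" if full "s ~= t" "s ~= t'" "same_image s t" "same_image s t'" for s t t'
  using that unfolding full_def by blast
 have fD'': "s \<in> K" "simple_cusp s" if full "ramified s" for s
  using that unfolding full_def by blast+
 note fD = fD fD' fD''
 have mult: "card {i. i < n \<and> ts ! i = s} = order s (fibre_poly x)" for s
  using count_mset_eq_card[of ts s] by (simp add: tsm len)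
 define xs :: "nat => complex" where "xs = (%k. x + 1 / of_nat (Suc k))"
 have xs: "xs \<longlonglongrightarrow> x"
 proof -
  have "(%k. 1 / of_nat (Suc k)) \<longlonglongrightarrow> (0::complex)" by (rule lim_1_over_n[THEN LIMSEQ_Suc])
  from tendsto_add[OF tendsto_const this, of x] show ?thesis by (simp add: xs_def)
 qed
 have xne: "xs k ~= x" for k unfolding xs_def by (simp del: of_nat_Suc)
 obtain rs where rs: "\<And>k. mset (rs k) = proots (fibre_poly (xs k))" "\<And>i. i < n ==> (%k. rs k ! i) \<longlonglongrightarrow> ts ! i"
  using fibre_tendsto[OF xs tsm] by blast
 have rslen: "length (rs k) = n" for k using poly_root_list(2)[OF rs(1)] by simp
 have fibr: "poly g (rs k ! i) = xs k * poly f (rs k ! i)" if "i < n" for i k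
 proof -
  have "rs k ! i \<in> set (rs k)" using that rslen by simp
  thus ?thesis unfolding set_root_list[OF rs(1) fibre_poly_nz] by (simp add: poly_fibre_poly)
 qed
 have B0: "bdd f h (ts ! i) (ts ! j) ~= 0" if full: full and ij: "i < n" "j < n" "i ~= j" and iI: "i \<notin> I" for i j
 proof
  assume b: "bdd f h (ts ! i) (ts ! j) = 0"
  show False
  proof (cases "ts ! i = ts ! j")
   case False
   hence "same_image (ts ! i) (ts ! j)" using same_image_iff_bdd[OF fibt fibt] b ij by simp
   hence "ts ! i \<in> T" using fD(1)[OF full False] by blast
   thus False using iI ij by (simp add: I_def)
  next
   case True
   have "card {i, j} \<le> card {k. k < n \<and> ts ! k = ts ! i}" using ij True by (intro card_mono) auto
   hence "order (ts ! i) (fibre_poly x) ~= 1" using ij(3) by (simp add: mult)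
   hence "poly wronski (ts ! i) = 0" using order_fibre_poly(1)[OF fibt] ij by blast
   moreover have "poly wronskh (ts ! i) = 0" using b True by (simp add: bdd_self wronskh_def)
   ultimately have "ramified (ts ! i)" using fnz ij by (simp add: ramified_def)
   hence "ts ! i \<in> K" using fD(4)[OF full] by blast
   thus False using iI ij by (simp add: I_def)
  qed
 qed
 \<comment> \<open>The row of the product that belongs to index \<open>i\<close>: it vanishes to
   first order when \<open>i\<close> belongs to \<open>I\<close>, and otherwise stays away from zero
   if \<open>full\<close> holds.\<close>
 define Q where "Q = (%k i. \<Prod>j\<in>{..<n} - {i}. bdd f h (rs k ! i) (rs k ! j))"
 have "\<exists>L. (%k. Q k i / (if i \<in> I then xs k - x else 1)) \<longlonglongrightarrow> L \<and> (full --> L ~= 0)" if i: "i < n" for i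
 proof (cases "i \<in> I")
  case False
  have "(%k. Q k i) \<longlonglongrightarrow> (\<Prod>j\<in>{..<n} - {i}. bdd f h (ts ! i) (ts ! j))"
   unfolding Q_def using i by (intro tendsto_intros rs) auto
  moreover have "(\<Prod>j\<in>{..<n} - {i}. bdd f h (ts ! i) (ts ! j)) ~= 0" if full
   using B0[OF that i] False by auto
  ultimately show ?thesis using False by auto
 next
  case True
  \<comment> \<open>The partner \<open>j\<close> is the index of the second parameter of the double
    point, or the second occurrence of a cusp parameter in its fibre.\<close>
  have "\<exists>j L. j < n \<and> j ~= i \<and> (%k. bdd f h (rs k ! i) (rs k ! j) / (xs k - x)) \<longlonglongrightarrow> L \<and> (full --> L ~= 0) \<and>
    (full --> (\<forall>j'. j' < n --> j' ~= i --> j' ~= j --> bdd f h (ts ! i) (ts ! j') ~= 0))"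
  proof (cases "ts ! i \<in> T")
   case iT: True
   then obtain t where t: "t \<in> T" "t ~= ts ! i" "same_image (ts ! i) t" using T by blast
   have w: "poly wronski (ts ! i) ~= 0" "poly wronski t ~= 0" using T iT t by auto
   have gt: "poly g t = x * poly f t" using same_image_fibre[OF t(3) fibt[OF i]] .
   hence "t \<in> set ts" by (simp add: ts_def set_fibre)
   then obtain j where j: "j < n" "ts ! j = t" using len by (auto simp: in_set_conv_nth)
   have ji: "j ~= i" using j t by auto
   have "\<exists>L. (%k. bdd f h (rs k ! i) (rs k ! j) / (xs k - x)) \<longlonglongrightarrow> L \<and>
     (poly wronski (ts ! i) * poly wronskh t ~= poly wronski t * poly wronskh (ts ! i) --> L ~= 0)"
    using rs(2)[OF j(1)] t(2)
    by (intro node_limit[OF t(3) _ fibt[OF i] w rs(2)[OF i] _ xs xne fibr[OF i] fibr[OF j(1)]]) (auto simp: j)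
   then obtain L where L: "(%k. bdd f h (rs k ! i) (rs k ! j) / (xs k - x)) \<longlonglongrightarrow> L"
    "transversal (ts ! i) t ==> L ~= 0" unfolding transversal_def by blast
   have "bdd f h (ts ! i) (ts ! j') ~= 0" if full: full and j': "j' < n" "j' ~= i" "j' ~= j" for j'
   proof
    assume b: "bdd f h (ts ! i) (ts ! j') = 0"
    have o1: "card {k. k < n \<and> ts ! k = ts ! i} = 1" "card {k. k < n \<and> ts ! k = t} = 1"
     using order_fibre_poly(1) fibt[OF i] gt w by (auto simp: mult)
    have "ts ! j' ~= ts ! i"
    proof
     assume "ts ! j' = ts ! i"
     hence "card {i, j'} \<le> card {k. k < n \<and> ts ! k = ts ! i}" using i j' by (intro card_mono) auto
     thus False using o1 j' by simp
    qed
    hence "same_image (ts ! i) (ts ! j')" using same_image_iff_bdd[OF fibt fibt] b i j' by simp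
    hence "ts ! j' = t" using fD(3)[OF full _ _ _ t(3)] t(2) \<open>ts ! j' ~= ts ! i\<close> by metis
    hence "card {j, j'} \<le> card {k. k < n \<and> ts ! k = t}" using j j' by (intro card_mono) auto
    thus False using o1 j' by simp
   qed
   moreover have "L ~= 0" if full using L(2) fD(2)[OF that _ t(3)] t(2) by metis
   ultimately show ?thesis using L(1) j(1) ji by blast
  next
   case False
   hence iK: "ts ! i \<in> K" using True by (simp add: I_def)
   hence r: "ramified (ts ! i)" "poly (pderiv wronski) (ts ! i) ~= 0" using K by auto
   have o2: "card {k. k < n \<and> ts ! k = ts ! i} = 2"
    using order_fibre_poly(2)[OF fibt[OF i]] r by (simp add: mult ramified_def)
   have "{k. k < n \<and> ts ! k = ts ! i} - {i} ~= {}"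
   proof
    assume "{k. k < n \<and> ts ! k = ts ! i} - {i} = {}"
    hence "{k. k < n \<and> ts ! k = ts ! i} \<subseteq> {i}" by blast
    hence "card {k. k < n \<and> ts ! k = ts ! i} \<le> card {i}" by (intro card_mono) auto
    thus False using o2 by simp
   qed
   then obtain j where j: "j < n" "ts ! j = ts ! i" "j ~= i" by blast
   have "\<exists>L. (%k. bdd f h (rs k ! i) (rs k ! j) / (xs k - x)) \<longlonglongrightarrow> L \<and>
    (poly (pderiv wronski) (ts ! i) * poly (pderiv (pderiv wronskh)) (ts ! i) ~=
     poly (pderiv wronskh) (ts ! i) * poly (pderiv (pderiv wronski)) (ts ! i) --> L ~= 0)"
    using r rs(2)[OF j(1)] j bdd_fibre(2)[OF rs(1) i j(1)]
    by (intro cusp_limit[OF fibt[OF i] _ _ _ rs(2)[OF i] _ xs xne fibr[OF i]]) (auto simp: ramified_def)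
   then obtain L where L: "(%k. bdd f h (rs k ! i) (rs k ! j) / (xs k - x)) \<longlonglongrightarrow> L"
    "simple_cusp (ts ! i) ==> L ~= 0" unfolding simple_cusp_def by blast
   have "bdd f h (ts ! i) (ts ! j') ~= 0" if full: full and j': "j' < n" "j' ~= i" "j' ~= j" for j'
   proof
    assume b: "bdd f h (ts ! i) (ts ! j') = 0"
    show False
    proof (cases "ts ! j' = ts ! i")
     case True
     hence "card {i, j, j'} \<le> card {k. k < n \<and> ts ! k = ts ! i}" using i j j' by (intro card_mono) auto
     thus False using o2 i j j' by simp
    next
     case ne: False
     hence "same_image (ts ! i) (ts ! j')" using same_image_iff_bdd[OF fibt fibt] b i j' by simp
     hence "ts ! i \<in> T" using fD(1)[OF full] ne by metis
     thus False using False by simp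
    qed
   qed
   moreover have "L ~= 0" if full using L(2) fD(5)[OF that r(1)] by simp
   ultimately show ?thesis using L(1) j by blast
  qed
  then obtain j L where J: "j < n \<and> j ~= i \<and> (%k. bdd f h (rs k ! i) (rs k ! j) / (xs k - x)) \<longlonglongrightarrow> L \<and> (full --> L ~= 0) \<and>
    (full --> (\<forall>j'. j' < n --> j' ~= i --> j' ~= j --> bdd f h (ts ! i) (ts ! j') ~= 0))" by (elim exE)
  hence j: "j < n" "j ~= i" and L: "(%k. bdd f h (rs k ! i) (rs k ! j) / (xs k - x)) \<longlonglongrightarrow> L" "full ==> L ~= 0"
   "\<And>j'. full ==> j' < n ==> j' ~= i ==> j' ~= j ==> bdd f h (ts ! i) (ts ! j') ~= 0" by blast+
  have "(%k. bdd f h (rs k ! i) (rs k ! j) / (xs k - x) * (\<Prod>j\<in>{..<n} - {i} - {j}. bdd f h (rs k ! i) (rs k ! j)))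
    \<longlonglongrightarrow> L * (\<Prod>j\<in>{..<n} - {i} - {j}. bdd f h (ts ! i) (ts ! j))"
   using i by (intro tendsto_intros L rs) auto
  moreover have "Q k i = bdd f h (rs k ! i) (rs k ! j) * (\<Prod>j\<in>{..<n} - {i} - {j}. bdd f h (rs k ! i) (rs k ! j))" for k
   unfolding Q_def using j by (intro prod.remove) auto
  moreover have "L * (\<Prod>j\<in>{..<n} - {i} - {j}. bdd f h (ts ! i) (ts ! j)) ~= 0" if full
   using L(2,3)[OF that] by (auto simp: prod_zero_iff)
  ultimately show ?thesis using True by auto
 qed
 then obtain L where L: "\<And>i. i < n ==> (%k. Q k i / (if i \<in> I then xs k - x else 1)) \<longlonglongrightarrow> L i"
  "\<And>i. i < n ==> full ==> L i ~= 0" by metis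
 have "(%k. \<Prod>i<n. Q k i / (if i \<in> I then xs k - x else 1)) \<longlonglongrightarrow> (\<Prod>i<n. L i)"
  by (intro tendsto_prod L) auto
 moreover have "(\<Prod>i<n. Q k i / (if i \<in> I then xs k - x else 1)) = poly pairpoly (xs k) / (xs k - x) ^ card I" for k
 proof -
  have "(\<Prod>i<n. (if i \<in> I then xs k - x else 1)) = (\<Prod>i\<in>I. xs k - x)"
   by (rule prod.mono_neutral_cong_right) (auto simp: I_def)
  thus ?thesis by (simp add: prod_dividef poly_pairpoly[OF rs(1)] pair_prod_def Q_def)
 qed
 ultimately have lim: "(%k. poly pairpoly (xs k) / (xs k - x) ^ card I) \<longlonglongrightarrow> (\<Prod>i<n. L i)" by simp
 show "card {i. i < n \<and> fibre x ! i \<in> T \<union> K} \<le> order x pairpoly"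
  using order_via_limit(1)[OF nz xs xne lim] by (simp add: I_def ts_def)
 assume "\<And>s t. s ~= t ==> same_image s t ==> s \<in> T \<and> transversal s t"
   "\<And>s t t'. s ~= t ==> s ~= t' ==> same_image s t ==> same_image s t' ==> t = t'"
   "\<And>s. ramified s ==> s \<in> K \<and> simple_cusp s"
 hence full unfolding full_def by blast
 hence "(\<Prod>i<n. L i) ~= 0" using L(2) by (simp add: prod_zero_iff)
 thus "card {i. i < n \<and> fibre x ! i \<in> T \<union> K} = order x pairpoly"
  using order_via_limit(2)[OF nz xs xne lim] by (simp add: I_def ts_def)
qed

text \<open>A zero of the product over x puts a coincidence or a ramified parameter into the fibre,
  which a finite set of such parameters allows only for finitely many x.\<close>

lemma pairpoly_nz:
 assumes "finite {s. ramified s \<or> (\<exists>t. t ~= s \<and> same_image s t)}"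
 shows "pairpoly ~= 0"
proof
 assume z: "pairpoly = 0"
 define F where "F = {s. ramified s \<or> (\<exists>t. t ~= s \<and> same_image s t)}"
 have "finite ((%s. poly g s / poly f s) ` F)" using assms by (simp add: F_def)
 then obtain x where x: "x \<notin> (%s. poly g s / poly f s) ` F"
  using ex_new_if_finite[OF infinite_UNIV_char_0] by blast
 have "pair_prod (bdd f h) (fibre x) = 0" using poly_pairpoly[OF mset_fibre, of x] z by simp
 then obtain i j where ij: "i < n" "j < n" "i ~= j" and b: "bdd f h (fibre x ! i) (fibre x ! j) = 0"
  unfolding pair_prod_def by (auto simp: prod_zero_iff)
 have fib: "poly g (fibre x ! i) = x * poly f (fibre x ! i)" if "i < n" for i
  using nth_mem[of i "fibre x"] that unfolding set_fibre by simp
 have xi: "x = poly g (fibre x ! i) / poly f (fibre x ! i)"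
  using fib[OF ij(1)] f_nz_fibre[OF fib[OF ij(1)]] by simp
 have "fibre x ! i \<in> F"
 proof (cases "fibre x ! i = fibre x ! j")
  case False
  hence "same_image (fibre x ! i) (fibre x ! j)" using same_image_iff_bdd[OF fib fib] b ij by simp
  hence "fibre x ! j ~= fibre x ! i \<and> same_image (fibre x ! i) (fibre x ! j)" using False by simp
  thus ?thesis unfolding F_def by (intro CollectI disjI2 exI[of _ "fibre x ! j"])
 next
  case True
  have "card {i, j} \<le> card {k. k < n \<and> fibre x ! k = fibre x ! i}" using ij True by (intro card_mono) auto
  hence "order (fibre x ! i) (fibre_poly x) ~= 1"
   using ij(3) count_mset_eq_card[of "fibre x" "fibre x ! i"] by (simp add: mset_fibre)
  hence "poly wronski (fibre x ! i) = 0" using order_fibre_poly(1)[OF fib] ij by blast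
  moreover have "poly wronskh (fibre x ! i) = 0" using b True by (simp add: bdd_self wronskh_def)
  ultimately have "ramified (fibre x ! i)" using f_nz_fibre[OF fib[OF ij(1)]] by (simp add: ramified_def)
  thus ?thesis by (simp add: F_def)
 qed
 thus False using x xi by blast
qed

text \<open>A parameter in \<open>T\<close> is a simple and one in \<open>K\<close> a double element
  of its fibre; this is the source of the coefficient 2.\<close>

lemma sum_card_fibre:
 assumes T: "\<And>s. s \<in> T ==> poly wronski s ~= 0 \<and> poly f s ~= 0"
  and K: "\<And>s. s \<in> K ==> ramified s \<and> poly (pderiv wronski) s ~= 0"
  and fin: "finite T" "finite K" "finite X" "(%s. poly g s / poly f s) ` (T \<union> K) \<subseteq> X"
 shows "(\<Sum>x\<in>X. card {i. i < n \<and> fibre x ! i \<in> T \<union> K}) = card T + 2 * card K"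
proof -
 define xx where "xx = (%s. poly g s / poly f s)"
 have fnz: "poly f s ~= 0" if "s \<in> T \<union> K" for s using T K that by (auto simp: ramified_def)
 have "card {i. i < n \<and> fibre x ! i \<in> T \<union> K} = (\<Sum>s | s \<in> T \<union> K \<and> xx s = x. order s (fibre_poly (xx s)))" for x
 proof -
  have eq: "{i. i < n \<and> fibre x ! i \<in> T \<union> K} = (\<Union>s\<in>{s \<in> T \<union> K. xx s = x}. {i. i < n \<and> fibre x ! i = s})"
  proof (rule subset_antisym; rule subsetI)
   fix i assume "i \<in> {i. i < n \<and> fibre x ! i \<in> T \<union> K}"
   hence i: "i < n" "fibre x ! i \<in> T \<union> K" by auto
   have "fibre x ! i \<in> set (fibre x)" using i(1) by simp
   hence "xx (fibre x ! i) = x" using fnz[OF i(2)] unfolding set_fibre xx_def by simp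
   thus "i \<in> (\<Union>s\<in>{s \<in> T \<union> K. xx s = x}. {i. i < n \<and> fibre x ! i = s})" using i by blast
  qed auto
  have "card {i. i < n \<and> fibre x ! i \<in> T \<union> K} = (\<Sum>s\<in>{s \<in> T \<union> K. xx s = x}. card {i. i < n \<and> fibre x ! i = s})"
   unfolding eq using fin by (intro card_UN_disjoint) auto
  also have "\<dots> = (\<Sum>s\<in>{s \<in> T \<union> K. xx s = x}. order s (fibre_poly (xx s)))"
   using count_mset_eq_card[of "fibre x"] by (intro sum.cong refl) (auto simp: mset_fibre)
  finally show ?thesis .
 qed
 hence "(\<Sum>x\<in>X. card {i. i < n \<and> fibre x ! i \<in> T \<union> K}) = (\<Sum>x\<in>X. \<Sum>s | s \<in> T \<union> K \<and> xx s = x. order s (fibre_poly (xx s)))"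
  by simp
 also have "\<dots> = (\<Sum>s\<in>T \<union> K. order s (fibre_poly (xx s)))"
  using fin by (intro sum.group) (auto simp: xx_def)
 also have "\<dots> = (\<Sum>s\<in>T. order s (fibre_poly (xx s))) + (\<Sum>s\<in>K. order s (fibre_poly (xx s)))"
  using fin T K by (intro sum.union_disjoint) (auto simp: ramified_def)
 also have "(\<Sum>s\<in>T. order s (fibre_poly (xx s))) = (\<Sum>s\<in>T. 1)"
  using T fnz by (intro sum.cong refl order_fibre_poly(1)) (auto simp: xx_def)
 also have "(\<Sum>s\<in>K. order s (fibre_poly (xx s))) = (\<Sum>s\<in>K. 2)"
 proof (intro sum.cong refl)
  fix s assume "s \<in> K"
  hence "order s (fibre_poly (xx s)) = 2 \<and> poly (pderiv (pderiv (fibre_poly (xx s)))) s ~= 0 \<and> poly (pderiv (fibre_poly (xx s))) s = 0"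
   using K fnz[of s] by (intro order_fibre_poly(2)) (auto simp: xx_def ramified_def)
  thus "order s (fibre_poly (xx s)) = 2" by blast
 qed
 finally show ?thesis by simp
qed

theorem double_points_le:
 assumes T: "\<And>s. s \<in> T ==> poly wronski s ~= 0 \<and> (\<exists>t\<in>T. t ~= s \<and> same_image s t)"
  and K: "\<And>s. s \<in> K ==> ramified s \<and> poly (pderiv wronski) s ~= 0"
  and fin: "finite T" "finite K" and nz: "pairpoly ~= 0"
 shows "card T + 2 * card K \<le> (n - 1) * (n - 2)"
proof -
 define X where "X = (%s. poly g s / poly f s) ` (T \<union> K)"
 have X: "finite X" using fin by (simp add: X_def)
 have T': "poly wronski s ~= 0 \<and> poly f s ~= 0" if "s \<in> T" for s using T[OF that] by (auto simp: same_image_def)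
 have "card T + 2 * card K = (\<Sum>x\<in>X. card {i. i < n \<and> fibre x ! i \<in> T \<union> K})"
  using sum_card_fibre[OF T' K fin X] by (simp add: X_def)
 also have "\<dots> \<le> (\<Sum>x\<in>X. order x pairpoly)" by (intro sum_mono order_pairpoly(1) T K nz)
 also have "\<dots> \<le> degree pairpoly" by (rule sum_order_le[OF X nz])
 also have "\<dots> \<le> (n - 1) * (n - 2)" by (rule pairpoly_degree(1))
 finally show ?thesis .
qed

theorem double_points_eq:
 assumes T: "\<And>s. s \<in> T ==> poly wronski s ~= 0 \<and> (\<exists>t\<in>T. t ~= s \<and> same_image s t)"
  and K: "\<And>s. s \<in> K ==> ramified s \<and> poly (pderiv wronski) s ~= 0"
  and fin: "finite T" "finite K"
  and full: "\<And>s t. s ~= t ==> same_image s t ==> s \<in> T \<and> transversal s t"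
   "\<And>s t t'. s ~= t ==> s ~= t' ==> same_image s t ==> same_image s t' ==> t = t'"
   "\<And>s. ramified s ==> s \<in> K \<and> simple_cusp s"
  and inf: "mset ss = proots (rv n f)" "pair_prod (bdd (rv n g) (rv n h)) ss ~= 0"
 shows "card T + 2 * card K = (n - 1) * (n - 2)"
proof -
 define X where "X = (%s. poly g s / poly f s) ` (T \<union> K)"
 have X: "finite X" using fin by (simp add: X_def)
 have "{s. ramified s \<or> (\<exists>t. t ~= s \<and> same_image s t)} \<subseteq> T \<union> K"
 proof
  fix s assume "s \<in> {s. ramified s \<or> (\<exists>t. t ~= s \<and> same_image s t)}"
  then consider "ramified s" | t where "t ~= s" "same_image s t" by auto
  thus "s \<in> T \<union> K"
  proof cases
   case 1 thus ?thesis using full(3)[of s] by simp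
  next
   case 2 thus ?thesis using full(1)[of s t] by simp
  qed
 qed
 hence nz: "pairpoly ~= 0" using fin by (intro pairpoly_nz) (auto intro: finite_subset)
 have T': "poly wronski s ~= 0 \<and> poly f s ~= 0" if "s \<in> T" for s using T[OF that] by (auto simp: same_image_def)
 have o: "card {i. i < n \<and> fibre x ! i \<in> T \<union> K} = order x pairpoly" for x
  by (rule order_pairpoly(2)[OF T K nz full])
 have "card T + 2 * card K = (\<Sum>x\<in>X. card {i. i < n \<and> fibre x ! i \<in> T \<union> K})"
  using sum_card_fibre[OF T' K fin X] by (simp add: X_def)
 also have "\<dots> = (\<Sum>x\<in>X. order x pairpoly)" by (intro sum.cong[OF refl] o)
 also have "\<dots> = degree pairpoly"
 proof (rule sum_order_eq[OF X nz])
  fix x assume "poly pairpoly x = 0"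
  hence "order x pairpoly ~= 0" using nz order_root by blast
  hence "{i. i < n \<and> fibre x ! i \<in> T \<union> K} ~= {}" using o[of x] by (metis card.empty)
  then obtain i where i: "i < n" "fibre x ! i \<in> T \<union> K" by blast
  have "fibre x ! i \<in> set (fibre x)" using i(1) by simp
  hence gx: "poly g (fibre x ! i) = x * poly f (fibre x ! i)" unfolding set_fibre by simp
  hence "x = poly g (fibre x ! i) / poly f (fibre x ! i)" using f_nz_fibre[OF gx] by simp
  thus "x \<in> X" using i(2) unfolding X_def by blast
 qed
 also have "\<dots> = (n - 1) * (n - 2)" by (rule pairpoly_degree(2)[OF inf])
 finally show ?thesis .
qed

end

no_notation fps_nth (infixl "$" 75)

section \<open>Double points of a polynomial curve\<close>

text \<open>The image of the parameter at infinity.\<close>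

definition top_coeff :: "nat => complex poly ^ 3 => complex ^ 3" where
 "top_coeff n p = (\<chi> i. coeff (p $ i) n)"

text \<open>The tangent line in dual coordinates. For a nowhere vanishing \<open>p\<close> it is
  zero exactly where the parametrization is not immersed.\<close>

definition chi :: "complex poly ^ 3 => complex poly ^ 3" where
 "chi p = vcross p (pd p)"

definition rvec :: "nat => complex poly ^ 3 => complex poly ^ 3" where
 "rvec n p = (\<chi> i. rv n (p $ i))"

lemma top_coeff_nth [simp]: "top_coeff n p $ i = coeff (p $ i) n" by (simp add: top_coeff_def)
lemma rvec_nth [simp]: "rvec n p $ i = rv n (p $ i)" by (simp add: rvec_def)

lemma pev_rvec:
 assumes "\<And>i. degree (p $ i) \<le> n"
 shows "s ~= 0 ==> pev (rvec n p) s = s ^ n *s pev p (1 / s)" "pev (rvec n p) 0 = top_coeff n p"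
 using assms by (simp_all add: vec_eq_iff poly_rv poly_rv_0)

lemma pev_chi: "pev (chi p) s = vcross (pev p s) (pev (pd p) s)" by (simp add: chi_def)

lemma pev_chi_nth:
 "pev (chi p) s $ 1 = bdd (p $ 2) (p $ 3) s s"
 "pev (chi p) s $ 2 = bdd (p $ 3) (p $ 1) s s"
 "pev (chi p) s $ 3 = bdd (p $ 1) (p $ 2) s s"
 by (simp_all only: pev_chi bdd_self vcross_nth) (simp_all add: algebra_simps)

lemma pev_chi_rvec:
 assumes d: "\<And>i. degree (p $ i) \<le> n" and "n > 0" "s ~= 0"
 shows "pev (chi (rvec n p)) s = - (s ^ (2 * (n - 1))) *s pev (chi p) (1 / s)"
proof -
 have e: "(s * s) ^ (n - 1) = s ^ (2 * (n - 1))" by (simp add: power_mult power2_eq_square)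
 show ?thesis
  unfolding vec_eq_iff forall_3 vector_smult_component pev_chi_nth
  by (simp only: rvec_nth bdd_rv[OF d d assms(2,3,3)] e) simp
qed

lemma lincomb_rvec:
 assumes d: "\<And>i. degree (p $ i) \<le> n"
 shows "lincomb \<alpha> (rvec n p) = rv n (lincomb \<alpha> p)"
proof (rule poly_eqI)
 fix i
 have d': "degree (lincomb \<alpha> p) \<le> n" unfolding lincomb_def
  by (intro degree_add_le order_trans[OF degree_smult_le] d)
 show "coeff (lincomb \<alpha> (rvec n p)) i = coeff (rv n (lincomb \<alpha> p)) i"
 proof (cases "i \<le> n")
  case True thus ?thesis using d d' by (simp add: coeff_rv lincomb_def)
 next
  case False
  hence "coeff (rv n (p $ j)) i = 0" for j using degree_rv[OF d] by (intro coeff_eq_0) (metis le_less_trans not_le)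
  moreover have "coeff (rv n (lincomb \<alpha> p)) i = 0" using degree_rv[OF d'] False by (intro coeff_eq_0) auto
  ultimately show ?thesis by (simp add: lincomb_def)
 qed
qed

lemma coeff_lincomb: "coeff (lincomb \<alpha> p) k = vdot \<alpha> (\<chi> i. coeff (p $ i) k)"
 by (simp add: lincomb_def vdot_def)

lemma finite_vcross_eq_0:
 assumes "vcross (pev p s0) v ~= 0"
 shows "finite {s. vcross (pev p s) v = 0}"
proof -
 obtain i where i: "vcross (pev p s0) v $ i ~= 0" using assms by (auto simp: vec_eq_iff)
 obtain \<alpha> where \<alpha>: "\<And>u. vcross u v $ i = vdot \<alpha> u"
 proof -
  consider "i = 1" | "i = 2" | "i = 3" using exhaust_3 by blast
  thus ?thesis
  proof cases
   case 1 thus ?thesis using that[of "vector [0, v$3, - v$2]"] by (simp add: vdot_def algebra_simps)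
  next
   case 2 thus ?thesis using that[of "vector [- v$3, 0, v$1]"] by (simp add: vdot_def algebra_simps)
  next
   case 3 thus ?thesis using that[of "vector [v$2, - v$1, 0]"] by (simp add: vdot_def algebra_simps)
  qed
 qed
 have "poly (lincomb \<alpha> p) s0 ~= 0" using i by (simp add: \<alpha>)
 hence "lincomb \<alpha> p ~= 0" by (metis poly_0)
 hence "finite {s. poly (lincomb \<alpha> p) s = 0}" by (rule poly_roots_finite)
 moreover have "{s. vcross (pev p s) v = 0} \<subseteq> {s. poly (lincomb \<alpha> p) s = 0}"
  by (auto simp flip: \<alpha>)
 ultimately show ?thesis by (rule finite_subset[rotated])
qed

text \<open>All general position arguments reduce to this: each condition excludes at most one value
  of a scalar.\<close>

lemma linear_avoid:
 fixes a b :: "'x => complex"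
 assumes "finite S" "\<And>s. s \<in> S ==> a s ~= 0 \<or> b s ~= 0"
 shows "\<exists>z. \<forall>s\<in>S. a s + z * b s ~= 0"
proof -
 have "finite ((%s. - a s / b s) ` S)" using assms by blast
 then obtain z where z: "z \<notin> (%s. - a s / b s) ` S" using ex_new_if_finite[OF infinite_UNIV_char_0] by blast
 have "a s + z * b s ~= 0" if "s \<in> S" for s
 proof
  assume e: "a s + z * b s = 0"
  hence "b s ~= 0" using assms(2)[OF that] by auto
  hence "z = - a s / b s" using e by (simp add: field_simps eq_neg_iff_add_eq_0)
  thus False using z that by blast
 qed
 thus ?thesis by blast
qed

lemma perp_basis:
 fixes v :: "complex ^ 3"
 assumes "v ~= 0"
 obtains a b c where "vdot a v = 0" "vdot b v = 0" "vdot c v ~= 0" "vdet a b c ~= 0"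
proof -
 consider "v$1 ~= 0" | "v$2 ~= 0" | "v$3 ~= 0" using assms by (auto simp: vec_eq_iff forall_3)
 thus ?thesis
 proof cases
  case 1
  thus ?thesis by (intro that[of "vector [- v$2, v$1, 0]" "vector [- v$3, 0, v$1]" "vector [1, 0, 0]"])
   (simp_all add: vdot_def vdet_def algebra_simps)
 next
  case 2
  thus ?thesis by (intro that[of "vector [v$2, - v$1, 0]" "vector [0, - v$3, v$2]" "vector [0, 1, 0]"])
   (simp_all add: vdot_def vdet_def algebra_simps)
 next
  case 3
  thus ?thesis by (intro that[of "vector [v$3, 0, - v$1]" "vector [0, v$3, - v$2]" "vector [0, 0, 1]"])
   (simp_all add: vdot_def vdet_def algebra_simps)
 qed
qed

lemma vdet_rotate: "vdet u v w = vdet v w u" "vdet u v w = - vdet v u w" "vdet u v w = - vdet u w v"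
 by (simp_all add: vdot_def vdet_def algebra_simps)

text \<open>The line \<alpha> = 0 becomes the line at infinity; it must pass through
  \<open>c\<close> and avoid the parameters in \<open>U\<close>. The centre of projection is
  \<open>vcross \<alpha> \<beta>\<close>; it must avoid the curve and the lines \<open>L s\<close>,
  which will be tangents. First \<alpha> moves in the pencil of lines through \<open>c\<close>, then
  \<beta> in a pencil.\<close>

lemma good_coordinates:
 assumes top: "c ~= 0" and inf: "\<And>t. vcross (pev p t) c ~= 0" and fin: "finite U" "finite S" "S \<subseteq> U" "U ~= {}"
  and L: "\<And>s. s \<in> S ==> L s ~= 0 \<and> vdot (L s) (pev p s) = 0"
 obtains \<alpha> \<beta> \<gamma> where "vdet \<alpha> \<beta> \<gamma> ~= 0" "vdot \<alpha> c = 0" "vdot \<gamma> c = 0" "vdot \<beta> c ~= 0"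
  "\<And>s. s \<in> U ==> vdot \<alpha> (pev p s) ~= 0" "\<And>s. s \<in> S ==> vdot (vcross \<alpha> \<beta>) (L s) ~= 0"
  "\<And>t. vdot \<alpha> (pev p t) = 0 ==> vdot \<beta> (pev p t) ~= 0"
proof -
 obtain a1 a2 b0 where B: "vdot a1 c = 0" "vdot a2 c = 0" "vdot b0 c ~= 0" "vdet a1 a2 b0 ~= 0"
  by (rule perp_basis[OF top])
 have nz2: "u = 0 \<or> vcross u c = 0" if "vdot a1 u = 0" "vdot a2 u = 0" for u
 proof -
  have "vdet a1 a2 b0 *s u = vdot b0 u *s vcross a1 a2" "vdet a1 a2 b0 *s c = vdot b0 c *s vcross a1 a2"
   using vcramer'[of a1 a2 b0] that B by auto
  hence "vcross (vdet a1 a2 b0 *s u) (vdet a1 a2 b0 *s c) = 0" by (simp add: vcross_bilinear)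
  thus ?thesis using B(4) by (simp add: vcross_bilinear)
 qed
 have "vdot a1 (pev p s) ~= 0 \<or> vdot a2 (pev p s) ~= 0" for s
  using nz2[of "pev p s"] inf[of s] by (metis vcross_simps(1))
 then obtain z where z: "\<forall>s\<in>U. vdot a1 (pev p s) + z * vdot a2 (pev p s) ~= 0"
  using linear_avoid[OF fin(1), of "%s. vdot a1 (pev p s)" "%s. vdot a2 (pev p s)"] by blast
 define \<alpha> where "\<alpha> = a1 + z *s a2"
 have \<alpha>: "vdot \<alpha> c = 0" "\<And>u. vdot \<alpha> u = vdot a1 u + z * vdot a2 u"
  using B by (simp_all add: \<alpha>_def vdot_bilinear)
 have \<alpha>U: "vdot \<alpha> (pev p s) ~= 0" if "s \<in> U" for s using z that by (simp add: \<alpha>)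
 have det0: "vdet \<alpha> a2 b0 = vdet a1 a2 b0" by (simp add: \<alpha>_def vdet_add vdet_scale)
 have "poly (lincomb \<alpha> p) s ~= 0" if "s \<in> U" for s using \<alpha>U[OF that] by simp
 define R where "R = {t. vdot \<alpha> (pev p t) = 0}"
 have "finite R"
 proof -
  have "lincomb \<alpha> p ~= 0"
  proof
   assume "lincomb \<alpha> p = 0"
   hence "vdot \<alpha> (pev p t) = 0" for t by (metis poly_lincomb poly_0)
   thus False using fin(4) \<alpha>U by blast
  qed
  hence "finite {t. poly (lincomb \<alpha> p) t = 0}" by (rule poly_roots_finite)
  thus ?thesis by (simp add: R_def)
 qed
 have R: "vdot a2 (pev p t) ~= 0" if "t \<in> R" for t
 proof
  assume a: "vdot a2 (pev p t) = 0"
  hence "vdot a1 (pev p t) = 0" using that by (simp add: R_def \<alpha>)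
  thus False using nz2[OF _ a] inf[of t] by (metis vcross_simps(1))
 qed
 have SL: "vdot (vcross \<alpha> b0) (L s) ~= 0 \<or> vdot (vcross \<alpha> a2) (L s) ~= 0" if "s \<in> S" for s
 proof (rule ccontr)
  assume "\<not> ?thesis"
  hence 0: "vdot (vcross \<alpha> b0) (L s) = 0" "vdot (vcross \<alpha> a2) (L s) = 0" by auto
  have "vdet \<alpha> a2 b0 *s L s = vdot (vcross a2 b0) (L s) *s \<alpha> + vdot (vcross b0 \<alpha>) (L s) *s a2 + vdot (vcross \<alpha> a2) (L s) *s b0"
   by (simp add: v3_simps algebra_simps)
  also have "vdot (vcross b0 \<alpha>) (L s) = 0" using 0(1) by (simp add: v3_simps algebra_simps)
  finally have e: "vdet \<alpha> a2 b0 *s L s = vdot (vcross a2 b0) (L s) *s \<alpha>" using 0 by simp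
  have "vdot (vdet \<alpha> a2 b0 *s L s) (pev p s) = 0" using L[OF that] by (simp add: vdot_bilinear)
  hence "vdot (vcross a2 b0) (L s) * vdot \<alpha> (pev p s) = 0" unfolding e by (simp add: vdot_bilinear)
  hence "vdot (vcross a2 b0) (L s) = 0" using \<alpha>U[of s] that fin(3) by auto
  hence "vdet \<alpha> a2 b0 *s L s = 0" using e by simp
  thus False using det0 B(4) L[OF that] by simp
 qed
 \<comment> \<open>The sum type collects the conditions on the curve and those on the lines, so that
   one scalar avoids both kinds.\<close>
 define W where "W = Inl ` R \<union> Inr ` S"
 have "\<exists>y. \<forall>w\<in>W. (case w of Inl t => vdot b0 (pev p t) | Inr s => vdot (vcross \<alpha> b0) (L s)) +
   y * (case w of Inl t => vdot a2 (pev p t) | Inr s => vdot (vcross \<alpha> a2) (L s)) ~= 0"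
  by (rule linear_avoid) (use \<open>finite R\<close> fin R SL in \<open>auto simp: W_def\<close>)
 then obtain y where y0: "\<forall>w\<in>W. (case w of Inl t => vdot b0 (pev p t) | Inr s => vdot (vcross \<alpha> b0) (L s)) +
   y * (case w of Inl t => vdot a2 (pev p t) | Inr s => vdot (vcross \<alpha> a2) (L s)) ~= 0" by (elim exE)
 have y: "vdot b0 (pev p t) + y * vdot a2 (pev p t) ~= 0" if "t \<in> R" for t
  using y0[THEN bspec, of "Inl t"] that by (simp add: W_def)
 have y': "vdot (vcross \<alpha> b0) (L s) + y * vdot (vcross \<alpha> a2) (L s) ~= 0" if "s \<in> S" for s
  using y0[THEN bspec, of "Inr s"] that by (simp add: W_def)
 show ?thesis
 proof (rule that[of \<alpha> "b0 + y *s a2" a2])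
  show "vdet \<alpha> (b0 + y *s a2) a2 ~= 0"
   using det0 B(4) vdet_rotate(3)[of \<alpha> a2 b0] by (auto simp: vdet_add vdet_scale)
 qed (use \<alpha> \<alpha>U B y y' in \<open>auto simp: vdot_bilinear vcross_bilinear R_def\<close>)
qed

lemma vdet_alt: "vdet u v w = vdot (vcross u v) w"
 by (simp add: v3_simps algebra_simps)

lemma wronskian_lincomb:
 "lincomb \<alpha> p * pderiv (lincomb \<beta> p) - lincomb \<beta> p * pderiv (lincomb \<alpha> p) = lincomb (vcross \<alpha> \<beta>) (chi p)"
proof -
 have "poly (lincomb \<alpha> p * pderiv (lincomb \<beta> p) - lincomb \<beta> p * pderiv (lincomb \<alpha> p)) s = poly (lincomb (vcross \<alpha> \<beta>) (chi p)) s" for s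
  by (simp add: chi_def vdot_vcross_vcross algebra_simps)
 thus ?thesis by (simp add: fun_eq_iff flip: poly_eq_poly_eq_iff)
qed

section \<open>Counting in coordinates in general position\<close>

lemma vcross_eq_0_coords:
 fixes u v :: "complex ^ 3"
 assumes "vdet \<alpha> \<beta> \<gamma> ~= 0" "vdot \<alpha> u ~= 0"
  "vdot \<alpha> u * vdot \<beta> v = vdot \<beta> u * vdot \<alpha> v" "vdot \<alpha> u * vdot \<gamma> v = vdot \<gamma> u * vdot \<alpha> v"
 shows "vcross u v = 0"
proof -
 have "vdot \<alpha> u *s v - vdot \<alpha> v *s u = 0"
  by (rule vdot_all_eq_0[OF assms(1)]) (use assms in \<open>simp_all add: vdot_bilinear algebra_simps\<close>)
 hence "vcross u (vdot \<alpha> u *s v) = vcross u (vdot \<alpha> v *s u)" by simp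
 thus ?thesis using assms(2) by (simp add: vcross_bilinear)
qed

lemma coords_vcross_eq_0:
 assumes "vcross u v = 0"
 shows "vdot \<alpha> u * vdot \<beta> v = vdot \<beta> u * vdot \<alpha> v"
 using vdot_vcross_vcross[of \<alpha> \<beta> u v] assms by (simp add: vdot_bilinear algebra_simps)

lemma pd_chi: "pd (chi p) = vcross p (pd (pd p))"
 by (simp add: chi_def pd_vcross)

lemma pd_pd_chi: "pd (pd (chi p)) = vcross (pd p) (pd (pd p)) + vcross p (pd (pd (pd p)))"
 by (simp add: pd_chi pd_vcross)

text \<open>The last assumption says that the image of the parameter at infinity has no other
  parameter, so that all coincidences are visible in the affine chart.\<close>

locale poly_curve =
 fixes p :: "complex poly ^ 3" and n :: nat
 assumes deg: "\<And>i. degree (p $ i) \<le> n" and n_pos: "n > 0"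
  and nz: "\<And>t. pev p t ~= 0" and inf: "\<And>t. vcross (pev p t) (top_coeff n p) ~= 0"
begin

lemma projection:
 assumes det: "vdet \<alpha> \<beta> \<gamma> ~= 0" and c: "vdot \<alpha> (top_coeff n p) = 0" "vdot \<gamma> (top_coeff n p) = 0" "vdot \<beta> (top_coeff n p) ~= 0"
  and nz0: "vdot \<alpha> (pev p 0) ~= 0" and nc: "\<forall>t. vdot \<alpha> (pev p t) = 0 --> vdot \<beta> (pev p t) ~= 0"
 shows "plane_fibration (lincomb \<alpha> p) (lincomb \<beta> p) n (lincomb \<gamma> p)"
  "fibration.wronski (lincomb \<alpha> p) (lincomb \<beta> p) = lincomb (vcross \<alpha> \<beta>) (chi p)"
  "plane_fibration.wronskh (lincomb \<alpha> p) (lincomb \<gamma> p) = lincomb (vcross \<alpha> \<gamma>) (chi p)"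
  "plane_fibration.same_image (lincomb \<alpha> p) (lincomb \<beta> p) (lincomb \<gamma> p) s t \<longleftrightarrow>
   vdot \<alpha> (pev p s) ~= 0 \<and> vdot \<alpha> (pev p t) ~= 0 \<and> meet p s t"
  "plane_fibration.ramified (lincomb \<alpha> p) (lincomb \<beta> p) (lincomb \<gamma> p) s \<longleftrightarrow>
   vdot \<alpha> (pev p s) ~= 0 \<and> pev (chi p) s = 0"
proof -
 have le: "degree (lincomb \<delta> p) \<le> n" for \<delta> unfolding lincomb_def
  by (intro degree_add_le order_trans[OF degree_smult_le] deg)
 have co: "coeff (lincomb \<delta> p) n = vdot \<delta> (top_coeff n p)" for \<delta> by (simp add: coeff_lincomb top_coeff_def)
 have less: "degree (lincomb \<delta> p) < n" if "vdot \<delta> (top_coeff n p) = 0" for \<delta>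
 proof (rule ccontr)
  assume "\<not> ?thesis"
  hence e: "degree (lincomb \<delta> p) = n" using le[of \<delta>] by simp
  hence "lead_coeff (lincomb \<delta> p) = 0" using that co by simp
  hence "lincomb \<delta> p = 0" by (simp only: leading_coeff_0_iff)
  thus False using e n_pos by simp
 qed
 interpret pf: plane_fibration "lincomb \<alpha> p" "lincomb \<beta> p" n "lincomb \<gamma> p"
 proof
  show "degree (lincomb \<beta> p) = n" using le co c by (intro antisym le_degree) auto
 qed (use less c nz0 nc in auto)
 show "plane_fibration (lincomb \<alpha> p) (lincomb \<beta> p) n (lincomb \<gamma> p)" by unfold_locales
 show w: "pf.wronski = lincomb (vcross \<alpha> \<beta>) (chi p)"
  unfolding pf.wronski_def by (rule wronskian_lincomb)
 show wh: "pf.wronskh = lincomb (vcross \<alpha> \<gamma>) (chi p)"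
  unfolding pf.wronskh_def by (rule wronskian_lincomb)
 show "pf.same_image s t \<longleftrightarrow> vdot \<alpha> (pev p s) ~= 0 \<and> vdot \<alpha> (pev p t) ~= 0 \<and> meet p s t"
  using vcross_eq_0_coords[OF det, of "pev p s" "pev p t"] coords_vcross_eq_0[of "pev p s" "pev p t"]
  by (auto simp: pf.same_image_def)
 show "pf.ramified s \<longleftrightarrow> vdot \<alpha> (pev p s) ~= 0 \<and> pev (chi p) s = 0"
  using vcross_eq_0_coords[OF det, of "pev p s" "pev (pd p) s"] coords_vcross_eq_0[of "pev p s" "pev (pd p) s"]
  by (auto simp: pf.ramified_def w wh chi_def vdot_vcross_vcross vdot_bilinear mult.commute)
qed

text \<open>The exact count needs the full degree of the product polynomial. For this the line at
  infinity is chosen away from all double points and cusps, and the parameter at infinity itself is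
  immersed by \<open>imm\<close>.\<close>

theorem node_count_eq:
 assumes imm: "vcross (top_coeff n p) (\<chi> i. coeff (p $ i) (n - 1)) ~= 0"
  and fin: "finite T" "finite K"
  and T: "\<And>s. s \<in> T ==> \<exists>t. t ~= s \<and> meet p s t"
  and pair: "\<And>s t. s ~= t ==> meet p s t ==>
    s \<in> T \<and> tangent_det p s t ~= 0"
  and unique: "\<And>s t t'. s ~= t ==> s ~= t' ==> meet p s t ==> meet p s t' ==> t = t'"
  and K: "\<And>s. s \<in> K ==> pev (chi p) s = 0"
  and cusp: "\<And>s. pev (chi p) s = 0 ==> s \<in> K \<and> cusp_det p s ~= 0"
 shows "card T + 2 * card K = (n - 1) * (n - 2)"
proof -
 \<comment> \<open>The tangent lines: \<open>chi p\<close> itself at double points, its derivative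
   at cusps, where \<open>chi p\<close> vanishes.\<close>
 define L where "L = (%s. if s \<in> T then pev (chi p) s else pev (pd (chi p)) s)"
 have T1: "pev (chi p) s ~= 0" if s: "s \<in> T" for s
 proof
  assume "pev (chi p) s = 0"
  moreover obtain t where "t ~= s" "meet p s t" using T[OF s] by blast
  ultimately show False using pair[of s t] by (simp add: pev_chi vdet_alt vdot_bilinear)
 qed
 have K1: "pev (pd (chi p)) s ~= 0" if "s \<in> K" for s
  using cusp[OF K[OF that]] by (auto simp: pd_chi vdet_alt vdot_bilinear)
 have TK: "s \<notin> T" if "s \<in> K" for s using K[OF that] T1 by blast
 have U: "finite (insert 0 (T \<union> K))" "finite (T \<union> K)" "T \<union> K \<subseteq> insert 0 (T \<union> K)" "insert 0 (T \<union> K) ~= {}"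
  using fin by auto
 have top: "top_coeff n p ~= 0" using inf[of 0] by auto
 have Ls: "L s ~= 0 \<and> vdot (L s) (pev p s) = 0" if "s \<in> T \<union> K" for s
  using that T1[of s] K1[of s] by (auto simp: L_def pev_chi pd_chi)
 obtain \<alpha> \<beta> \<gamma> where det: "vdet \<alpha> \<beta> \<gamma> ~= 0" and c: "vdot \<alpha> (top_coeff n p) = 0" "vdot \<gamma> (top_coeff n p) = 0" "vdot \<beta> (top_coeff n p) ~= 0"
  and \<alpha>U: "\<And>s. s \<in> insert 0 (T \<union> K) ==> vdot \<alpha> (pev p s) ~= 0" and \<alpha>L: "\<And>s. s \<in> T \<union> K ==> vdot (vcross \<alpha> \<beta>) (L s) ~= 0"
  and nc: "\<And>t. vdot \<alpha> (pev p t) = 0 ==> vdot \<beta> (pev p t) ~= 0"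
  by (rule good_coordinates[OF top inf U Ls]) auto
 have nz0: "vdot \<alpha> (pev p 0) ~= 0" using \<alpha>U by blast
 have nc': "\<forall>t. vdot \<alpha> (pev p t) = 0 --> vdot \<beta> (pev p t) ~= 0" using nc by blast
 note pr = projection[OF det c nz0 nc']
 define f where "f = lincomb \<alpha> p"
 define g where "g = lincomb \<beta> p"
 define h where "h = lincomb \<gamma> p"
 interpret pf: plane_fibration f g n h unfolding f_def g_def h_def by (rule pr(1))
 note pr = pr[folded f_def g_def h_def]
 obtain ss where ss: "mset ss = proots (rv n f)" using ex_mset by blast
 show ?thesis
 proof (rule pf.double_points_eq[OF _ _ fin _ _ _ ss])
  fix s assume s: "s \<in> T"
  obtain t where t: "t ~= s" "meet p s t" using T[OF s] by blast
  have "meet p t s" using t(2) vcross_eq_0_commute by blast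
  hence tT: "t \<in> T" using pair[of t s] t(1) by blast
  have "pf.same_image s t" unfolding pr(4) using s tT t(2) \<alpha>U[of s] \<alpha>U[of t] by simp
  moreover have "poly pf.wronski s ~= 0" using \<alpha>L[of s] s by (simp add: pr L_def)
  ultimately show "poly pf.wronski s ~= 0 \<and> (\<exists>t\<in>T. t ~= s \<and> pf.same_image s t)" using t tT by blast
 next
  fix s assume s: "s \<in> K"
  have "pf.ramified s" unfolding pr(5) using K[OF s] \<alpha>U[of s] s by simp
  moreover have "poly (pderiv pf.wronski) s ~= 0" using \<alpha>L[of s] s TK[OF s] by (simp add: pr L_def)
  ultimately show "pf.ramified s \<and> poly (pderiv pf.wronski) s ~= 0" ..
 next
  fix s t assume st: "s ~= t" "pf.same_image s t"
  hence p0: "meet p s t" and \<alpha>s: "vdot \<alpha> (pev p s) ~= 0" by (auto simp: pr(4))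
  have d: "s \<in> T" "tangent_det p s t ~= 0" using pair[OF st(1) p0] by auto
  obtain k where k: "pev p t = k *s pev p s" using vcross_eq_0_iff[OF nz] p0 by blast
  have k0: "k ~= 0" using nz[of t] k by auto
  \<comment> \<open>The slopes are those of the tangent lines \<open>chi p\<close> at
    \<open>s\<close> and \<open>t\<close>, which meet in the common image point; this turns
    transversality into \<open>tangent_det\<close>.\<close>
  have "poly pf.wronski s * poly pf.wronskh t - poly pf.wronski t * poly pf.wronskh s =
   vdot (vcross (vcross \<alpha> \<beta>) (vcross \<alpha> \<gamma>)) (vcross (pev (chi p) s) (pev (chi p) t))"
   by (simp add: pr vdot_vcross_vcross)
  also have "\<dots> = vdet \<alpha> \<beta> \<gamma> * vdot \<alpha> (vcross (pev (chi p) s) (pev (chi p) t))"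
   by (simp add: vcross_vcross vdot_bilinear)
  also have "vcross (pev (chi p) s) (pev (chi p) t) = (k * tangent_det p s t) *s pev p s"
   by (simp add: pev_chi k vcross_bilinear vcross_vcross vector_smult_assoc)
  finally have "poly pf.wronski s * poly pf.wronskh t - poly pf.wronski t * poly pf.wronskh s ~= 0"
   using det k0 d \<alpha>s by (simp add: vdot_bilinear)
  thus "s \<in> T \<and> pf.transversal s t" using d by (simp add: pf.transversal_def)
 next
  fix s t t' assume "s ~= t" "s ~= t'" "pf.same_image s t" "pf.same_image s t'"
  thus "t = t'" using unique[of s t t'] by (simp add: pr(4))
 next
  fix s assume "pf.ramified s"
  hence c0: "pev (chi p) s = 0" and \<alpha>s: "vdot \<alpha> (pev p s) ~= 0" by (auto simp: pr(5))
  have d: "s \<in> K" "cusp_det p s ~= 0" using cusp[OF c0] by auto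
  obtain k where k: "pev (pd p) s = k *s pev p s" using vcross_eq_0_iff[OF nz] c0 by (auto simp: pev_chi)
  have "poly (pderiv pf.wronski) s * poly (pderiv (pderiv pf.wronskh)) s - poly (pderiv pf.wronskh) s * poly (pderiv (pderiv pf.wronski)) s
   = vdot (vcross (vcross \<alpha> \<beta>) (vcross \<alpha> \<gamma>)) (vcross (pev (pd (chi p)) s) (pev (pd (pd (chi p))) s))"
   by (simp add: pr vdot_vcross_vcross algebra_simps)
  also have "\<dots> = vdet \<alpha> \<beta> \<gamma> * vdot \<alpha> (vcross (pev (pd (chi p)) s) (pev (pd (pd (chi p))) s))"
   by (simp add: vcross_vcross vdot_bilinear)
  also have "vcross (pev (pd (chi p)) s) (pev (pd (pd (chi p))) s) =
    cusp_det p s *s pev p s"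
   by (simp add: pd_chi pd_pd_chi[unfolded pd_chi] pd_vcross k vcross_bilinear vcross_vcross)
  finally have "poly (pderiv pf.wronski) s * poly (pderiv (pderiv pf.wronskh)) s - poly (pderiv pf.wronskh) s * poly (pderiv (pderiv pf.wronski)) s ~= 0"
   using det d \<alpha>s by (simp add: vdot_bilinear)
  thus "s \<in> K \<and> pf.simple_cusp s" using d by (simp add: pf.simple_cusp_def)
 next
  have f_rv: "rv n f = lincomb \<alpha> (rvec n p)" "rv n g = lincomb \<beta> (rvec n p)" "rv n h = lincomb \<gamma> (rvec n p)"
   unfolding f_def g_def h_def using lincomb_rvec[of p n] deg by auto
  have rnz: "rv n f ~= 0"
  proof
   assume "rv n f = 0"
   moreover have "coeff (rv n f) n = poly f 0" using pf.deg_f by (simp add: coeff_rv poly_0_coeff_0)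
   ultimately show False using nz0 by (simp add: f_def)
  qed
  have "poly (rv n f) (ss ! i) = 0" if "i < length ss" for i
   using nth_mem[OF that] unfolding set_root_list[OF ss rnz] by simp
  hence \<sigma>0: "vdot \<alpha> (pev (rvec n p) (ss ! i)) = 0" if "i < length ss" for i using that by (simp add: f_rv)
  have len: "length ss = n"
  proof -
   have "degree (rv n f) = n"
    using degree_rv[of f n] pf.deg_f pf.f0 by (intro antisym le_degree) (auto simp: coeff_rv poly_0_coeff_0)
   thus ?thesis using poly_root_list(2)[OF ss] by simp
  qed
  have notU: "1 / \<sigma> \<notin> T \<union> K" if "\<sigma> ~= 0" "vdot \<alpha> (pev (rvec n p) \<sigma>) = 0" for \<sigma>
  proof
   assume "1 / \<sigma> \<in> T \<union> K"
   hence "vdot \<alpha> (pev p (1 / \<sigma>)) ~= 0" using \<alpha>U by blast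
   thus False using that pev_rvec(1)[OF deg that(1)] by (simp add: vdot_bilinear)
  qed
  \<comment> \<open>A vanishing factor would be a coincidence or a cusp among the parameters on the
    line \<alpha> = 0. Finite ones are excluded by the choice of \<alpha>, the parameter at infinity
    by \<open>inf\<close> and \<open>imm\<close>.\<close>
  have "bdd (rv n g) (rv n h) (ss ! i) (ss ! j) ~= 0" if ij: "i < n" "j < n" "i ~= j" for i j
  proof
   let ?P = "rvec n p" and ?\<sigma> = "ss ! i" and ?\<tau> = "ss ! j"
   assume b: "bdd (rv n g) (rv n h) ?\<sigma> ?\<tau> = 0"
   have z: "vdot \<alpha> (pev ?P ?\<sigma>) = 0" "vdot \<alpha> (pev ?P ?\<tau>) = 0" using \<sigma>0 ij len by auto
   have dz: "dd (rv n f) ?\<sigma> ?\<tau> = 0" using dd_roots[OF ss _ _ ij(3) rnz] ij len by simp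
   show False
   proof (cases "?\<sigma> = ?\<tau>")
    case True
    have "poly (pderiv (rv n f)) ?\<sigma> = 0" using dz True by simp
    hence z': "vdot \<alpha> (pev (pd ?P) ?\<sigma>) = 0" by (simp add: f_rv)
    have "vdot (vcross \<beta> \<gamma>) (pev (chi ?P) ?\<sigma>) = 0"
     using b True by (simp add: f_rv bdd_self chi_def vdot_vcross_vcross algebra_simps)
    moreover have "vdot (vcross \<gamma> \<alpha>) (pev (chi ?P) ?\<sigma>) = 0" "vdot (vcross \<alpha> \<beta>) (pev (chi ?P) ?\<sigma>) = 0"
     using z z' by (simp_all add: chi_def vdot_vcross_vcross)
    ultimately have "vdet \<alpha> \<beta> \<gamma> *s pev (chi ?P) ?\<sigma> = 0"
     by (simp add: v3_simps) algebra
    hence c0: "pev (chi ?P) ?\<sigma> = 0" using det by simp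
    show False
    proof (cases "?\<sigma> = 0")
     case True
     have "pev (pd ?P) 0 = (\<chi> i. coeff (p $ i) (n - 1))"
      using n_pos deg by (simp add: vec_eq_iff poly_0_coeff_0 coeff_pderiv coeff_rv)
     thus False using c0 True imm by (simp add: pev_chi pev_rvec(2)[OF deg])
    next
     case s0: False
     hence "pev (chi p) (1 / ?\<sigma>) = 0" using pev_chi_rvec[OF deg n_pos s0] c0 by simp
     thus False using cusp notU[OF s0 z(1)] by blast
    qed
   next
    case False
    have "poly (rv n g) ?\<sigma> * poly (rv n h) ?\<tau> = poly (rv n h) ?\<sigma> * poly (rv n g) ?\<tau>"
     using bdd_eq[of ?\<tau> ?\<sigma> "rv n g" "rv n h"] b by simp
    hence "vdot (vcross \<beta> \<gamma>) (vcross (pev ?P ?\<sigma>) (pev ?P ?\<tau>)) = 0"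
     by (simp add: f_rv vdot_vcross_vcross algebra_simps)
    moreover have "vdot (vcross \<gamma> \<alpha>) (vcross (pev ?P ?\<sigma>) (pev ?P ?\<tau>)) = 0" "vdot (vcross \<alpha> \<beta>) (vcross (pev ?P ?\<sigma>) (pev ?P ?\<tau>)) = 0"
     using z by (simp_all add: vdot_vcross_vcross)
    moreover have "vdet \<alpha> \<beta> \<gamma> *s w = vdot (vcross \<beta> \<gamma>) w *s \<alpha> + vdot (vcross \<gamma> \<alpha>) w *s \<beta> + vdot (vcross \<alpha> \<beta>) w *s \<gamma>" for w
     by (simp add: v3_simps algebra_simps)
    ultimately have "vdet \<alpha> \<beta> \<gamma> *s vcross (pev ?P ?\<sigma>) (pev ?P ?\<tau>) = 0" by simp
    hence c0: "vcross (pev ?P ?\<sigma>) (pev ?P ?\<tau>) = 0" using det by simp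
    consider "?\<sigma> = 0" "?\<tau> ~= 0" | "?\<tau> = 0" "?\<sigma> ~= 0" | "?\<sigma> ~= 0" "?\<tau> ~= 0" using False by metis
    thus False
    proof cases
     case 1
     hence "vcross (top_coeff n p) (pev p (1 / ?\<tau>)) = 0"
      using c0 by (simp add: pev_rvec[OF deg] vcross_bilinear)
     thus False using inf[of "1 / ?\<tau>"] vcross_eq_0_commute by blast
    next
     case 2
     hence "vcross (pev p (1 / ?\<sigma>)) (top_coeff n p) = 0"
      using c0 by (simp add: pev_rvec[OF deg] vcross_bilinear)
     thus False using inf by blast
    next
     case 3
     hence "meet p (1 / ?\<sigma>) (1 / ?\<tau>)"
      using c0 by (simp add: pev_rvec[OF deg] vcross_bilinear)
     moreover have "1 / ?\<sigma> ~= 1 / ?\<tau>" using 3 False by simp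
     ultimately have "1 / ?\<sigma> \<in> T" using pair by blast
     thus False using notU[OF 3(1) z(1)] by blast
    qed
   qed
  qed
  thus "pf.pair_prod (bdd (rv n g) (rv n h)) ss ~= 0"
   unfolding pf.pair_prod_def by (auto simp: prod_zero_iff)
 qed
qed

text \<open>For a lower bound of the orders, \<open>T\<close> and \<open>K\<close> may be any double
  points and cusps of the required kind; finiteness of all of them makes the product polynomial
  nonzero.\<close>

lemma node_count_le_aux:
 assumes fin: "finite T" "finite K" "finite {s. pev (chi p) s = 0 \<or> (\<exists>t. t ~= s \<and> meet p s t)}"
  and T: "\<And>s. s \<in> T ==> pev (chi p) s ~= 0 \<and> (\<exists>t\<in>T. t ~= s \<and> meet p s t)"
  and K: "\<And>s. s \<in> K ==> pev (chi p) s = 0 \<and> pev (pd (chi p)) s ~= 0"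
 shows "card T + 2 * card K \<le> (n - 1) * (n - 2)"
proof -
 define L where "L = (%s. if s \<in> T then pev (chi p) s else pev (pd (chi p)) s)"
 have TK: "s \<notin> T" if "s \<in> K" for s using K[OF that] T by blast
 have U: "finite (insert 0 (T \<union> K))" "finite (T \<union> K)" "T \<union> K \<subseteq> insert 0 (T \<union> K)" "insert 0 (T \<union> K) ~= {}"
  using fin by auto
 have top: "top_coeff n p ~= 0" using inf[of 0] by auto
 have Ls: "L s ~= 0 \<and> vdot (L s) (pev p s) = 0" if "s \<in> T \<union> K" for s
  using that T[of s] K[of s] by (auto simp: L_def pev_chi pd_chi)
 obtain \<alpha> \<beta> \<gamma> where det: "vdet \<alpha> \<beta> \<gamma> ~= 0" and c: "vdot \<alpha> (top_coeff n p) = 0" "vdot \<gamma> (top_coeff n p) = 0" "vdot \<beta> (top_coeff n p) ~= 0"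
  and \<alpha>U: "\<And>s. s \<in> insert 0 (T \<union> K) ==> vdot \<alpha> (pev p s) ~= 0" and \<alpha>L: "\<And>s. s \<in> T \<union> K ==> vdot (vcross \<alpha> \<beta>) (L s) ~= 0"
  and nc: "\<And>t. vdot \<alpha> (pev p t) = 0 ==> vdot \<beta> (pev p t) ~= 0"
  by (rule good_coordinates[OF top inf U Ls]) auto
 have nz0: "vdot \<alpha> (pev p 0) ~= 0" using \<alpha>U by blast
 have nc': "\<forall>t. vdot \<alpha> (pev p t) = 0 --> vdot \<beta> (pev p t) ~= 0" using nc by blast
 note pr = projection[OF det c nz0 nc']
 define f where "f = lincomb \<alpha> p"
 define g where "g = lincomb \<beta> p"
 define h where "h = lincomb \<gamma> p"
 interpret pf: plane_fibration f g n h unfolding f_def g_def h_def by (rule pr(1))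
 note pr = pr[folded f_def g_def h_def]
 show ?thesis
 proof (rule pf.double_points_le[OF _ _ fin(1,2)])
  fix s assume s: "s \<in> T"
  obtain t where t: "t \<in> T" "t ~= s" "meet p s t" using T[OF s] by blast
  have "pf.same_image s t" using s t(1,3) \<alpha>U[of s] \<alpha>U[of t] by (simp add: pr(4))
  moreover have "poly pf.wronski s ~= 0" using \<alpha>L[of s] s by (simp add: pr L_def)
  ultimately show "poly pf.wronski s ~= 0 \<and> (\<exists>t\<in>T. t ~= s \<and> pf.same_image s t)" using t by blast
 next
  fix s assume s: "s \<in> K"
  have "pf.ramified s" unfolding pr(5) using K[OF s] \<alpha>U[of s] s by simp
  moreover have "poly (pderiv pf.wronski) s ~= 0" using \<alpha>L[of s] s TK[OF s] by (simp add: pr L_def)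
  ultimately show "pf.ramified s \<and> poly (pderiv pf.wronski) s ~= 0" ..
 next
  show "pf.pairpoly ~= 0"
  proof (rule pf.pairpoly_nz, rule finite_subset[OF _ fin(3)], rule subsetI)
   fix s assume "s \<in> {s. pf.ramified s \<or> (\<exists>t. t ~= s \<and> pf.same_image s t)}"
   then consider "pf.ramified s" | t where "t ~= s" "pf.same_image s t" by auto
   thus "s \<in> {s. pev (chi p) s = 0 \<or> (\<exists>t. t ~= s \<and> meet p s t)}"
    unfolding pr(4,5) by cases blast+
  qed
 qed
qed

end

section \<open>Moving a good parameter to infinity\<close>

lemma deriv_reversed:
 assumes e: "\<And>s. s ~= 0 ==> poly a s = k * s ^ m * poly b (1 / s)" and k: "k ~= 0"
  and s: "s ~= 0" "poly b (1 / s) = 0" "poly (pderiv a) s = 0"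
 shows "poly (pderiv b) (1 / s) = (0::complex)"
proof -
 have "((%u. k * u ^ m * poly b (1 / u)) has_field_derivative
   k * (of_nat m * s ^ (m - 1)) * poly b (1 / s) + k * s ^ m * (poly (pderiv b) (1 / s) * (- 1 / s ^ 2))) (at s)"
  using s(1) by (auto intro!: derivative_eq_intros DERIV_chain'[OF _ poly_DERIV] simp: power2_eq_square)
 moreover have "(poly a has_field_derivative poly (pderiv a) s) (at s)" by (rule poly_DERIV)
 hence "((%u. k * u ^ m * poly b (1 / u)) has_field_derivative poly (pderiv a) s) (at s)"
  by (rule has_field_derivative_transform_within_open[of _ _ _ "- {0}"]) (use s e in auto)
 ultimately have "k * (of_nat m * s ^ (m - 1)) * poly b (1 / s) + k * s ^ m * (poly (pderiv b) (1 / s) * (- 1 / s ^ 2)) = poly (pderiv a) s"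
  by (rule DERIV_unique)
 thus ?thesis using k s by simp
qed

definition shiftv :: "complex => complex poly ^ 3 => complex poly ^ 3" where
 "shiftv c p = (\<chi> i. p $ i \<circ>\<^sub>p [:c, 1:])"

lemma shiftv_nth [simp]: "shiftv c p $ i = p $ i \<circ>\<^sub>p [:c, 1:]" by (simp add: shiftv_def)

lemma pev_shiftv [simp]: "pev (shiftv c p) s = pev p (c + s)"
 by (simp add: vec_eq_iff poly_pcompose add.commute)

lemma pd_shiftv: "pd (shiftv c p) = shiftv c (pd p)"
 by (simp add: vec_eq_iff pderiv_pcompose pderiv_pCons)

lemma chi_shiftv: "chi (shiftv c p) = shiftv c (chi p)"
 by (rule pev_eqI) (simp add: pev_chi pd_shiftv)

lemma degree_shiftv: "degree (shiftv c p $ i) = degree (p $ i)"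
 by (simp add: degree_pcompose)

text \<open>The substitution t = c + 1/u sends a parameter \<open>c\<close> without coincidences to
  infinity, where the previous lemma wants one; the old point at infinity becomes u = 0.\<close>

theorem node_count_le:
 assumes deg: "\<And>i. degree (p $ i) \<le> n" and n: "n > 0"
  and nz: "\<And>t. pev p t ~= 0" and top: "top_coeff n p ~= 0"
  and fin: "finite T" "finite K" "finite {s. pev (chi p) s = 0 \<or> (\<exists>t. t ~= s \<and> meet p s t)}"
  and T: "\<And>s. s \<in> T ==> pev (chi p) s ~= 0 \<and> (\<exists>t\<in>T. t ~= s \<and> meet p s t)"
  and K: "\<And>s. s \<in> K ==> pev (chi p) s = 0 \<and> pev (pd (chi p)) s ~= 0"
 shows "card T + 2 * card K \<le> (n - 1) * (n - 2)"
proof -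
 define F where "F = {s. pev (chi p) s = 0 \<or> (\<exists>t. t ~= s \<and> meet p s t)}"
 have F: "finite F" using fin by (simp add: F_def)
 have "\<exists>s. vcross (pev p s) (top_coeff n p) ~= 0"
 proof (rule ccontr)
  assume "\<not> ?thesis"
  hence "vcross (top_coeff n p) (pev p s) = 0" for s using vcross_eq_0_commute by blast
  hence "meet p s t" for s t using vcross_eq_0_trans[OF top] by blast
  hence "s \<in> F" for s unfolding F_def by (intro CollectI disjI2 exI[of _ "s + 1"]) simp
  hence "F = UNIV" by auto
  thus False using F infinite_UNIV_char_0 by metis
 qed
 hence finV: "finite {s. vcross (pev p s) (top_coeff n p) = 0}" using finite_vcross_eq_0 by blast
 hence "finite (F \<union> {s. vcross (pev p s) (top_coeff n p) = 0})" using F by simp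
 then obtain c where c: "c \<notin> F" "vcross (pev p c) (top_coeff n p) ~= 0"
  using ex_new_if_finite[OF infinite_UNIV_char_0] by blast
 define q where "q = rvec n (shiftv c p)"
 have degs: "degree (shiftv c p $ i) \<le> n" for i using deg degree_shiftv by metis
 have ev: "pev q s = s ^ n *s pev p (c + 1 / s)" if "s ~= 0" for s
  unfolding q_def using pev_rvec(1)[OF degs that] by simp
 have ch: "pev (chi q) s = - (s ^ (2 * (n - 1))) *s pev (chi p) (c + 1 / s)" if "s ~= 0" for s
  unfolding q_def using pev_chi_rvec[OF degs n that] by (simp add: chi_shiftv)
 have topp: "pev q 0 = top_coeff n p"
 proof -
  have "coeff (p $ i \<circ>\<^sub>p [:c, 1:]) n = coeff (p $ i) n" for i
  proof (cases "degree (p $ i) = n")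
   case True
   thus ?thesis using lead_coeff_comp[of "[:c, 1:]" "p $ i"] by (simp add: degree_pcompose)
  next
   case False
   hence "degree (p $ i) < n" using deg[of i] by simp
   thus ?thesis by (simp add: coeff_eq_0 degree_pcompose)
  qed
  thus ?thesis unfolding q_def pev_rvec(2)[OF degs] by (simp add: vec_eq_iff)
 qed
 have topq: "top_coeff n q = pev p c"
  unfolding q_def by (simp add: vec_eq_iff coeff_rv[OF degs[unfolded shiftv_nth]] pcompose_0' poly_0_coeff_0[symmetric] poly_pcompose)
 have par: "meet q s t \<longleftrightarrow> meet p (c + 1 / s) (c + 1 / t)"
  if "s ~= 0" "t ~= 0" for s t
  using that by (simp add: ev vcross_bilinear)
 have c1: "c + 1 / s ~= c" if "s ~= 0" for s using that by simp
 have cF: "\<not> meet p (c + 1 / s) c" if "s ~= 0" for s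
 proof
  assume "meet p (c + 1 / s) c"
  hence "meet p c (c + 1 / s)" using vcross_eq_0_commute by blast
  thus False using c(1) c1[OF that] unfolding F_def by blast
 qed
 interpret poly_curve q n
 proof
  show "degree (q $ i) \<le> n" for i unfolding q_def by (simp add: degree_rv[OF degs[unfolded shiftv_nth]])
  show "pev q t ~= 0" for t using ev[of t] nz topp top by (cases "t = 0") auto
  show "vcross (pev q t) (top_coeff n q) ~= 0" for t
  proof (cases "t = 0")
   case True
   thus ?thesis using c(2) vcross_eq_0_commute by (auto simp: topp topq)
  next
   case False
   thus ?thesis using cF[OF False] by (simp add: topq ev vcross_bilinear)
  qed
 qed (rule n)
 define \<theta> where "\<theta> = (%s. 1 / (s - c))"
 have \<theta>: "c + 1 / \<theta> s = s" "s ~= c ==> \<theta> s ~= 0" for s by (auto simp: \<theta>_def)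
 have inj: "inj \<theta>" using \<theta>(1) by (metis injI)
 have TF: "s ~= c" if "s \<in> T \<union> K" for s using that T[of s] K[of s] c(1) unfolding F_def by blast
 have "card (\<theta> ` T) + 2 * card (\<theta> ` K) \<le> (n - 1) * (n - 2)"
 proof (rule node_count_le_aux)
  show "finite (\<theta> ` T)" "finite (\<theta> ` K)" using fin by auto
  show "finite {s. pev (chi q) s = 0 \<or> (\<exists>t. t ~= s \<and> meet q s t)}"
  proof (rule finite_subset)
   show "finite (insert 0 (\<theta> ` (F \<union> {s. vcross (pev p s) (top_coeff n p) = 0})))" using F finV by auto
   show "{s. pev (chi q) s = 0 \<or> (\<exists>t. t ~= s \<and> meet q s t)} \<subseteq> insert 0 (\<theta> ` (F \<union> {s. vcross (pev p s) (top_coeff n p) = 0}))"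
   proof
    fix s assume s: "s \<in> {s. pev (chi q) s = 0 \<or> (\<exists>t. t ~= s \<and> meet q s t)}"
    show "s \<in> insert 0 (\<theta> ` (F \<union> {s. vcross (pev p s) (top_coeff n p) = 0}))"
    proof (cases "s = 0")
     case False
     have e: "s = \<theta> (c + 1 / s)" using False by (simp add: \<theta>_def)
     consider "pev (chi q) s = 0" | "meet q s 0" | t where "t ~= s" "t ~= 0" "meet q s t"
      using s by auto
     hence "c + 1 / s \<in> F \<union> {s. vcross (pev p s) (top_coeff n p) = 0}"
     proof cases
      case 1 thus ?thesis using ch[OF False] False by (simp add: F_def)
     next
      case 2 thus ?thesis using ev[OF False] False by (simp add: topp vcross_bilinear)
     next
      case (3 t)
      hence "meet p (c + 1 / s) (c + 1 / t)" using par False by blast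
      moreover have "c + 1 / t ~= c + 1 / s" using 3 False by simp
      ultimately show ?thesis unfolding F_def by blast
     qed
     thus ?thesis using e by blast
    qed simp
   qed
  qed
  fix u assume "u \<in> \<theta> ` T"
  then obtain s where s: "s \<in> T" "u = \<theta> s" by blast
  obtain t where t: "t \<in> T" "t ~= s" "meet p s t" using T[OF s(1)] by blast
  have nz': "\<theta> s ~= 0" "\<theta> t ~= 0" using \<theta>(2) TF s t by auto
  have "pev (chi q) u ~= 0" using ch[OF nz'(1)] T[OF s(1)] nz' by (simp add: s \<theta>)
  moreover have "\<theta> t ~= u" using t inj s by (auto dest: injD)
  moreover have "meet q u (\<theta> t)" using par[OF nz'] t(3) by (simp add: s \<theta>)
  ultimately show "pev (chi q) u ~= 0 \<and> (\<exists>t\<in>\<theta> ` T. t ~= u \<and> meet q u t)" using t(1) by blast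
 next
  fix u assume "u \<in> \<theta> ` K"
  then obtain s where s: "s \<in> K" "u = \<theta> s" by blast
  have nz': "\<theta> s ~= 0" using \<theta>(2) TF s by auto
  have c0: "pev (chi p) s = 0" and c1: "pev (pd (chi p)) s ~= 0" using K[OF s(1)] by auto
  have "pev (chi q) u = 0" using ch[OF nz'] c0 by (simp add: s \<theta>)
  moreover have "pev (pd (chi q)) u ~= 0"
  proof
   assume z: "pev (pd (chi q)) u = 0"
   have "poly (pderiv (chi p $ i)) s = 0" for i
   proof -
    \<comment> \<open>As \<open>chi p\<close> vanishes at this parameter, the derivative of the
      power of u in the change of chart does not contribute, and a zero derivative is carried
      over.\<close>
    have "poly (pderiv (chi (shiftv c p) $ i)) (1 / u) = 0"
    proof (rule deriv_reversed[of "chi q $ i" "-1" "2 * (n - 1)"])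
     show "poly (chi q $ i) v = - 1 * v ^ (2 * (n - 1)) * poly (chi (shiftv c p) $ i) (1 / v)" if "v ~= 0" for v
      using ch[OF that] by (simp add: vec_eq_iff chi_shiftv poly_pcompose add.commute)
     show "u ~= 0" using nz' s by simp
     show "poly (chi (shiftv c p) $ i) (1 / u) = 0"
      using c0 by (simp add: chi_shiftv poly_pcompose add.commute s \<theta> vec_eq_iff)
     show "poly (pderiv (chi q $ i)) u = 0" using z by (simp add: vec_eq_iff)
    qed simp
    thus ?thesis by (simp add: chi_shiftv pderiv_pcompose pderiv_pCons poly_pcompose add.commute s \<theta>)
   qed
   thus False using c1 by (simp add: vec_eq_iff)
  qed
  ultimately show "pev (chi q) u = 0 \<and> pev (pd (chi q)) u ~= 0" ..
 qed
 thus ?thesis using inj by (simp add: card_image inj_on_subset[OF inj])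
qed

section \<open>Finiteness of the set of double points\<close>

text \<open>Polynomials in two variables: the outer variable is \<open>t\<close>, and the
  coefficients are polynomials in \<open>s\<close>.\<close>

definition ev2 :: "complex poly poly => complex => complex => complex" where
 "ev2 Q s t = poly (poly Q [:t:]) s"

lemma ev2_simps [simp]:
 "ev2 0 s t = 0" "ev2 (pCons a Q) s t = poly a s + t * ev2 Q s t"
 "ev2 (Q + R) s t = ev2 Q s t + ev2 R s t" "ev2 (Q - R) s t = ev2 Q s t - ev2 R s t"
 "ev2 (Q * R) s t = ev2 Q s t * ev2 R s t" "ev2 (smult a Q) s t = poly a s * ev2 Q s t"
 by (simp_all add: ev2_def)

lemma ev2_pcompose: "ev2 (pcompose Q [:[:0, 1:], 1:]) s u = ev2 Q s (s + u)"
proof -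
 have "poly (poly Q r) s = ev2 Q s (poly r s)" for r by (induction Q) simp_all
 thus ?thesis by (simp add: ev2_def[of "pcompose _ _"] poly_pcompose add.commute)
qed

lemma ev2_altdef: "ev2 Q s t = (\<Sum>k\<le>degree Q. poly (coeff Q k) s * t ^ k)"
 by (simp add: ev2_def poly_altdef[of Q] poly_sum poly_power)

lemma dd_ev2: "\<exists>Q. \<forall>s t. dd q s t = ev2 Q s t"
proof (induction q)
 case (pCons a q)
 then obtain Q where "\<forall>s t. dd q s t = ev2 Q s t" by blast
 thus ?case by (intro exI[of _ "pCons q Q"]) (simp add: dd_pCons)
qed (auto intro: exI[of _ 0])

lemma bdd_ev2: "\<exists>Q. \<forall>s t. bdd a b s t = ev2 Q s t"
proof -
 obtain A B where "\<forall>s t. dd a s t = ev2 A s t" "\<forall>s t. dd b s t = ev2 B s t" using dd_ev2 by metis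
 thus ?thesis by (intro exI[of _ "smult a B - smult b A"]) (simp add: bdd_def)
qed

text \<open>Each factor u - r with |r| >= e has coefficients bounded by (1 + 1/e) times its constant
  coefficient, and such bounds multiply.\<close>

lemma root_coeff_bound:
 fixes q :: "complex poly"
 assumes e: "0 < e" and r: "\<And>u. poly q u = 0 ==> e \<le> norm u"
 shows "norm (coeff q k) \<le> (1 + 1 / e) ^ degree q * norm (coeff q 0)"
proof (cases "q = 0")
 case False
 obtain rs where rs: "mset rs = proots q" using ex_mset by blast
 have "\<And>u. u \<in> set rs ==> e \<le> norm u" using r unfolding set_root_list[OF rs False] by simp
 hence "norm (coeff (\<Prod>r\<leftarrow>rs. [:-r, 1:]) k) \<le> (1 + 1 / e) ^ length rs * norm (coeff (\<Prod>r\<leftarrow>rs. [:-r, 1:]) 0)"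
 proof (induction rs arbitrary: k)
  case Nil thus ?case by (cases k) auto
 next
  case (Cons r rs)
  define P where "P = (\<Prod>r\<leftarrow>rs. [:-r, 1:])"
  define B where "B = (1 + 1 / e) ^ length rs * norm (coeff P 0)"
  have IH: "norm (coeff P k) \<le> B" for k unfolding B_def P_def using Cons by simp
  have re: "e \<le> norm r" using Cons.prems by simp
  have c: "norm (coeff ([:-r, 1:] * P) k) \<le> (1 + norm r) * B"
  proof (cases k)
   case 0
   hence "norm (coeff ([:-r, 1:] * P) k) = norm r * norm (coeff P 0)" by (simp add: norm_mult)
   also have "\<dots> \<le> (1 + norm r) * B" using IH[of 0] by (intro mult_mono) (auto intro: order_trans[OF norm_ge_zero])
   finally show ?thesis .
  next
   case (Suc j)
   have "norm (coeff ([:-r, 1:] * P) k) \<le> norm (coeff P j) + norm r * norm (coeff P k)"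
    using norm_triangle_ineq4[of "coeff P j" "r * coeff P k"] by (simp add: Suc norm_mult norm_minus_commute)
   also have "\<dots> \<le> B + norm r * B" using IH by (intro add_mono mult_left_mono) auto
   finally show ?thesis by (simp add: algebra_simps)
  qed
  have "1 + norm r \<le> (1 + 1 / e) * norm r" using re e by (simp add: field_simps)
  hence "(1 + norm r) * B \<le> ((1 + 1 / e) * norm r) * B"
   using IH[of 0] by (intro mult_right_mono) (auto intro: order_trans[OF norm_ge_zero])
  also have "\<dots> = (1 + 1 / e) ^ length (r # rs) * norm (coeff ([:-r, 1:] * P) 0)"
   by (simp add: B_def norm_mult)
  finally show ?case using c by (simp only: P_def list.map prod_list.Cons)
 qed
 hence "norm (lead_coeff q) * norm (coeff (\<Prod>r\<leftarrow>rs. [:-r, 1:]) k) \<le> norm (lead_coeff q) * ((1 + 1 / e) ^ length rs * norm (coeff (\<Prod>r\<leftarrow>rs. [:-r, 1:]) 0))"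
  by (intro mult_left_mono) auto
 moreover have "coeff q j = lead_coeff q * coeff (\<Prod>r\<leftarrow>rs. [:-r, 1:]) j" for j
  by (subst poly_root_list(1)[OF rs]) simp
 hence "norm (coeff q j) = norm (lead_coeff q) * norm (coeff (\<Prod>r\<leftarrow>rs. [:-r, 1:]) j)" for j
  using norm_mult by metis
 ultimately show ?thesis unfolding poly_root_list(2)[OF rs] by (metis mult.left_commute)
qed simp

text \<open>By continuity every root of \<open>b\<close> is a root of \<open>a\<close>; after
  dividing out all of them \<open>b\<close> is constant and \<open>a\<close> bounded.\<close>

lemma poly_dominated:
 fixes a b :: "complex poly"
 assumes "b ~= 0" "finite F" "\<And>s. s \<notin> F ==> norm (poly a s) \<le> C * norm (poly b s)"
 shows "\<exists>c. a = smult c b"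
 using assms
proof (induction "degree b" arbitrary: a b F)
 case 0
 then obtain b0 where b: "b = [:b0:]" "b0 ~= 0" by (metis degree_eq_zeroE pCons_eq_0_iff)
 have "degree a = 0"
 proof (rule ccontr)
  assume "degree a ~= 0"
  then obtain a0 a1 where a: "a = pCons a0 a1" "a1 ~= 0" by (metis degree_pCons_0 pCons_cases)
  obtain r where r: "\<And>z. r \<le> norm z ==> C * norm b0 + 1 \<le> norm (poly a z)"
   using poly_infinity[OF a(2), of "C * norm b0 + 1" a0] a(1) by blast
  have "infinite {z::complex. r \<le> norm z}"
  proof
   assume "finite {z::complex. r \<le> norm z}"
   moreover have "inj (%k::nat. complex_of_real (\<bar>r\<bar> + real k))" by (auto simp: inj_def simp flip: of_real_add)
   moreover have "range (%k::nat. complex_of_real (\<bar>r\<bar> + real k)) \<subseteq> {z. r \<le> norm z}"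
    by (auto simp del: of_real_add)
   ultimately have "finite (UNIV :: nat set)" using finite_imageD finite_subset by blast
   thus False by simp
  qed
  hence "\<not> {z::complex. r \<le> norm z} \<subseteq> F" using 0(3) finite_subset by blast
  then obtain z where "r \<le> norm z" "z \<notin> F" by blast
  thus False using r[of z] 0(4)[of z] by (simp add: b)
 qed
 then obtain a0 where "a = [:a0:]" by (metis degree_eq_zeroE)
 thus ?case using b by (intro exI[of _ "a0 / b0"]) simp
next
 case (Suc n)
 obtain r where r: "poly b r = 0" using Suc.hyps(2) fundamental_theorem_of_algebra[of b] constant_degree[of b] by auto
 have ar: "poly a r = 0"
 proof -
  have l1: "((%s. norm (poly a s)) \<longlongrightarrow> norm (poly a r)) (at r)" by (intro tendsto_intros)
  have l2: "((%s. C * norm (poly b s)) \<longlongrightarrow> C * norm (poly b r)) (at r)" by (intro tendsto_intros)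
  have l3: "\<forall>\<^sub>F s in at r. norm (poly a s) \<le> C * norm (poly b s)"
  proof -
   have "open (- (F - {r}))" using Suc.prems by (intro open_Compl finite_imp_closed) auto
   hence "\<forall>\<^sub>F s in at r. s \<in> - (F - {r})" by (rule eventually_at_in_open') auto
   moreover have "\<forall>\<^sub>F s in at r. s ~= r" by (rule eventually_neq_at_within)
   ultimately show ?thesis by eventually_elim (use Suc.prems(3) in auto)
  qed
  have "norm (poly a r) \<le> C * norm (poly b r)" by (rule tendsto_le[OF trivial_limit_at l2 l1 l3])
  thus ?thesis using r by simp
 qed
 obtain a' where a': "a = [:-r, 1:] * a'" using ar poly_single_root by blast
 obtain b' where b': "b = [:-r, 1:] * b'" using r poly_single_root by blast
 have b'0: "b' ~= 0" using b' Suc.prems(1) by auto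
 have "degree b = Suc (degree b')" unfolding b' using b'0 by (subst degree_mult_eq) auto
 hence "n = degree b'" using Suc.hyps(2) by simp
 moreover have "norm (poly a' s) \<le> C * norm (poly b' s)" if "s \<notin> insert r F" for s
 proof -
  have "norm (s - r) * norm (poly a' s) \<le> norm (s - r) * (C * norm (poly b' s))"
  proof -
   have "poly a s = (s - r) * poly a' s" "poly b s = (s - r) * poly b' s" by (simp_all add: a' b' algebra_simps)
   thus ?thesis using Suc.prems(3)[of s] that by (simp add: norm_mult mult_ac)
  qed
  thus ?thesis using that by (simp add: mult_le_cancel_left)
 qed
 ultimately obtain c where "a' = smult c b'" using Suc.hyps(1)[of b' "insert r F" a'] b'0 Suc.prems by auto
 thus ?case by (intro exI[of _ c]) (simp add: a' b')
qed

text \<open>The divided 2 by 2 minors vanish along the coinciding pairs and tend to the components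
  of \<open>chi p\<close> on the diagonal.\<close>

lemma injective_near_immersed:
 assumes "pev (chi p) s0 ~= 0" "ss \<longlonglongrightarrow> s0" "ts \<longlonglongrightarrow> s0"
 shows "\<exists>k. ss k = ts k \<or> \<not> meet p (ss k) (ts k)"
proof (rule ccontr)
 assume "\<not> ?thesis"
 hence ne: "ss k ~= ts k" and 0: "meet p (ss k) (ts k)" for k by auto
 have "bdd (p $ i) (p $ j) s0 s0 = 0" if ij: "\<And>u v :: complex ^ 3. vcross u v = 0 ==> u $ i * v $ j = u $ j * v $ i" for i j
 proof -
  have "bdd (p $ i) (p $ j) (ss k) (ts k) = 0" for k
   using bdd_eq[of "ts k" "ss k" "p $ i" "p $ j"] ij[OF 0[of k]] ne[of k] by simp
  moreover have "(%k. bdd (p $ i) (p $ j) (ss k) (ts k)) \<longlonglongrightarrow> bdd (p $ i) (p $ j) s0 s0"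
   by (intro tendsto_intros assms)
  ultimately show ?thesis by (simp add: LIMSEQ_const_iff)
 qed
 hence "pev (chi p) s0 = 0"
  unfolding vec_eq_iff forall_3 pev_chi_nth by (auto simp: v3_simps algebra_simps)
 thus False using assms(1) by simp
qed

lemma vdot_axis: "vdot (axis i 1) u = u $ i"
 using exhaust_3[of i] by (auto simp: vdot_def axis_def)

text \<open>Two coordinates \<open>g\<close>, \<open>h\<close> vanish at the cusp to orders 2 and 3,
  and their quotient is a local parameter of the branch that depends only on the image
  point.\<close>

lemma injective_near_cusp:
 assumes P: "pev p s0 ~= 0" "pev (chi p) s0 = 0" and d: "cusp_det p s0 ~= 0"
  and lim: "ss \<longlonglongrightarrow> s0" "ts \<longlonglongrightarrow> s0"
 shows "\<exists>k. ss k = ts k \<or> \<not> meet p (ss k) (ts k)"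
proof (rule ccontr)
 assume "\<not> ?thesis"
 hence ne: "ss k ~= ts k" and 0: "meet p (ss k) (ts k)" for k by auto
 obtain m where m: "pev (pd p) s0 = m *s pev p s0" using P vcross_eq_0_iff[OF P(1)] by (auto simp: pev_chi)
 obtain i where i: "pev p s0 $ i ~= 0" using P(1) by (auto simp: vec_eq_iff)
 define f where "f = lincomb (axis i 1) p"
 define g where "g = lincomb (vcross (pev p s0) (pev (pd (pd (pd p))) s0)) p"
 define h where "h = lincomb (vcross (pev p s0) (pev (pd (pd p)) s0)) p"
 have f0: "poly f s0 ~= 0" using i by (simp add: f_def vdot_axis)
 have g2: "poly g s0 = 0" "poly (pderiv g) s0 = 0" "poly (pderiv (pderiv g)) s0 ~= 0"
  using d by (simp_all add: g_def m vdot_bilinear) (simp add: v3_simps algebra_simps)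
 have h3: "poly h s0 = 0" "poly (pderiv h) s0 = 0" "poly (pderiv (pderiv h)) s0 = 0" "poly (pderiv (pderiv (pderiv h))) s0 ~= 0"
  using d by (simp_all add: h_def m vdot_bilinear) (simp add: v3_simps algebra_simps)
 obtain l where l: "g = [:-s0, 1:] ^ 2 * l" "poly l s0 ~= 0" using poly_double_root[OF g2(1,2)] g2(3) by auto
 obtain k where k: "h = [:-s0, 1:] ^ 3 * k" "poly k s0 ~= 0" using poly_triple_root[OF h3(1,2,3)] h3(4) by auto
 define q where "q = [:-s0, 1:] * k"
 have fg: "poly f s * poly g t = poly g s * poly f t" if "meet p s t" for s t
  unfolding f_def g_def poly_lincomb by (rule coords_vcross_eq_0[OF that])
 have gh: "poly g s * poly h t = poly h s * poly g t" if "meet p s t" for s t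
  unfolding g_def h_def poly_lincomb by (rule coords_vcross_eq_0[OF that])
 have evn: "\<forall>\<^sub>F j in sequentially. poly f (us j) ~= 0 \<and> poly l (us j) ~= 0" if "us \<longlonglongrightarrow> s0" for us
  using tendsto_imp_eventually_ne[OF tendsto_poly[OF that] f0] tendsto_imp_eventually_ne[OF tendsto_poly[OF that] l(2)]
  by eventually_elim simp
 have ev: "\<forall>\<^sub>F j in sequentially. bdd l q (ss j) (ts j) = 0"
  using evn[OF lim(1)] evn[OF lim(2)]
 proof eventually_elim
  case (elim j)
  let ?s = "ss j" and ?t = "ts j"
  have gs: "poly g u = (u - s0)\<^sup>2 * poly l u" "poly h u = (u - s0)\<^sup>2 * poly q u" for u
   by (simp_all add: l(1) k(1) q_def power2_eq_square power3_eq_cube algebra_simps)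
  have "poly f ?s * poly g ?t = poly g ?s * poly f ?t" using fg[OF 0] .
  hence "?s ~= s0 \<and> ?t ~= s0" using elim ne[of j] by (auto simp: gs)
  moreover have "(?s - s0)\<^sup>2 * (?t - s0)\<^sup>2 * (poly l ?s * poly q ?t - poly q ?s * poly l ?t) = 0"
   using gh[OF 0[of j]] by (simp add: gs algebra_simps)
  ultimately have "poly l ?s * poly q ?t - poly q ?s * poly l ?t = 0" by simp
  thus ?case using bdd_eq[of ?t ?s l q] ne[of j] by simp
 qed
 have "(%j. bdd l q (ss j) (ts j)) \<longlonglongrightarrow> bdd l q s0 s0" by (intro tendsto_intros lim)
 hence "bdd l q s0 s0 = 0" using tendsto_eventually[OF ev] by (rule LIMSEQ_unique)
 moreover have "poly q s0 = 0" by (simp add: q_def)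
 moreover have "poly (pderiv q) s0 = poly k s0" by (simp add: q_def pderiv_mult pderiv_pCons del: mult_pCons_left)
 ultimately show False using l k by (simp add: bdd_self)
qed

text \<open>If the coinciding pairs were infinite in number, they would contain a curve D(s, t) = 0.
  Local injectivity keeps pairs at distance at least e from the diagonal, and not both members can
  be large. With t = s + u all roots u of D satisfy |u| >= e, so the coefficients are dominated by
  the constant one and proportional to it. Hence some fixed u pairs almost every s with s + u, which
  fails for large s.\<close>

theorem finite_double_points:
 assumes deg: "\<And>i. degree (p $ i) \<le> n" and n: "n > 0" and nz: "\<And>t. pev p t ~= 0"
  and imm: "pev (chi (rvec n p)) 0 ~= 0" and fin: "finite {s. pev (chi p) s = 0}"
  and cusp: "\<And>s. pev (chi p) s = 0 ==> cusp_det p s ~= 0"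
 shows "finite {s. \<exists>t. t ~= s \<and> meet p s t}"
proof -
 define par where "par = (%s t. s ~= t \<and> meet p s t)"
 have li: "\<exists>k. \<not> par (ss k) (ts k)" if "ss \<longlonglongrightarrow> s0" "ts \<longlonglongrightarrow> s0" for ss ts s0
  using injective_near_immersed[OF _ that, of p] injective_near_cusp[OF nz _ cusp that] unfolding par_def by blast
 have linf: "\<exists>R. \<forall>s t. R < norm s --> R < norm t --> \<not> par s t"
 proof (rule ccontr)
  assume "\<not> ?thesis"
  hence "\<forall>k::nat. \<exists>s t. real (Suc k) < norm s \<and> real (Suc k) < norm t \<and> par s t" by meson
  then obtain ss ts where st: "\<And>k. real (Suc k) < norm (ss k)" "\<And>k. real (Suc k) < norm (ts k)" "\<And>k. par (ss k) (ts k)"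
   by metis
  have lim: "(%k. 1 / us k) \<longlonglongrightarrow> 0" if "\<And>k. real (Suc k) < norm (us k)" for us :: "nat => complex"
  proof (rule Lim_null_comparison)
   show "\<forall>\<^sub>F k in sequentially. norm (1 / us k) \<le> 1 / real (Suc k)"
   proof (intro always_eventually allI)
    fix k show "norm (1 / us k) \<le> 1 / real (Suc k)"
     using that[of k] by (simp add: norm_divide frac_le del: of_nat_Suc)
   qed
   show "(%k. 1 / real (Suc k)) \<longlonglongrightarrow> 0" by (rule lim_1_over_n[THEN LIMSEQ_Suc])
  qed
  have nz': "ss k ~= 0" "ts k ~= 0" for k using st(1,2)[of k] by (auto simp del: of_nat_Suc)
  obtain k where "1 / ss k = 1 / ts k \<or> vcross (pev (rvec n p) (1 / ss k)) (pev (rvec n p) (1 / ts k)) ~= 0"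
   using injective_near_immersed[OF imm lim[OF st(1)] lim[OF st(2)]] by blast
  thus False using st(3)[of k] nz'[of k] by (simp add: par_def pev_rvec(1)[OF deg] vcross_bilinear)
 qed
 then obtain R where R: "\<And>s t. R < norm s ==> R < norm t ==> \<not> par s t" by blast
 \<comment> \<open>Pairs approaching the diagonal would stay bounded by the previous bound, so a
   subsequence would converge to one parameter and contradict local injectivity.\<close>
 have "\<exists>e>0. \<forall>s t. par s t --> e \<le> dist s t"
 proof (rule ccontr)
  assume "\<not> ?thesis"
  hence "\<forall>k::nat. \<exists>s t. par s t \<and> dist s t < 1 / real (Suc k)"
   by (metis not_le of_nat_0_less_iff zero_less_Suc zero_less_divide_1_iff)
  then obtain ss ts where st: "\<And>k. par (ss k) (ts k)" "\<And>k. dist (ss k) (ts k) < 1 / real (Suc k)" by metis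
  have "ss k \<in> cball 0 (R + 1)" for k
  proof (rule ccontr)
   assume "ss k \<notin> cball 0 (R + 1)"
   hence "R + 1 < norm (ss k)" by simp
   moreover have "dist (ss k) (ts k) < 1" using st(2)[of k] by (rule less_le_trans) simp
   hence "norm (ss k) - norm (ts k) < 1" using norm_triangle_ineq2[of "ss k" "ts k"] by (simp add: dist_norm)
   ultimately show False using R[of "ss k" "ts k"] st(1)[of k] by linarith
  qed
  then obtain s0 r where r: "strict_mono r" "(ss \<circ> r) \<longlonglongrightarrow> s0"
   using compact_cball[of "0::complex" "R + 1"] unfolding compact_eq_seq_compact_metric seq_compact_def by metis
  have d0: "(%k. dist (ss k) (ts k)) \<longlonglongrightarrow> 0"
  proof (rule Lim_null_comparison)
   show "\<forall>\<^sub>F k in sequentially. norm (dist (ss k) (ts k)) \<le> 1 / real (Suc k)"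
    using st(2) by (intro always_eventually allI) (simp add: less_imp_le del: of_nat_Suc)
   show "(%k. 1 / real (Suc k)) \<longlonglongrightarrow> 0" by (rule lim_1_over_n[THEN LIMSEQ_Suc])
  qed
  have "(%k. ts k - ss k) \<longlonglongrightarrow> 0"
   using d0 by (simp add: dist_norm norm_minus_commute[of "ss _"] tendsto_norm_zero_iff)
  hence "((%k. ts k - ss k) \<circ> r) \<longlonglongrightarrow> 0" using r(1) by (rule LIMSEQ_subseq_LIMSEQ)
  from tendsto_add[OF r(2) this] have "(ts \<circ> r) \<longlonglongrightarrow> s0" by (simp add: o_def)
  from li[OF r(2) this] obtain k where "\<not> par (ss (r k)) (ts (r k))" by auto
  thus False using st(1) by blast
 qed
 then obtain e where e: "e > 0" "\<And>s t. par s t ==> e \<le> dist s t" by blast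
 obtain Q1 where Q1: "\<And>s t. bdd (p$2) (p$3) s t = ev2 Q1 s t" using bdd_ev2 by blast
 obtain Q2 where Q2: "\<And>s t. bdd (p$3) (p$1) s t = ev2 Q2 s t" using bdd_ev2 by blast
 obtain Q3 where Q3: "\<And>s t. bdd (p$1) (p$2) s t = ev2 Q3 s t" using bdd_ev2 by blast
 have parQ: "par s t \<longleftrightarrow> ev2 Q1 s t = 0 \<and> ev2 Q2 s t = 0 \<and> ev2 Q3 s t = 0" if "s ~= t" for s t
  using that bdd_eq[of t s "p$2" "p$3"] bdd_eq[of t s "p$3" "p$1"] bdd_eq[of t s "p$1" "p$2"]
  unfolding Q1 Q2 Q3 by (auto simp: par_def v3_simps algebra_simps)
 have diagQ: "pev (chi p) s = 0" if "ev2 Q1 s s = 0" "ev2 Q2 s s = 0" "ev2 Q3 s s = 0" for s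
  unfolding vec_eq_iff forall_3 pev_chi_nth Q1 Q2 Q3 using that by simp
 \<comment> \<open>A nonzero element of least degree in t in the ideal of the three minors divides
   each of them up to powers of its leading coefficient: it is their greatest common divisor over
   the rational functions of s.\<close>
 define I where "I = {D. D ~= 0 \<and> (\<exists>A B C. D = A * Q1 + B * Q2 + C * Q3)}"
 have "I ~= {}"
 proof
  assume I0: "I = {}"
  have "Q1 = 1 * Q1 + 0 * Q2 + 0 * Q3" "Q2 = 0 * Q1 + 1 * Q2 + 0 * Q3" "Q3 = 0 * Q1 + 0 * Q2 + 1 * Q3" by simp_all
  hence z: "Q1 = 0" "Q2 = 0" "Q3 = 0" using I0 unfolding I_def by blast+
  define x y where "x = complex_of_real (\<bar>R\<bar> + 1)" and "y = complex_of_real (\<bar>R\<bar> + 2)"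
  have "x ~= y" unfolding x_def y_def of_real_eq_iff by simp
  hence "par x y" using parQ z by simp
  moreover have "R < norm x" "R < norm y" unfolding x_def y_def norm_of_real by arith+
  ultimately show False using R by blast
 qed
 then obtain D where D: "D \<in> I" "\<And>D'. D' \<in> I ==> degree D \<le> degree D'"
  using ex_has_least_nat[of "%D. D \<in> I" _ degree] by blast
 hence D0: "D ~= 0" by (simp add: I_def)
 obtain A B C where ABC: "D = A * Q1 + B * Q2 + C * Q3" using D(1) by (auto simp: I_def)
 have div: "\<exists>k q. smult (lead_coeff D ^ k) Q = D * q" if Q: "Q = A' * Q1 + B' * Q2 + C' * Q3" for Q A' B' C'
 proof -
  obtain q r where qr: "pseudo_divmod Q D = (q, r)" by fastforce
  define k where "k = Suc (degree Q) - degree D"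
  have e: "smult (lead_coeff D ^ k) Q = D * q + r" and r: "r = 0 \<or> degree r < degree D"
   using pseudo_divmod[OF D0 qr] by (auto simp: k_def)
  have "r = smult (lead_coeff D ^ k) Q - D * q" using e by simp
  also have "\<dots> = (smult (lead_coeff D ^ k) A' - A * q) * Q1 + (smult (lead_coeff D ^ k) B' - B * q) * Q2 + (smult (lead_coeff D ^ k) C' - C * q) * Q3"
   unfolding Q ABC by (simp add: algebra_simps smult_add_right)
  finally have "r = 0 \<or> r \<in> I" unfolding I_def by blast
  hence "r = 0" using r D(2)[of r] by auto
  thus ?thesis using e by auto
 qed
 obtain k1 q1 where d1: "smult (lead_coeff D ^ k1) Q1 = D * q1" using div[of Q1 1 0 0] by auto
 obtain k2 q2 where d2: "smult (lead_coeff D ^ k2) Q2 = D * q2" using div[of Q2 0 1 0] by auto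
 obtain k3 q3 where d3: "smult (lead_coeff D ^ k3) Q3 = D * q3" using div[of Q3 0 0 1] by auto
 have ldnz: "lead_coeff D ~= 0" using D0 by simp
 show ?thesis
 proof (cases "degree D = 0")
  case True
  then obtain d where d: "D = [:d:]" by (metis degree_eq_zeroE)
  \<comment> \<open>Here \<open>D\<close> depends on s alone and vanishes at the first member of
    every pair.\<close>
  have "{s. \<exists>t. t ~= s \<and> meet p s t} \<subseteq> {s. poly d s = 0}"
  proof clarify
   fix s t assume "t ~= s" "meet p s t"
   hence "par s t" by (simp add: par_def)
   hence "ev2 D s t = 0" unfolding ABC using parQ[of s t] \<open>t ~= s\<close> by simp
   thus "poly d s = 0" by (simp add: d)
  qed
  moreover have "finite {s. poly d s = 0}" using D0 d by (intro poly_roots_finite) auto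
  ultimately show ?thesis by (rule finite_subset)
 next
  case False
  define bad where "bad = {s. poly (lead_coeff D) s = 0} \<union> {s. pev (chi p) s = 0}"
  have finbad: "finite bad" unfolding bad_def using fin poly_roots_finite[OF ldnz] by simp
  have root: "par s t" if s: "s \<notin> bad" and z: "ev2 D s t = 0" for s t
  proof -
   have l: "poly (lead_coeff D) s ~= 0" using s by (simp add: bad_def)
   have "ev2 (smult (lead_coeff D ^ k1) Q1) s t = 0" "ev2 (smult (lead_coeff D ^ k2) Q2) s t = 0"
    "ev2 (smult (lead_coeff D ^ k3) Q3) s t = 0" unfolding d1 d2 d3 using z by simp_all
   hence Qz: "ev2 Q1 s t = 0" "ev2 Q2 s t = 0" "ev2 Q3 s t = 0" using l by (simp_all add: poly_power)
   show ?thesis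
   proof (cases "s = t")
    case True
    hence "pev (chi p) s = 0" using diagQ Qz by simp
    thus ?thesis using s by (simp add: bad_def)
   qed (use Qz parQ in blast)
  qed
  \<comment> \<open>The polynomial D(s, s + u): its roots u are the displacements of the
    pairs.\<close>
  define E where "E = pcompose D [:[:0, 1:], 1:]"
  have evE: "ev2 E s u = ev2 D s (s + u)" for s u unfolding E_def by (rule ev2_pcompose)
  have degE: "degree E = degree D" unfolding E_def by (simp add: degree_pcompose)
  have lcE: "lead_coeff E = lead_coeff D" unfolding E_def by (subst lead_coeff_comp) auto
  define C0 where "C0 = (1 + 1 / e) ^ degree D"
  have bound: "norm (poly (coeff E k) s) \<le> C0 * norm (poly (coeff E 0) s)" and E0: "poly (coeff E 0) s ~= 0" if s: "s \<notin> bad" for k s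
  proof -
   define q where "q = map_poly (%c. poly c s) E"
   have cq: "coeff q k = poly (coeff E k) s" for k by (simp add: q_def coeff_map_poly)
   have dq: "degree q \<le> degree D" by (intro degree_le allI impI) (simp add: cq coeff_eq_0 degE)
   have pq: "poly q u = ev2 E s u" for u
   proof -
    have "poly q u = (\<Sum>k\<le>degree E. coeff q k * u ^ k)"
     unfolding poly_altdef using dq degE by (intro sum.mono_neutral_left) (auto simp: coeff_eq_0)
    thus ?thesis by (simp add: ev2_altdef cq)
   qed
   have roots: "e \<le> norm u" if "poly q u = 0" for u
   proof -
    have "par s (s + u)" using root[OF s] that by (simp add: pq evE)
    thus ?thesis using e(2)[of s "s + u"] by (simp add: dist_norm)
   qed
   have "norm (coeff q k) \<le> (1 + 1 / e) ^ degree q * norm (coeff q 0)" by (rule root_coeff_bound[OF e(1) roots])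
   also have "\<dots> \<le> C0 * norm (coeff q 0)"
    unfolding C0_def using dq e(1) by (intro mult_right_mono power_increasing) auto
   finally show "norm (poly (coeff E k) s) \<le> C0 * norm (poly (coeff E 0) s)" by (simp add: cq)
   have "poly q 0 ~= 0" using roots[of 0] e(1) by auto
   thus "poly (coeff E 0) s ~= 0" by (simp add: poly_0_coeff_0 cq)
  qed
  obtain s1 where s1: "s1 \<notin> bad" using ex_new_if_finite[OF infinite_UNIV_char_0 finbad] by blast
  have E00: "coeff E 0 ~= 0" using E0[OF s1] by auto
  have "\<forall>k. \<exists>c. coeff E k = smult c (coeff E 0)" using poly_dominated[OF E00 finbad bound] by blast
  then obtain c where c: "\<And>k. coeff E k = smult (c k) (coeff E 0)" by metis
  have c0: "c 0 = 1"
  proof -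
   have "poly (coeff E 0) s1 = c 0 * poly (coeff E 0) s1" by (subst c) simp
   thus ?thesis using E0[OF s1] by simp
  qed
  have cm: "c (degree D) ~= 0" using c[of "degree D"] lcE degE ldnz by auto
  \<comment> \<open>Proportional coefficients make E(s, u) a product of a polynomial in s with
    \<open>w\<close> in u, so any root of \<open>w\<close> is a displacement that works for all
    s.\<close>
  define w where "w = (\<Sum>k\<le>degree D. monom (c k) k)"
  have cw: "coeff w j = (if j \<le> degree D then c j else 0)" for j
   by (simp add: w_def coeff_sum)
  have "degree w ~= 0"
  proof
   assume "degree w = 0"
   hence "coeff w (degree D) = 0" using False by (intro coeff_eq_0) simp
   thus False using cm by (simp add: cw)
  qed
  then obtain u where u: "poly w u = 0" using fundamental_theorem_of_algebra[of w] constant_degree[of w] by auto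
  have "poly w 0 = 1" using c0 by (simp add: poly_0_coeff_0 cw)
  hence u0: "u ~= 0" using u by auto
  have all: "par s (s + u)" if "s \<notin> bad" for s
  proof (rule root[OF that])
   have "ev2 D s (s + u) = (\<Sum>k\<le>degree D. poly (coeff E k) s * u ^ k)" by (simp only: evE[symmetric] ev2_altdef[of E] degE)
   also have "\<dots> = (\<Sum>k\<le>degree D. poly (coeff E 0) s * (c k * u ^ k))"
    by (intro sum.cong refl) (subst c, simp)
   also have "\<dots> = poly (coeff E 0) s * poly w u" by (simp add: w_def poly_sum poly_monom sum_distrib_left)
   finally show "ev2 D s (s + u) = 0" using u by simp
  qed
  have "infinite (range (%k::nat. complex_of_real (\<bar>R\<bar> + norm u + 1 + real k)))"
   by (intro range_inj_infinite) (auto simp: inj_def simp flip: of_real_add)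
  then obtain s where s: "s \<in> range (%k::nat. complex_of_real (\<bar>R\<bar> + norm u + 1 + real k))" "s \<notin> bad"
   using finbad by (meson finite_subset subsetI)
  then obtain k :: nat where k: "s = complex_of_real (\<bar>R\<bar> + norm u + 1 + real k)" by blast
  have ns: "norm s = \<bar>R\<bar> + norm u + 1 + real k" unfolding k norm_of_real by simp
  have "norm (s + u) \<ge> norm s - norm u" using norm_diff_ineq by blast
  hence "R < norm s" "R < norm (s + u)" using ns norm_ge_zero[of u] by linarith+
  thus ?thesis using R all[OF s(2)] by blast
 qed
qed

section \<open>Inflected curves and their duals\<close>

lemma poly_eqI_punctured:
 fixes a b :: "complex poly"
 assumes "\<And>s. s ~= 0 ==> poly a s = poly b s" shows "a = b"
proof (rule ccontr)
 assume "a ~= b"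
 hence "finite {s. poly (a - b) s = 0}" by (intro poly_roots_finite) simp
 moreover have "- {0} \<subseteq> {s. poly (a - b) s = 0}" using assms by auto
 ultimately have "finite (- {0::complex})" by (rule finite_subset[rotated])
 thus False using infinite_UNIV_char_0[where 'a = complex] by (simp add: finite_compl)
qed

lemma pev_eqI_punctured:
 assumes "\<And>s. s ~= 0 ==> pev p s = pev q s" shows "p = q"
proof -
 have "p $ i = q $ i" for i using assms by (intro poly_eqI_punctured) (auto simp: vec_eq_iff)
 thus ?thesis by (simp add: vec_eq_iff)
qed

lemma degree_le_reversed:
 fixes a b :: "complex poly"
 assumes "\<And>s. s ~= 0 ==> poly a s = k * s ^ N * poly b (1 / s)"
 shows "degree a \<le> N"
proof (rule degree_via_limit(1)[where xs = "%j. of_nat (Suc j)" and L = "k * poly b 0"])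
 show "filterlim (%k. of_nat (Suc k) :: complex) at_infinity sequentially"
  by (rule filterlim_compose[OF tendsto_of_nat filterlim_Suc])
 have "(%j. 1 / of_nat (Suc j)) \<longlonglongrightarrow> (0::complex)" by (rule lim_1_over_n[THEN LIMSEQ_Suc])
 hence "(%j. k * poly b (1 / of_nat (Suc j))) \<longlonglongrightarrow> k * poly b 0" by (intro tendsto_intros)
 moreover have "poly a (of_nat (Suc j)) / of_nat (Suc j) ^ N = k * poly b (1 / of_nat (Suc j))" for j
  using assms[of "of_nat (Suc j)"] by (simp del: of_nat_Suc)
 ultimately show "(%j. poly a (of_nat (Suc j)) / of_nat (Suc j) ^ N) \<longlonglongrightarrow> k * poly b 0" by simp
qed (simp del: of_nat_Suc)

lemma prod_linear_dvd:
 fixes q :: "complex poly"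
 assumes "finite K" "q ~= 0" "\<And>c. c \<in> K ==> m \<le> order c q"
 shows "\<exists>r. q = (\<Prod>c\<in>K. [:-c, 1:]) ^ m * r"
 using assms
proof (induction K arbitrary: q rule: finite_induct)
 case (insert c K)
 have "[:-c, 1:] ^ m dvd q" using insert.prems by (simp add: order_divides)
 then obtain r where r: "q = [:-c, 1:] ^ m * r" by (elim dvdE)
 hence r0: "r ~= 0" using insert.prems by auto
 have "m \<le> order a r" if "a \<in> K" for a
 proof -
  have "order a q = order a ([:-c, 1:] ^ m) + order a r"
   unfolding r using r0 by (intro order_mult) (auto simp del: mult_pCons_left)
  moreover have "poly ([:-c, 1:] ^ m) a ~= 0" using that insert.hyps by auto
  hence "order a ([:-c, 1:] ^ m) = 0" by (rule order_0I)
  ultimately show ?thesis using insert.prems(2)[of a] that by simp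
 qed
 then obtain r' where "r = (\<Prod>c\<in>K. [:-c, 1:]) ^ m * r'" using insert.IH[OF r0] by blast
 thus ?case using r insert.hyps by (intro exI[of _ r']) (simp add: power_mult_distrib mult_ac del: mult_pCons_left)
qed auto

lemma coeff_mult_top:
 fixes a b :: "complex poly"
 assumes "degree b \<le> j"
 shows "coeff (a * b) (degree a + j) = lead_coeff a * coeff b j"
proof (cases "degree b = j")
 case True thus ?thesis using coeff_mult_degree_sum[of a b] by simp
next
 case False
 hence "degree (a * b) < degree a + j" using assms degree_mult_le[of a b] by simp
 thus ?thesis using False assms by (simp add: coeff_eq_0)
qed

text \<open>By \<open>number\<close> the zeros of the Wronskian at \<open>K\<close> and
  \<open>F\<close>, with multiplicities 2 and 1, already add up to the largest degree 3 (d - 2) that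
  it can have.\<close>

locale inflected =
 fixes p :: "complex poly ^ 3" and d :: nat and K F :: "complex set"
 assumes deg: "\<And>i. degree (p $ i) \<le> d" and d3: "d \<ge> 3"
  and nz: "\<And>t. pev p t ~= 0" and top: "top_coeff d p ~= 0"
  and fin: "finite K" "finite F" and number: "2 * card K + card F = 3 * (d - 2)"
  and cusp: "\<And>s. s \<in> K ==> pev (chi p) s = 0 \<and> cusp_det p s ~= 0"
  and flex: "\<And>s. s \<in> F ==> osc_det p s = 0 \<and>
   flex_det p s ~= 0"
begin

definition W :: "complex poly" where "W = vdet p (pd p) (pd (pd p))"

text \<open>Biduality: two neighbouring tangent lines meet in the point of contact.\<close>

lemma chi_chi: "vcross (chi p) (pd (chi p)) = W *s p"
 by (simp add: pd_chi) (simp add: chi_def vcross_vcross W_def)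

lemma poly_W: "poly W s = vdot (pev (chi p) s) (pev (pd (pd p)) s)"
 by (simp add: W_def pev_chi vdet_alt)

lemma pderiv_W: "pderiv W = vdet p (pd p) (pd (pd (pd p)))"
 by (simp add: W_def pderiv_vdet)

lemma pderiv2_W: "pderiv (pderiv W) = vdet p (pd (pd p)) (pd (pd (pd p))) + vdet p (pd p) (pd (pd (pd (pd p))))"
 by (simp add: pderiv_W pderiv_vdet)

lemma F_chi: "s \<in> F ==> pev (chi p) s ~= 0"
 using flex[of s] by (auto simp: pev_chi vdet_alt vdot_bilinear)

lemma KF_disjoint: "K \<inter> F = {}" using cusp F_chi by blast

lemma W_at_K:
 assumes "s \<in> K"
 shows "poly W s = 0" "poly (pderiv W) s = 0" "poly (pderiv (pderiv W)) s ~= 0"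
proof -
 have c: "vcross (pev p s) (pev (pd p) s) = 0" using cusp[OF assms] by (simp add: pev_chi)
 have "vdet (pev p s) (pev (pd p) s) w = 0" for w by (simp add: vdet_alt c vdot_bilinear)
 thus "poly W s = 0" "poly (pderiv W) s = 0" "poly (pderiv (pderiv W)) s ~= 0"
  using cusp[OF assms] by (simp add: W_def, simp add: pderiv_W, simp add: pderiv2_W)
qed

lemma W_at_F: assumes "s \<in> F" shows "poly W s = 0" "poly (pderiv W) s ~= 0"
 using flex[OF assms] by (simp add: W_def, simp add: pderiv_W)

lemma W_nz: "W ~= 0"
proof
 assume "W = 0"
 hence "K = {}" "F = {}" using W_at_K(3) W_at_F(2) by auto
 thus False using number d3 by simp
qed

lemma order_W: "s \<in> K ==> order s W = 2" "s \<in> F ==> order s W = 1"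
proof -
 show "order s W = 2" if s: "s \<in> K"
 proof -
  obtain r where r: "W = [:-s, 1:] ^ 2 * r" "poly (pderiv (pderiv W)) s = 2 * poly r s"
   using poly_double_root[OF W_at_K(1,2)[OF s]] by blast
  hence "poly r s ~= 0" using W_at_K(3)[OF s] by simp
  thus ?thesis using order_eqI[OF r(1)] by simp
 qed
 show "order s W = 1" if s: "s \<in> F"
 proof -
  obtain r where r: "W = [:-s, 1:] * r" "poly (pderiv W) s = poly r s"
   using poly_single_root[OF W_at_F(1)[OF s]] by blast
  hence "poly r s ~= 0" using W_at_F(2)[OF s] by simp
  thus ?thesis using order_eqI[of W s 1 r] r(1) by simp
 qed
qed

definition R :: "complex poly ^ 3" where "R = rvec d p"

lemma R_eval: "s ~= 0 ==> pev R s = s ^ d *s pev p (1 / s)" "pev R 0 = top_coeff d p"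
 unfolding R_def using pev_rvec[OF deg] by auto

lemma chi_R: "s ~= 0 ==> pev (chi R) s = - (s ^ (2 * (d - 1))) *s pev (chi p) (1 / s)"
 unfolding R_def using d3 by (intro pev_chi_rvec deg) auto

lemma deg_chi: "degree (chi p $ i) \<le> 2 * (d - 1)"
proof (rule degree_le_reversed[of _ "-1" _ "chi R $ i"])
 fix s :: complex assume s: "s ~= 0"
 have "pev (chi R) (1 / s) $ i = (- ((1 / s) ^ (2 * (d - 1))) *s pev (chi p) (1 / (1 / s))) $ i"
  using chi_R[of "1 / s"] s by simp
 hence "poly (chi R $ i) (1 / s) = - ((1 / s) ^ (2 * (d - 1))) * poly (chi p $ i) s" using s by simp
 thus "poly (chi p $ i) s = - 1 * s ^ (2 * (d - 1)) * poly (chi R $ i) (1 / s)"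
  using s by (simp add: power_one_over)
qed

definition WR :: "complex poly" where "WR = vdet R (pd R) (pd (pd R))"

text \<open>Second derivatives of reversed polynomials are avoided: \<open>chi\<close> is applied
  twice, its change of chart is used both times, and biduality returns the Wronskian times the
  curve, from which the curve is cancelled.\<close>

lemma WR_eq:
 assumes s: "s ~= 0"
 shows "poly WR s = - (s ^ (3 * (d - 2))) * poly W (1 / s)"
proof -
 have d1: "2 * (d - 1) > 0" using d3 by simp
 have e: "chi R = - 1 *s rvec (2 * (d - 1)) (chi p)"
 proof (rule pev_eqI_punctured)
  fix s :: complex assume "s ~= 0"
  thus "pev (chi R) s = pev (- 1 *s rvec (2 * (d - 1)) (chi p)) s"
   using pev_rvec(1)[OF deg_chi, of s] chi_R[of s] by (simp add: vec_eq_iff)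
 qed
 have "vcross (chi R) (pd (chi R)) = vcross (rvec (2 * (d - 1)) (chi p)) (pd (rvec (2 * (d - 1)) (chi p)))"
  unfolding e by (simp add: v3_simps pderiv_minus)
 hence "pev (vcross (chi R) (pd (chi R))) s = pev (chi (rvec (2 * (d - 1)) (chi p))) s" by (simp add: chi_def)
 also have "\<dots> = - (s ^ (2 * (2 * (d - 1) - 1))) *s pev (chi (chi p)) (1 / s)"
  by (rule pev_chi_rvec[OF deg_chi d1 s])
 also have "chi (chi p) = W *s p" by (simp add: chi_def[of "chi p"] chi_chi)
 finally have "pev (vcross (chi R) (pd (chi R))) s = (- (s ^ (2 * (2 * (d - 1) - 1))) * poly W (1 / s)) *s pev p (1 / s)"
  by (simp add: vector_smult_assoc)
 moreover have "vcross (chi R) (pd (chi R)) = WR *s R"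
  by (simp add: pd_chi) (simp add: chi_def vcross_vcross WR_def)
 ultimately have "(poly WR s * s ^ d) *s pev p (1 / s) = (- (s ^ (2 * (2 * (d - 1) - 1))) * poly W (1 / s)) *s pev p (1 / s)"
  using R_eval(1)[OF s] by (simp add: vector_smult_assoc)
 hence "poly WR s * s ^ d = - (s ^ (2 * (2 * (d - 1) - 1))) * poly W (1 / s)"
  using nz[of "1 / s"] by (simp only: vector_mul_rcancel) blast
 moreover have "2 * (2 * (d - 1) - 1) = 3 * (d - 2) + d" using d3 by simp
 ultimately have "poly WR s * s ^ d = (- (s ^ (3 * (d - 2))) * poly W (1 / s)) * s ^ d"
  by (simp only: power_add) simp
 thus ?thesis by (rule mult_right_cancel[THEN iffD1, rotated]) (use s in simp)
qed

lemma degree_W_le: "degree W \<le> 3 * (d - 2)"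
proof (rule degree_le_reversed[of _ "-1" _ WR])
 fix s :: complex assume s: "s ~= 0"
 thus "poly W s = - 1 * s ^ (3 * (d - 2)) * poly WR (1 / s)"
  using WR_eq[of "1 / s"] by (simp add: power_one_over)
qed

lemma sum_order_W: "(\<Sum>s\<in>K \<union> F. order s W) = 3 * (d - 2)"
proof -
 have "(\<Sum>s\<in>K \<union> F. order s W) = (\<Sum>s\<in>K. order s W) + (\<Sum>s\<in>F. order s W)"
  using fin KF_disjoint by (rule sum.union_disjoint)
 also have "(\<Sum>s\<in>K. order s W) = (\<Sum>s\<in>K. 2)" using order_W by (intro sum.cong) auto
 also have "(\<Sum>s\<in>F. order s W) = (\<Sum>s\<in>F. 1)" using order_W by (intro sum.cong) auto
 finally show ?thesis using number by simp
qed

text \<open>The prescribed zeros meet the upper bound for the degree, so there are no further zeros,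
  and none at infinity either.\<close>

lemma degree_W: "degree W = 3 * (d - 2)"
 using sum_order_le[of "K \<union> F" W] sum_order_W degree_W_le W_nz fin by auto

lemma W_roots: "poly W s = 0 \<longleftrightarrow> s \<in> K \<union> F"
proof
 assume s: "poly W s = 0"
 show "s \<in> K \<union> F"
 proof (rule ccontr)
  assume n: "s \<notin> K \<union> F"
  have "order s W ~= 0" using s W_nz order_root by blast
  moreover have "(\<Sum>t\<in>insert s (K \<union> F). order t W) \<le> 3 * (d - 2)"
   using sum_order_le[of "insert s (K \<union> F)" W] fin W_nz degree_W by auto
  ultimately show False using sum_order_W n fin by simp
 qed
qed (use W_at_K W_at_F in auto)

lemma chi_zero: "pev (chi p) s = 0 \<longleftrightarrow> s \<in> K"
proof
 assume "pev (chi p) s = 0"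
 hence "poly W s = 0" by (simp add: poly_W vdot_bilinear)
 thus "s \<in> K" using W_roots F_chi \<open>pev (chi p) s = 0\<close> by blast
qed (use cusp in blast)

lemma WR_0: "poly WR 0 ~= 0"
proof -
 have "WR = - rv (3 * (d - 2)) W"
  by (rule poly_eqI_punctured) (simp add: WR_eq poly_rv degree_W)
 thus ?thesis using W_nz degree_W by (simp add: poly_rv_0) (metis leading_coeff_0_iff)
qed

lemma chi_R_0: "pev (chi R) 0 ~= 0"
 using WR_0 by (auto simp: WR_def pev_chi vdet_alt vdot_bilinear)

lemma finite_pairs: "finite {s. \<exists>t. t ~= s \<and> meet p s t}"
proof (rule finite_double_points[OF deg _ nz])
 show "pev (chi (rvec d p)) 0 ~= 0" using chi_R_0 by (simp add: R_def)
 show "finite {s. pev (chi p) s = 0}" using chi_zero fin by simp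
qed (use d3 cusp chi_zero in auto)

section \<open>The dual curve\<close>

definition kp :: "complex poly" where "kp = (\<Prod>c\<in>K. [:-c, 1:])"

lemma kp_root: "poly kp s = 0 \<longleftrightarrow> s \<in> K"
 using fin by (auto simp: kp_def poly_prod prod_zero_iff)

lemma kp_deg: "degree kp = card K" "lead_coeff kp = 1" "kp ~= 0"
proof -
 show "kp ~= 0" using fin by (simp add: kp_def prod_zero_iff)
 show "degree kp = card K" unfolding kp_def by (subst degree_prod_eq_sum_degree) auto
 show "lead_coeff kp = 1" by (simp add: kp_def lead_coeff_prod)
qed

lemma ex_dual: "\<exists>q. chi p = kp *s q"
proof -
 have "\<exists>r. chi p $ i = kp * r" for i
 proof (cases "chi p $ i = 0")
  case False
  have "1 \<le> order c (chi p $ i)" if "c \<in> K" for c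
  proof -
   have "poly (chi p $ i) c = 0" using chi_zero[of c] that by (simp add: vec_eq_iff)
   thus ?thesis using False order_root[of "chi p $ i" c] by simp
  qed
  thus ?thesis using prod_linear_dvd[OF fin(1) False, of 1] by (simp add: kp_def)
 qed auto
 then obtain r where "\<And>i. chi p $ i = kp * r i" by metis
 thus ?thesis by (intro exI[of _ "\<chi> i. r i"]) (simp add: vec_eq_iff)
qed

definition dual :: "complex poly ^ 3" where "dual = (SOME q. chi p = kp *s q)"
text \<open>The Wronskian has a double zero at every cusp; what remains has exactly the flexes as
  zeros, all simple.\<close>

definition dw :: "complex poly" where "dw = (SOME w. W = kp ^ 2 * w)"

lemma chi_dual: "chi p = kp *s dual"
 unfolding dual_def by (rule someI_ex[OF ex_dual])

lemma W_dw: "W = kp ^ 2 * dw"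
proof -
 have "\<exists>w. W = kp ^ 2 * w" unfolding kp_def
  by (rule prod_linear_dvd[OF fin(1) W_nz]) (simp add: order_W)
 thus ?thesis unfolding dw_def by (rule someI_ex)
qed

lemma dw_nz: "dw ~= 0" using W_dw W_nz by auto

lemma degree_dw: "degree dw = card F"
proof -
 have "degree W = 2 * card K + degree dw"
  unfolding W_dw using dw_nz kp_deg by (subst degree_mult_eq) (auto simp: degree_power_eq)
 thus ?thesis using degree_W number by simp
qed

lemma vec_cancel:
 fixes u v :: "complex poly ^ 3" and a :: "complex poly"
 assumes "a *s u = a *s v" "a ~= 0" shows "u = v"
 using assms by (simp add: vec_eq_iff)

text \<open>Biduality after division by the cusps: the dual of the dual curve is the curve, with the
  extra factor \<open>dw\<close>. So the cusps of the dual curve are the flexes.\<close>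

lemma chi_of_dual: "chi dual = dw *s p"
proof (rule vec_cancel[of "kp ^ 2"])
 have "vcross (chi p) (pd (chi p)) = kp ^ 2 *s chi dual"
  unfolding chi_dual pd_smult by (simp add: vcross_bilinear chi_def[of dual] vector_smult_assoc power2_eq_square)
 thus "kp ^ 2 *s chi dual = kp ^ 2 *s (dw *s p)"
  unfolding chi_chi by (simp add: W_dw vector_smult_assoc)
qed (simp add: kp_deg)

text \<open>A zero of \<open>dual\<close> would be a double zero of \<open>chi p\<close> and make
  P'' proportional to P at the cusp.\<close>

lemma dual_nz: "pev dual t ~= 0"
proof
 assume z: "pev dual t = 0"
 hence "pev (chi p) t = 0" by (simp add: chi_dual)
 hence "t \<in> K" using chi_zero by blast
 hence t: "poly kp t = 0" using kp_root by blast
 have "pev (pd (chi p)) t = 0" by (simp add: chi_dual pd_smult z t)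
 hence "vcross (pev p t) (pev (pd (pd p)) t) = 0" by (simp add: pd_chi)
 thus False using cusp[OF \<open>t \<in> K\<close>] by (simp add: vdet_alt vdot_bilinear)
qed

text \<open>The degree of the dual curve: P x P' has degree 2 (d - 1), and each cusp removes
  one.\<close>

definition m :: nat where "m = 2 * (d - 1) - card K"

lemma kappa_le: "2 * card K \<le> 3 * (d - 2)" using number by simp

lemma m_facts: "card K + m = 2 * (d - 1)" "m > 0" "2 * (m - 1) = card F + d"
 using kappa_le number d3 unfolding m_def by auto

lemma deg_dual: "degree (dual $ i) \<le> m"
proof (cases "dual $ i = 0")
 case False
 have "chi p $ i = kp * dual $ i" by (simp add: chi_dual)
 hence "degree (chi p $ i) = card K + degree (dual $ i)"
  using False kp_deg by (simp add: degree_mult_eq)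
 thus ?thesis using deg_chi[of i] m_facts(1) by simp
qed simp

lemma top_dual: "top_coeff m dual ~= 0"
proof -
 have "coeff (chi p $ i) (2 * (d - 1)) = coeff (dual $ i) m" for i
  using coeff_mult_top[OF deg_dual[of i], of kp] kp_deg m_facts(1) by (simp add: chi_dual)
 moreover have "coeff (chi p $ i) (2 * (d - 1)) = - (pev (chi R) 0 $ i)" for i
 proof -
  have "chi R $ i = - rv (2 * (d - 1)) (chi p $ i)"
  proof (rule poly_eqI_punctured)
   fix s :: complex assume "s ~= 0"
   thus "poly (chi R $ i) s = poly (- rv (2 * (d - 1)) (chi p $ i)) s"
    using chi_R[of s] deg_chi[of i] by (simp add: vec_eq_iff poly_rv)
  qed
  thus ?thesis using poly_rv_0[OF deg_chi[of i]] by simp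
 qed
 ultimately have "top_coeff m dual = - pev (chi R) 0" by (simp add: vec_eq_iff)
 thus ?thesis using chi_R_0 by simp
qed

lemma dw_at_K: "s \<in> K ==> poly dw s ~= 0"
proof
 assume s: "s \<in> K" "poly dw s = 0"
 moreover have "poly kp s = 0" using s kp_root by blast
 ultimately have "poly (pderiv (pderiv W)) s = 0"
  by (simp add: W_dw pderiv_mult pderiv_add power2_eq_square)
 thus False using W_at_K(3)[OF s(1)] by simp
qed

lemma dw_root: "poly dw s = 0 \<longleftrightarrow> s \<in> F"
proof
 assume "poly dw s = 0"
 hence "poly W s = 0" by (simp add: W_dw)
 thus "s \<in> F" using W_roots dw_at_K \<open>poly dw s = 0\<close> by blast
next
 assume s: "s \<in> F"
 hence "poly kp s ~= 0" using kp_root KF_disjoint by blast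
 thus "poly dw s = 0" using W_at_F(1)[OF s] by (simp add: W_dw)
qed

lemma dw_deriv: "s \<in> F ==> poly (pderiv dw) s ~= 0"
 using W_at_F(2)[of s] dw_root[of s] by (auto simp: W_dw pderiv_mult)

text \<open>The dual curve annihilates P and P'. Differentiating these incidences gives the pairings
  of P with the derivatives of the dual, and the determinant becomes 2 \<open>kp\<close> times the
  square of the derivative of \<open>dw\<close>, nonzero at a flex.\<close>

lemma dual_cusp:
 assumes s: "s \<in> F"
 shows "cusp_det dual s ~= 0"
proof -
 have "kp * vdot p dual = vdot p (chi p)" by (simp add: chi_dual vdot_bilinear)
 hence a1: "vdot p dual = 0" using kp_deg(3) by (simp add: chi_def)
 have "kp * vdot (pd p) dual = vdot (pd p) (chi p)" by (simp add: chi_dual vdot_bilinear)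
 hence a2: "vdot (pd p) dual = 0" using kp_deg(3) by (simp add: chi_def)
 have "kp * vdot (pd (pd p)) dual = vdot (pd (pd p)) (chi p)" by (simp add: chi_dual vdot_bilinear)
 also have "\<dots> = W" by (simp add: W_def chi_def vdet_alt vdot_commute)
 finally have "kp * vdot (pd (pd p)) dual = kp * (kp * dw)" by (simp add: W_dw power2_eq_square mult.assoc)
 hence a3: "vdot (pd (pd p)) dual = kp * dw" using kp_deg(3) by simp
 have b1: "vdot p (pd dual) = 0" using arg_cong[OF a1, of pderiv] a2 by (simp add: pderiv_vdot)
 have b2: "vdot (pd p) (pd dual) = - (kp * dw)"
  using arg_cong[OF a2, of pderiv] a3 by (simp add: pderiv_vdot eq_neg_iff_add_eq_0 add.commute)
 have c1: "vdot p (pd (pd dual)) = kp * dw"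
  using arg_cong[OF b1, of pderiv] b2 by (simp add: pderiv_vdot)
 have c2: "vdot (pd (pd p)) (pd dual) + vdot (pd p) (pd (pd dual)) = - pderiv (kp * dw)"
  using arg_cong[OF b2, of pderiv] by (simp add: pderiv_vdot pderiv_minus)
 have e1: "vdot (pd p) (pd (pd dual)) + vdot p (pd (pd (pd dual))) = pderiv (kp * dw)"
  using arg_cong[OF c1, of pderiv] by (simp add: pderiv_vdot)
 have "vdot p (pd (pd (pd dual))) = 2 * pderiv (kp * dw) + vdot (pd (pd p)) (pd dual)"
  using c2 e1 by algebra
 hence "poly (vdot p (pd (pd (pd dual)))) s = poly (2 * pderiv (kp * dw) + vdot (pd (pd p)) (pd dual)) s" by simp
 hence e2: "vdot (pev p s) (pev (pd (pd (pd dual))) s) = 2 * (poly kp s * poly (pderiv dw) s) + vdot (pev (pd (pd p)) s) (pev (pd dual) s)"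
  using dw_root s by (simp add: pderiv_mult)
 have "vcross (pev dual s) (pev (pd dual) s) = 0"
 proof -
  have "pev (chi dual) s = 0" using dw_root s by (simp add: chi_of_dual)
  thus ?thesis by (simp add: pev_chi)
 qed
 then obtain k where k: "pev (pd dual) s = k *s pev dual s" using vcross_eq_0_iff[OF dual_nz] by blast
 have "vdot (pev (pd (pd p)) s) (pev dual s) = 0"
  using arg_cong[OF a3, of "%q. poly q s"] dw_root s by simp
 hence e3: "vdot (pev p s) (pev (pd (pd (pd dual))) s) = 2 * (poly kp s * poly (pderiv dw) s)"
  using e2 by (simp add: k vdot_bilinear)
 have "pd (chi dual) = pderiv dw *s p + dw *s pd p" by (simp add: chi_of_dual pd_smult)
 hence "vcross dual (pd (pd dual)) = pderiv dw *s p + dw *s pd p" by (simp add: pd_chi)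
 hence "pev (vcross dual (pd (pd dual))) s = poly (pderiv dw) s *s pev p s" using dw_root s by simp
 hence "vcross (pev dual s) (pev (pd (pd dual)) s) = poly (pderiv dw) s *s pev p s" by simp
 hence "cusp_det dual s = poly (pderiv dw) s * (2 * (poly kp s * poly (pderiv dw) s))"
  by (simp add: vdet_alt vdot_bilinear e3)
 moreover have "poly kp s ~= 0" using kp_root KF_disjoint s by blast
 ultimately show ?thesis using dw_deriv[OF s] by simp
qed

lemma finite_dual_pairs: "finite {s. \<exists>t. t ~= s \<and> meet dual s t}"
proof (rule finite_double_points[OF deg_dual m_facts(2) dual_nz])
 \<comment> \<open>This is \<open>chi_of_dual\<close> in the chart at infinity. At 0 it is a nonzero
   multiple of the image of infinity, because \<open>dw\<close> has full degree
   \<open>card F\<close>.\<close>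
 have "chi (rvec m dual) = (- rv (card F) dw) *s R"
 proof (rule pev_eqI_punctured)
  fix s :: complex assume s: "s ~= 0"
  have "pev (chi (rvec m dual)) s = - (s ^ (2 * (m - 1))) *s pev (chi dual) (1 / s)"
   by (rule pev_chi_rvec[OF deg_dual m_facts(2) s])
  moreover have "s ^ (2 * (m - 1)) = s ^ card F * s ^ d" by (simp only: m_facts(3) power_add)
  ultimately show "pev (chi (rvec m dual)) s = pev ((- rv (card F) dw) *s R) s"
   using s by (simp add: chi_of_dual R_eval poly_rv degree_dw power_add vector_smult_assoc mult_ac)
 qed
 moreover have "poly (rv (card F) dw) 0 ~= 0" using degree_dw dw_nz by (simp add: poly_rv_0) (metis leading_coeff_0_iff)
 ultimately show "pev (chi (rvec m dual)) 0 ~= 0" using R_eval(2) top by simp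
 have z: "pev (chi dual) s = 0 \<longleftrightarrow> s \<in> F" for s using nz[of s] by (simp add: chi_of_dual dw_root)
 thus "finite {s. pev (chi dual) s = 0}" using fin by simp
 show "cusp_det dual s ~= 0" if "pev (chi dual) s = 0" for s
  using dual_cusp that z by blast
qed

text \<open>The elements of \<open>T\<close> are parameters of immersed double points of the dual
  curve and those of \<open>F\<close> its cusps, so the bound for a curve of degree \<open>m\<close>
  applies.\<close>

theorem dual_count:
 assumes T: "\<And>s. s \<in> T ==> poly W s ~= 0 \<and> (\<exists>t\<in>T. t ~= s \<and> vcross (pev (chi p) s) (pev (chi p) t) = 0)"
 shows "finite T" "card T + 2 * card F \<le> (m - 1) * (m - 2)"
proof -
 have z: "pev (chi dual) s = 0 \<longleftrightarrow> s \<in> F" for s using nz[of s] by (simp add: chi_of_dual dw_root)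
 have T': "pev (chi dual) s ~= 0 \<and> (\<exists>t\<in>T. t ~= s \<and> meet dual s t)" if s: "s \<in> T" for s
 proof -
  obtain t where t: "t \<in> T" "t ~= s" "vcross (pev (chi p) s) (pev (chi p) t) = 0" using T[OF s] by blast
  have "poly kp s ~= 0" "poly kp t ~= 0" using T[OF s] T[OF t(1)] W_roots kp_root by auto
  hence "meet dual s t" using t(3) by (simp add: chi_dual vcross_bilinear)
  moreover have "pev (chi dual) s ~= 0" using T[OF s] z W_roots by blast
  ultimately show ?thesis using t by blast
 qed
 have "T \<subseteq> {s. \<exists>t. t ~= s \<and> meet dual s t}" using T' by blast
 thus finT: "finite T" using finite_dual_pairs finite_subset by blast
 show "card T + 2 * card F \<le> (m - 1) * (m - 2)"
 proof (rule node_count_le[OF deg_dual m_facts(2) dual_nz top_dual finT fin(2)])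
  have "{s. pev (chi dual) s = 0 \<or> (\<exists>t. t ~= s \<and> meet dual s t)} =
   F \<union> {s. \<exists>t. t ~= s \<and> meet dual s t}" using z by auto
  thus "finite {s. pev (chi dual) s = 0 \<or> (\<exists>t. t ~= s \<and> meet dual s t)}"
   using finite_dual_pairs fin by simp
  fix s assume s: "s \<in> F"
  have "pev (pd (chi dual)) s = poly (pderiv dw) s *s pev p s"
   using dw_root s by (simp add: chi_of_dual pd_smult)
  thus "pev (chi dual) s = 0 \<and> pev (pd (chi dual)) s ~= 0" using z s dw_deriv nz by simp
 qed (use T' in blast)
qed

end

section \<open>Klein's formula\<close>

text \<open>After removal of the positive scale \<rho>, the leading part \<open>G\<close> fixes the
  direction and the vanishing error only narrows the cone.\<close>

lemma winds_approx:
 assumes ev: "\<forall>\<^sub>F z in F. 0 < \<rho> z \<and> h z = of_real (\<rho> z) * (G z + E z) \<and>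
   \<epsilon> \<le> Re (G z * cnj (c * sgn (w z) powi k)) \<and> norm (G z) \<le> C"
  and E: "(E \<longlongrightarrow> 0) F" and c: "c ~= 0" "0 < \<epsilon>"
 shows "winds h w k F"
proof -
 have e2: "0 \<le> \<epsilon> / (2 * norm c)" using c(2) by (intro divide_nonneg_nonneg) auto
 define C' where "C' = \<bar>C\<bar> + 1"
 have C': "C' > 0" "C' \<ge> C + 1" by (auto simp: C'_def)
 have "0 < min 1 (\<epsilon> / (2 * norm c))" using c by simp
 from tendstoD[OF E this]
 have evE: "\<forall>\<^sub>F z in F. norm (E z) < min 1 (\<epsilon> / (2 * norm c))" by simp
 have "\<forall>\<^sub>F z in F. h z ~= 0 \<and> (\<epsilon> / 2 / C') * norm (h z) \<le> Re (h z * cnj (c * sgn (w z) powi k))"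
  using ev evE
 proof eventually_elim
  case (elim z)
  let ?u = "cnj (c * sgn (w z) powi k)"
  have r: "0 < \<rho> z" using elim by simp
  have nu: "norm ?u \<le> norm c"
   using mult_left_mono[OF norm_sgn_powi_le[of "w z" k], of "norm c"] by (simp only: norm_mult complex_mod_cnj) simp
  have "norm (E z * ?u) \<le> (\<epsilon> / (2 * norm c)) * norm c"
   unfolding norm_mult by (intro mult_mono nu e2 norm_ge_zero) (use elim in linarith)
  hence "norm (E z * ?u) \<le> \<epsilon> / 2" using c by simp
  moreover have "\<bar>Re (E z * ?u)\<bar> \<le> norm (E z * ?u)" by (rule abs_Re_le_cmod)
  moreover have "Re ((G z + E z) * ?u) = Re (G z * ?u) + Re (E z * ?u)" by (simp only: distrib_right plus_complex.sel)
  moreover have "\<epsilon> \<le> Re (G z * ?u)" using elim by blast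
  ultimately have 1: "\<epsilon> / 2 \<le> Re ((G z + E z) * ?u)" by linarith
  have "norm (G z + E z) \<le> C'" using norm_triangle_ineq[of "G z" "E z"] elim C'(2) by linarith
  hence "(\<epsilon> / 2 / C') * norm (G z + E z) \<le> (\<epsilon> / 2 / C') * C'" using c C' by (intro mult_left_mono) auto
  also have "\<dots> = \<epsilon> / 2" using C' by simp
  finally have 2: "(\<epsilon> / 2 / C') * norm (G z + E z) \<le> Re ((G z + E z) * ?u)" using 1 by linarith
  have h: "h z = of_real (\<rho> z) * (G z + E z)" using elim by blast
  have "h z * ?u = of_real (\<rho> z) * ((G z + E z) * ?u)" unfolding h by (simp only: mult.assoc)
  hence Re: "Re (h z * ?u) = \<rho> z * Re ((G z + E z) * ?u)"
   by (simp only: times_complex.sel Re_complex_of_real Im_complex_of_real)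
  have "norm (h z) = \<rho> z * norm (G z + E z)" unfolding h norm_mult norm_of_real using r by simp
  hence "(\<epsilon> / 2 / C') * norm (h z) = \<rho> z * ((\<epsilon> / 2 / C') * norm (G z + E z))" by simp
  also have "\<dots> \<le> \<rho> z * Re ((G z + E z) * ?u)" using 2 r by (intro mult_left_mono) auto
  finally have 3: "(\<epsilon> / 2 / C') * norm (h z) \<le> Re (h z * ?u)" by (simp only: Re)
  have "Re (h z * ?u) > 0" unfolding Re using 1 c r by (intro mult_pos_pos) auto
  hence "h z ~= 0" by auto
  thus ?case using 3 by blast
 qed
 moreover have "0 < \<epsilon> / 2 / C'" using c C' by simp
 ultimately show ?thesis unfolding winds_def using c(1) by blast
qed

lemma unit_facts:
 assumes "(w::complex) ~= 0"
 shows "norm (sgn w) = 1" "sgn w * cnj (sgn w) = 1" "of_real (norm w) * sgn w = w" "of_real (norm w) * cnj (sgn w) = cnj w"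
proof -
 show n: "norm (sgn w) = 1" using assms by (simp add: norm_sgn)
 show "sgn w * cnj (sgn w) = 1" using complex_norm_square[of "sgn w"] n by simp
 show s: "of_real (norm w) * sgn w = w" using assms by (simp add: sgn_eq)
 show "of_real (norm w) * cnj (sgn w) = cnj w"
  using arg_cong[OF s, of cnj] by simp
qed

text \<open>The real linear map \<alpha> w + \<beta> cnj w preserves orientation when |\<alpha>| >
  |\<beta>| and reverses it in the opposite case.\<close>

lemma winds_linear:
 assumes ev: "\<forall>\<^sub>F z in at a. h z = (z - a) * A z + cnj (z - a) * B z"
  and A: "(A \<longlongrightarrow> \<alpha>) (at a)" and B: "(B \<longlongrightarrow> \<beta>) (at a)"
 shows "norm \<beta> < norm \<alpha> ==> winds h (%z. z - a) 1 (at a)"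
  "norm \<alpha> < norm \<beta> ==> winds h (%z. z - a) (- 1) (at a)"
proof -
 define u where "u = (%z. sgn (z - a))"
 define G where "G = (%z. \<alpha> * u z + \<beta> * cnj (u z))"
 define E where "E = (%z. u z * (A z - \<alpha>) + cnj (u z) * (B z - \<beta>))"
 have nu: "norm (u z) \<le> 1" for z by (cases "z = a") (simp_all add: u_def norm_sgn)
 have E0: "(E \<longlongrightarrow> 0) (at a)"
 proof (rule Lim_null_comparison)
  show "\<forall>\<^sub>F z in at a. norm (E z) \<le> norm (A z - \<alpha>) + norm (B z - \<beta>)"
  proof (intro always_eventually allI)
   fix z
   have "norm (E z) \<le> norm (u z) * norm (A z - \<alpha>) + norm (cnj (u z)) * norm (B z - \<beta>)"
    unfolding E_def by (metis norm_mult norm_triangle_ineq)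
   also have "\<dots> \<le> 1 * norm (A z - \<alpha>) + 1 * norm (B z - \<beta>)"
    using nu by (intro add_mono mult_right_mono) auto
   finally show "norm (E z) \<le> norm (A z - \<alpha>) + norm (B z - \<beta>)" by simp
  qed
  have "((%z. norm (A z - \<alpha>) + norm (B z - \<beta>)) \<longlongrightarrow> norm (\<alpha> - \<alpha>) + norm (\<beta> - \<beta>)) (at a)"
   by (intro tendsto_intros A B)
  thus "((%z. norm (A z - \<alpha>) + norm (B z - \<beta>)) \<longlongrightarrow> 0) (at a)" by simp
 qed
 have nea: "\<forall>\<^sub>F z in at a. z ~= a" by (rule eventually_neq_at_within)
 have hG: "\<forall>\<^sub>F z in at a. 0 < norm (z - a) \<and> h z = of_real (norm (z - a)) * (G z + E z) \<and> norm (G z) \<le> norm \<alpha> + norm \<beta> \<and>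
   norm (u z) = 1 \<and> u z * cnj (u z) = 1"
  using ev nea
 proof eventually_elim
  case (elim z)
  hence z: "z - a ~= 0" by simp
  note f = unit_facts[OF z, folded u_def]
  have fu: "sgn (z - a) = u z" by (simp add: u_def)
  have "of_real (norm (z - a)) * (G z + E z) = (of_real (norm (z - a)) * u z) * A z + (of_real (norm (z - a)) * cnj (u z)) * B z"
   by (simp add: G_def E_def algebra_simps)
  also have "\<dots> = h z" using f elim by (simp add: fu)
  finally have "h z = of_real (norm (z - a)) * (G z + E z)" ..
  moreover have "norm (G z) \<le> norm \<alpha> * norm (u z) + norm \<beta> * norm (cnj (u z))"
   unfolding G_def by (metis norm_mult norm_triangle_ineq)
  ultimately show ?case using f z by (simp add: fu)
 qed
 show "winds h (%z. z - a) 1 (at a)" if lt: "norm \<beta> < norm \<alpha>"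
 proof (rule winds_approx[OF _ E0, where c = \<alpha> and \<epsilon> = "norm \<alpha> * (norm \<alpha> - norm \<beta>)"])
  show "\<alpha> ~= 0" "0 < norm \<alpha> * (norm \<alpha> - norm \<beta>)" using lt by (auto intro!: mult_pos_pos intro: le_less_trans[OF norm_ge_zero])
  show "\<forall>\<^sub>F z in at a. 0 < norm (z - a) \<and> h z = of_real (norm (z - a)) * (G z + E z) \<and>
   norm \<alpha> * (norm \<alpha> - norm \<beta>) \<le> Re (G z * cnj (\<alpha> * sgn (z - a) powi 1)) \<and> norm (G z) \<le> norm \<alpha> + norm \<beta>"
   using hG
  proof eventually_elim
   case (elim z)
   define X where "X = \<beta> * cnj \<alpha> * (cnj (u z) * cnj (u z))"
   have "G z * cnj (\<alpha> * u z) = \<alpha> * cnj \<alpha> * (u z * cnj (u z)) + X" by (simp add: G_def X_def algebra_simps)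
   also have "\<dots> = of_real ((norm \<alpha>)\<^sup>2) + X" using elim complex_norm_square[of \<alpha>] by simp
   finally have "Re (G z * cnj (\<alpha> * u z)) = (norm \<alpha>)\<^sup>2 + Re X" by (simp only: plus_complex.sel Re_complex_of_real)
   moreover have "norm X = norm \<alpha> * norm \<beta>" using elim by (simp add: X_def norm_mult)
   hence "- (norm \<alpha> * norm \<beta>) \<le> Re X" using abs_Re_le_cmod[of X] by linarith
   ultimately have "norm \<alpha> * (norm \<alpha> - norm \<beta>) \<le> Re (G z * cnj (\<alpha> * u z))" by (simp add: power2_eq_square algebra_simps)
   thus ?case using elim unfolding u_def power_int_1_right by blast
  qed
 qed
 show "winds h (%z. z - a) (- 1) (at a)" if lt: "norm \<alpha> < norm \<beta>"
 proof (rule winds_approx[OF _ E0, where c = \<beta> and \<epsilon> = "norm \<beta> * (norm \<beta> - norm \<alpha>)"])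
  show "\<beta> ~= 0" "0 < norm \<beta> * (norm \<beta> - norm \<alpha>)" using lt by (auto intro!: mult_pos_pos intro: le_less_trans[OF norm_ge_zero])
  show "\<forall>\<^sub>F z in at a. 0 < norm (z - a) \<and> h z = of_real (norm (z - a)) * (G z + E z) \<and>
   norm \<beta> * (norm \<beta> - norm \<alpha>) \<le> Re (G z * cnj (\<beta> * sgn (z - a) powi (- 1))) \<and> norm (G z) \<le> norm \<alpha> + norm \<beta>"
   using hG
  proof eventually_elim
   case (elim z)
   have inv: "sgn (z - a) powi (- 1) = cnj (u z)"
   proof -
    have "inverse (u z) = cnj (u z)" using elim by (metis inverse_unique)
    thus ?thesis by (simp add: u_def power_int_minus)
   qed
   define X where "X = \<alpha> * cnj \<beta> * (u z * u z)"
   have "G z * cnj (\<beta> * cnj (u z)) = \<beta> * cnj \<beta> * (u z * cnj (u z)) + X" by (simp add: G_def X_def algebra_simps)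
   also have "\<dots> = of_real ((norm \<beta>)\<^sup>2) + X" using elim complex_norm_square[of \<beta>] by simp
   finally have "Re (G z * cnj (\<beta> * cnj (u z))) = (norm \<beta>)\<^sup>2 + Re X" by (simp only: plus_complex.sel Re_complex_of_real)
   moreover have "norm X = norm \<alpha> * norm \<beta>" using elim by (simp add: X_def norm_mult)
   hence "- (norm \<alpha> * norm \<beta>) \<le> Re X" using abs_Re_le_cmod[of X] by linarith
   ultimately have "norm \<beta> * (norm \<beta> - norm \<alpha>) \<le> Re (G z * cnj (\<beta> * cnj (u z)))" by (simp add: power2_eq_square algebra_simps)
   thus ?case using elim unfolding inv by blast
  qed
 qed
qed

text \<open>Iterated divided differences with a repeated first node.\<close>

definition dk :: "nat => complex poly => complex => complex => complex" where
 "dk k q s t = poly (((%r. synthetic_div r s) ^^ k) q) t"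

lemma dk_0: "dk 0 q s t = poly q t" by (simp add: dk_def)

lemma dk_zero [simp]: "dk k 0 s t = 0"
proof -
 have "((%r. synthetic_div r s) ^^ k) 0 = 0" by (induction k) auto
 thus ?thesis by (simp add: dk_def)
qed

lemma dk_step: "dk k q s t = dk k q s s + (t - s) * dk (Suc k) q s t"
 using dd_eq[of "((%r. synthetic_div r s) ^^ k) q" t s] by (simp add: dk_def dd_def)

lemma dk_pCons: "dk (Suc k) (pCons a q) s t = dk k q s s + t * dk (Suc k) q s t"
proof -
 have "((%r. synthetic_div r s) ^^ Suc k) (pCons a q) = pCons (dk k q s s) (((%r. synthetic_div r s) ^^ Suc k) q)"
  by (induction k) (simp_all add: dk_def)
 thus ?thesis by (simp add: dk_def del: funpow.simps)
qed

lemma tendsto_dk [tendsto_intros]: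
 assumes "(f \<longlongrightarrow> a) F" "(g \<longlongrightarrow> b) F"
 shows "((%x. dk k q (f x) (g x)) \<longlongrightarrow> dk k q a b) F"
 using assms(2)
proof (induction k arbitrary: q g b)
 case 0 thus ?case unfolding dk_0 by (intro tendsto_intros)
next
 case (Suc k)
 show ?case
 proof (induction q)
  case (pCons c q)
  show ?case unfolding dk_pCons by (intro tendsto_intros Suc.IH assms Suc.prems pCons)
 qed simp
qed

lemma dk_values:
 "dk (Suc 0) q s s = poly (pderiv q) s" "2 * dk 2 q s s = poly (pderiv (pderiv q)) s"
 "6 * dk 3 q s s = poly (pderiv (pderiv (pderiv q))) s"
proof -
 show 1: "dk (Suc 0) q s s = poly (pderiv q) s" for q
  by (induction q) (simp_all add: dk_pCons dk_0 pderiv_pCons)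
 show 2: "2 * dk 2 q s s = poly (pderiv (pderiv q)) s" for q unfolding numeral_2_eq_2
  by (induction q) (simp_all add: dk_pCons 1 pderiv_pCons pderiv_add algebra_simps)
 show "6 * dk 3 q s s = poly (pderiv (pderiv (pderiv q))) s" unfolding numeral_3_eq_3
 proof (induction q)
  case (pCons a q)
  have "pderiv (pderiv (pderiv (pCons a q))) = pderiv (pderiv q) + (pderiv (pderiv q) + (pderiv (pderiv q) + pCons 0 (pderiv (pderiv (pderiv q)))))"
   by (simp only: pderiv_pCons pderiv_add)
  thus ?case using 2[of q] pCons by (simp add: dk_pCons algebra_simps numeral_2_eq_2)
 qed simp
qed

section \<open>Klein's determinant\<close>

definition dvec :: "nat => complex poly ^ 3 => complex => complex => complex ^ 3" where
 "dvec k p s t = (\<chi> i. dk k (p $ i) s t)"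

lemma tendsto_vdet:
 assumes "(u \<longlongrightarrow> a) F" "(v \<longlongrightarrow> b) F" "(w \<longlongrightarrow> c) F"
 shows "((%x. vdet (u x) (v x) (w x)) \<longlongrightarrow> (vdet a b c :: complex)) F"
 unfolding vdet_def vdot_def vcross_nth by (intro tendsto_intros assms)

lemma tendsto_pev [tendsto_intros]: "(f \<longlongrightarrow> a) F ==> ((%x. pev p (f x)) \<longlongrightarrow> pev p a) F"
 unfolding pev_def by (intro tendsto_vec_lambda tendsto_intros)

lemma tendsto_dvec [tendsto_intros]:
 assumes "(f \<longlongrightarrow> a) F" "(g \<longlongrightarrow> b) F"
 shows "((%x. dvec k p (f x) (g x)) \<longlongrightarrow> dvec k p a b) F"
 unfolding dvec_def by (intro tendsto_vec_lambda tendsto_intros assms)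

lemma dvec_step: "dvec k p s t = dvec k p s s + (t - s) *s dvec (Suc k) p s t"
 unfolding vec_eq_iff dvec_def vector_add_component vector_smult_component vec_lambda_beta by (intro allI dk_step)

lemma dvec_values:
 "dvec 0 p s t = pev p t" "dvec (Suc 0) p s s = pev (pd p) s" "2 *s dvec 2 p s s = pev (pd (pd p)) s"
 "6 *s dvec 3 p s s = pev (pd (pd (pd p))) s"
 by (simp_all add: vec_eq_iff dvec_def dk_0 dk_values)

text \<open>The determinant of P(s), P'(s), P(t) divided by (t - s)^2. Modulo P(s) and P'(s), the
  vector P(t) is (t - s)^2 times its second divided difference, which also makes sense on the
  diagonal.\<close>

definition HH :: "complex poly ^ 3 => complex => complex => complex" where
 "HH p s t = vdet (pev p s) (pev (pd p) s) (dvec 2 p s t)"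

lemma HH_eq: "(t - s)\<^sup>2 * HH p s t = vdet (pev p s) (pev (pd p) s) (pev p t)"
proof -
 define u where "u = t - s"
 have "pev p t = pev p s + u *s (pev (pd p) s + u *s dvec 2 p s t)"
  using dvec_step[of 0 p s t, folded u_def] dvec_step[of "Suc 0" p s t, folded u_def] by (simp add: dvec_values numeral_2_eq_2)
 thus ?thesis unfolding u_def[symmetric]
  by (simp add: HH_def vdet_add vdet_scale vector_add_ldistrib power2_eq_square algebra_simps)
qed

lemma tendsto_HH:
 assumes "(f \<longlongrightarrow> a) F" "(g \<longlongrightarrow> b) F"
 shows "((%x. HH p (f x) (g x)) \<longlongrightarrow> HH p a b) F"
 unfolding HH_def by (intro tendsto_vdet tendsto_intros assms)

lemma HH_diag: "2 * HH p s s = osc_det p s"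
 unfolding HH_def dvec_values(3)[symmetric] vdet_scale ..

text \<open>The divided differences on the diagonal are derivatives over factorials, whence 1/2 and
  1/6. On the real line W and W' thus determine the first terms of Klein's determinant.\<close>

lemma HH_expand:
 "HH p s t = osc_det p s / 2
   + (t - s) * flex_det p s / 6
   + (t - s)\<^sup>2 * vdet (pev p s) (pev (pd p) s) (dvec 4 p s t)"
proof -
 define u where "u = t - s"
 have e: "dvec 2 p s t = dvec 2 p s s + u *s (dvec 3 p s s + u *s dvec 4 p s t)"
  using dvec_step[of 2 p s t, folded u_def] dvec_step[of 3 p s t, folded u_def] by (simp add: eval_nat_numeral)
 have v: "vdet x y (pev (pd (pd p)) s) = 2 * vdet x y (dvec 2 p s s)" for x y
  by (simp only: dvec_values(3)[symmetric] vdet_scale)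
 have w: "vdet x y (pev (pd (pd (pd p))) s) = 6 * vdet x y (dvec 3 p s s)" for x y
  by (simp only: dvec_values(4)[symmetric] vdet_scale)
 show ?thesis unfolding u_def[symmetric] HH_def e v w
  by (simp add: vdet_add vdet_scale vector_add_ldistrib power2_eq_square algebra_simps)
qed

text \<open>The assumption \<open>trans\<close> makes every solitary point a nondegenerate zero of
  Klein's determinant.\<close>

locale real_inflected = inflected +
 assumes real: "\<And>i j. coeff (p $ i) j \<in> \<real>" and realK: "K \<subseteq> \<real>" "F \<subseteq> \<real>"
  and trans: "\<And>s. s \<notin> \<real> ==> meet p s (cnj s) ==>
    tangent_det p s (cnj s) ~= 0"
begin

definition solitary :: "complex set" where
 "solitary = {s. s \<notin> \<real> \<and> meet p s (cnj s)}"

text \<open>Parameters of solitary bitangents, that is, real lines touching the curve at two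
  conjugate points. It is enough to require that the tangent at \<open>s\<close> passes through the
  conjugate point.\<close>

definition bitangent :: "complex set" where
 "bitangent = {s. s \<notin> \<real> \<and> \<not> meet p s (cnj s) \<and> vdet (pev p s) (pev (pd p) s) (pev p (cnj s)) = 0}"

definition hh :: "complex => complex" where "hh z = HH p z (cnj z)"

lemma pev_cnj: "pev p (cnj s) = (\<chi> i. cnj (pev p s $ i))"
 using real by (simp add: vec_eq_iff poly_cnj_real)

lemma pev_pd_cnj: "pev (pd p) (cnj s) = (\<chi> i. cnj (pev (pd p) s $ i))"
 using real by (simp add: vec_eq_iff poly_cnj_real coeff_pderiv)

lemma vdet_cnj: "vdet (\<chi> i. cnj (u $ i)) (\<chi> i. cnj (v $ i)) (\<chi> i. cnj (w $ i)) = cnj (vdet u v w)"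
 by (simp add: v3_simps)

lemma vcross_cnj: "vcross (\<chi> i. cnj (u $ i)) (\<chi> i. cnj (v $ i)) = (\<chi> i. cnj (vcross u v $ i))"
 by (simp add: v3_simps)

lemma cnj_cnj_vec: "(\<chi> i. cnj ((\<chi> i. cnj (u $ i)) $ i)) = (u :: complex ^ 3)"
 by (simp add: vec_eq_iff)

lemma cnj_real: "s \<in> \<real> \<longleftrightarrow> cnj s = s" by (simp add: Reals_cnj_iff)

text \<open>The tangent at \<open>s\<close> is the line joining two conjugate points. By conjugation
  the tangent at \<open>cnj s\<close> also joins them, so both tangents are the same line.\<close>

lemma bitangent_facts:
 assumes "s \<in> bitangent"
 shows "cnj s \<in> bitangent" "vcross (pev (chi p) s) (pev (chi p) (cnj s)) = 0"
  "tangent_det p s (cnj s) = 0"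
proof -
 let ?P = "pev p s" and ?Q = "pev p (cnj s)" and ?P' = "pev (pd p) s" and ?Q' = "pev (pd p) (cnj s)"
 have s: "s \<notin> \<real>" "vcross ?P ?Q ~= 0" "vdet ?P ?P' ?Q = 0" using assms by (auto simp: bitangent_def)
 have c: "vdet ?Q ?Q' ?P = 0"
 proof -
  have "vdet ?Q ?Q' ?P = cnj (vdet ?P ?P' ?Q)"
   by (subst vdet_cnj[symmetric]) (simp only: pev_cnj pev_pd_cnj cnj_cnj_vec)
  thus ?thesis using s by simp
 qed
 have c2: "vcross ?Q ?P ~= 0" using s(2) vcross_eq_0_commute by blast
 have "cnj s \<notin> \<real>" using s(1) by (simp add: cnj_real)
 thus "cnj s \<in> bitangent" using c c2 by (simp add: bitangent_def)
 have "vcross (vcross ?P ?Q) (pev (chi p) s) = 0"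
  by (rule vperp2[OF s(2)]) (use s(3) in \<open>simp_all add: pev_chi vdet_alt vdot_commute\<close>)
 moreover have "vcross (vcross ?P ?Q) (pev (chi p) (cnj s)) = 0"
  by (rule vperp2[OF s(2)]) (use c in \<open>simp_all add: pev_chi vdet_alt vdot_commute\<close>)
 ultimately show par: "vcross (pev (chi p) s) (pev (chi p) (cnj s)) = 0"
  by (rule vcross_eq_0_trans[OF s(2)])
 have "s \<notin> K" "cnj s \<notin> K" using s(1) \<open>cnj s \<notin> \<real>\<close> realK by auto
 hence "pev (chi p) (cnj s) ~= 0" using chi_zero by blast
 moreover have "vcross (pev (chi p) (cnj s)) (pev (chi p) s) = 0" using par vcross_eq_0_commute by blast
 ultimately obtain k where "pev (chi p) s = k *s pev (chi p) (cnj s)" using vcross_eq_0_iff by blast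
 moreover have "vdot (pev (chi p) (cnj s)) ?Q' = 0" by (simp add: pev_chi)
 ultimately show "vdet ?P ?P' ?Q' = 0" by (simp add: vdet_alt vdot_bilinear flip: pev_chi)
qed

lemma bitangent_count: "finite bitangent" "card bitangent + 2 * card F \<le> (m - 1) * (m - 2)"
proof -
 have "poly W s ~= 0 \<and> (\<exists>t\<in>bitangent. t ~= s \<and> vcross (pev (chi p) s) (pev (chi p) t) = 0)" if s: "s \<in> bitangent" for s
 proof -
  have "s \<notin> \<real>" using s by (simp add: bitangent_def)
  hence "poly W s ~= 0" "cnj s ~= s" using W_roots realK cnj_real by auto
  thus ?thesis using bitangent_facts[OF s] by blast
 qed
 from dual_count[OF this] show "finite bitangent" "card bitangent + 2 * card F \<le> (m - 1) * (m - 2)" by auto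
qed

lemma finite_solitary: "finite solitary"
proof (rule finite_subset[OF _ finite_pairs])
 show "solitary \<subseteq> {s. \<exists>t. t ~= s \<and> meet p s t}"
 proof
  fix s assume "s \<in> solitary"
  hence "cnj s ~= s" "meet p s (cnj s)" by (auto simp: solitary_def cnj_real)
  thus "s \<in> {s. \<exists>t. t ~= s \<and> meet p s t}" by blast
 qed
qed

lemma W_vdet: "osc_det p s = poly W s"
 "flex_det p s = poly (pderiv W) s"
 by (simp add: W_def, simp add: pderiv_W)

lemma hh_zero: "hh z = 0 \<longleftrightarrow> z \<in> K \<union> F \<union> solitary \<union> bitangent"
proof (cases "z \<in> \<real>")
 case True
 hence "2 * hh z = poly W z" using HH_diag[of p z] cnj_real by (simp add: hh_def W_vdet)
 hence "hh z = 0 \<longleftrightarrow> z \<in> K \<union> F" using W_roots[of z] by auto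
 thus ?thesis using True by (simp add: solitary_def bitangent_def)
next
 case False
 hence "cnj z - z ~= 0" using cnj_real by simp
 hence e: "hh z = 0 \<longleftrightarrow> vdet (pev p z) (pev (pd p) z) (pev p (cnj z)) = 0"
  using HH_eq[of "cnj z" z p] by (simp add: hh_def) (metis mult_eq_0_iff power_not_zero right_minus_eq)
 have "vdet (pev p z) (pev (pd p) z) (pev p (cnj z)) = 0" if "meet p z (cnj z)"
  using that vdet_rotate(3)[of "pev p z" "pev (pd p) z"] by (simp add: vdet_alt[of _ "pev p (cnj z)"] vdot_bilinear)
 thus ?thesis using e False realK by (auto simp: solitary_def bitangent_def)
qed

text \<open>Off the real line the denominator is a nonzero factor. The numerator depends on z and
  cnj z separately, and \<alpha> and \<beta> are its derivatives in these two variables.\<close>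

lemma nonreal_winds:
 assumes a: "a \<notin> \<real>"
 defines "\<alpha> \<equiv> vdet (pev p a) (pev (pd (pd p)) a) (pev p (cnj a))"
  and "\<beta> \<equiv> tangent_det p a (cnj a)"
 assumes z: "vdet (pev p a) (pev (pd p) a) (pev p (cnj a)) = 0"
 shows "norm \<beta> < norm \<alpha> ==> winds hh (%z. z - a) 1 (at a)"
  "norm \<alpha> < norm \<beta> ==> winds hh (%z. z - a) (- 1) (at a)"
proof -
 define D where "D = (%z. vdet (pev p z) (pev (pd p) z) (pev p (cnj z)))"
 define q where "q = lincomb (pev p (cnj a)) (chi p)"
 have q: "poly q s = vdet (pev p s) (pev (pd p) s) (pev p (cnj a))" for s
  by (simp add: q_def pev_chi vdet_alt vdot_commute)
 have q': "poly (pderiv q) a = \<alpha>"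
  by (simp add: q_def pd_chi \<alpha>_def vdet_alt vdot_commute)
 define A where "A = (%z. dd q a z)"
 define B where "B = (%z. vdet (pev p z) (pev (pd p) z) (dvec (Suc 0) p (cnj a) (cnj z)))"
 have "D z = (z - a) * A z + cnj (z - a) * B z" for z
 proof -
  have "pev p (cnj z) = pev p (cnj a) + cnj (z - a) *s dvec (Suc 0) p (cnj a) (cnj z)"
   using dvec_step[of 0 p "cnj a" "cnj z"] unfolding dvec_values complex_cnj_diff .
  hence "D z = poly q z + cnj (z - a) * B z"
   by (simp only: D_def q vdet_add vdet_scale B_def)
  moreover have "poly q z = (z - a) * A z" using dd_eq[of q z a] z by (simp add: A_def q)
  ultimately show ?thesis by simp
 qed
 hence ev: "\<forall>\<^sub>F z in at a. D z = (z - a) * A z + cnj (z - a) * B z" by simp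
 have A: "(A \<longlongrightarrow> \<alpha>) (at a)"
 proof -
  have "(A \<longlongrightarrow> dd q a a) (at a)" unfolding A_def by (intro tendsto_dd tendsto_const tendsto_ident_at)
  thus ?thesis by (simp add: q')
 qed
 have B: "(B \<longlongrightarrow> \<beta>) (at a)" unfolding B_def \<beta>_def
  by (subst dvec_values(2)[symmetric]) (intro tendsto_vdet tendsto_intros)
 have nz: "cnj a - a ~= 0" using a cnj_real by simp
 have lim: "((%z. 1 / (cnj z - z)\<^sup>2) \<longlongrightarrow> 1 / (cnj a - a)\<^sup>2) (at a)" by (intro tendsto_intros) (use nz in simp)
 have cnz: "1 / (cnj a - a)\<^sup>2 ~= 0" using nz by simp
 have ne: "\<forall>\<^sub>F z in at a. cnj z - z ~= 0"
  by (rule tendsto_imp_eventually_ne[OF _ nz]) (intro tendsto_intros)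
 have eq: "\<forall>\<^sub>F z in at a. D z * (1 / (cnj z - z)\<^sup>2) = hh z"
  using ne
 proof eventually_elim
  case (elim z)
  have "D z = (cnj z - z)\<^sup>2 * hh z" using HH_eq[of "cnj z" z p] by (simp add: D_def hh_def)
  thus ?case using elim by simp
 qed
 show "winds hh (%z. z - a) 1 (at a)" if "norm \<beta> < norm \<alpha>"
  using winds_cong[OF winds_mult[OF winds_linear(1)[OF ev A B that] lim cnz] eq] .
 show "winds hh (%z. z - a) (- 1) (at a)" if "norm \<alpha> < norm \<beta>"
  using winds_cong[OF winds_mult[OF winds_linear(2)[OF ev A B that] lim cnz] eq] .
qed

text \<open>At a solitary point P(cnj a) is a multiple of P(a), so the derivative in z vanishes; the
  derivative in cnj z does not, by transversality.\<close>

lemma solitary_winds: assumes "a \<in> solitary" shows "winds hh (%z. z - a) (- 1) (at a)"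
proof -
 have a: "a \<notin> \<real>" "meet p a (cnj a)" using assms by (auto simp: solitary_def)
 obtain k where k: "pev p (cnj a) = k *s pev p a" using vcross_eq_0_iff[OF nz] a(2) by blast
 show ?thesis using trans[OF a] by (intro nonreal_winds(2) a) (simp_all add: k vdet_scale)
qed

text \<open>Here the derivative in cnj z vanishes because the tangents agree, and the derivative in
  z is a nonzero multiple of the Wronskian, P(cnj a) being on the tangent but not at the point of
  contact.\<close>

lemma bitangent_winds: assumes "a \<in> bitangent" shows "winds hh (%z. z - a) 1 (at a)"
proof -
 have a: "a \<notin> \<real>" "\<not> meet p a (cnj a)" "vdet (pev p a) (pev (pd p) a) (pev p (cnj a)) = 0"
  using assms by (auto simp: bitangent_def)
 have "pev (chi p) a ~= 0" using a(1) realK chi_zero by blast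
 then obtain x y where xy: "pev p (cnj a) = x *s pev p a + y *s pev (pd p) a"
  using vdet_eq_0_span[OF _ a(3)] by (auto simp: pev_chi)
 have y: "y ~= 0" using a(2) by (auto simp: xy vcross_bilinear)
 have "poly W a ~= 0" using a(1) realK W_roots by blast
 hence "vdet (pev p a) (pev (pd (pd p)) a) (pev p (cnj a)) ~= 0"
  using y vdet_rotate(3)[of "pev p a" "pev (pd (pd p)) a" "pev (pd p) a"]
  by (simp add: xy vdet_add vdet_scale W_vdet)
 thus ?thesis using bitangent_facts(3)[OF assms] by (intro nonreal_winds(1) a) simp_all
qed

text \<open>With l = W'(a) the linear part is l (z - a) / 2 + l (cnj z - z) / 6. So z - a has the
  coefficient l/3 and its conjugate l/6, and the first one dominates.\<close>

lemma flex_winds: assumes "a \<in> F" shows "winds hh (%z. z - a) 1 (at a)"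
proof -
 have ca: "cnj a = a" using assms realK cnj_real by blast
 define l where "l = poly (pderiv W) a"
 have l: "l ~= 0" using W_at_F(2)[OF assms] by (simp add: l_def)
 define r where "r = (%z. vdet (pev p z) (pev (pd p) z) (dvec 4 p z (cnj z)))"
 define A where "A = (%z. dd W a z / 2 - poly (pderiv W) z / 6 - (cnj z - z) * r z)"
 define B where "B = (%z. poly (pderiv W) z / 6 + (cnj z - z) * r z)"
 have "hh z = (z - a) * A z + cnj (z - a) * B z" for z
 proof -
  have "poly W z = (z - a) * dd W a z" using dd_eq[of W z a] W_at_F(1)[OF assms] by simp
  hence "hh z = (z - a) * dd W a z / 2 + (cnj z - z) * poly (pderiv W) z / 6 + (cnj z - z)\<^sup>2 * r z"
   using HH_expand[of p z "cnj z"] by (simp add: hh_def W_vdet r_def)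
  moreover define x y where "x = z - a" and "y = cnj (z - a)"
  moreover have "cnj z - z = y - x" using ca by (simp add: x_def y_def)
  ultimately have e: "hh z = x * dd W a z / 2 + (y - x) * poly (pderiv W) z / 6 + (y - x)\<^sup>2 * r z"
   "A z = dd W a z / 2 - poly (pderiv W) z / 6 - (y - x) * r z" "B z = poly (pderiv W) z / 6 + (y - x) * r z"
   by (simp_all only: A_def B_def)
  show ?thesis unfolding y_def[symmetric] unfolding x_def[symmetric] e by (simp add: power2_eq_square field_simps)
 qed
 hence ev: "\<forall>\<^sub>F z in at a. hh z = (z - a) * A z + cnj (z - a) * B z" by simp
 have limr: "(r \<longlongrightarrow> r a) (at a)" unfolding r_def by (intro tendsto_vdet tendsto_intros)
 have "(A \<longlongrightarrow> dd W a a / 2 - poly (pderiv W) a / 6 - (cnj a - a) * r a) (at a)"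
  unfolding A_def by (intro tendsto_intros limr) simp_all
 hence A: "(A \<longlongrightarrow> l / 3) (at a)" by (simp add: ca l_def)
 have "(B \<longlongrightarrow> poly (pderiv W) a / 6 + (cnj a - a) * r a) (at a)"
  unfolding B_def by (intro tendsto_intros limr) simp_all
 hence B: "(B \<longlongrightarrow> l / 6) (at a)" by (simp add: ca l_def)
 show ?thesis by (rule winds_linear(1)[OF ev A B]) (use l in \<open>simp add: norm_divide\<close>)
qed

text \<open>The terms of order two are c (x^2 + 2 x cnj x) with x = z - a, that is |x|^2 c (u^2 + 2)
  for the direction u. Since u^2 + 2 has real part at least 1, nothing winds.\<close>

lemma cusp_winds: assumes "a \<in> K" shows "winds hh (%z. z - a) 0 (at a)"
proof -
 have ca: "cnj a = a" using assms realK cnj_real by blast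
 \<comment> \<open>The expansion gives W''/4 x^2 + W''/6 x (cnj x - x), in which W''/12 is the
   common unit.\<close>
 define c where "c = poly (pderiv (pderiv W)) a / 12"
 have c: "c ~= 0" using W_at_K(3)[OF assms] by (simp add: c_def)
 obtain w where w: "W = [:-a, 1:] ^ 2 * w" "poly (pderiv (pderiv W)) a = 2 * poly w a"
  using poly_double_root[OF W_at_K(1,2)[OF assms]] by blast
 define r where "r = (%z. vdet (pev p z) (pev (pd p) z) (dvec 4 p z (cnj z)))"
 have r0: "r a = 0" using cusp[OF assms] by (simp add: r_def vdet_alt vdot_bilinear flip: pev_chi)
 have limr: "(r \<longlongrightarrow> 0) (at a)"
  by (subst r0[symmetric]) (unfold r_def, intro tendsto_vdet tendsto_intros)
 define u where "u = (%z. sgn (z - a))"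
 define G where "G = (%z. c * ((u z)\<^sup>2 + 2))"
 define E where "E = (%z. (u z)\<^sup>2 * (poly w z / 2 - 3 * c) + (dd (pderiv W) a z / 6 - 2 * c) * (1 - (u z)\<^sup>2) + (cnj (u z) - u z)\<^sup>2 * r z)"
 have nu: "norm (u z) \<le> 1" for z by (cases "z = a") (simp_all add: u_def norm_sgn)
 have E0: "(E \<longlongrightarrow> 0) (at a)"
 proof (rule Lim_null_comparison)
  show "\<forall>\<^sub>F z in at a. norm (E z) \<le> norm (poly w z / 2 - 3 * c) + norm (dd (pderiv W) a z / 6 - 2 * c) * 2 + 4 * norm (r z)"
  proof (intro always_eventually allI)
   fix z
   have u2: "norm ((u z)\<^sup>2) \<le> 1" using nu[of z] by (simp add: norm_power power_le_one)
   have "norm (1 - (u z)\<^sup>2) \<le> 2" using norm_triangle_ineq4[of 1 "(u z)\<^sup>2"] u2 by simp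
   moreover have "norm (cnj (u z) - u z) \<le> 2" using norm_triangle_ineq4[of "cnj (u z)" "u z"] nu[of z] by simp
   hence "norm ((cnj (u z) - u z)\<^sup>2) \<le> 2\<^sup>2" unfolding norm_power by (intro power_mono) auto
   moreover have "norm (E z) \<le> norm ((u z)\<^sup>2) * norm (poly w z / 2 - 3 * c) + norm (dd (pderiv W) a z / 6 - 2 * c) * norm (1 - (u z)\<^sup>2) + norm ((cnj (u z) - u z)\<^sup>2) * norm (r z)"
    unfolding E_def by (intro order_trans[OF norm_triangle_ineq] add_mono) (simp_all only: norm_mult order_refl)
   moreover have "norm ((u z)\<^sup>2) * norm (poly w z / 2 - 3 * c) \<le> 1 * norm (poly w z / 2 - 3 * c)" using u2 by (intro mult_right_mono) auto
   moreover have "norm (dd (pderiv W) a z / 6 - 2 * c) * norm (1 - (u z)\<^sup>2) \<le> norm (dd (pderiv W) a z / 6 - 2 * c) * 2"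
    using calculation(1) by (intro mult_left_mono) auto
   moreover have "norm ((cnj (u z) - u z)\<^sup>2) * norm (r z) \<le> 2\<^sup>2 * norm (r z)" using calculation(2) by (intro mult_right_mono) auto
   ultimately show "norm (E z) \<le> norm (poly w z / 2 - 3 * c) + norm (dd (pderiv W) a z / 6 - 2 * c) * 2 + 4 * norm (r z)"
    by simp
  qed
  have "((%z. norm (poly w z / 2 - 3 * c) + norm (dd (pderiv W) a z / 6 - 2 * c) * 2 + 4 * norm (r z)) \<longlongrightarrow>
   norm (poly w a / 2 - 3 * c) + norm (dd (pderiv W) a a / 6 - 2 * c) * 2 + 4 * norm (0::complex)) (at a)"
   by (intro tendsto_intros limr) simp_all
  moreover have "poly w a / 2 - 3 * c = 0" "dd (pderiv W) a a / 6 - 2 * c = 0" using w(2) by (simp_all add: c_def)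
  ultimately show "((%z. norm (poly w z / 2 - 3 * c) + norm (dd (pderiv W) a z / 6 - 2 * c) * 2 + 4 * norm (r z)) \<longlongrightarrow> 0) (at a)"
   by simp
 qed
 show ?thesis
 proof (rule winds_approx[OF _ E0, where c = c and \<epsilon> = "(norm c)\<^sup>2" and \<rho> = "%z. (norm (z - a))\<^sup>2" and G = G and C = "norm c * 3"])
  show "c ~= 0" "0 < (norm c)\<^sup>2" using c by auto
  have nea: "\<forall>\<^sub>F z in at a. z ~= a" by (rule eventually_neq_at_within)
  thus "\<forall>\<^sub>F z in at a. 0 < (norm (z - a))\<^sup>2 \<and> hh z = of_real ((norm (z - a))\<^sup>2) * (G z + E z) \<and>
   (norm c)\<^sup>2 \<le> Re (G z * cnj (c * sgn (z - a) powi 0)) \<and> norm (G z) \<le> norm c * 3"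
  proof eventually_elim
   case (elim z)
   hence z: "z - a ~= 0" by simp
   have fu: "sgn (z - a) = u z" by (simp add: u_def)
   note f = unit_facts[OF z, unfolded fu]
   define n where "n = complex_of_real (norm (z - a))"
   have cn: "cnj n = n" by (simp add: n_def)
   have e: "z - a = n * u z" "cnj (z - a) = n * cnj (u z)" "u z * cnj (u z) = 1" using f by (simp_all add: n_def)
   have "poly W z = (z - a)\<^sup>2 * poly w z" by (subst w(1)) simp
   moreover have "poly (pderiv W) z = (z - a) * dd (pderiv W) a z"
    using dd_eq[of "pderiv W" z a] W_at_K(2)[OF assms] by simp
   ultimately have "hh z = (z - a)\<^sup>2 * poly w z / 2 + (cnj z - z) * ((z - a) * dd (pderiv W) a z) / 6 + (cnj z - z)\<^sup>2 * r z"
    using HH_expand[of p z "cnj z"] by (simp add: hh_def W_vdet r_def)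
   also have "cnj z - z = cnj (z - a) - (z - a)" using ca by simp
   also have "(z - a)\<^sup>2 * poly w z / 2 + (cnj (z - a) - (z - a)) * ((z - a) * dd (pderiv W) a z) / 6 + (cnj (z - a) - (z - a))\<^sup>2 * r z
    = n\<^sup>2 * ((u z)\<^sup>2 * poly w z / 2 + (u z * cnj (u z) - (u z)\<^sup>2) * dd (pderiv W) a z / 6 + (cnj (u z) - u z)\<^sup>2 * r z)"
    unfolding e(1,2) by (simp add: cn power2_eq_square algebra_simps)
   also have "\<dots> = n\<^sup>2 * (G z + E z)" unfolding e(3) by (simp add: G_def E_def algebra_simps)
   finally have h: "hh z = of_real ((norm (z - a))\<^sup>2) * (G z + E z)" by (simp add: n_def)
   have u2: "norm ((u z)\<^sup>2) = 1" using f(1) by (simp add: norm_power)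
   have "G z * cnj c = of_real ((norm c)\<^sup>2) * ((u z)\<^sup>2 + 2)"
    unfolding complex_norm_square by (simp add: G_def mult_ac)
   hence "Re (G z * cnj c) = (norm c)\<^sup>2 * (Re ((u z)\<^sup>2) + 2)"
    by (simp only: times_complex.sel Re_complex_of_real Im_complex_of_real plus_complex.sel) simp
   moreover have "Re ((u z)\<^sup>2) \<ge> - 1" using abs_Re_le_cmod[of "(u z)\<^sup>2"] u2 by linarith
   hence "(norm c)\<^sup>2 * 1 \<le> (norm c)\<^sup>2 * (Re ((u z)\<^sup>2) + 2)" by (intro mult_left_mono) auto
   ultimately have g: "(norm c)\<^sup>2 \<le> Re (G z * cnj (c * sgn (z - a) powi 0))" by simp
   have "norm ((u z)\<^sup>2 + 2) \<le> 3" using norm_triangle_ineq[of "(u z)\<^sup>2" 2] u2 by simp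
   hence "norm (G z) \<le> norm c * 3" unfolding G_def norm_mult by (intro mult_left_mono) auto
   thus ?case using h g z by simp
  qed
 qed
qed

text \<open>The tangent line contributes 2 (d - 1) powers of s and the point d powers of its
  conjugate; the divisor (t - s)^2 takes away two of each. For real s the formula is the change of
  chart of the Wronskian.\<close>

lemma HH_reversed:
 assumes "s ~= 0"
 shows "HH p s (cnj s) = - (s ^ (2 * (d - 2)) * cnj s ^ (d - 2)) * HH R (1 / s) (1 / cnj s)"
proof (cases "cnj s = s")
 case True
 have 1: "2 * HH p s s = poly W s" by (simp add: HH_diag W_vdet)
 have 2: "poly W s = - (s ^ (3 * (d - 2))) * poly WR (1 / s)"
  using WR_eq[of "1 / s"] assms by (simp add: power_one_over)
 have 3: "poly WR (1 / s) = 2 * HH R (1 / s) (1 / s)" by (simp add: HH_diag WR_def)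
 have "3 * (d - 2) = 2 * (d - 2) + (d - 2)" by simp
 hence "s ^ (3 * (d - 2)) = s ^ (2 * (d - 2)) * s ^ (d - 2)" by (simp only: power_add)
 hence "2 * HH p s s = 2 * (- (s ^ (2 * (d - 2)) * s ^ (d - 2)) * HH R (1 / s) (1 / s))"
  unfolding 1 2 3 by simp
 thus ?thesis unfolding True by (simp only: mult_cancel_left) simp
next
 case False
 define t where "t = cnj s"
 have st: "t ~= 0" "t ~= s" using assms False by (auto simp: t_def)
 have e1: "(t - s)\<^sup>2 * HH p s t = vdot (pev (chi p) s) (pev p t)" by (simp add: HH_eq vdet_alt pev_chi)
 have e2: "(1 / t - 1 / s)\<^sup>2 * HH R (1 / s) (1 / t) = vdot (pev (chi R) (1 / s)) (pev R (1 / t))"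
  by (simp add: HH_eq vdet_alt pev_chi)
 have "vdot (pev (chi R) (1 / s)) (pev R (1 / t)) = - ((1 / s) ^ (2 * (d - 1))) * (1 / t) ^ d * vdot (pev (chi p) s) (pev p t)"
 proof -
  have 1: "pev (chi R) (1 / s) = (- ((1 / s) ^ (2 * (d - 1)))) *s pev (chi p) s" using chi_R[of "1 / s"] assms by simp
  have 2: "pev R (1 / t) = (1 / t) ^ d *s pev p t" using R_eval(1)[of "1 / t"] st by simp
  show ?thesis unfolding 1 2 by (simp only: vdot_bilinear mult_ac)
 qed
 hence "(1 / t - 1 / s)\<^sup>2 * HH R (1 / s) (1 / t) = - ((1 / s) ^ (2 * (d - 1))) * (1 / t) ^ d * ((t - s)\<^sup>2 * HH p s t)"
  using e1 e2 by simp
 moreover have "(1 / t - 1 / s) = - (t - s) / (s * t)" using assms st by (simp add: field_simps)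
 moreover have "2 * (d - 1) = 2 * (d - 2) + 2" "d = (d - 2) + 2" using d3 by auto
 ultimately have e3: "((t - s)\<^sup>2 / (s * t)\<^sup>2) * HH R (1 / s) (1 / t) = - ((1 / s) ^ (2 * (d - 2) + 2)) * (1 / t) ^ ((d - 2) + 2) * ((t - s)\<^sup>2 * HH p s t)"
  by (simp only: power_divide power2_minus)
 have gen: "h = - a * b * g" if "X / (s * t)\<^sup>2 * h = - (a * (1 / s)\<^sup>2) * (b * (1 / t)\<^sup>2) * (X * g)" "X ~= 0" for X a b g h
 proof -
  have "X * h = X * (- a * b * g)" using that st assms by (simp add: field_simps)
  thus ?thesis using that(2) by (simp only: mult_cancel_left) simp
 qed
 have "(t - s)\<^sup>2 ~= 0" using st(2) by simp
 from gen[OF e3[unfolded power_add] this]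
 have "HH R (1 / s) (1 / t) = - ((1 / s) ^ (2 * (d - 2))) * (1 / t) ^ (d - 2) * HH p s t" .
 thus ?thesis using st assms unfolding t_def[symmetric] by (simp add: field_simps)
qed

text \<open>The factor z^(2 (d - 2)) cnj z^(d - 2) turns d - 2 times, and the other factor tends to
  half the Wronskian at infinity, which is not zero.\<close>

lemma infinity_winds: "winds hh (%z. z) (int (d - 2)) at_infinity"
proof -
 define H0 where "H0 = HH R 0 0"
 have H0: "H0 ~= 0" using HH_diag[of R 0] WR_0 by (auto simp: H0_def WR_def)
 define u :: "complex => complex" where "u = sgn"
 define G where "G = (%z. - H0 * u z ^ (d - 2))"
 define E where "E = (%z. - (u z ^ (d - 2)) * (HH R (1 / z) (1 / cnj z) - H0))"
 have inv: "((%z::complex. 1 / z) \<longlongrightarrow> 0) at_infinity"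
  using tendsto_inverse_0[where 'a = complex] unfolding inverse_eq_divide .
 have inv': "((%z::complex. 1 / cnj z) \<longlongrightarrow> 0) at_infinity"
  using tendsto_cnj[OF inv] by simp
 have limH: "((%z. HH R (1 / z) (1 / cnj z)) \<longlongrightarrow> H0) at_infinity" unfolding H0_def by (rule tendsto_HH[OF inv inv'])
 have nu: "norm (u z) \<le> 1" for z by (cases "z = 0") (simp_all add: u_def norm_sgn)
 have E0: "(E \<longlongrightarrow> 0) at_infinity"
 proof (rule Lim_null_comparison)
  show "\<forall>\<^sub>F z in at_infinity. norm (E z) \<le> norm (HH R (1 / z) (1 / cnj z) - H0)"
  proof (intro always_eventually allI)
   fix z
   have "norm (E z) = norm (u z) ^ (d - 2) * norm (HH R (1 / z) (1 / cnj z) - H0)" by (simp add: E_def norm_mult norm_power)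
   also have "\<dots> \<le> 1 * norm (HH R (1 / z) (1 / cnj z) - H0)" using nu by (intro mult_right_mono power_le_one) auto
   finally show "norm (E z) \<le> norm (HH R (1 / z) (1 / cnj z) - H0)" by simp
  qed
  show "((%z. norm (HH R (1 / z) (1 / cnj z) - H0)) \<longlongrightarrow> 0) at_infinity"
   using limH by (simp add: LIM_zero_iff tendsto_norm_zero_iff)
 qed
 show ?thesis
 proof (rule winds_approx[OF _ E0, where c = "- H0" and \<epsilon> = "(norm H0)\<^sup>2" and \<rho> = "%z. norm z ^ (3 * (d - 2))" and G = G and C = "norm H0"])
  show "- H0 ~= 0" "0 < (norm H0)\<^sup>2" using H0 by auto
  show "\<forall>\<^sub>F z in at_infinity. 0 < norm z ^ (3 * (d - 2)) \<and> hh z = of_real (norm z ^ (3 * (d - 2))) * (G z + E z) \<and>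
   (norm H0)\<^sup>2 \<le> Re (G z * cnj (- H0 * sgn z powi int (d - 2))) \<and> norm (G z) \<le> norm H0"
   using eventually_not_equal_at_infinity[of 0]
  proof eventually_elim
   case (elim z)
   note f = unit_facts[OF elim, folded u_def]
   define n where "n = complex_of_real (norm z)"
   have e: "z = n * u z" "cnj z = n * cnj (u z)" using f by (simp_all add: n_def)
   have "z ^ (2 * (d - 2)) * cnj z ^ (d - 2) = (z * (z * cnj z)) ^ (d - 2)"
    by (simp add: power_mult power2_eq_square power_mult_distrib mult_ac)
   also have "z * (z * cnj z) = n ^ 3 * u z * (u z * cnj (u z))"
    by (subst (1 2) e(1), subst e(2)) (simp add: power3_eq_cube mult_ac)
   also have "\<dots> = n ^ 3 * u z" using f by simp
   finally have "z ^ (2 * (d - 2)) * cnj z ^ (d - 2) = n ^ (3 * (d - 2)) * u z ^ (d - 2)"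
    by (simp add: power_mult power_mult_distrib)
   hence h: "hh z = of_real (norm z ^ (3 * (d - 2))) * (G z + E z)"
    using HH_reversed[OF elim] by (simp add: hh_def G_def E_def n_def algebra_simps)
   have un: "u z ^ (d - 2) * cnj (u z ^ (d - 2)) = 1"
   proof -
    have "u z ^ (d - 2) * cnj (u z ^ (d - 2)) = (u z * cnj (u z)) ^ (d - 2)" by (simp add: power_mult_distrib)
    thus ?thesis using f by simp
   qed
   have "G z * cnj (- H0 * sgn z powi int (d - 2)) = H0 * cnj H0 * (u z ^ (d - 2) * cnj (u z ^ (d - 2)))"
    by (simp add: G_def u_def)
   also have "\<dots> = of_real ((norm H0)\<^sup>2)" unfolding un complex_norm_square by simp
   finally have "Re (G z * cnj (- H0 * sgn z powi int (d - 2))) = (norm H0)\<^sup>2" by (simp only: Re_complex_of_real)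
   moreover have "norm (G z) = norm H0" using f by (simp add: G_def norm_mult norm_power)
   ultimately show ?case using h elim by simp
  qed
 qed
qed

text \<open>Klein's formula: the zeros of \<open>hh\<close> on the Riemann sphere, on which \<open>hh\<close> is a section of a
 complex line bundle of degree \<open>d - 2\<close>, are counted with local degree \<open>1\<close> at flexes and solitary
 bitangents, \<open>0\<close> at cusps, and \<open>-1\<close> at solitary points.\<close>

theorem klein: "int (card solitary) = int (card bitangent) + 2 * (int d - 2) - 2 * int (card K)"
proof -
 define Z where "Z = K \<union> F \<union> solitary \<union> bitangent"
 define k :: "complex => int" where "k = (%a. if a \<in> K then 0 else if a \<in> F then 1 else if a \<in> solitary then - 1 else 1)"
 have dis: "K \<inter> F = {}" "(K \<union> F) \<inter> solitary = {}" "(K \<union> F \<union> solitary) \<inter> bitangent = {}"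
  using KF_disjoint realK by (auto simp: solitary_def bitangent_def)
 have "int (d - 2) = (\<Sum>a\<in>Z. k a)"
 proof (rule sum_winding[of Z hh])
  show "finite Z" using fin finite_solitary bitangent_count(1) by (simp add: Z_def)
  have "isCont hh z" for z unfolding isCont_def hh_def by (intro tendsto_HH tendsto_intros)
  thus "continuous_on (- Z) hh" by (simp add: continuous_at_imp_continuous_on)
  show "hh z ~= 0" if "z \<notin> Z" for z using that hh_zero by (simp add: Z_def)
  show "winds hh (%z. z - a) (k a) (at a)" if "a \<in> Z" for a
   using that dis cusp_winds flex_winds solitary_winds bitangent_winds by (auto simp: Z_def k_def)
  show "winds hh (%z. z) (int (d - 2)) at_infinity" by (rule infinity_winds)
 qed
 also have "(\<Sum>a\<in>Z. k a) = (\<Sum>a\<in>K. k a) + (\<Sum>a\<in>F. k a) + (\<Sum>a\<in>solitary. k a) + (\<Sum>a\<in>bitangent. k a)"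
  unfolding Z_def using dis fin finite_solitary bitangent_count(1) by (simp add: sum.union_disjoint)
 also have "(\<Sum>a\<in>K. k a) = 0" by (simp add: k_def)
 also have "(\<Sum>a\<in>F. k a) = (\<Sum>a\<in>F. 1)" using dis by (intro sum.cong) (auto simp: k_def)
 also have "(\<Sum>a\<in>solitary. k a) = (\<Sum>a\<in>solitary. - 1)" using dis by (intro sum.cong) (auto simp: k_def)
 also have "(\<Sum>a\<in>bitangent. k a) = (\<Sum>a\<in>bitangent. 1)" using dis by (intro sum.cong) (auto simp: k_def)
 finally have "int (d - 2) = int (card F) - int (card solitary) + int (card bitangent)" by simp
 moreover have "2 * int (card K) + int (card F) = 3 * int (d - 2)" using number by linarith
 moreover have "int (d - 2) = int d - 2" using d3 by simp
 ultimately show ?thesis by presburger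
qed

end

section \<open>Forms and charts\<close>

lemma finite_exponents: "finite {a :: 'n::finite => nat. (\<Sum>i\<in>UNIV. a i) = n}"
proof (rule finite_subset)
 show "{a :: 'n => nat. (\<Sum>i\<in>UNIV. a i) = n} \<subseteq> (\<Pi>\<^sub>E i\<in>UNIV. {..n})"
  by (auto simp: PiE_def intro: member_le_sum)
qed (rule finite_PiE, simp_all)

lemma is_form_add:
 assumes "is_form n G" "is_form n H" shows "is_form n (%x. G x + H x)"
proof -
 obtain c e where "G = form_of n c" "H = form_of n e" using assms by (auto simp: is_form_def)
 hence "(%x. G x + H x) = form_of n (%a. c a + e a)"
  by (simp add: fun_eq_iff form_of_def distrib_right sum.distrib)
 thus ?thesis by (auto simp: is_form_def)
qed

lemma is_form_cmult: "is_form n G ==> is_form n (%x. k * G x)"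
proof -
 assume "is_form n G"
 then obtain c where "G = form_of n c" by (auto simp: is_form_def)
 hence "(%x. k * G x) = form_of n (%a. k * c a)"
  by (simp add: fun_eq_iff form_of_def sum_distrib_left mult.assoc)
 thus ?thesis by (auto simp: is_form_def)
qed

lemma is_form_zero: "is_form n (%x. 0)"
 unfolding is_form_def by (rule exI[of _ "%a. 0"]) (simp add: form_of_def fun_eq_iff)

lemma is_form_sum: "(\<And>k. k \<in> A ==> is_form n (G k)) ==> is_form n (%x. \<Sum>k\<in>A. G k x)"
 by (induction A rule: infinite_finite_induct) (simp_all add: is_form_zero is_form_add)

lemma is_form_const: "is_form 0 (%x :: complex ^ 'n::finite. c)"
proof -
 have "{a :: 'n => nat. (\<Sum>i\<in>UNIV. a i) = 0} = {%_. 0}" by (auto simp: fun_eq_iff)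
 thus ?thesis unfolding is_form_def by (intro exI[of _ "%_. c"]) (simp add: form_of_def fun_eq_iff)
qed

lemma is_form_coord_mult:
 fixes G :: "complex ^ 'n::finite => complex"
 assumes "is_form n G" shows "is_form (Suc n) (%x. x $ i * G x)"
proof -
 obtain c where c: "G = form_of n c" using assms by (auto simp: is_form_def)
 define up :: "('n => nat) => 'n => nat" where "up = (%a. a(i := Suc (a i)))"
 define dn :: "('n => nat) => 'n => nat" where "dn = (%a. a(i := a i - 1))"
 define e where "e = (%a. if a i > 0 then c (dn a) else 0)"
 have su: "(\<Sum>j\<in>UNIV. up a j) = Suc (\<Sum>j\<in>UNIV. a j)" for a :: "'n => nat"
 proof -
  have "(\<Sum>j\<in>UNIV. up a j) = (\<Sum>j\<in>UNIV. a j + (if j = i then 1 else 0))" by (intro sum.cong) (auto simp: up_def)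
  thus ?thesis by (simp add: sum.distrib)
 qed
 have ud: "up (dn a) = a" if "a i > 0" for a using that by (simp add: up_def dn_def)
 have du: "dn (up a) = a" for a by (simp add: up_def dn_def)
 have pr: "(\<Prod>j\<in>UNIV. (x $ j) ^ up a j) = x $ i * (\<Prod>j\<in>UNIV. (x $ j) ^ a j)" for x :: "complex ^ 'n" and a
 proof -
  have "(\<Prod>j\<in>UNIV. (x $ j) ^ up a j) = (\<Prod>j\<in>UNIV. (x $ j) ^ a j * (if j = i then x $ i else 1))"
   by (intro prod.cong) (auto simp: up_def)
  thus ?thesis by (simp add: prod.distrib)
 qed
 have "x $ i * G x = form_of (Suc n) e x" for x
 proof -
  have "form_of (Suc n) e x = (\<Sum>a | (\<Sum>j\<in>UNIV. a j) = Suc n \<and> a i > 0. c (dn a) * (\<Prod>j\<in>UNIV. (x $ j) ^ a j))"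
   unfolding form_of_def by (rule sum.mono_neutral_cong_right[OF finite_exponents]) (auto simp: e_def)
  also have "\<dots> = (\<Sum>a | (\<Sum>j\<in>UNIV. a j) = n. c a * (x $ i * (\<Prod>j\<in>UNIV. (x $ j) ^ a j)))"
  proof (rule sum.reindex_bij_witness[of _ up dn])
   fix a :: "'n => nat" assume a: "a \<in> {a. (\<Sum>j\<in>UNIV. a j) = Suc n \<and> a i > 0}"
   thus "up (dn a) = a" by (simp add: ud)
   have "Suc (\<Sum>j\<in>UNIV. dn a j) = Suc n" using a ud[of a] su[of "dn a"] by simp
   thus "dn a \<in> {a. (\<Sum>j\<in>UNIV. a j) = n}" by simp
   show "c (dn a) * (x $ i * (\<Prod>j\<in>UNIV. (x $ j) ^ dn a j)) = c (dn a) * (\<Prod>j\<in>UNIV. (x $ j) ^ a j)"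
    using a ud[of a] pr[of x "dn a"] by simp
  next
   fix a :: "'n => nat" assume "a \<in> {a. (\<Sum>j\<in>UNIV. a j) = n}"
   thus "dn (up a) = a" "up a \<in> {a. (\<Sum>j\<in>UNIV. a j) = Suc n \<and> a i > 0}"
    by (simp_all only: du su mem_Collect_eq) (simp add: up_def)
  qed
  finally show ?thesis by (simp add: c form_of_def sum_distrib_left mult_ac)
 qed
 thus ?thesis unfolding is_form_def by (intro exI[of _ e]) (simp add: fun_eq_iff)
qed

lemma is_form_linear_mult:
 assumes "is_form n G" shows "is_form (Suc n) (%x. (\<Sum>i\<in>UNIV. l $ i * x $ i) * G x)"
proof -
 have "is_form (Suc n) (%x. \<Sum>i\<in>UNIV. l $ i * (x $ i * G x))"
  by (intro is_form_sum is_form_cmult is_form_coord_mult assms)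
 thus ?thesis by (simp add: sum_distrib_right mult.assoc)
qed

lemma is_form_linear_power_mult:
 assumes "is_form n G" shows "is_form (k + n) (%x. (\<Sum>i\<in>UNIV. l $ i * x $ i) ^ k * G x)"
proof (induction k)
 case (Suc k) thus ?case using is_form_linear_mult[OF Suc.IH, of l] by (simp add: mult.assoc)
qed (use assms in simp)

lemma is_form_linear_power: "is_form k (%x. (\<Sum>i\<in>UNIV. l $ i * x $ i) ^ k)"
 using is_form_linear_power_mult[OF is_form_const[of 1], of k l] by simp

lemma form_scale: assumes "is_form n G" shows "G (k *s x) = k ^ n * G x"
proof -
 obtain c where c: "G = form_of n c" using assms by (auto simp: is_form_def)
 have "(\<Prod>i\<in>UNIV. ((k *s x) $ i) ^ a i) = k ^ (\<Sum>i\<in>UNIV. a i) * (\<Prod>i\<in>UNIV. (x $ i) ^ a i)" for a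
  by (simp add: power_mult_distrib prod.distrib power_sum)
 thus ?thesis by (simp add: c form_of_def sum_distrib_left mult_ac)
qed

lemma form_line:
 assumes "is_form n G"
 obtains q where "degree q \<le> n" "\<And>t. G (v + t *s w) = poly q t"
proof -
 obtain c where c: "G = form_of n c" using assms by (auto simp: is_form_def)
 define q where "q = (\<Sum>a | (\<Sum>i\<in>UNIV. a i) = n. smult (c a) (\<Prod>i\<in>UNIV. [:v $ i, w $ i:] ^ a i))"
 have "degree (\<Prod>i\<in>UNIV. [:v $ i, w $ i:] ^ a i) \<le> (\<Sum>i\<in>UNIV. a i)" for a
 proof -
  have "degree ([:v $ i, w $ i:] ^ a i) \<le> a i" for i
   using degree_power_le[of "[:v $ i, w $ i:]" "a i"] by (simp split: if_splits)
  thus ?thesis by (intro order_trans[OF degree_prod_sum_le] sum_mono) auto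
 qed
 hence "degree q \<le> n" unfolding q_def
  by (intro degree_sum_le finite_exponents order_trans[OF degree_smult_le]) auto
 moreover have "G (v + t *s w) = poly q t" for t
  by (simp add: c form_of_def q_def poly_sum poly_prod poly_power mult_ac)
 ultimately show ?thesis by (rule that)
qed

lemma form_plane:
 assumes "is_form n G"
 obtains Q where "\<And>y z. G (v + y *s u + z *s w) = ev2 Q y z"
proof -
 obtain c where c: "G = form_of n c" using assms by (auto simp: is_form_def)
 have s: "ev2 (sum h A) y z = (\<Sum>a\<in>A. ev2 (h a) y z)" for h :: "('a => nat) => complex poly poly" and A y z
  by (induction A rule: infinite_finite_induct) simp_all
 have p: "ev2 (prod h A) y z = (\<Prod>i\<in>A. ev2 (h i) y z)" for h :: "'a => complex poly poly" and A y z
  by (induction A rule: infinite_finite_induct) (simp_all add: one_pCons)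
 have w: "ev2 (h ^ k) y z = ev2 h y z ^ k" for h k y z
  by (induction k) (simp_all add: one_pCons)
 define Q where "Q = (\<Sum>a | (\<Sum>i\<in>UNIV. a i) = n. smult [:c a:] (\<Prod>i\<in>UNIV. [:[:v $ i, u $ i:], [:w $ i:]:] ^ a i))"
 have "G (v + y *s u + z *s w) = ev2 Q y z" for y z
  by (simp add: c form_of_def Q_def s p w mult_ac add_ac)
 thus ?thesis by (rule that)
qed

lemma dir_deriv_line:
 assumes "\<And>t. G (v + t *s w) = poly q t"
 shows "dir_deriv k G v w = poly ((pderiv ^^ k) q) 0" "dir_deriv k G v w = fact k * coeff q k"
proof -
 have "(deriv ^^ k) (poly q) = poly ((pderiv ^^ k) q)"
 proof (induction k arbitrary: q)
  case (Suc k)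
  have "deriv (poly q) = poly (pderiv q)" by (simp add: fun_eq_iff DERIV_imp_deriv)
  thus ?case by (simp only: funpow_Suc_right o_apply Suc.IH)
 qed simp
 moreover have "(%t. G (v + t *s w)) = poly q" using assms by (simp add: fun_eq_iff)
 ultimately show "dir_deriv k G v w = poly ((pderiv ^^ k) q) 0" by (simp add: dir_deriv_def)
 thus "dir_deriv k G v w = fact k * coeff q k"
  by (simp add: poly_0_coeff_0 coeff_higher_pderiv pochhammer_fact[symmetric])
qed

text \<open>Lets a coefficient be computed from an expression that is only known near 0, for
  instance after dividing by a function that is nonzero there.\<close>

lemma coeff_via_limit:
 fixes q :: "complex poly"
 assumes "\<forall>\<^sub>F t in at 0. poly q t = t ^ m * S t" "(S \<longlongrightarrow> L) (at 0)"
 shows "coeff q m = L"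
 using assms(1)
proof (induction m arbitrary: q)
 case 0
 have "(poly q \<longlongrightarrow> poly q 0) (at 0)" by (intro tendsto_intros)
 moreover have "(poly q \<longlongrightarrow> L) (at 0)"
  by (rule Lim_transform_eventually[OF assms(2)]) (use 0 in \<open>auto elim: eventually_mono\<close>)
 ultimately have "poly q 0 = L" by (rule tendsto_unique[OF at_neq_bot])
 thus ?case by (simp add: poly_0_coeff_0)
next
 case (Suc m)
 have "((%t. t ^ Suc m * S t) \<longlongrightarrow> 0 ^ Suc m * L) (at 0)" by (intro tendsto_intros assms(2))
 hence "(poly q \<longlongrightarrow> 0) (at 0)"
  by (rule Lim_transform_eventually[THEN tendsto_eq_rhs]) (use Suc.prems in \<open>auto elim: eventually_mono\<close>)
 moreover have "(poly q \<longlongrightarrow> poly q 0) (at 0)" by (intro tendsto_intros)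
 ultimately have "poly q 0 = 0" by (metis tendsto_unique at_neq_bot)
 then obtain r where r: "q = pCons 0 r" by (cases q) auto
 have "\<forall>\<^sub>F t in at 0. poly r t = t ^ m * S t"
  using Suc.prems eventually_neq_at_within[of 0 0 UNIV] by eventually_elim (simp add: r)
 thus ?case using Suc.IH[of r] r by simp
qed

text \<open>By homogeneity v + t (x v + y w) may be rescaled to v + t' w with t' = t y / (1 + t x).
  So the first nonvanishing derivative only sees the direction modulo v.\<close>

lemma dir_deriv_shift:
 assumes G: "is_form n G" and low: "\<And>k. k < m ==> dir_deriv k G v w = 0"
 shows "dir_deriv m G v (x *s v + y *s w) = y ^ m * dir_deriv m G v w"
proof -
 obtain q where q: "\<And>t. G (v + t *s w) = poly q t" using form_line[OF G] by blast
 obtain r where r: "\<And>t. G (v + t *s (x *s v + y *s w)) = poly r t" using form_line[OF G] by blast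
 have "coeff q k = 0" if "k < m" for k using low[OF that] dir_deriv_line(2)[OF q, of k] by simp
 hence "monom 1 m dvd q" by (simp add: monom_1_dvd_iff')
 then obtain e where e: "q = monom 1 m * e" by (elim dvdE)
 have qm: "coeff q m = poly e 0" by (simp add: e coeff_monom_mult poly_0_coeff_0)
 define S where "S = (%t. (1 + t * x) ^ n * (y / (1 + t * x)) ^ m * poly e (t * y / (1 + t * x)))"
 have "(S \<longlongrightarrow> (1 + 0 * x) ^ n * (y / (1 + 0 * x)) ^ m * poly e (0 * y / (1 + 0 * x))) (at 0)"
  unfolding S_def by (intro tendsto_intros) simp_all
 hence lim: "(S \<longlongrightarrow> y ^ m * coeff q m) (at 0)" by (simp add: qm)
 have "((%t. 1 + t * x) \<longlongrightarrow> 1 + 0 * x) (at 0)" by (intro tendsto_intros)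
 hence "\<forall>\<^sub>F t in at 0. 1 + t * x ~= 0" by (rule tendsto_imp_eventually_ne) simp
 hence "\<forall>\<^sub>F t in at 0. poly r t = t ^ m * S t"
 proof eventually_elim
  case (elim t)
  have "v + t *s (x *s v + y *s w) = (1 + t * x) *s (v + (t * y / (1 + t * x)) *s w)"
   using elim by (simp add: vec_eq_iff field_simps)
  hence "poly r t = (1 + t * x) ^ n * poly q (t * y / (1 + t * x))" by (simp only: r[symmetric] form_scale[OF G] q)
  also have "\<dots> = t ^ m * S t" by (simp add: e poly_monom S_def power_mult_distrib power_divide)
  finally show ?case .
 qed
 hence "coeff r m = y ^ m * coeff q m" by (rule coeff_via_limit[OF _ lim])
 thus ?thesis using dir_deriv_line(2)[OF q, of m] dir_deriv_line(2)[OF r, of m] by simp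
qed

section \<open>Charts of the projective line\<close>

definition cdet :: "complex ^ 2 => complex ^ 2 => complex" where "cdet a b = a $ 1 * b $ 2 - a $ 2 * b $ 1"

lemma cdet_cramer: "cdet a b *s x = cdet x b *s a + cdet a x *s b"
 by (simp add: cdet_def vec_eq_iff forall_2 algebra_simps)

lemma cdet_simps [simp]:
 "cdet a a = 0" "cdet (x + y) b = cdet x b + cdet y b" "cdet a (x + y) = cdet a x + cdet a y"
 "cdet (k *s x) b = k * cdet x b" "cdet a (k *s x) = k * cdet a x"
 by (simp_all add: cdet_def algebra_simps)

lemma cdet_commute: "cdet b a = - cdet a b" by (simp add: cdet_def)

lemma cdet_cases:
 assumes "cdet a b ~= 0" and "x ~= 0"
 obtains k where "k ~= 0" "x = k *s a" | k t where "k ~= 0" "x = k *s (t *s a + b)"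
proof -
 define X Y where "X = cdet x b / cdet a b" and "Y = cdet a x / cdet a b"
 have "x = X *s a + Y *s b"
  using cdet_cramer[of a b x] assms(1) by (simp add: X_def Y_def vec_eq_iff field_simps)
 thus ?thesis
 proof (cases "Y = 0")
  case True
  hence "x = X *s a" using \<open>x = _\<close> by simp
  thus ?thesis using that(1)[of X] assms(2) by (cases "X = 0") auto
 next
  case False
  hence "x = Y *s ((X / Y) *s a + b)" using \<open>x = _\<close> by (simp add: vec_eq_iff field_simps)
  thus ?thesis using that(2) False by blast
 qed
qed

lemma proj_pt_eq: "x ~= 0 ==> proj_pt x = proj_pt y \<longleftrightarrow> (\<exists>k. k ~= 0 \<and> y = k *s x)"
proof -
 assume x: "x ~= 0"
 have m: "z \<in> proj_pt u \<longleftrightarrow> (\<exists>k. z = k *s u)" for z u :: "complex ^ 'a" by (auto simp: proj_pt_def vec.span_singleton)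
 show ?thesis
 proof
  assume e: "proj_pt x = proj_pt y"
  have "x \<in> proj_pt y" unfolding e[symmetric] m by (intro exI[of _ 1]) simp
  then obtain k where k: "x = k *s y" unfolding m by blast
  hence "k ~= 0" using x by auto
  thus "\<exists>k. k ~= 0 \<and> y = k *s x" by (intro exI[of _ "1 / k"]) (simp add: k)
 next
  assume "\<exists>k. k ~= 0 \<and> y = k *s x"
  then obtain k where k: "k ~= 0" "y = k *s x" by blast
  hence "x = (1 / k) *s y" by simp
  thus "proj_pt x = proj_pt y" using k unfolding set_eq_iff m by (metis vector_smult_assoc)
 qed
qed

text \<open>The chart t a + b misses the point \<open>a\<close>, which is its point at infinity;
  exchanging \<open>a\<close> and \<open>b\<close> amounts to reversing the polynomials.\<close>

lemma chart_exists:
 fixes \<phi> :: "complex ^ 2 => complex ^ 3"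
 assumes form: "\<And>i. is_form d (%x. \<phi> x $ i)"
 obtains p where "\<And>i. degree (p $ i) \<le> d" "\<And>t. pev p t = \<phi> (t *s a + b)" "top_coeff d p = \<phi> a"
  "\<And>t. pev (rvec d p) t = \<phi> (t *s b + a)"
proof -
 have "\<forall>i. \<exists>q. degree q \<le> d \<and> (\<forall>t. \<phi> (b + t *s a) $ i = poly q t)" using form_line[OF form] by metis
 then obtain q where q: "\<And>i. degree (q i) \<le> d" "\<And>i t. \<phi> (b + t *s a) $ i = poly (q i) t" by metis
 have "\<forall>i. \<exists>q. degree q \<le> d \<and> (\<forall>t. \<phi> (a + t *s b) $ i = poly q t)" using form_line[OF form] by metis
 then obtain r where r: "\<And>i t. \<phi> (a + t *s b) $ i = poly (r i) t" by metis
 define p :: "complex poly ^ 3" where "p = (\<chi> i. q i)"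
 have p: "pev p t = \<phi> (t *s a + b)" for t by (simp add: p_def vec_eq_iff q(2)[symmetric] add.commute)
 have deg: "degree (p $ i) \<le> d" for i by (simp add: p_def q)
 have "rvec d p = (\<chi> i. r i)"
 proof (rule pev_eqI_punctured)
  fix s :: complex assume s: "s ~= 0"
  have "\<phi> (a + s *s b) = s ^ d *s \<phi> ((1 / s) *s a + b)"
  proof -
   have "a + s *s b = s *s ((1 / s) *s a + b)" using s by (simp add: vec_eq_iff field_simps)
   hence "\<phi> (a + s *s b) $ i = s ^ d * \<phi> ((1 / s) *s a + b) $ i" for i by (simp only: form_scale[OF form])
   thus ?thesis by (simp only: vec_eq_iff vector_smult_component) simp
  qed
  thus "pev (rvec d p) s = pev (\<chi> i. r i) s"
   using pev_rvec(1)[OF deg s] by (simp add: p) (simp add: vec_eq_iff r)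
 qed
 hence R: "pev (rvec d p) t = \<phi> (t *s b + a)" for t by (simp add: vec_eq_iff r[symmetric] add.commute)
 hence "top_coeff d p = \<phi> a" using pev_rvec(2)[OF deg] R[of 0] by simp
 thus ?thesis using that deg p R by blast
qed

lemma chart_real:
 assumes form: "\<And>i. is_real_form d (%x. \<phi> x $ i)" and p: "\<And>t. pev p t = \<phi> (t *s a + b)"
  and ab: "\<And>i. a $ i \<in> \<real>" "\<And>i. b $ i \<in> \<real>"
 shows "coeff (p $ i) j \<in> \<real>"
proof -
 obtain c where c: "\<And>e. c e \<in> \<real>" "(%x. \<phi> x $ i) = form_of d c" using form[of i] by (auto simp: is_real_form_def)
 have cc: "cnj (c e) = c e" for e using c(1) Reals_cnj_iff by blast
 have cab: "cnj (a $ j) = a $ j" "cnj (b $ j) = b $ j" for j using ab Reals_cnj_iff by blast+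
 have "poly (p $ i) (cnj t) = cnj (poly (p $ i) t)" for t
 proof -
  have "poly (p $ i) t = form_of d c (t *s a + b)" for t
   using p[of t] c(2) by (simp add: vec_eq_iff fun_eq_iff)
  thus ?thesis by (simp add: form_of_def cc cab)
 qed
 hence "poly (map_poly cnj (p $ i)) t = poly (p $ i) t" for t
  using poly_cnj[of "p $ i" "cnj t"] by simp
 hence "map_poly cnj (p $ i) = p $ i" by (simp add: poly_eq_poly_eq_iff fun_eq_iff flip: poly_eq_poly_eq_iff)
 hence "cnj (coeff (p $ i) j) = coeff (p $ i) j" by (metis coeff_map_poly complex_cnj_zero)
 thus ?thesis by (simp add: Reals_cnj_iff)
qed

text \<open>The order of vanishing allows every direction, the chart moves only along
  \<open>a\<close>. As \<open>x\<close> and \<open>a\<close> form a basis and the direction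
  \<open>x\<close> does not contribute, both give the same order.\<close>

lemma order_in_chart:
 assumes G: "is_form n G" and v: "vanishes_to_order G x k" and x: "x = l *s (s *s a + b)" "l ~= 0"
  and ab: "cdet a b ~= 0" and q: "\<And>t. G (t *s a + b) = poly q t"
 shows "j < k ==> poly ((pderiv ^^ j) q) s = 0" "poly ((pderiv ^^ k) q) s ~= 0"
proof -
 define r where "r = smult (l ^ n) (pcompose q [:s, 1 / l:])"
 have r: "G (x + t *s a) = poly r t" for t
 proof -
  have "x + t *s a = l *s ((s + t / l) *s a + b)" using x by (simp add: vec_eq_iff field_simps)
  hence "G (x + t *s a) = l ^ n * poly q (s + t / l)" by (simp only: form_scale[OF G] q)
  thus ?thesis by (simp add: r_def poly_pcompose)
 qed
 have D: "(pderiv ^^ j) r = smult (l ^ n * (1 / l) ^ j) (pcompose ((pderiv ^^ j) q) [:s, 1 / l:])" for j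
  by (induction j) (simp_all add: r_def pderiv_smult pderiv_pcompose pderiv_pCons mult_ac)
 have E: "dir_deriv j G x a = l ^ n * (1 / l) ^ j * poly ((pderiv ^^ j) q) s" for j
  unfolding dir_deriv_line(1)[OF r] D by (simp add: poly_pcompose)
 show low: "poly ((pderiv ^^ j) q) s = 0" if "j < k" for j
  using that v E[of j] x(2) by (simp add: vanishes_to_order_def)
 obtain w where w: "dir_deriv k G x w ~= 0" using v by (auto simp: vanishes_to_order_def)
 have ax: "cdet x a ~= 0" using ab x by (simp add: cdet_commute[of a b])
 have "w = (cdet w a / cdet x a) *s x + (cdet x w / cdet x a) *s a"
  using cdet_cramer[of x a w] ax by (simp add: vec_eq_iff field_simps)
 moreover have "dir_deriv j G x a = 0" if "j < k" for j using that v by (simp add: vanishes_to_order_def)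
 ultimately have "dir_deriv k G x a ~= 0" using dir_deriv_shift[OF G, of k x a] w by (metis mult_zero_right)
 thus "poly ((pderiv ^^ k) q) s ~= 0" using E[of k] by auto
qed

lemma cdet_zero [simp]: "cdet a 0 = 0" "cdet 0 a = 0" by (simp_all add: cdet_def)

lemma matrix_vector_row: "(A *v u) $ i = vdot (A $ i) (u :: complex ^ 3)"
 by (simp add: matrix_vector_mult_def vdot_def sum_3)

lemma vdet_mult:
 fixes u v w :: "'a::comm_ring_1 ^ 3"
 shows "vdet \<alpha> \<beta> \<gamma> * vdet u v w
  = vdot \<alpha> u * (vdot \<beta> v * vdot \<gamma> w - vdot \<beta> w * vdot \<gamma> v)
  - vdot \<alpha> v * (vdot \<beta> u * vdot \<gamma> w - vdot \<beta> w * vdot \<gamma> u)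
  + vdot \<alpha> w * (vdot \<beta> u * vdot \<gamma> v - vdot \<beta> v * vdot \<gamma> u)"
 by (simp add: v3_simps algebra_simps)

lemma vdet_rows: "invertible (A :: complex ^ 3 ^ 3) ==> vdet (A $ 1) (A $ 2) (A $ 3) ~= 0"
 unfolding invertible_det_nz det_3 by (simp add: v3_simps algebra_simps)

lemma ramification_rows:
 assumes form: "\<And>i. is_form d (%x. \<phi> x $ i)" and ram: "has_ramification \<phi> x k1 k2"
  and x: "x = l *s (s *s a + b)" "l ~= 0" and ab: "cdet a b ~= 0" and p: "\<And>t. pev p t = \<phi> (t *s a + b)"
 obtains \<alpha> \<beta> \<gamma> where "vdet \<alpha> \<beta> \<gamma> ~= 0" "vdot \<alpha> (pev p s) ~= 0"
  "\<forall>j<k1. poly ((pderiv ^^ j) (lincomb \<beta> p)) s = 0" "poly ((pderiv ^^ k1) (lincomb \<beta> p)) s ~= 0"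
  "\<forall>j<k2. poly ((pderiv ^^ j) (lincomb \<gamma> p)) s = 0" "poly ((pderiv ^^ k2) (lincomb \<gamma> p)) s ~= 0"
proof -
 obtain A :: "complex ^ 3 ^ 3" where A: "invertible A" "vanishes_to_order (%z. (A *v \<phi> z) $ 1) x 0"
  "vanishes_to_order (%z. (A *v \<phi> z) $ 2) x k1" "vanishes_to_order (%z. (A *v \<phi> z) $ 3) x k2"
  using ram unfolding has_ramification_def by blast
 have f: "is_form d (%z. (A *v \<phi> z) $ i)" for i
  unfolding matrix_vector_mult_def by (simp only: vec_lambda_beta) (intro is_form_sum is_form_cmult form)
 have q: "(A *v \<phi> (t *s a + b)) $ i = poly (lincomb (A $ i) p) t" for i t
  by (simp add: matrix_vector_row p)
 note o = order_in_chart[OF f _ x ab q]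
 show ?thesis
  by (rule that[OF vdet_rows[OF A(1)]]) (use o(2)[OF A(2)] o(1)[OF A(3)] o(2)[OF A(3)] o(1)[OF A(4)] o(2)[OF A(4)] in auto)
qed

text \<open>Both P and P' are killed by the independent functionals \<beta> and \<gamma>, hence are
  proportional. In the coordinates \<alpha>, \<beta>, \<gamma> the matrix of P, P'', P''' is
  triangular with nonzero diagonal.\<close>

lemma cusp_in_chart:
 assumes form: "\<And>i. is_form d (%x. \<phi> x $ i)" and ram: "has_ramification \<phi> x 2 3"
  and x: "x = l *s (s *s a + b)" "l ~= 0" and ab: "cdet a b ~= 0" and p: "\<And>t. pev p t = \<phi> (t *s a + b)"
 shows "pev (chi p) s = 0 \<and> cusp_det p s ~= 0"
proof -
 obtain \<alpha> \<beta> \<gamma> where r: "vdet \<alpha> \<beta> \<gamma> ~= 0" "vdot \<alpha> (pev p s) ~= 0"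
  "\<forall>j<2. poly ((pderiv ^^ j) (lincomb \<beta> p)) s = 0" "poly ((pderiv ^^ 2) (lincomb \<beta> p)) s ~= 0"
  "\<forall>j<3. poly ((pderiv ^^ j) (lincomb \<gamma> p)) s = 0" "poly ((pderiv ^^ 3) (lincomb \<gamma> p)) s ~= 0"
  by (rule ramification_rows[OF assms], rule that, assumption+)
 have b: "vdot \<beta> (pev p s) = 0" "vdot \<beta> (pev (pd p) s) = 0" "vdot \<beta> (pev (pd (pd p)) s) ~= 0"
  using spec[OF r(3), of 0] spec[OF r(3), of 1] r(4) by (simp_all add: eval_nat_numeral)
 have c: "vdot \<gamma> (pev p s) = 0" "vdot \<gamma> (pev (pd p) s) = 0" "vdot \<gamma> (pev (pd (pd p)) s) = 0" "vdot \<gamma> (pev (pd (pd (pd p))) s) ~= 0"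
  using spec[OF r(5), of 0] spec[OF r(5), of 1] spec[OF r(5), of 2] r(6) by (simp_all add: eval_nat_numeral)
 have bc: "vcross \<beta> \<gamma> ~= 0"
  using r(1) vdet_rotate(1)[of \<alpha> \<beta> \<gamma>] by (auto simp: vdet_alt vdot_bilinear)
 have "vcross (pev p s) (pev (pd p) s) = 0"
  by (rule vcross_eq_0_trans[OF bc]) (intro vperp2 bc b c)+
 moreover have "vdet \<alpha> \<beta> \<gamma> * cusp_det p s ~= 0"
  unfolding vdet_mult using r(2) b c by simp
 ultimately show ?thesis by (auto simp: pev_chi)
qed

lemma flex_in_chart:
 assumes form: "\<And>i. is_form d (%x. \<phi> x $ i)" and ram: "has_ramification \<phi> x 1 3"
  and x: "x = l *s (s *s a + b)" "l ~= 0" and ab: "cdet a b ~= 0" and p: "\<And>t. pev p t = \<phi> (t *s a + b)"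
 shows "osc_det p s = 0 \<and> flex_det p s ~= 0"
proof -
 obtain \<alpha> \<beta> \<gamma> where r: "vdet \<alpha> \<beta> \<gamma> ~= 0" "vdot \<alpha> (pev p s) ~= 0"
  "\<forall>j<1. poly ((pderiv ^^ j) (lincomb \<beta> p)) s = 0" "poly ((pderiv ^^ 1) (lincomb \<beta> p)) s ~= 0"
  "\<forall>j<3. poly ((pderiv ^^ j) (lincomb \<gamma> p)) s = 0" "poly ((pderiv ^^ 3) (lincomb \<gamma> p)) s ~= 0"
  by (rule ramification_rows[OF assms], rule that, assumption+)
 have b: "vdot \<beta> (pev p s) = 0" "vdot \<beta> (pev (pd p) s) ~= 0"
  using spec[OF r(3), of 0] r(4) by simp_all
 have c: "vdot \<gamma> (pev p s) = 0" "vdot \<gamma> (pev (pd p) s) = 0" "vdot \<gamma> (pev (pd (pd p)) s) = 0" "vdot \<gamma> (pev (pd (pd (pd p))) s) ~= 0"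
  using spec[OF r(5), of 0] spec[OF r(5), of 1] spec[OF r(5), of 2] r(6) by (simp_all add: eval_nat_numeral)
 have "vdet \<alpha> \<beta> \<gamma> * osc_det p s = 0"
  "vdet \<alpha> \<beta> \<gamma> * flex_det p s ~= 0"
  unfolding vdet_mult using r(2) b c by simp_all
 thus ?thesis using r(1) by auto
qed

lemma real_avoid: "finite (S :: complex set) ==> \<exists>t\<in>\<real>. t \<notin> S"
proof (rule ccontr)
 assume "finite S" "\<not> (\<exists>t\<in>\<real>. t \<notin> S)"
 moreover have "range (of_nat :: nat => complex) \<subseteq> \<real>" by auto
 ultimately have "finite (range (of_nat :: nat => complex))" by (meson finite_subset subset_iff)
 thus False using finite_imageD[OF _ inj_of_nat] infinite_UNIV_nat by blast
qed

text \<open>A real vector spanning the point yields \<open>s\<close> as a quotient of two real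
  determinants.\<close>

lemma real_subspace_chart:
 assumes real: "real_subspace (proj_pt (s *s a + b))" and ab: "\<And>i. a $ i \<in> \<real>" "\<And>i. b $ i \<in> \<real>" and "cdet a b ~= 0"
 shows "s \<in> \<real>"
proof -
 obtain B where B: "\<And>v i. v \<in> B ==> v $ i \<in> \<real>" "proj_pt (s *s a + b) = vec.span B" using real by (auto simp: real_subspace_def)
 have ne: "cdet a (s *s a + b) ~= 0" using assms(4) by simp
 have "\<exists>v\<in>B. v ~= 0"
 proof (rule ccontr)
  assume "\<not> (\<exists>v\<in>B. v ~= 0)"
  hence "vec.span B \<subseteq> {0}" by (metis vec.span_mono vec.span_empty vec.span_insert_0 subset_singleton_iff insertCI subsetI)
  hence "s *s a + b = 0" unfolding B(2)[symmetric] proj_pt_def using vec.span_base[of "s *s a + b" "{s *s a + b}"] by blast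
  hence "cdet a (s *s a + b) = cdet a (0 *s a)" by simp
  thus False using ne by simp
 qed
 then obtain v where v: "v \<in> B" "v ~= 0" by blast
 hence "v \<in> proj_pt (s *s a + b)" unfolding B(2) by (simp add: vec.span_base)
 then obtain k where k: "v = k *s (s *s a + b)" by (auto simp: proj_pt_def vec.span_singleton)
 have "cdet a v \<in> \<real>" "cdet v b \<in> \<real>" using ab B(1)[OF v(1)] by (simp_all add: cdet_def)
 hence "cdet v b / cdet a v \<in> \<real>" by (rule Reals_divide[rotated])
 moreover have "k ~= 0" using k v(2) by auto
 hence "cdet v b / cdet a v = s" unfolding k cdet_simps using assms(4) by simp
 ultimately show ?thesis by simp
qed

section \<open>Maximally inflected curves in a chart\<close>

locale inflected_curve =
 fixes d :: nat and \<phi> :: "complex ^ 2 => complex ^ 3"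
 assumes d3: "d \<ge> 3" and mi: "maximally_inflected d \<phi>"
  and count: "2 * card (cusps \<phi>) + card (flexes \<phi>) = 3 * (d - 2)"
begin

lemma form: "is_form d (%x. \<phi> x $ i)" and real_form: "is_real_form d (%x. \<phi> x $ i)"
 using mi by (simp_all add: maximally_inflected_def rational_plane_curve_def)

lemma phi_scale: "\<phi> (k *s x) = k ^ d *s \<phi> x"
 using form_scale[OF form] by (simp add: vec_eq_iff)

lemma exists_independent: "x ~= 0 ==> \<exists>a. cdet a x ~= 0"
proof -
 assume x: "x ~= (0 :: complex ^ 2)"
 then consider "x $ 1 ~= 0" | "x $ 2 ~= 0" by (auto simp: vec_eq_iff forall_2)
 thus ?thesis
  by cases (rule exI[of _ "axis 2 1"], simp add: cdet_def axis_def, rule exI[of _ "axis 1 1"], simp add: cdet_def axis_def)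
qed

text \<open>A common zero \<open>x\<close> of the components would give them the common linear
  factor \<open>cdet z x\<close>, against coprimality.\<close>

lemma phi_nonzero: assumes x: "x ~= 0" shows "\<phi> x ~= 0"
proof
 assume x0: "\<phi> x = 0"
 obtain a where a: "cdet a x ~= 0" using exists_independent[OF x] by blast
 define D where "D = cdet a x"
 define h where "h = (%z. cdet z x)"
 define l m :: "complex ^ 2" where "l = (\<chi> i. if i = 1 then x $ 2 else - x $ 1)" and "m = (\<chi> i. if i = 1 then - a $ 2 else a $ 1)"
 have l: "cdet z x = (\<Sum>i\<in>UNIV. l $ i * z $ i)" "cdet a z = (\<Sum>i\<in>UNIV. m $ i * z $ i)" for z
  by (simp_all add: cdet_def sum_2 l_def m_def)
 have "is_form 1 h" using is_form_linear_power[of 1 l] by (simp add: h_def l)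
 moreover have "\<exists>n g. is_form n g \<and> (\<forall>z. \<phi> z $ i = h z * g z)" for i
 proof -
  obtain p where p: "\<And>j. degree (p $ j) \<le> d" "\<And>t. pev p t = \<phi> (t *s a + x)" "top_coeff d p = \<phi> a" "\<And>t. pev (rvec d p) t = \<phi> (t *s x + a)"
   by (rule chart_exists[OF form, where a = a and b = x], rule that, assumption+)
  have "poly (p $ i) 0 = 0" using p(2)[of 0] x0 by (simp add: vec_eq_iff)
  then obtain q where q: "p $ i = pCons 0 q" by (cases "p $ i") auto
  have dq: "degree q \<le> d - 1" using p(1)[of i] d3 by (cases "q = 0") (auto simp: q)
  \<comment> \<open>The quotient \<open>q\<close> of the component by the chart parameter, made
    homogeneous in \<open>cdet z x\<close> and \<open>cdet a z\<close>; the power of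
    \<open>D\<close> compensates Cramer's rule.\<close>
  define g where "g = (%z. \<Sum>k\<le>d - 1. (1 / D ^ d * coeff q k) * (cdet z x ^ k * cdet a z ^ (d - 1 - k)))"
  have "is_form (d - 1) g" unfolding g_def
  proof (intro is_form_sum is_form_cmult)
   fix k assume "k \<in> {..d - 1}"
   hence "k + (d - 1 - k) = d - 1" by simp
   thus "is_form (d - 1) (%z. cdet z x ^ k * cdet a z ^ (d - 1 - k))"
    using is_form_linear_power_mult[OF is_form_linear_power, of k "d - 1 - k" l m] by (simp only: l)
  qed
  moreover have "\<phi> z $ i = h z * g z" for z
  proof -
   define X Y where "X = cdet z x" and "Y = cdet a z"
   have dd: "d = Suc (d - 1)" using d3 by simp
   have sg: "D ^ d * g z = (\<Sum>k\<le>d - 1. coeff q k * (X ^ k * Y ^ (d - 1 - k)))"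
    using a by (simp add: g_def D_def X_def Y_def sum_distrib_left)
   have "D ^ d * \<phi> z $ i = \<phi> (X *s a + Y *s x) $ i"
    using form_scale[OF form, of D z i] cdet_cramer[of a x z] by (simp add: D_def X_def Y_def)
   also have "\<dots> = X * (D ^ d * g z)"
   \<comment> \<open>For \<open>Y = 0\<close> the point is \<open>a\<close>, which the chart misses,
     and only the top coefficient contributes.\<close>
   proof (cases "Y = 0")
    case True
    have "\<phi> (X *s a + Y *s x) $ i = X ^ d * coeff (p $ i) d"
     using True p(3) form_scale[OF form, of X a i] by (simp add: vec_eq_iff)
    also have "coeff (p $ i) d = coeff q (d - 1)" by (subst dd) (simp add: q)
    also have "X ^ d * coeff q (d - 1) = X * (\<Sum>k\<in>{d - 1}. coeff q k * (X ^ k * Y ^ (d - 1 - k)))"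
     by (subst dd) simp
    also have "(\<Sum>k\<in>{d - 1}. coeff q k * (X ^ k * Y ^ (d - 1 - k))) = D ^ d * g z"
     unfolding sg by (rule sum.mono_neutral_left) (auto simp: True)
    finally show ?thesis .
   next
    case False
    have "X *s a + Y *s x = Y *s ((X / Y) *s a + x)" using False by (simp add: vec_eq_iff field_simps)
    hence "\<phi> (X *s a + Y *s x) $ i = Y ^ d * poly (p $ i) (X / Y)"
     by (simp only: form_scale[OF form] p(2)[symmetric] pev_nth)
    also have "\<dots> = X * (Y ^ (d - 1) * poly q (X / Y))" using False by (subst dd) (simp add: q)
    also have "poly q (X / Y) = (\<Sum>k\<le>d - 1. coeff q k * (X / Y) ^ k)" unfolding poly_altdef
     by (rule sum.mono_neutral_left) (use dq in \<open>auto simp: coeff_eq_0\<close>)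
    also have "Y ^ (d - 1) * \<dots> = (\<Sum>k\<le>d - 1. coeff q k * (X ^ k * Y ^ (d - 1 - k)))"
     unfolding sum_distrib_left
    proof (intro sum.cong refl)
     fix k assume "k \<in> {..d - 1}"
     hence "d - 1 = k + (d - 1 - k)" by auto
     hence "Y ^ (d - 1) = Y ^ k * Y ^ (d - 1 - k)" by (metis power_add)
     thus "Y ^ (d - 1) * (coeff q k * (X / Y) ^ k) = coeff q k * (X ^ k * Y ^ (d - 1 - k))"
      using False by (simp only: power_divide) simp
    qed
    finally show ?thesis unfolding sg .
   qed
   finally show ?thesis using a by (simp add: h_def X_def D_def)
  qed
  ultimately show ?thesis by blast
 qed
 ultimately have "(1::nat) = 0" using mi unfolding maximally_inflected_def rational_plane_curve_def by blast
 thus False by simp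
qed

lemma chart_nonzero: "cdet a b ~= 0 ==> t *s a + b ~= 0"
proof
 assume "cdet a b ~= 0" "t *s a + b = 0"
 hence "cdet a (t *s a + b) = cdet a (0 *s a)" by simp
 thus False using \<open>cdet a b ~= 0\<close> by simp
qed

lemma chart_cusp:
 assumes ab: "cdet a b ~= 0" and p: "\<And>t. pev p t = \<phi> (t *s a + b)" and s: "proj_pt (s *s a + b) \<in> cusps \<phi>"
 shows "pev (chi p) s = 0 \<and> cusp_det p s ~= 0"
proof -
 obtain x where x: "proj_pt (s *s a + b) = proj_pt x" "has_ramification \<phi> x 2 3" using s by (auto simp: cusps_def)
 then obtain k where "k ~= 0" "x = k *s (s *s a + b)" using proj_pt_eq[OF chart_nonzero[OF ab]] by blast
 thus ?thesis using cusp_in_chart[OF form x(2) _ _ ab p] by blast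
qed

lemma chart_flex:
 assumes ab: "cdet a b ~= 0" and p: "\<And>t. pev p t = \<phi> (t *s a + b)" and s: "proj_pt (s *s a + b) \<in> flexes \<phi>"
 shows "osc_det p s = 0 \<and> flex_det p s ~= 0"
proof -
 obtain x where x: "proj_pt (s *s a + b) = proj_pt x" "has_ramification \<phi> x 1 3" using s by (auto simp: flexes_def)
 then obtain k where "k ~= 0" "x = k *s (s *s a + b)" using proj_pt_eq[OF chart_nonzero[OF ab]] by blast
 thus ?thesis using flex_in_chart[OF form x(2) _ _ ab p] by blast
qed

lemma inj_chart: "cdet a b ~= 0 ==> inj (%t. proj_pt (t *s a + b))"
proof (rule injI)
 fix s t assume ab: "cdet a b ~= 0" and "proj_pt (s *s a + b) = proj_pt (t *s a + b)"
 then obtain k where k: "t *s a + b = k *s (s *s a + b)" using proj_pt_eq[OF chart_nonzero[OF ab]] by blast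
 have "cdet a (t *s a + b) = cdet a (k *s (s *s a + b))" "cdet (t *s a + b) b = cdet (k *s (s *s a + b)) b"
  unfolding k by (rule refl)+
 hence "1 = k" "t = k * s" using ab by simp_all
 thus "s = t" by simp
qed

lemma chart_surj:
 assumes "cdet a b ~= 0" "L \<in> cusps \<phi> \<union> flexes \<phi>" "L ~= proj_pt a"
 shows "\<exists>s. L = proj_pt (s *s a + b)"
proof -
 obtain x where x: "L = proj_pt x" "x ~= 0" using assms(2) by (auto simp: cusps_def flexes_def)
 show ?thesis
 proof (rule cdet_cases[OF assms(1) x(2)])
  fix k assume k: "k ~= 0" "x = k *s a"
  hence "a ~= 0" using x by auto
  hence "proj_pt a = proj_pt x" using proj_pt_eq k by blast
  thus ?thesis using x assms by simp
 next
  fix k t assume "k ~= 0" "x = k *s (t *s a + b)"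
  hence "proj_pt (t *s a + b) = proj_pt x" using proj_pt_eq[OF chart_nonzero[OF assms(1)]] by blast
  thus ?thesis using x by auto
 qed
qed

text \<open>The cardinality of an infinite set is 0, so \<open>count\<close> alone does not give
  finiteness. It gives one cusp or flex; there a derivative of the Wronskian is nonzero, and all
  cusps and flexes of the chart are zeros of the Wronskian.\<close>

lemma finite_cusps_flexes: "finite (cusps \<phi> \<union> flexes \<phi>)"
proof -
 have "cusps \<phi> ~= {} \<or> flexes \<phi> ~= {}" using count d3 by auto
 then obtain x where x: "x ~= 0" "proj_pt x \<in> cusps \<phi> \<or> proj_pt x \<in> flexes \<phi>" unfolding cusps_def flexes_def by blast
 obtain a where a: "cdet a x ~= 0" using exists_independent[OF x(1)] by blast
 obtain p where p: "\<And>t. pev p t = \<phi> (t *s a + x)" by (rule chart_exists[OF form, where a = a and b = x], rule that, assumption+)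
 define W where "W = vdet p (pd p) (pd (pd p))"
 have "W ~= 0"
 proof
  assume W: "W = 0"
  hence 1: "vdet p (pd p) (pd (pd (pd p))) = 0" using pderiv_vdet[of p "pd p" "pd (pd p)"] by (simp add: W_def)
  hence 2: "vdet p (pd (pd p)) (pd (pd (pd p))) + vdet p (pd p) (pd (pd (pd (pd p)))) = 0"
   using pderiv_vdet[of p "pd p" "pd (pd (pd p))"] by simp
  show False using x(2)
  proof
   assume "proj_pt x \<in> cusps \<phi>"
   hence c: "vcross (pev p 0) (pev (pd p) 0) = 0" "cusp_det p 0 ~= 0"
    using chart_cusp[OF a p, of 0] by (simp_all add: pev_chi)
   have "cusp_det p 0 = 0"
    using arg_cong[OF 2, of "%q. poly q 0"] by (simp add: vdet_alt[of "pev p 0" "pev (pd p) 0"] c(1) vdot_bilinear)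
   thus False using c by simp
  next
   assume "proj_pt x \<in> flexes \<phi>"
   thus False using chart_flex[OF a p, of 0] arg_cong[OF 1, of "%q. poly q 0"] by simp
  qed
 qed
 hence fin: "finite {s. poly W s = 0}" by (rule poly_roots_finite)
 have "cusps \<phi> \<union> flexes \<phi> \<subseteq> insert (proj_pt a) ((%s. proj_pt (s *s a + x)) ` {s. poly W s = 0})"
 proof
  fix L assume L: "L \<in> cusps \<phi> \<union> flexes \<phi>"
  show "L \<in> insert (proj_pt a) ((%s. proj_pt (s *s a + x)) ` {s. poly W s = 0})"
  proof (cases "L = proj_pt a")
   case False
   then obtain s where s: "L = proj_pt (s *s a + x)" using chart_surj[OF a L] by blast
   have "poly W s = 0"
   proof (cases "L \<in> cusps \<phi>")
    case True
    thus ?thesis using chart_cusp[OF a p, of s] by (simp add: s W_def pev_chi vdet_alt vdot_bilinear)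
   next
    case False
    thus ?thesis using chart_flex[OF a p, of s] L by (simp add: s W_def)
   qed
   thus ?thesis using s by blast
  qed simp
 qed
 thus ?thesis using fin by (meson finite_imageI finite_insert finite_subset)
qed

lemma ramified_real: "L \<in> cusps \<phi> \<union> flexes \<phi> ==> real_subspace L"
proof -
 assume "L \<in> cusps \<phi> \<union> flexes \<phi>"
 then obtain x where x: "L = proj_pt x" "x ~= 0" "has_ramification \<phi> x 2 3 \<or> has_ramification \<phi> x 1 3"
  by (auto simp: cusps_def flexes_def)
 have "(2, 3) ~= (1, 2 :: nat)" "(1, 3) ~= (1 :: nat, 2 :: nat)" by simp_all
 hence "L \<in> ramification_points \<phi>" unfolding ramification_points_def using x by blast
 thus ?thesis using mi by (simp add: maximally_inflected_def)
qed

lemma chart_inflected: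
 assumes ab: "cdet a b ~= 0" and re: "\<And>i. a $ i \<in> \<real>" "\<And>i. b $ i \<in> \<real>" and a: "proj_pt a \<notin> cusps \<phi> \<union> flexes \<phi>"
  and p: "\<And>i. degree (p $ i) \<le> d" "\<And>t. pev p t = \<phi> (t *s a + b)" "top_coeff d p = \<phi> a"
 defines "K \<equiv> {s. proj_pt (s *s a + b) \<in> cusps \<phi>}" and "F \<equiv> {s. proj_pt (s *s a + b) \<in> flexes \<phi>}"
 shows "inflected p d K F" "K \<subseteq> \<real>" "F \<subseteq> \<real>" "card K = card (cusps \<phi>)" "card F = card (flexes \<phi>)"
proof -
 note inj = inj_chart[OF ab]
 have "(%s. proj_pt (s *s a + b)) ` K = cusps \<phi>" "(%s. proj_pt (s *s a + b)) ` F = flexes \<phi>"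
  using chart_surj[OF ab] a unfolding K_def F_def by blast+
 hence bij: "bij_betw (%s. proj_pt (s *s a + b)) K (cusps \<phi>)" "bij_betw (%s. proj_pt (s *s a + b)) F (flexes \<phi>)"
  using inj by (auto simp: bij_betw_def intro: inj_on_subset)
 show cards: "card K = card (cusps \<phi>)" "card F = card (flexes \<phi>)" using bij by (auto intro: bij_betw_same_card)
 have fin: "finite K" "finite F" using bij finite_cusps_flexes by (auto simp: bij_betw_finite)
 show "K \<subseteq> \<real>" "F \<subseteq> \<real>" using real_subspace_chart[OF ramified_real re ab] unfolding K_def F_def by blast+
 show "inflected p d K F"
 proof
  show "pev p t ~= 0" for t unfolding p(2) by (rule phi_nonzero[OF chart_nonzero[OF ab]])
  have "a ~= 0"
  proof
   assume "a = 0" thus False using ab by (simp add: cdet_def)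
  qed
  thus "top_coeff d p ~= 0" unfolding p(3) by (rule phi_nonzero)
 qed (use p(1) d3 fin cards count chart_cusp[OF ab p(2)] chart_flex[OF ab p(2)] in \<open>simp_all add: K_def F_def\<close>)
qed

text \<open>Two charts are needed. In the first, only the point at infinity is unramified, which
  suffices for finiteness of the coincidences. Then two real points outside the finitely many bad
  ones become infinity and origin of the second chart.\<close>

lemma good_chart:
 obtains a b p K F where "cdet a b ~= 0" "\<And>i. degree (p $ i) \<le> d" "\<And>t. pev p t = \<phi> (t *s a + b)"
  "top_coeff d p = \<phi> a" "\<And>t. pev (rvec d p) t = \<phi> (t *s b + a)"
  "\<And>y. cdet a y ~= 0 ==> vcross (\<phi> a) (\<phi> y) ~= 0" "\<And>y. cdet b y ~= 0 ==> vcross (\<phi> b) (\<phi> y) ~= 0"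
  "inflected p d K F" "K \<subseteq> \<real>" "F \<subseteq> \<real>" "card K = card (cusps \<phi>)" "card F = card (flexes \<phi>)"
  "K = {s. proj_pt (s *s a + b) \<in> cusps \<phi>}" "\<And>i j. coeff (p $ i) j \<in> \<real>"
proof -
 define e1 e2 :: "complex ^ 2" where "e1 = axis 1 1" and "e2 = axis 2 1"
 have e: "cdet e1 e2 ~= 0" "e1 $ i \<in> \<real>" "e2 $ i \<in> \<real>" for i by (auto simp: e1_def e2_def cdet_def axis_def)
 have "finite ((%t. proj_pt (t *s e1 + e2)) -` (cusps \<phi> \<union> flexes \<phi>))"
  by (intro finite_vimageI finite_cusps_flexes inj_chart e)
 then obtain t0 where t0: "t0 \<in> \<real>" "proj_pt (t0 *s e1 + e2) \<notin> cusps \<phi> \<union> flexes \<phi>" using real_avoid by blast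
 define a0 where "a0 = t0 *s e1 + e2"
 have re0: "a0 $ i \<in> \<real>" for i using t0 e by (simp add: a0_def)
 have c0: "cdet a0 e1 ~= 0" using e(1) by (simp add: a0_def cdet_commute[of e1 e2])
 obtain p0 where p0: "\<And>i. degree (p0 $ i) \<le> d" "\<And>t. pev p0 t = \<phi> (t *s a0 + e1)" "top_coeff d p0 = \<phi> a0"
  by (rule chart_exists[OF form, where a = a0 and b = e1], rule that, assumption+)
 define K0 F0 where "K0 = {s. proj_pt (s *s a0 + e1) \<in> cusps \<phi>}" and "F0 = {s. proj_pt (s *s a0 + e1) \<in> flexes \<phi>}"
 interpret i0: inflected p0 d K0 F0 unfolding K0_def F0_def
  by (rule chart_inflected(1)[OF c0 re0 e(2) t0(2)[folded a0_def] p0])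
 define N where "N = {s. \<exists>t. t ~= s \<and> meet p0 s t}"
 have N: "finite N" unfolding N_def by (rule i0.finite_pairs)
 have A0: "\<phi> a0 ~= 0" using i0.top p0(3) by simp
 \<comment> \<open>Parameters sharing the image of the point at infinity; were all parameters of
   this kind, all of them would coincide pairwise.\<close>
 define M where "M = {s. vcross (pev p0 s) (\<phi> a0) = 0}"
 have M: "finite M"
 proof (cases "\<exists>s. vcross (pev p0 s) (\<phi> a0) ~= 0")
  case True thus ?thesis unfolding M_def using finite_vcross_eq_0 by blast
 next
  case False
  hence "vcross (\<phi> a0) (pev p0 s) = 0" for s using vcross_eq_0_commute by blast
  hence "meet p0 s t" for s t using vcross_eq_0_trans[OF A0] by blast
  hence "s \<in> N" for s unfolding N_def by (intro CollectI exI[of _ "s + 1"]) simp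
  hence "N = UNIV" by blast
  thus ?thesis using N infinite_UNIV_char_0[where 'a = complex] by simp
 qed
 define B where "B = N \<union> M \<union> K0 \<union> F0"
 have B: "finite B" unfolding B_def using N M i0.fin by simp
 obtain t1 where t1: "t1 \<in> \<real>" "t1 \<notin> B" using real_avoid[OF B] by blast
 obtain t2 where t2: "t2 \<in> \<real>" "t2 \<notin> insert t1 B" using real_avoid[of "insert t1 B"] B by blast
 \<comment> \<open>A point outside \<open>B\<close> is separated by \<phi> from all other points:
   from the chart by \<open>N\<close>, from its point at infinity by \<open>M\<close>.\<close>
 have lone: "vcross (\<phi> (t *s a0 + e1)) (\<phi> y) ~= 0" if t: "t \<notin> B" and y: "cdet (t *s a0 + e1) y ~= 0" for t y
 proof -
  have "y ~= 0"
  proof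
   assume "y = 0" thus False using y by (simp add: cdet_def)
  qed
  thus ?thesis
  proof (rule cdet_cases[OF c0])
   fix k assume "k ~= 0" "y = k *s a0"
   thus ?thesis using t by (simp add: phi_scale vcross_bilinear B_def M_def p0(2))
  next
   fix k u assume k: "k ~= 0" "y = k *s (u *s a0 + e1)"
   have "cdet X (k *s X) = 0" for X by (simp only: cdet_simps mult_zero_right)
   hence "u ~= t" using y k(2) by blast
   hence "\<not> meet p0 t u" using t by (auto simp: B_def N_def)
   thus ?thesis using k(1) unfolding k(2) phi_scale p0(2) by (simp add: vcross_bilinear del: vector_add_ldistrib)
  qed
 qed
 define a b where "a = t1 *s a0 + e1" and "b = t2 *s a0 + e1"
 have "cdet a b = (t1 - t2) * cdet a0 e1" unfolding a_def b_def by (simp add: cdet_commute[of e1 a0] algebra_simps)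
 hence ab: "cdet a b ~= 0" using c0 t2(2) by auto
 have re: "a $ i \<in> \<real>" "b $ i \<in> \<real>" for i using t1 t2 re0 e by (simp_all add: a_def b_def)
 have na: "proj_pt a \<notin> cusps \<phi> \<union> flexes \<phi>" using t1(2) by (auto simp: a_def B_def K0_def F0_def)
 obtain p where p: "\<And>i. degree (p $ i) \<le> d" "\<And>t. pev p t = \<phi> (t *s a + b)" "top_coeff d p = \<phi> a"
  "\<And>t. pev (rvec d p) t = \<phi> (t *s b + a)"
  by (rule chart_exists[OF form, where a = a and b = b], rule that, assumption+)
 note c = chart_inflected[OF ab re na p(1-3)]
 have re_p: "coeff (p $ i) j \<in> \<real>" for i j by (rule chart_real[OF real_form p(2) re])
 show ?thesis
  by (rule that[OF ab p _ _ c refl re_p]) (use lone[of t1] lone[of t2] t1 t2 in \<open>simp_all add: a_def b_def\<close>)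
qed

end

section \<open>Equations of the image curve\<close>

lemma poly_growth:
 fixes q :: "complex poly"
 shows "\<exists>C\<ge>0. \<exists>m. \<forall>t R. 1 \<le> R --> norm t \<le> R --> norm (poly q t) \<le> C * R ^ m"
proof (induction q)
 case 0 thus ?case by (intro exI[of _ 0]) auto
next
 case (pCons a q)
 then obtain C m where C: "C \<ge> 0" "\<And>t R. 1 \<le> R ==> norm t \<le> R ==> norm (poly q t) \<le> C * R ^ m" by blast
 have "norm (poly (pCons a q) t) \<le> (norm a + C) * R ^ Suc m" if R: "1 \<le> R" "norm t \<le> R" for t R
 proof -
  have "norm (poly (pCons a q) t) \<le> norm a + norm t * norm (poly q t)"
   using norm_triangle_ineq[of a "t * poly q t"] by (simp add: norm_mult)
  also have "\<dots> \<le> norm a * R ^ Suc m + R * (C * R ^ m)"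
  proof (intro add_mono mult_mono C R)
   show "norm a \<le> norm a * R ^ Suc m" using one_le_power[OF R(1), of "Suc m"] by (simp add: mult_le_cancel_left1)
  qed (use R in auto)
  finally show ?thesis by (simp add: algebra_simps)
 qed
 thus ?case using C(1) by (intro exI[of _ "norm a + C"] conjI exI[of _ "Suc m"]) auto
qed

lemma coeff_linear_mult: "coeff ([:a, b:] * q) j = a * coeff q j + b * (case j of 0 => 0 | Suc i => coeff q i)"
 for a b :: "'a::comm_ring_1"
 by (simp add: mult_pCons_left coeff_pCons split: nat.split)

context fibration
begin

text \<open>The norm of y f - h over a fibre: its roots are the ordinates h/f of the points of the
  curve with the given abscissa.\<close>

definition eliminant :: "complex poly => complex list => complex poly" where
 "eliminant h rs = (\<Prod>r\<leftarrow>rs. [:- poly h r, poly f r:])"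

lemma eliminant_simps: "eliminant h [] = 1"
 "coeff (eliminant h (r # rs)) j = - poly h r * coeff (eliminant h rs) j
  + poly f r * (case j of 0 => 0 | Suc i => coeff (eliminant h rs) i)"
 unfolding eliminant_def list.map prod_list.Cons coeff_linear_mult by simp_all

lemma degree_eliminant: "degree (eliminant h rs) \<le> length rs"
proof (induction rs)
 case (Cons r rs)
 have "eliminant h (r # rs) = [:- poly h r, poly f r:] * eliminant h rs" by (simp add: eliminant_def)
 moreover have "degree ([:- poly h r, poly f r:] * eliminant h rs) \<le> 1 + length rs"
  by (rule order_trans[OF degree_mult_le add_mono[OF _ Cons.IH]]) simp
 ultimately show ?case by simp
qed (simp add: eliminant_def)

lemma poly_eliminant: "poly (eliminant h rs) y = (\<Prod>r\<leftarrow>rs. y * poly f r - poly h r)"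
 by (induction rs) (simp_all add: eliminant_def algebra_simps)

lemma eliminant_mset: "mset xs = mset ys ==> eliminant h xs = eliminant h ys"
 unfolding eliminant_def by (simp only: prod_mset_prod_list[symmetric] mset_map)

text \<open>Each coefficient is a symmetric function of the fibre. The degree bound is uniform in
  the index, as the homogeneous equation needs one degree for all terms.\<close>

lemma eliminant_coeff_polynomial: "\<exists>N c. \<forall>j. degree (c j) \<le> N \<and> (\<forall>x. coeff (eliminant h (fibre x)) j = poly (c j) x)"
proof -
 obtain C1 m1 where C1: "C1 \<ge> 0" "\<And>t R. 1 \<le> R ==> norm t \<le> R ==> norm (poly f t) \<le> C1 * R ^ m1"
  using poly_growth[of f] by blast
 obtain C2 m2 where C2: "C2 \<ge> 0" "\<And>t R. 1 \<le> R ==> norm t \<le> R ==> norm (poly h t) \<le> C2 * R ^ m2"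
  using poly_growth[of h] by blast
 define m where "m = m1 + m2"
 have "\<exists>q. degree q \<le> n * m \<and> (\<forall>x. coeff (eliminant h (fibre x)) j = poly q x)" for j
 proof (rule symmetric_polynomial)
  show "coeff (eliminant h xs) j = coeff (eliminant h ys) j" if "mset xs = mset ys" for xs ys
   using eliminant_mset[OF that] by simp
 next
  fix xss :: "nat => complex list" and xs
  assume len: "\<And>k. length (xss k) = n" "length xs = n" and lim: "\<And>i. i < n ==> (%k. xss k ! i) \<longlonglongrightarrow> xs ! i"
  have "\<forall>j. (%k. coeff (eliminant h (map (%i. xss k ! i) is)) j) \<longlonglongrightarrow> coeff (eliminant h (map (%i. xs ! i) is)) j"
   if "set is \<subseteq> {..<n}" for "is"
   using that
  proof (induction "is")
   case Nil thus ?case by simp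
  next
   case (Cons i "is")
   hence "(%k. xss k ! i) \<longlonglongrightarrow> xs ! i" using lim by simp
   thus ?case using Cons by (auto simp: eliminant_simps intro!: tendsto_intros split: nat.split)
  qed
  from this[of "[0..<n]"] show "(%k. coeff (eliminant h (xss k)) j) \<longlonglongrightarrow> coeff (eliminant h xs) j"
   using len map_nth[of xs] map_nth[of "xss _"] by (simp add: atLeast0LessThan)
 next
  fix U and \<tau> :: "nat => complex => complex"
  assume U: "open U" "\<And>i. i < n ==> \<tau> i holomorphic_on U"
  have "\<forall>j. (%x. coeff (eliminant h (map (%i. \<tau> i x) is)) j) holomorphic_on U" if "set is \<subseteq> {..<n}" for "is"
   using that
  proof (induction "is")
   case Nil thus ?case by simp
  next
   case (Cons i "is")
   have ph: "(%x. poly q (\<tau> i x)) holomorphic_on U" for q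
   proof (induction q)
    case (pCons a q) thus ?case using Cons.prems U(2) by (auto intro!: holomorphic_intros)
   qed simp
   show ?case
   proof
    fix j show "(%x. coeff (eliminant h (map (%i. \<tau> i x) (i # is))) j) holomorphic_on U"
     using Cons ph U(2) by (cases j) (auto simp: eliminant_simps intro!: holomorphic_intros)
   qed
  qed
  from this[of "[0..<n]"] show "(%x. coeff (eliminant h (map (%i. \<tau> i x) [0..<n])) j) holomorphic_on U"
   by (simp add: atLeast0LessThan)
 next
  fix xs :: "complex list" and R :: real
  assume len: "length xs = n" and R: "1 \<le> R" and x: "\<And>x. x \<in> set xs ==> norm x \<le> R"
  have "\<forall>j. norm (coeff (eliminant h ys) j) \<le> ((C1 + C2) * R ^ m) ^ length ys" if "set ys \<subseteq> set xs" for ys :: "complex list"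
   using that
  proof (induction ys)
   case Nil thus ?case by (simp add: eliminant_simps coeff_1)
  next
   case (Cons r ys)
   let ?B = "((C1 + C2) * R ^ m) ^ length ys"
   have r: "norm r \<le> R" using Cons.prems x by simp
   have B: "?B \<ge> 0" using C1(1) C2(1) R by simp
   have mono: "R ^ m1 \<le> R ^ m" "R ^ m2 \<le> R ^ m" using R by (auto simp: m_def intro: power_increasing)
   have ch: "norm (poly h r) \<le> C2 * R ^ m" using C2(2)[OF R r] mult_left_mono[OF mono(2) C2(1)] by linarith
   have cf: "norm (poly f r) \<le> C1 * R ^ m" using C1(2)[OF R r] mult_left_mono[OF mono(1) C1(1)] by linarith
   show ?case
   proof
    fix j
    have b: "norm (coeff (eliminant h ys) j) \<le> ?B" "norm (case j of 0 => 0 | Suc i => coeff (eliminant h ys) i) \<le> ?B"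
     using Cons B by (auto split: nat.split)
    have "norm (coeff (eliminant h (r # ys)) j) \<le> norm (poly h r) * norm (coeff (eliminant h ys) j)
     + norm (poly f r) * norm (case j of 0 => 0 | Suc i => coeff (eliminant h ys) i)"
     unfolding eliminant_simps by (rule order_trans[OF norm_triangle_ineq]) (simp add: norm_mult)
    also have "\<dots> \<le> C2 * R ^ m * ?B + C1 * R ^ m * ?B"
     using C1(1) C2(1) R by (intro add_mono mult_mono ch cf b) auto
    also have "\<dots> = ((C1 + C2) * R ^ m) ^ length (r # ys)" by (simp add: algebra_simps)
    finally show "norm (coeff (eliminant h (r # ys)) j) \<le> ((C1 + C2) * R ^ m) ^ length (r # ys)" .
   qed
  qed
  from this[of xs] show "norm (coeff (eliminant h xs) j) \<le> (C1 + C2) ^ n * R ^ (n * m)"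
   using len by (simp add: power_mult_distrib flip: power_mult mult.commute[of n m])
 qed
 thus ?thesis by metis
qed

lemma simple_in_fibre:
 assumes s: "poly g s = x * poly f s" and w: "poly wronski s ~= 0"
 obtains rs where "mset (fibre x) = mset (s # rs)" "s \<notin> set rs"
proof -
 have "s \<in> set (fibre x)" using s by (simp add: set_fibre)
 hence rs: "mset (fibre x) = mset (s # remove1 s (fibre x))" by simp
 define rs where "rs = remove1 s (fibre x)"
 note rs = rs[folded rs_def]
 have "s \<notin> set rs"
 proof
  assume "s \<in> set rs"
  define rs' where "rs' = remove1 s rs"
  have "mset rs = mset (s # rs')" using \<open>s \<in> set rs\<close> by (simp add: rs'_def)
  hence "mset (s # s # rs') = proots (fibre_poly x)" using rs mset_fibre[of x] by simp
  from poly_root_list(1)[OF this]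
  have "fibre_poly x = [:-s, 1:] * ([:-s, 1:] * smult (lead_coeff (fibre_poly x)) (\<Prod>r\<leftarrow>rs'. [:-r, 1:]))"
   by (simp add: mult_ac)
  then obtain e where "fibre_poly x = [:-s, 1:] * ([:-s, 1:] * e)" by blast
  moreover have "poly (pderiv ([:-s, 1:] * q)) s = poly q s" for q
   by (simp only: pderiv_mult poly_add poly_mult) (simp add: pderiv_pCons)
  ultimately have "poly (pderiv (fibre_poly x)) s = 0" by (simp only: poly_mult) simp
  hence "poly (pderiv g) s = x * poly (pderiv f) s" by (simp add: fibre_poly_def pderiv_diff pderiv_smult)
  thus False using w s by (simp add: wronski_def)
 qed
 thus ?thesis using rs that by blast
qed

end

lemma vdot_sum: "vdot l x = (\<Sum>i\<in>UNIV. l $ i * x $ i)" by (simp add: vdot_def sum_3)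

text \<open>The form \<open>G\<close> is the norm of \<open>X\<^sub>2 - X\<^sub>1 h / f\<close> along the pencil of lines through the point
 \<open>X\<^sub>0 = X\<^sub>1 = 0\<close>, made homogeneous.\<close>

lemma (in poly_curve) smooth_equation:
 assumes single: "\<And>t. t ~= s0 ==> \<not> meet p s0 t" and unram: "pev (chi p) s0 ~= 0"
 obtains M G where "is_form M G" "\<And>k t. G (k *s pev p t) = 0" "\<And>k. G (k *s top_coeff n p) = 0"
  "\<And>k. k ~= 0 ==> \<exists>w. dir_deriv 1 G (k *s pev p s0) w ~= 0"
proof -
 have top: "top_coeff n p ~= 0" using inf[of 0] by (auto simp: vcross_bilinear)
 have L: "pev (chi p) s0 ~= 0 \<and> vdot (pev (chi p) s0) (pev p s0) = 0" using unram by (simp add: pev_chi)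
 obtain \<alpha> \<beta> \<gamma> where c: "vdet \<alpha> \<beta> \<gamma> ~= 0" "vdot \<alpha> (top_coeff n p) = 0" "vdot \<gamma> (top_coeff n p) = 0" "vdot \<beta> (top_coeff n p) ~= 0"
  and U: "\<And>s. s \<in> {s0, 0} ==> vdot \<alpha> (pev p s) ~= 0" and S: "\<And>s. s \<in> {s0} ==> vdot (vcross \<alpha> \<beta>) (pev (chi p) s) ~= 0"
  and nc: "\<And>t. vdot \<alpha> (pev p t) = 0 ==> vdot \<beta> (pev p t) ~= 0"
  by (rule good_coordinates[OF top inf, of "{s0, 0}" "{s0}" "pev (chi p)"]) (use L in auto)
 define f g h where "f = lincomb \<alpha> p" and "g = lincomb \<beta> p" and "h = lincomb \<gamma> p"
 have nc': "\<forall>t. vdot \<alpha> (pev p t) = 0 --> vdot \<beta> (pev p t) ~= 0" using nc by blast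
 note pr = projection[OF c U[of 0] nc', folded f_def g_def h_def, simplified]
 interpret pf: plane_fibration f g n h by (rule pr(1))
 have fgh: "poly f t = vdot \<alpha> (pev p t)" "poly g t = vdot \<beta> (pev p t)" "poly h t = vdot \<gamma> (pev p t)" for t
  by (simp_all add: f_def g_def h_def)
 obtain N e where e: "\<And>j. degree (e j) \<le> N" "\<And>j x. coeff (pf.eliminant h (pf.fibre x)) j = poly (e j) x"
  using pf.eliminant_coeff_polynomial by metis
 \<comment> \<open>The summand 1 leaves at least one factor \<alpha> in every term, so
   \<open>G\<close> also vanishes on the line at infinity and in particular at the image of
   infinity.\<close>
 define M where "M = N + n + 1"
 define G where "G = (%x. \<Sum>j\<le>n. \<Sum>i\<le>N. coeff (e j) i * (vdot \<alpha> x ^ (M - i - j) * (vdot \<beta> x ^ i * vdot \<gamma> x ^ j)))"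
 have G: "is_form M G" unfolding G_def
 proof (intro is_form_sum is_form_cmult)
  fix j i assume "j \<in> {..n}" "i \<in> {..N}"
  hence "(M - i - j) + (i + j) = M" by (simp add: M_def)
  moreover have "is_form ((M - i - j) + (i + j)) (%x. vdot \<alpha> x ^ (M - i - j) * (vdot \<beta> x ^ i * vdot \<gamma> x ^ j))"
   unfolding vdot_sum by (intro is_form_linear_power_mult is_form_linear_power)
  ultimately show "is_form M (%x. vdot \<alpha> x ^ (M - i - j) * (vdot \<beta> x ^ i * vdot \<gamma> x ^ j))" by (simp only:)
 qed
 have G0: "G x = 0" if "vdot \<alpha> x = 0" for x
  unfolding G_def using that by (intro sum.neutral ballI) (simp add: M_def)
 have G1: "G x = vdot \<alpha> x ^ M * poly (pf.eliminant h (pf.fibre (vdot \<beta> x / vdot \<alpha> x))) (vdot \<gamma> x / vdot \<alpha> x)"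
  if a: "vdot \<alpha> x ~= 0" for x
 proof -
  define A X Y where "A = vdot \<alpha> x" and "X = vdot \<beta> x / A" and "Y = vdot \<gamma> x / A"
  have A: "A ~= 0" "vdot \<beta> x = A * X" "vdot \<gamma> x = A * Y" using a by (simp_all add: A_def X_def Y_def)
  have "poly (pf.eliminant h (pf.fibre X)) Y = (\<Sum>j\<le>n. coeff (pf.eliminant h (pf.fibre X)) j * Y ^ j)"
   unfolding poly_altdef by (rule sum.mono_neutral_left) (use pf.degree_eliminant[of h "pf.fibre X"] in \<open>auto simp: coeff_eq_0\<close>)
  also have "\<dots> = (\<Sum>j\<le>n. \<Sum>i\<le>N. coeff (e j) i * X ^ i * Y ^ j)"
  proof (intro sum.cong refl)
   fix j
   have "poly (e j) X = (\<Sum>i\<le>N. coeff (e j) i * X ^ i)"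
    unfolding poly_altdef by (rule sum.mono_neutral_left) (use e(1)[of j] in \<open>auto simp: coeff_eq_0\<close>)
   thus "coeff (pf.eliminant h (pf.fibre X)) j * Y ^ j = (\<Sum>i\<le>N. coeff (e j) i * X ^ i * Y ^ j)"
    by (simp add: e(2) sum_distrib_right)
  qed
  finally have "A ^ M * poly (pf.eliminant h (pf.fibre X)) Y = (\<Sum>j\<le>n. \<Sum>i\<le>N. A ^ M * (coeff (e j) i * X ^ i * Y ^ j))"
   by (simp add: sum_distrib_left)
  also have "\<dots> = G x" unfolding G_def
  proof (intro sum.cong refl)
   fix j i assume "j \<in> {..n}" "i \<in> {..N}"
   hence "M = (M - i - j) + (i + j)" by (simp add: M_def)
   hence "A ^ M = A ^ (M - i - j) * (A ^ i * A ^ j)" by (metis power_add)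
   thus "A ^ M * (coeff (e j) i * X ^ i * Y ^ j)
    = coeff (e j) i * (vdot \<alpha> x ^ (M - i - j) * (vdot \<beta> x ^ i * vdot \<gamma> x ^ j))"
    by (simp only: A(2,3) A_def[symmetric] power_mult_distrib mult_ac)
  qed
  finally show ?thesis by (simp add: A_def X_def Y_def)
 qed
 have van: "G (k *s pev p t) = 0" for k t
 proof (cases "vdot \<alpha> (k *s pev p t) = 0")
  case False
  hence kf: "k ~= 0" "poly f t ~= 0" by (auto simp: fgh vdot_bilinear)
  have "t \<in> set (pf.fibre (poly g t / poly f t))" using kf by (simp add: pf.set_fibre)
  hence "(0::complex) \<in> set (map (%r. poly h t / poly f t * poly f r - poly h r) (pf.fibre (poly g t / poly f t)))"
   using kf by (auto simp: image_iff intro!: bexI[of _ t])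
  hence "poly (pf.eliminant h (pf.fibre (poly g t / poly f t))) (poly h t / poly f t) = 0"
   unfolding pf.poly_eliminant by (simp add: prod_list_zero_iff)
  thus ?thesis using kf by (simp add: G1[OF False] vdot_bilinear flip: fgh)
 qed (rule G0)
 have van': "G (k *s top_coeff n p) = 0" for k by (rule G0) (simp add: vdot_bilinear c)
 have der: "\<exists>w. dir_deriv 1 G (k *s pev p s0) w ~= 0" if k: "k ~= 0" for k
 proof -
  define x0 y0 where "x0 = poly g s0 / poly f s0" and "y0 = poly h s0 / poly f s0"
  \<comment> \<open>The direction along which \<alpha> and \<beta> stay fixed and \<gamma> grows
    with unit speed: only the ordinate moves.\<close>
  define w where "w = (1 / vdet \<alpha> \<beta> \<gamma>) *s vcross \<alpha> \<beta>"
  have w: "vdot \<alpha> w = 0" "vdot \<beta> w = 0" "vdot \<gamma> w = 1"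
   using c(1) by (simp_all add: w_def vdot_bilinear vdet_alt vdot_commute[of \<gamma>])
  have f0: "poly f s0 ~= 0" using U by (simp add: fgh)
  define A where "A = k * poly f s0"
  have A: "A ~= 0" using k f0 by (simp add: A_def)
  define E where "E = pf.eliminant h (pf.fibre x0)"
  have line: "G (k *s pev p s0 + t *s w) = poly (smult (A ^ M) (pcompose E [:y0, 1 / A:])) t" for t
  proof -
   have a: "vdot \<alpha> (k *s pev p s0 + t *s w) = A" "vdot \<beta> (k *s pev p s0 + t *s w) = A * x0" "vdot \<gamma> (k *s pev p s0 + t *s w) = A * y0 + t"
    using f0 by (simp_all add: vdot_bilinear w A_def x0_def y0_def fgh)
   hence "vdot \<alpha> (k *s pev p s0 + t *s w) ~= 0" using A by simp
   from G1[OF this] show ?thesis using A unfolding a by (simp add: E_def poly_pcompose add_divide_distrib)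
  qed
  have w0: "poly pf.wronski s0 ~= 0" using S[of s0] by (simp add: pr)
  have "poly g s0 = x0 * poly f s0" using f0 by (simp add: x0_def)
  then obtain rs where rs: "mset (pf.fibre x0) = mset (s0 # rs)" "s0 \<notin> set rs" by (rule pf.simple_in_fibre[OF _ w0])
  have Ec: "E = [:- poly h s0, poly f s0:] * pf.eliminant h rs"
   unfolding E_def pf.eliminant_mset[OF rs(1)] by (simp add: pf.eliminant_def)
  \<comment> \<open>Another parameter of the fibre with the same ordinate would have the same image
    point, against \<open>single\<close>. So the ordinate of \<open>s0\<close> is a simple root of
    the eliminant.\<close>
  have nz: "y0 * poly f r - poly h r ~= 0" if r: "r \<in> set rs" for r
  proof
   assume y: "y0 * poly f r - poly h r = 0"
   have rs0: "r ~= s0" using r rs by auto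
   have "r \<in> set (pf.fibre x0)" using r rs(1) by (metis list.set_intros(2) set_mset_mset)
   hence gx: "poly g r = x0 * poly f r" by (simp add: pf.set_fibre)
   have "vdet \<alpha> \<beta> \<gamma> *s pev p r = (poly f r / poly f s0) *s (vdet \<alpha> \<beta> \<gamma> *s pev p s0)"
   proof -
    have "poly g r = (poly f r / poly f s0) * poly g s0" "poly h r = (poly f r / poly f s0) * poly h s0" "poly f r = (poly f r / poly f s0) * poly f s0"
     using gx y f0 by (simp_all add: x0_def y0_def mult_ac)
    thus ?thesis unfolding vcramer'[of \<alpha> \<beta> \<gamma>] fgh[symmetric]
     by (metis (no_types, lifting) vector_add_ldistrib vector_smult_assoc)
   qed
   hence "vcross (pev p s0) (vdet \<alpha> \<beta> \<gamma> *s pev p r) = vcross (pev p s0) ((poly f r / poly f s0) *s (vdet \<alpha> \<beta> \<gamma> *s pev p s0))"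
    by (rule arg_cong)
   moreover have "vcross u u = 0" for u :: "complex ^ 3" by (simp add: v3_simps)
   ultimately have "vdet \<alpha> \<beta> \<gamma> *s vcross (pev p s0) (pev p r) = 0" by (simp add: vcross_bilinear)
   thus False using single[OF rs0] c(1) by simp
  qed
  have "dir_deriv 1 G (k *s pev p s0) w = poly (pderiv (smult (A ^ M) (pcompose E [:y0, 1 / A:]))) 0"
   using dir_deriv_line(1)[OF line, of 1] by simp
  also have "\<dots> = A ^ M * (poly (pderiv E) y0 / A)"
   by (simp add: pderiv_smult pderiv_pcompose pderiv_pCons poly_pcompose)
  also have "poly (pderiv E) y0 = poly f s0 * poly (pf.eliminant h rs) y0"
   unfolding Ec pderiv_mult using f0 by (simp add: pderiv_pCons y0_def)
  also have "poly (pf.eliminant h rs) y0 ~= 0" unfolding pf.poly_eliminant prod_list_zero_iff using nz by auto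
  hence "A ^ M * (poly f s0 * poly (pf.eliminant h rs) y0 / A) ~= 0" using A f0 by simp
  finally show ?thesis by blast
 qed
 show ?thesis by (rule that[OF G van van' der])
qed

section \<open>Branches\<close>

lemma tendsto_ev2:
 assumes "(f \<longlongrightarrow> a) F" "(g \<longlongrightarrow> b) F" shows "((%x. ev2 Q (f x) (g x)) \<longlongrightarrow> ev2 Q a b) F"
 unfolding ev2_altdef by (intro tendsto_intros assms)

text \<open>The uniqueness half of the implicit function theorem: the divided difference in z is
  continuous and nonzero at the origin.\<close>

lemma unique_near:
 assumes "poly (coeff Q 1) 0 ~= 0"
 shows "\<exists>r>0. \<forall>y z z'. norm y < r --> norm z < r --> norm z' < r --> ev2 Q y z = ev2 Q y z' --> z = z'"
proof (rule ccontr)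
 assume neg: "\<not> ?thesis"
 have "\<exists>D. (\<forall>y z z'. ev2 Q y z - ev2 Q y z' = (z - z') * D y z z') \<and> D 0 0 0 = poly (coeff Q 1) 0 \<and>
   (\<forall>(f :: nat => complex) g h a b c. f \<longlonglongrightarrow> a --> g \<longlonglongrightarrow> b --> h \<longlonglongrightarrow> c --> (%k. D (f k) (g k) (h k)) \<longlonglongrightarrow> D a b c)"
 proof (induction Q)
  case 0 thus ?case by (intro exI[of _ "%_ _ _. 0"]) simp
 next
  case (pCons a Q)
  then obtain D where D: "\<And>y z z'. ev2 Q y z - ev2 Q y z' = (z - z') * D y z z'"
   "\<And>(f :: nat => complex) g h a b c. f \<longlonglongrightarrow> a ==> g \<longlonglongrightarrow> b ==> h \<longlonglongrightarrow> c ==> (%k. D (f k) (g k) (h k)) \<longlonglongrightarrow> D a b c"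
   by blast
  have e: "ev2 Q 0 0 = poly (coeff Q 0) 0" by (cases Q) simp
  have "ev2 (pCons a Q) y z - ev2 (pCons a Q) y z' = (z - z') * (ev2 Q y z + z' * D y z z')" for y z z'
  proof -
   have "ev2 (pCons a Q) y z - ev2 (pCons a Q) y z' = (z - z') * ev2 Q y z + z' * (ev2 Q y z - ev2 Q y z')"
    by (simp add: algebra_simps)
   thus ?thesis unfolding D(1) by (simp add: algebra_simps)
  qed
  thus ?case
   using e by (intro exI[of _ "%y z z'. ev2 Q y z + z' * D y z z'"]) (auto intro!: tendsto_intros tendsto_ev2 D(2))
 qed
 then obtain D where D: "\<And>y z z'. ev2 Q y z - ev2 Q y z' = (z - z') * D y z z'" "D 0 0 0 = poly (coeff Q 1) 0"
   "\<And>(f :: nat => complex) g h a b c. f \<longlonglongrightarrow> a ==> g \<longlonglongrightarrow> b ==> h \<longlonglongrightarrow> c ==> (%k. D (f k) (g k) (h k)) \<longlonglongrightarrow> D a b c"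
  by blast
 have "\<forall>k::nat. \<exists>y z z'. norm y < 1 / real (Suc k) \<and> norm z < 1 / real (Suc k) \<and> norm z' < 1 / real (Suc k) \<and> ev2 Q y z = ev2 Q y z' \<and> z ~= z'"
  using neg by (metis of_nat_0_less_iff zero_less_Suc zero_less_divide_1_iff)
 then obtain y z z' where yz: "\<And>k. norm (y k) < 1 / real (Suc k)" "\<And>k. norm (z k) < 1 / real (Suc k)" "\<And>k. norm (z' k) < 1 / real (Suc k)"
  "\<And>k. ev2 Q (y k) (z k) = ev2 Q (y k) (z' k)" "\<And>k. z k ~= z' k" by metis
 have lim: "x \<longlonglongrightarrow> 0" if "\<And>k. norm (x k) < 1 / real (Suc k)" for x :: "nat => complex"
 proof (rule Lim_null_comparison)
  show "\<forall>\<^sub>F k in sequentially. norm (x k) \<le> 1 / real (Suc k)" using that by (intro always_eventually allI less_imp_le) blast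
  show "(%k. 1 / real (Suc k)) \<longlonglongrightarrow> 0" by (rule lim_1_over_n[THEN LIMSEQ_Suc])
 qed
 have "(%k. D (y k) (z k) (z' k)) \<longlonglongrightarrow> D 0 0 0" by (intro D(3) lim yz)
 moreover have "D (y k) (z k) (z' k) = 0" for k using D(1)[of "y k" "z k" "z' k"] yz(4,5)[of k] by simp
 ultimately have "(%k. 0) \<longlonglongrightarrow> D 0 0 0" by simp
 hence "D 0 0 0 = 0" by (metis LIMSEQ_unique tendsto_const)
 thus False using D(2) assms by simp
qed

text \<open>The abscissa Y/A takes a common nonzero value near two different zeros by the open
  mapping theorem. Near a multiple zero it is not injective, which again gives two
  parameters.\<close>

lemma branches_meet:
 fixes Y A :: "complex poly"
 assumes Y: "poly Y s0 = 0" "poly Y t0 = 0" and e: "0 < e"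
  and ne: "\<And>s. dist s s0 < e \<or> dist s t0 < e ==> poly A s ~= 0" "\<And>s. s ~= s0 ==> dist s s0 < e ==> poly Y s ~= 0"
   "\<And>s. s ~= t0 ==> dist s t0 < e ==> poly Y s ~= 0"
  and alt: "s0 ~= t0 \<or> poly (pderiv Y) s0 = 0"
 shows "\<exists>s t. s ~= t \<and> s ~= s0 \<and> dist s s0 < e \<and> t ~= t0 \<and> dist t t0 < e \<and> poly Y s / poly A s = poly Y t / poly A t"
proof -
 define f where "f = (%s. poly Y s / poly A s)"
 have hol: "f holomorphic_on ball c e" if "c = s0 \<or> c = t0" for c
  unfolding f_def by (intro holomorphic_intros) (use ne(1) that in \<open>auto simp: dist_commute\<close>)
 show ?thesis
 proof (cases "s0 = t0")
  case False
  define r where "r = min e (dist s0 t0 / 2)"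
  have r: "0 < r" "r \<le> e" "2 * r \<le> dist s0 t0" using e False by (auto simp: r_def)
  have op: "open (f ` ball c r)" if c: "c = s0 \<or> c = t0" for c
  proof (rule open_mapping_thm[OF hol[OF c]])
   show "ball c r \<subseteq> ball c e" using r by auto
   show "\<not> f constant_on ball c e"
   proof
    assume "f constant_on ball c e"
    then obtain y where y: "\<And>s. s \<in> ball c e ==> f s = y" by (auto simp: constant_on_def)
    have "f c = 0" using Y c by (auto simp: f_def)
    moreover have "f (c + of_real (e / 2)) ~= 0"
     using ne c e by (auto simp: f_def dist_norm)
    moreover have "f c = y" "f (c + of_real (e / 2)) = y" using y e by (auto simp: dist_norm)
    ultimately show False by simp
   qed
  qed auto
  have "f s0 = 0" "f t0 = 0" using Y by (simp_all add: f_def)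
  hence "0 \<in> f ` ball s0 r" "0 \<in> f ` ball t0 r"
   using r image_eqI[of 0 f s0 "ball s0 r"] image_eqI[of 0 f t0 "ball t0 r"] by simp_all
  hence "0 \<in> f ` ball s0 r \<inter> f ` ball t0 r" by blast
  moreover have "open (f ` ball s0 r \<inter> f ` ball t0 r)" using op by (intro open_Int) auto
  ultimately have "f ` ball s0 r \<inter> f ` ball t0 r ~= {0}" using not_open_singleton by metis
  then obtain y where y: "y \<in> f ` ball s0 r" "y \<in> f ` ball t0 r" "y ~= 0" using \<open>0 \<in> f ` ball s0 r \<inter> f ` ball t0 r\<close> by blast
  then obtain s t where st: "dist s0 s < r" "dist t0 t < r" "f s = y" "f t = y" by auto
  have "s ~= t" using st(1,2) r(3) dist_triangle_half_r[of t s0 "dist s0 t0" t0] dist_triangle_less_add[of s0 s r t0 r] by (auto simp: dist_commute)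
  moreover have "s ~= s0" "t ~= t0" using st y(3) Y by (auto simp: f_def)
  ultimately show ?thesis using st r by (intro exI[of _ s] exI[of _ t]) (auto simp: f_def dist_commute)
 next
  case True
  have "\<not> inj_on f (ball s0 e)"
  proof
   assume "inj_on f (ball s0 e)"
   hence "deriv f s0 ~= 0" using holomorphic_injective_imp_regular[OF hol[OF disjI1[OF refl]]] e by simp
   moreover have "(f has_field_derivative 0) (at s0)"
    unfolding f_def using ne(1)[of s0] e Y alt True by (auto intro!: derivative_eq_intros)
   ultimately show False by (simp add: DERIV_imp_deriv)
  qed
  then obtain s t where st: "dist s s0 < e" "dist t s0 < e" "s ~= t" "f s = f t" by (auto simp: inj_on_def dist_commute)
  have nz: "f u ~= 0" if "u ~= s0" "dist u s0 < e" for u using ne that by (simp add: f_def)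
  have "f s0 = 0" using Y by (simp add: f_def)
  hence "s ~= s0" "t ~= s0" using nz[of s] nz[of t] st by auto
  thus ?thesis using st True by (intro exI[of _ s] exI[of _ t]) (auto simp: f_def)
 qed
qed

text \<open>On Q = 0 the second coordinate is locally a function of the first. Two branches, or one
  branch on which the first coordinate is not a local parameter, would therefore yield coinciding
  pairs arbitrarily close to \<open>s0\<close> and \<open>t0\<close>, outside the finite set
  \<open>N\<close>.\<close>

lemma no_common_smooth_branch:
 fixes Y A :: "complex poly" and \<zeta> :: "complex => complex"
 assumes Y: "Y ~= 0" "poly Y s0 = 0" "poly Y t0 = 0" and A: "poly A s0 ~= 0" "poly A t0 ~= 0"
  and \<zeta>: "(\<zeta> \<longlongrightarrow> 0) (at s0)" "(\<zeta> \<longlongrightarrow> 0) (at t0)"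
  and Q: "poly (coeff Q 1) 0 ~= 0" "\<And>s. poly A s ~= 0 ==> poly Y s ~= 0 ==> ev2 Q (poly Y s / poly A s) (\<zeta> s) = 0"
  and alt: "s0 ~= t0 \<or> poly (pderiv Y) s0 = 0" and N: "finite N"
  and pairs: "\<And>s t. s ~= t ==> poly A s ~= 0 ==> poly A t ~= 0 ==> poly Y s ~= 0 ==> poly Y t ~= 0 ==>
   poly Y s / poly A s = poly Y t / poly A t ==> \<zeta> s = \<zeta> t ==> s \<in> N"
 shows False
proof -
 obtain r where r: "0 < r" "\<And>y z z'. norm y < r ==> norm z < r ==> norm z' < r ==> ev2 Q y z = ev2 Q y z' ==> z = z'"
  using unique_near[OF Q(1)] by blast
 define good where "good = (%s. poly A s ~= 0 \<and> poly Y s ~= 0 \<and> norm (poly Y s / poly A s) < r \<and> norm (\<zeta> s) < r \<and> s \<notin> N)"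
 have ev: "\<forall>\<^sub>F s in at c. good s" if c: "poly Y c = 0" "poly A c ~= 0" "(\<zeta> \<longlongrightarrow> 0) (at c)" for c
 proof -
  have "(poly A \<longlongrightarrow> poly A c) (at c)" by (intro tendsto_intros)
  hence 1: "\<forall>\<^sub>F s in at c. poly A s ~= 0" using c(2) by (rule tendsto_imp_eventually_ne)
  have fin: "\<forall>\<^sub>F s in at c. s \<notin> S" if "finite S" for S :: "complex set"
   using islimpt_finite[OF that, of c] by (simp add: islimpt_iff_eventually)
  have 2: "\<forall>\<^sub>F s in at c. poly Y s ~= 0" using fin[OF poly_roots_finite[OF Y(1)]] by simp
  have "((%s. poly Y s / poly A s) \<longlongrightarrow> poly Y c / poly A c) (at c)" by (intro tendsto_intros c)
  hence "((%s. poly Y s / poly A s) \<longlongrightarrow> 0) (at c)" using c by simp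
  from tendstoD[OF this r(1)] have 3: "\<forall>\<^sub>F s in at c. norm (poly Y s / poly A s) < r" by simp
  from tendstoD[OF c(3) r(1)] have 4: "\<forall>\<^sub>F s in at c. norm (\<zeta> s) < r" by simp
  show ?thesis unfolding good_def using 1 2 3 4 fin[OF N] by eventually_elim blast
 qed
 obtain e1 where e1: "e1 > 0" "\<And>s. s ~= s0 ==> dist s s0 < e1 ==> good s"
  using ev[OF Y(2) A(1) \<zeta>(1)] unfolding eventually_at by auto
 obtain e2 where e2: "e2 > 0" "\<And>s. s ~= t0 ==> dist s t0 < e2 ==> good s"
  using ev[OF Y(3) A(2) \<zeta>(2)] unfolding eventually_at by auto
 define e where "e = min e1 e2"
 have g: "good s" if "s ~= s0 \<and> dist s s0 < e \<or> s ~= t0 \<and> dist s t0 < e" for s using that e1(2) e2(2) by (auto simp: e_def)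
 have "\<exists>s t. s ~= t \<and> s ~= s0 \<and> dist s s0 < e \<and> t ~= t0 \<and> dist t t0 < e \<and> poly Y s / poly A s = poly Y t / poly A t"
 proof (rule branches_meet[OF Y(2,3) _ _ _ _ alt])
  show "0 < e" using e1 e2 by (simp add: e_def)
  show "poly A s ~= 0" if "dist s s0 < e \<or> dist s t0 < e" for s
   using that g[of s] A by (cases "s = s0"; cases "s = t0") (auto simp: good_def)
  show "poly Y s ~= 0" if "s ~= s0" "dist s s0 < e" for s using that g[of s] by (simp add: good_def)
  show "poly Y s ~= 0" if "s ~= t0" "dist s t0 < e" for s using that g[of s] by (simp add: good_def)
 qed
 then obtain s t where st: "s ~= t" "good s" "good t" "poly Y s / poly A s = poly Y t / poly A t" using g by blast
 have "ev2 Q (poly Y s / poly A s) (\<zeta> s) = ev2 Q (poly Y s / poly A s) (\<zeta> t)"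
  using Q(2)[of s] Q(2)[of t] st by (simp add: good_def)
 hence "\<zeta> s = \<zeta> t" using r(2) st(2,3) by (auto simp: good_def)
 thus False using pairs[OF st(1)] st by (auto simp: good_def)
qed

text \<open>If Q has no terms of order below 2, the substitution of y z for z makes y^2 split off.
  The quadratic part of Q then sits on the exceptional line y = 0.\<close>

lemma blow_up:
 assumes "coeff (coeff Q 0) 0 = 0" "coeff (coeff Q 0) 1 = 0" "coeff (coeff Q 1) 0 = 0"
 obtains B where "\<And>y z. ev2 Q y (y * z) = y\<^sup>2 * ev2 B y z" "poly (coeff B 1) 0 = coeff (coeff Q 1) 1" "poly (coeff B 0) 0 = coeff (coeff Q 0) 2"
proof -
 obtain a Q1 where Q: "Q = pCons a Q1" by (cases Q) blast
 obtain b R where Q1: "Q1 = pCons b R" by (cases Q1) blast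
 obtain a0 a' where a: "a = pCons a0 a'" by (cases a) blast
 obtain a1 a2 where a': "a' = pCons a1 a2" by (cases a') blast
 obtain b0 b1 where b: "b = pCons b0 b1" by (cases b) blast
 have z: "a0 = 0" "a1 = 0" "b0 = 0" using assms by (simp_all add: Q Q1 a a' b)
 have "\<exists>R'. \<forall>y z. ev2 R y (y * z) = ev2 R' y z"
 proof (induction R)
  case (pCons c R)
  then obtain R' where "\<forall>y z. ev2 R y (y * z) = ev2 R' y z" by blast
  thus ?case by (intro exI[of _ "pCons c (smult [:0, 1:] R')"]) simp
 qed (auto intro: exI[of _ 0])
 then obtain R' where R': "\<And>y z. ev2 R y (y * z) = ev2 R' y z" by blast
 show ?thesis
 proof (rule that[of "pCons a2 (pCons b1 R')"])
  show "ev2 Q y (y * z) = y\<^sup>2 * ev2 (pCons a2 (pCons b1 R')) y z" for y z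
   by (simp add: Q Q1 a a' b z R' power2_eq_square algebra_simps)
  show "poly (coeff (pCons a2 (pCons b1 R')) 1) 0 = coeff (coeff Q 1) 1" by (simp add: Q Q1 b poly_0_coeff_0)
  show "poly (coeff (pCons a2 (pCons b1 R')) 0) 0 = coeff (coeff Q 0) 2" by (simp add: Q a a' poly_0_coeff_0 numeral_2_eq_2)
 qed
qed

lemma plane_derivatives:
 assumes Q: "\<And>y z. G (v + y *s u + z *s w) = ev2 Q y z"
 shows "dir_deriv k G v u = fact k * coeff (coeff Q 0) k" "dir_deriv k G v w = fact k * poly (coeff Q k) 0"
  "dir_deriv 2 G v (y *s u + z *s w)
   = 2 * (coeff (coeff Q 0) 2 * y\<^sup>2 + coeff (coeff Q 1) 1 * y * z + poly (coeff Q 2) 0 * z\<^sup>2)"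
proof -
 have "ev2 Q y 0 = poly (coeff Q 0) y" for y by (cases Q) simp
 hence "G (v + y *s u) = poly (coeff Q 0) y" for y using Q[of y 0] by simp
 thus "dir_deriv k G v u = fact k * coeff (coeff Q 0) k" by (rule dir_deriv_line)
 have "ev2 Q 0 z = poly (map_poly (%c. poly c 0) Q) z" for z
  by (induction Q) (simp_all add: map_poly_pCons)
 hence "G (v + z *s w) = poly (map_poly (%c. poly c 0) Q) z" for z using Q[of 0 z] by simp
 from dir_deriv_line(2)[OF this] show "dir_deriv k G v w = fact k * poly (coeff Q k) 0" by (simp add: coeff_map_poly)
 obtain a Q1 where Q0: "Q = pCons a Q1" by (cases Q) blast
 obtain b R where Q1: "Q1 = pCons b R" by (cases Q1) blast
 have "\<exists>r. (\<forall>t. poly r t = ev2 R (t * y) (t * z)) \<and> poly r 0 = poly (coeff R 0) 0"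
 proof (induction R)
  case 0 thus ?case by (intro exI[of _ 0]) simp
 next
  case (pCons c R)
  then obtain r where "\<forall>t. poly r t = ev2 R (t * y) (t * z)" by blast
  thus ?case by (intro exI[of _ "pcompose c [:0, y:] + [:0, z:] * r"]) (simp add: poly_pcompose)
 qed
 then obtain r where r: "\<And>t. poly r t = ev2 R (t * y) (t * z)" "poly r 0 = poly (coeff R 0) 0" by blast
 define q where "q = pcompose a [:0, y:] + pCons 0 (smult z (pcompose b [:0, y:])) + pCons 0 (pCons 0 (smult (z\<^sup>2) r))"
 have "G (v + t *s (y *s u + z *s w)) = poly q t" for t
 proof -
  have "v + t *s (y *s u + z *s w) = v + (t * y) *s u + (t * z) *s w" by (simp add: vec_eq_iff algebra_simps)
  hence "G (v + t *s (y *s u + z *s w)) = ev2 Q (t * y) (t * z)" by (simp only: Q)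
  also have "\<dots> = poly q t" by (simp add: q_def Q0 Q1 r poly_pcompose power2_eq_square algebra_simps)
  finally show ?thesis .
 qed
 from dir_deriv_line(2)[OF this, of 2]
 show "dir_deriv 2 G v (y *s u + z *s w)
   = 2 * (coeff (coeff Q 0) 2 * y\<^sup>2 + coeff (coeff Q 1) 1 * y * z + poly (coeff Q 2) 0 * z\<^sup>2)"
  using r(2) by (simp add: q_def Q0 Q1 coeff_pcompose_linear numeral_2_eq_2 poly_0_coeff_0 algebra_simps)
qed

text \<open>A branch of \<open>p\<close> through \<open>[v]\<close>, with tangent line spanned by \<open>v\<close> and \<open>u\<close>, written as a
 multiple of \<open>v\<close> plus a term of order \<open>k\<close> in the direction \<open>u\<close>.\<close>

definition tangent_branch :: "complex poly ^ 3 => complex ^ 3 => complex ^ 3 => complex => nat => bool" where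
 "tangent_branch p v u s k \<longleftrightarrow> k \<ge> 1 \<and> (\<exists>a r x y. (\<forall>t. pev p t = poly a t *s v + (t - s) ^ k *s pev r t) \<and>
   poly a s ~= 0 \<and> pev r s = x *s v + y *s u \<and> y ~= 0)"

text \<open>In the basis v, u, w the coordinate along the tangent vanishes to order
  \<open>k\<close>, while the transversal one vanishes to higher order, so that the slope Z/Y tends
  to 0.\<close>

lemma tangent_branch_coords:
 assumes "tangent_branch p v u s k" and D: "vdet v u w ~= 0"
 defines "A \<equiv> lincomb (vcross u w) p" and "Y \<equiv> lincomb (vcross w v) p" and "Z \<equiv> lincomb (vcross v u) p"
 shows "Y ~= 0" "poly Y s = 0" "poly A s ~= 0" "((%t. poly Z t / poly Y t) \<longlongrightarrow> 0) (at s)" "k \<ge> 2 ==> poly (pderiv Y) s = 0"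
proof -
 obtain a r x y where b: "k \<ge> 1" "\<And>t. pev p t = poly a t *s v + (t - s) ^ k *s pev r t" "poly a s ~= 0" "pev r s = x *s v + y *s u" "y ~= 0"
  using assms(1) unfolding tangent_branch_def by blast
 have c: "vdot (vcross u w) v = vdet v u w" "vdot (vcross w v) u = vdet v u w"
  by (simp_all add: v3_simps algebra_simps)
 define \<eta> \<theta> where "\<eta> = lincomb (vcross w v) r" and "\<theta> = lincomb (vcross v u) r"
 have Yt: "poly Y t = (t - s) ^ k * poly \<eta> t" and Zt: "poly Z t = (t - s) ^ k * poly \<theta> t" for t
  by (simp_all add: Y_def Z_def \<eta>_def \<theta>_def b(2) vdot_bilinear)
 have \<eta>: "poly \<eta> s ~= 0" and \<theta>: "poly \<theta> s = 0" using b D by (simp_all add: \<eta>_def \<theta>_def vdot_bilinear c)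
 show "poly Y s = 0" using b(1) by (simp add: Yt)
 show "poly A s ~= 0" using b D by (simp add: A_def vdot_bilinear c power_0_left)
 have Ypoly: "Y = [:-s, 1:] ^ k * \<eta>" by (rule poly_eqI_punctured) (simp add: Yt poly_power)
 show "Y ~= 0" unfolding Ypoly using \<eta> by auto
 have "((%t. poly \<theta> t / poly \<eta> t) \<longlongrightarrow> poly \<theta> s / poly \<eta> s) (at s)" by (intro tendsto_intros \<eta>)
 hence l: "((%t. poly \<theta> t / poly \<eta> t) \<longlongrightarrow> 0) (at s)" by (simp add: \<theta>)
 show "((%t. poly Z t / poly Y t) \<longlongrightarrow> 0) (at s)"
 proof (rule Lim_transform_eventually[OF l])
  show "\<forall>\<^sub>F t in at s. poly \<theta> t / poly \<eta> t = poly Z t / poly Y t"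
   using eventually_neq_at_within[of s s UNIV] by eventually_elim (simp add: Yt Zt)
 qed
 show "poly (pderiv Y) s = 0" if "k \<ge> 2"
 proof -
  have "k = Suc (Suc (k - 2))" using that by simp
  then obtain j where "k = Suc (Suc j)" by blast
  hence "Y = [:-s, 1:] * ([:-s, 1:] * ([:-s, 1:] ^ j * \<eta>))" unfolding Ypoly by (simp only: power_Suc mult.assoc)
  moreover have "poly (pderiv ([:-s, 1:] * q)) s = poly q s" for q
   by (simp only: pderiv_mult poly_add poly_mult) (simp add: pderiv_pCons)
  ultimately show ?thesis by (simp only: poly_mult) simp
 qed
qed

lemma plane_coords:
 assumes D: "vdet v u w ~= (0 :: complex)" and A: "vdot (vcross u w) x ~= 0"
 shows "v + (vdot (vcross w v) x / vdot (vcross u w) x) *s u + (vdot (vcross v u) x / vdot (vcross u w) x) *s w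
  = (vdet v u w / vdot (vcross u w) x) *s x"
proof -
 have "vdet v u w *s x = vdot (vcross u w) x *s v + vdot (vcross w v) x *s u + vdot (vcross v u) x *s w"
  by (subst vcramer) (simp add: v3_simps algebra_simps)
 hence "(1 / vdot (vcross u w) x) *s (vdet v u w *s x)
   = (1 / vdot (vcross u w) x) *s (vdot (vcross u w) x *s v + vdot (vcross w v) x *s u + vdot (vcross v u) x *s w)" by simp
 thus ?thesis using A by (simp add: vector_add_ldistrib vector_smult_assoc)
qed

lemma same_coords_parallel:
 assumes D: "vdet v u w ~= (0 :: complex)" and A: "vdot (vcross u w) x ~= 0" "vdot (vcross u w) x' ~= 0"
  and "vdot (vcross w v) x / vdot (vcross u w) x = vdot (vcross w v) x' / vdot (vcross u w) x'"
   "vdot (vcross v u) x / vdot (vcross u w) x = vdot (vcross v u) x' / vdot (vcross u w) x'"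
 shows "vcross x x' = 0"
proof -
 have "(vdet v u w / vdot (vcross u w) x) *s x = (vdet v u w / vdot (vcross u w) x') *s x'"
  using plane_coords[OF D A(1)] plane_coords[OF D A(2)] assms(4,5) by simp
 hence "vcross x ((vdet v u w / vdot (vcross u w) x) *s x) = vcross x ((vdet v u w / vdot (vcross u w) x') *s x')" by simp
 moreover have "vcross x x = 0" by (simp add: v3_simps)
 ultimately show ?thesis using D A by (simp add: vcross_bilinear)
qed

text \<open>Where an equation has nonzero differential, the curve it defines is a graph, which has
  no room for two branches unless infinitely many parameters coincide.\<close>

lemma smooth_equation_one_branch:
 assumes D: "vdet v u w ~= 0" and G: "is_form n G" "\<And>k t. G (k *s pev p t) = 0" "dir_deriv 1 G v w ~= 0"
  and N: "finite N" "\<And>s t. s ~= t ==> meet p s t ==> s \<in> N"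
  and st: "s0 ~= t0" "pev p s0 = x *s v" "pev p t0 = x' *s v" "x ~= 0" "x' ~= 0" and Y: "lincomb (vcross w v) p ~= 0"
 shows False
proof -
 define A Y Z where "A = lincomb (vcross u w) p" and "Y = lincomb (vcross w v) p" and "Z = lincomb (vcross v u) p"
 obtain Q where Q: "\<And>y z. G (v + y *s u + z *s w) = ev2 Q y z" using form_plane[OF G(1)] by blast
 have c: "vdot (vcross u w) v = vdet v u w" by (simp add: v3_simps algebra_simps)
 show False
 proof (rule no_common_smooth_branch[where Y = Y and A = A and Q = Q and \<zeta> = "%t. poly Z t / poly A t", OF _ _ _ _ _ _ _ _ _ _ N(1)])
  show "Y ~= 0" using Y by (simp add: Y_def)
  show z: "poly Y s0 = 0" "poly Y t0 = 0" "poly A s0 ~= 0" "poly A t0 ~= 0" using st D by (simp_all add: Y_def A_def vdot_bilinear c)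
  have z': "poly Z s0 = 0" "poly Z t0 = 0" using st by (simp_all add: Z_def vdot_bilinear)
  have "((%t. poly Z t / poly A t) \<longlongrightarrow> poly Z s0 / poly A s0) (at s0)" by (intro tendsto_intros z)
  thus "((%t. poly Z t / poly A t) \<longlongrightarrow> 0) (at s0)" by (simp add: z')
  have "((%t. poly Z t / poly A t) \<longlongrightarrow> poly Z t0 / poly A t0) (at t0)" by (intro tendsto_intros z)
  thus "((%t. poly Z t / poly A t) \<longlongrightarrow> 0) (at t0)" by (simp add: z')
  show "poly (coeff Q 1) 0 ~= 0" using G(3) plane_derivatives(2)[OF Q, of 1] by simp
  show "ev2 Q (poly Y s / poly A s) (poly Z s / poly A s) = 0" if "poly A s ~= 0" for s
   unfolding Q[symmetric] using plane_coords[OF D, of "pev p s"] that G(2) by (simp add: A_def Y_def Z_def)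
  show "s0 ~= t0 \<or> poly (pderiv Y) s0 = 0" using st by simp
  show "s \<in> N" if "s ~= t" "poly A s ~= 0" "poly A t ~= 0" "poly Y s / poly A s = poly Y t / poly A t"
   "poly Z s / poly A s = poly Z t / poly A t" for s t
   by (rule N(2)[OF that(1) same_coords_parallel[OF D]]) (use that in \<open>simp_all add: A_def Y_def Z_def\<close>)
 qed
qed

text \<open>After the blow-up the branch tends to the origin of the exceptional line. The blown-up
  equation holds along the branch, hence at the origin, where its value is the quadratic form at
  u.\<close>

lemma tangent_branch_deriv:
 assumes br: "tangent_branch p v u s k" and uv: "vcross v u ~= 0" and G: "is_form n G" "\<And>k t. G (k *s pev p t) = 0"
  and low: "\<And>j w. j < 2 ==> dir_deriv j G v w = 0"
 shows "dir_deriv 2 G v u = 0"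
proof -
 obtain i where "vcross v u $ i ~= 0" using uv by (auto simp: vec_eq_iff)
 then obtain w where D: "vdet v u w ~= 0" using vdot_axis[of i "vcross v u"] vdot_commute unfolding vdet_alt by metis
 define A Y Z where "A = lincomb (vcross u w) p" and "Y = lincomb (vcross w v) p" and "Z = lincomb (vcross v u) p"
 note bc = tangent_branch_coords[OF br D, folded A_def Y_def Z_def]
 obtain Q where Q: "\<And>y z. G (v + y *s u + z *s w) = ev2 Q y z" using form_plane[OF G(1)] by blast
 note pl = plane_derivatives[OF Q]
 have "coeff (coeff Q 0) 0 = 0" "coeff (coeff Q 0) 1 = 0" "coeff (coeff Q 1) 0 = 0"
  using low[of 0 u] low[of 1 u] low[of 1 w] pl(1)[of 0] pl(1)[of 1] pl(2)[of 1] by (simp_all add: poly_0_coeff_0)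
 then obtain B where B: "\<And>y z. ev2 Q y (y * z) = y\<^sup>2 * ev2 B y z" "poly (coeff B 0) 0 = coeff (coeff Q 0) 2"
  using blow_up by metis
 have ev: "\<forall>\<^sub>F t in at s. ev2 B (poly Y t / poly A t) (poly Z t / poly Y t) = 0"
 proof -
  have "(poly A \<longlongrightarrow> poly A s) (at s)" by (intro tendsto_intros)
  hence 1: "\<forall>\<^sub>F t in at s. poly A t ~= 0" using bc(3) by (rule tendsto_imp_eventually_ne)
  have 2: "\<forall>\<^sub>F t in at s. poly Y t ~= 0"
   using islimpt_finite[OF poly_roots_finite[OF bc(1)], of s] by (simp add: islimpt_iff_eventually)
  show ?thesis using 1 2
  proof eventually_elim
   case (elim t)
   have "ev2 Q (poly Y t / poly A t) ((poly Y t / poly A t) * (poly Z t / poly Y t)) = 0"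
    unfolding Q[symmetric] using plane_coords[OF D, of "pev p t"] elim G(2) by (simp add: A_def Y_def Z_def)
   thus ?case using elim unfolding B(1) by simp
  qed
 qed
 have "((%t. poly Y t / poly A t) \<longlongrightarrow> poly Y s / poly A s) (at s)" by (intro tendsto_intros bc)
 hence "((%t. poly Y t / poly A t) \<longlongrightarrow> 0) (at s)" by (simp add: bc(2))
 from tendsto_ev2[OF this bc(4), of B]
 have "((%t. 0) \<longlongrightarrow> ev2 B 0 0) (at s)" by (rule Lim_transform_eventually) (use ev in \<open>auto elim: eventually_mono\<close>)
 hence "ev2 B 0 0 = 0" by (simp add: tendsto_const_iff)
 moreover have "ev2 B 0 0 = poly (coeff B 0) 0" by (cases B) simp
 ultimately show ?thesis using B(2) pl(1)[of 2] by simp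
qed

text \<open>At a node the quadratic form has u as a simple zero, the other one being w. So the
  blown-up equation is smooth at slope 0 and leaves room for one immersed branch tangent to
  u.\<close>

lemma ordinary_one_branch:
 assumes br: "tangent_branch p v u s0 k" "tangent_branch p v u t0 k'" and alt: "s0 ~= t0 \<or> k \<ge> 2"
  and D: "vdet v u w ~= 0" and G: "is_form n G" "\<And>k t. G (k *s pev p t) = 0"
  and low: "\<And>j w. j < 2 ==> dir_deriv j G v w = 0"
  and G2: "dir_deriv 2 G v u = 0" "dir_deriv 2 G v w = 0" "dir_deriv 2 G v w' ~= 0"
  and N: "finite N" "\<And>s t. s ~= t ==> meet p s t ==> s \<in> N"
 shows False
proof -
 define A Y Z where "A = lincomb (vcross u w) p" and "Y = lincomb (vcross w v) p" and "Z = lincomb (vcross v u) p"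
 note bc = tangent_branch_coords[OF br(1) D, folded A_def Y_def Z_def]
 note bc' = tangent_branch_coords[OF br(2) D, folded A_def Y_def Z_def]
 obtain Q where Q: "\<And>y z. G (v + y *s u + z *s w) = ev2 Q y z" using form_plane[OF G(1)] by blast
 note pl = plane_derivatives[OF Q]
 have q: "coeff (coeff Q 0) 0 = 0" "coeff (coeff Q 0) 1 = 0" "coeff (coeff Q 1) 0 = 0"
  using low[of 0 u] low[of 1 u] low[of 1 w] pl(1)[of 0] pl(1)[of 1] pl(2)[of 1] by (simp_all add: poly_0_coeff_0)
 obtain B where B: "\<And>y z. ev2 Q y (y * z) = y\<^sup>2 * ev2 B y z" "poly (coeff B 1) 0 = coeff (coeff Q 1) 1"
  using blow_up[OF q] by metis
 \<comment> \<open>In the basis u, w of tangents the quadratic form is reduced to its mixed term,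
   which must then be nonzero.\<close>
 have q11: "coeff (coeff Q 1) 1 ~= 0"
 proof
  assume 0: "coeff (coeff Q 1) 1 = 0"
  have d: "dir_deriv 2 G v (y *s u + z *s w) = 0" for y z
   using pl(3)[of y z] pl(1)[of 2] pl(2)[of 2] G2 0 by simp
  have "vdet v u w *s w' = vdet w' u w *s v + (vdet v w' w *s u + vdet v u w' *s w)" by (subst vcramer) (simp add: add.assoc)
  hence "w' = (1 / vdet v u w) *s (vdet w' u w *s v + (vdet v w' w *s u + vdet v u w' *s w))" using D by (metis vector_smult_assoc vector_smult_lid divide_self_if times_divide_eq_left mult_1)
  hence w': "w' = (vdet w' u w / vdet v u w) *s v + 1 *s ((vdet v w' w / vdet v u w) *s u + (vdet v u w' / vdet v u w) *s w)"
   by (simp add: vec_eq_iff)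
  have "dir_deriv 2 G v w' = 0"
   by (subst w', subst dir_deriv_shift[OF G(1) low]) (simp_all add: d del: vector_add_ldistrib)
  thus False using G2 by simp
 qed
 show False
 proof (rule no_common_smooth_branch[where Y = Y and A = A and Q = B and \<zeta> = "%t. poly Z t / poly Y t",
   OF bc(1,2) bc'(2) bc(3) bc'(3) bc(4) bc'(4) _ _ _ N(1)])
  show "poly (coeff B 1) 0 ~= 0" using B q11 by simp
  show "ev2 B (poly Y t / poly A t) (poly Z t / poly Y t) = 0" if "poly A t ~= 0" "poly Y t ~= 0" for t
  proof -
   have "ev2 Q (poly Y t / poly A t) ((poly Y t / poly A t) * (poly Z t / poly Y t)) = 0"
    unfolding Q[symmetric] using plane_coords[OF D, of "pev p t"] that G(2) by (simp add: A_def Y_def Z_def)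
   thus ?thesis using that unfolding B(1) by simp
  qed
  show "s0 ~= t0 \<or> poly (pderiv Y) s0 = 0" using alt bc(5) by blast
  show "s \<in> N" if s: "s ~= t" "poly A s ~= 0" "poly A t ~= 0" "poly Y s ~= 0" "poly Y t ~= 0"
   "poly Y s / poly A s = poly Y t / poly A t" "poly Z s / poly Y s = poly Z t / poly Y t" for s t
  proof -
   have "poly Z r / poly A r = (poly Y r / poly A r) * (poly Z r / poly Y r)" if "poly Y r ~= 0" for r using that by simp
   hence "poly Z s / poly A s = poly Z t / poly A t" using s by metis
   thus ?thesis using N(2)[OF s(1) same_coords_parallel[OF D]] s by (simp add: A_def Y_def Z_def)
  qed
 qed
qed

section \<open>The nodes of the image curve\<close>

lemma span_pair: "vec.span {v, u} = {a *s v + b *s u | a b. True}"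
 unfolding vec.span_insert vec.span_singleton by (auto simp: diff_eq_eq add.commute)

lemma span_pair_shear:
 fixes v u :: "complex ^ 'n"
 assumes "b ~= 0" "c ~= 0"
 shows "vec.span {c *s v, a *s v + b *s u} = vec.span {v, u}"
proof
 show "vec.span {c *s v, a *s v + b *s u} \<subseteq> vec.span {v, u}"
  by (intro vec.span_minimal) (auto intro!: vec.span_add vec.span_scale simp: vec.span_base)
 have v: "v \<in> vec.span {c *s v, a *s v + b *s u}"
  using vec.span_scale[OF vec.span_base[of "c *s v" "{c *s v, a *s v + b *s u}"], of "1 / c"] assms by simp
 have "u = (1 / b) *s ((a *s v + b *s u) - a *s v)" using assms by simp
 also have "\<dots> \<in> vec.span {c *s v, a *s v + b *s u}"
  by (intro vec.span_scale vec.span_diff v vec.span_base) simp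
 finally show "vec.span {v, u} \<subseteq> vec.span {c *s v, a *s v + b *s u}"
  using v by (intro vec.span_minimal) auto
qed

lemma not_in_span: "v ~= 0 ==> w \<notin> vec.span {v} \<longleftrightarrow> vcross v w ~= (0 :: complex ^ 3)"
 using vcross_eq_0_iff[of v w] by (auto simp: vec.span_singleton)

lemma span_pair_eq_imp:
 assumes "vec.span {v, u} = vec.span {v, w}" shows "vdet v u w = (0 :: complex)"
proof -
 have "w \<in> vec.span {v, u}" unfolding assms by (rule vec.span_base) simp
 then obtain a b where "w = a *s v + b *s u" unfolding span_pair by blast
 thus ?thesis by (simp add: v3_simps algebra_simps)
qed

lemma span_pair_eq_if:
 assumes "vcross v u ~= 0" "vcross v w ~= 0" "vdet v u w = (0 :: complex)"
 shows "\<exists>a b. w = a *s v + b *s u \<and> b ~= 0" "vec.span {v, w} = vec.span {v, u}"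
proof -
 obtain a b where ab: "w = a *s v + b *s u" using vdet_eq_0_span[OF assms(1,3)] by blast
 have "b ~= 0"
 proof
  assume "b = 0"
  hence "vcross v w = 0" by (simp add: ab v3_simps)
  thus False using assms(2) by simp
 qed
 thus "\<exists>a b. w = a *s v + b *s u \<and> b ~= 0" "vec.span {v, w} = vec.span {v, u}"
  using ab span_pair_shear[of b 1 v a u] by auto
qed

definition cvec :: "complex ^ 'n => complex ^ 'n" where "cvec v = (\<chi> i. cnj (v $ i))"

lemma cvec_simps [simp]: "cvec (cvec v) = v" "cvec (u + v) = cvec u + cvec v" "cvec (k *s v) = cnj k *s cvec v" "cvec 0 = 0"
 "cvec v $ i = cnj (v $ i)"
 by (simp_all add: cvec_def vec_eq_iff)

lemma conj_subspace_eq: "conj_subspace L = cvec ` L"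
 by (simp add: conj_subspace_def cvec_def)

lemma conj_subspace_twice: "conj_subspace (conj_subspace L) = L"
 by (simp add: conj_subspace_eq image_image)

lemma conj_span: "conj_subspace (vec.span B) = vec.span (cvec ` B)"
proof -
 have 1: "cvec ` vec.span B \<subseteq> vec.span (cvec ` B)" for B :: "(complex ^ 'n) set"
 proof
  fix y assume "y \<in> cvec ` vec.span B"
  then obtain x where x: "x \<in> vec.span B" "y = cvec x" by blast
  have "cvec x \<in> vec.span (cvec ` B)" using x(1)
   by (induction rule: vec.span_induct_alt) (auto intro!: vec.span_add vec.span_scale intro: vec.span_base vec.span_zero)
  thus "y \<in> vec.span (cvec ` B)" by (simp add: x)
 qed
 have "vec.span (cvec ` B) = cvec ` (cvec ` vec.span (cvec ` B))" by (simp add: image_image)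
 also have "\<dots> \<subseteq> cvec ` vec.span (cvec ` cvec ` B)" by (intro image_mono 1)
 also have "cvec ` cvec ` B = B" by (simp add: image_image)
 finally show ?thesis using 1[of B] by (simp add: conj_subspace_eq)
qed

lemma conj_real_subspace: "real_subspace L ==> conj_subspace L = L"
proof -
 assume "real_subspace L"
 then obtain B where B: "\<And>v i. v \<in> B ==> v $ i \<in> \<real>" "L = vec.span B" by (auto simp: real_subspace_def)
 have "cvec v = v" if "v \<in> B" for v using B(1)[OF that] by (simp add: cvec_def vec_eq_iff Reals_cnj_iff[symmetric])
 hence "cvec ` B = B" by force
 thus ?thesis by (simp add: B conj_span)
qed

lemma real_subspace_proj_pt:
 assumes u: "u ~= (0 :: complex ^ 3)"
 shows "real_subspace (proj_pt u) \<longleftrightarrow> vcross u (cvec u) = 0"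
proof
 assume "real_subspace (proj_pt u)"
 from conj_real_subspace[OF this] have "cvec u \<in> proj_pt u"
  unfolding proj_pt_def conj_span by (metis image_insert insertI1 vec.span_base image_empty)
 thus "vcross u (cvec u) = 0" using not_in_span[OF u] by (auto simp: proj_pt_def)
next
 assume "vcross u (cvec u) = 0"
 then obtain l where l: "cvec u = l *s u" using vcross_eq_0_iff[OF u] by blast
 hence l': "cnj (u $ j) = l * u $ j" for j by (simp add: vec_eq_iff)
 obtain i where i: "u $ i ~= 0" using u by (auto simp: vec_eq_iff)
 define w where "w = (1 / u $ i) *s u"
 have "l ~= 0" using l'[of i] i by auto
 hence "cnj (w $ j) = w $ j" for j using l' i by (simp add: w_def)
 hence "w $ j \<in> \<real>" for j by (simp add: Reals_cnj_iff)
 moreover have "proj_pt u = proj_pt w" using proj_pt_eq[OF u] i by (auto simp: w_def intro: exI[of _ "1 / u $ i"])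
 ultimately show "real_subspace (proj_pt u)" unfolding real_subspace_def
  by (intro exI[of _ "{w}"]) (simp add: proj_pt_def)
qed

lemma proj_pt_parallel: "u ~= 0 ==> v ~= 0 ==> proj_pt u = proj_pt v \<longleftrightarrow> vcross u v = (0 :: complex ^ 3)"
 using proj_pt_eq[of u v] vcross_eq_0_iff[of u v] by (metis vector_smult_lzero)

section \<open>Parameters over the nodes\<close>

lemma card_double_cover:
 assumes "finite S" and "\<And>x. x \<in> S ==> \<exists>y. y ~= x \<and> {z \<in> S. f z = f x} = {x, y}"
 shows "card S = 2 * card (f ` S)"
proof -
 have "card {x \<in> S. f x = b} = 2" if b: "b \<in> f ` S" for b
 proof -
  obtain x where x: "x \<in> S" "b = f x" using b by blast
  obtain y where y: "y ~= x" "{z \<in> S. f z = f x} = {x, y}" using assms(2)[OF x(1)] by blast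
  show ?thesis unfolding x(2) y(2) using y(1) by simp
 qed
 hence "(\<Sum>b\<in>f ` S. \<Sum>x\<in>{x \<in> S. f x = b}. 1) = (\<Sum>b\<in>f ` S. 2 :: nat)" by (intro sum.cong) simp_all
 thus ?thesis using sum.image_gen[OF assms(1), of "%_. 1::nat" f] by simp
qed

text \<open>The assumptions \<open>lone\<close> serve both the chart and its reversal: neither the
  point at infinity nor the origin lies over a double point, so equations can be written in either
  chart.\<close>

locale node_curve = c: inflected_curve d \<phi> + inflected p d K F
 for d :: nat and \<phi> :: "complex ^ 2 => complex ^ 3" and p :: "complex poly ^ 3" and K F :: "complex set" +
 fixes a b :: "complex ^ 2"
 assumes ab: "cdet a b ~= 0" and P: "\<And>t. pev p t = \<phi> (t *s a + b)" and top_phi: "top_coeff d p = \<phi> a"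
  and R_phi: "\<And>t. pev (rvec d p) t = \<phi> (t *s b + a)"
  and lone: "\<And>y. cdet a y ~= 0 ==> vcross (\<phi> a) (\<phi> y) ~= 0" "\<And>y. cdet b y ~= 0 ==> vcross (\<phi> b) (\<phi> y) ~= 0"
  and K: "K = {s. proj_pt (s *s a + b) \<in> cusps \<phi>}"
  and sing: "singular_points (image_curve \<phi>) \<subseteq> image_cusps \<phi> \<union> nodes (image_curve \<phi>)"
begin

abbreviation X :: "(complex ^ 3) set set" where "X \<equiv> image_curve \<phi>"

lemma vanishing_iff: "G \<in> vanishing_forms X \<longleftrightarrow> (\<exists>n. is_form n G) \<and> (\<forall>y k. y ~= 0 --> G (k *s \<phi> y) = 0)"
 unfolding vanishing_forms_def image_curve_def by (auto simp: proj_pt_def vec.span_singleton)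

lemma vanishing_p: "G \<in> vanishing_forms X ==> G (k *s pev p t) = 0"
 unfolding P using c.chart_nonzero[OF ab] by (simp add: vanishing_iff)

sublocale pc: poly_curve p d
proof
 show "vcross (pev p t) (top_coeff d p) ~= 0" for t
  using lone(1)[of "t *s a + b"] ab vcross_eq_0_commute unfolding P top_phi by fastforce
qed (use deg nz d3 in auto)

sublocale pr: poly_curve "rvec d p" d
proof
 show "degree (rvec d p $ i) \<le> d" for i using degree_rv[OF deg] by simp
 show "pev (rvec d p) t ~= 0" for t
 proof -
  have "cdet b a ~= 0" using ab cdet_commute[of b a] by simp
  thus ?thesis unfolding R_phi by (intro c.phi_nonzero c.chart_nonzero)
 qed
 show "vcross (pev (rvec d p) t) (top_coeff d (rvec d p)) ~= 0" for t
 proof -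
  have "top_coeff d (rvec d p) = pev p 0" using deg by (simp add: vec_eq_iff coeff_rv poly_0_coeff_0)
  moreover have "vcross (\<phi> b) (\<phi> (t *s b + a)) ~= 0" using lone(2)[of "t *s b + a"] ab cdet_commute[of b a] by simp
  ultimately show ?thesis using vcross_eq_0_commute by (simp add: R_phi P) blast
 qed
qed (use d3 in simp)

lemma smooth_at_finite:
 assumes "\<And>t. t ~= s ==> \<not> meet p s t" "s \<notin> K"
 shows "\<exists>G\<in>vanishing_forms X. \<forall>k. k ~= 0 --> (\<exists>w. dir_deriv 1 G (k *s pev p s) w ~= 0)"
proof -
 have "pev (chi p) s ~= 0" using chi_zero assms(2) by blast
 then obtain M G where G: "is_form M G" "\<And>k t. G (k *s pev p t) = 0" "\<And>k. G (k *s top_coeff d p) = 0"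
  "\<And>k. k ~= 0 ==> \<exists>w. dir_deriv 1 G (k *s pev p s) w ~= 0"
  using pc.smooth_equation[OF assms(1)] by metis
 have "G (k *s \<phi> y) = 0" if "y ~= 0" for k y
  using that
 proof (rule cdet_cases[OF ab])
  fix l assume "y = l *s a"
  thus ?thesis using G(3)[of "k * l ^ d"] by (simp add: c.phi_scale top_phi)
 next
  fix l t assume y: "y = l *s (t *s a + b)"
  show ?thesis using G(2)[of "k * l ^ d" t] unfolding y c.phi_scale P by simp
 qed
 hence "G \<in> vanishing_forms X" using G(1) by (auto simp: vanishing_iff)
 thus ?thesis using G(4) by blast
qed

text \<open>The reversed chart has this point at its origin. The lemma keeps nodes away from
  infinity and also supplies a form in the ideal that is not identically zero.\<close>

lemma smooth_at_infinity: "\<exists>G\<in>vanishing_forms X. \<forall>k. k ~= 0 --> (\<exists>w. dir_deriv 1 G (k *s \<phi> a) w ~= 0)"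
proof -
 have ba: "cdet b a ~= 0" using ab cdet_commute[of b a] by simp
 have s: "vcross (pev (rvec d p) 0) (pev (rvec d p) t) ~= 0" if "t ~= 0" for t
  using lone(1)[of "t *s b + a"] ab that by (simp add: R_phi)
 have "pev (chi (rvec d p)) 0 ~= 0" using chi_R_0 by (simp add: R_def)
 then obtain M G where G: "is_form M G" "\<And>k t. G (k *s pev (rvec d p) t) = 0" "\<And>k. G (k *s top_coeff d (rvec d p)) = 0"
  "\<And>k. k ~= 0 ==> \<exists>w. dir_deriv 1 G (k *s pev (rvec d p) 0) w ~= 0"
  using pr.smooth_equation[OF s] by metis
 have t: "top_coeff d (rvec d p) = \<phi> b" using P[of 0] deg by (simp add: vec_eq_iff coeff_rv poly_0_coeff_0)
 have "G (k *s \<phi> y) = 0" if "y ~= 0" for k y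
  using that
 proof (rule cdet_cases[OF ba])
  fix l assume "y = l *s b"
  thus ?thesis using G(3)[of "k * l ^ d"] by (simp add: c.phi_scale t)
 next
  fix l t assume y: "y = l *s (t *s b + a)"
  show ?thesis using G(2)[of "k * l ^ d" t] unfolding y c.phi_scale R_phi by simp
 qed
 hence "G \<in> vanishing_forms X" using G(1) by (auto simp: vanishing_iff)
 moreover have "pev (rvec d p) 0 = \<phi> a" by (simp add: R_phi)
 ultimately show ?thesis using G(4) by auto
qed

text \<open>The minimum defining the multiplicity is over a nonempty set: a form of the ideal that
  is nonzero at some z has a nonzero derivative at v in the direction z - v.\<close>

lemma curve_mult_attained: "\<exists>G\<in>vanishing_forms X. \<exists>w. dir_deriv (curve_mult X v) G v w ~= 0"
proof -
 obtain G w where G: "G \<in> vanishing_forms X" "dir_deriv 1 G (\<phi> a) w ~= 0"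
  using smooth_at_infinity by (metis vector_smult_lid zero_neq_one)
 obtain n where n: "is_form n G" using G by (auto simp: vanishing_iff)
 obtain q where q: "\<And>t. G (\<phi> a + t *s w) = poly q t" using form_line[OF n] by blast
 have "q ~= 0" using G(2) dir_deriv_line(2)[OF q, of 1] by auto
 then obtain t where "poly q t ~= 0" by (metis poly_all_0_iff_0)
 then obtain z where z: "G z ~= 0" by (metis q)
 obtain r where r: "\<And>t. G (v + t *s (z - v)) = poly r t" using form_line[OF n] by blast
 have "poly r 1 ~= 0" using r[of 1] z by simp
 then obtain m where "coeff r m ~= 0" by (metis poly_0 poly_eqI coeff_0)
 hence "dir_deriv m G v (z - v) ~= 0" using dir_deriv_line(2)[OF r, of m] by simp
 hence "\<exists>m. \<exists>G\<in>vanishing_forms X. \<exists>w. dir_deriv m G v w ~= 0" using G(1) by blast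
 thus ?thesis unfolding curve_mult_def by (rule LeastI_ex)
qed

lemma curve_mult_low: "k < curve_mult X v ==> G \<in> vanishing_forms X ==> dir_deriv k G v w = 0"
 unfolding curve_mult_def using not_less_Least by blast

lemma finite_N: "finite {s. \<exists>t. t ~= s \<and> meet p s t}" by (rule finite_pairs)

lemma in_N: "s ~= t ==> meet p s t ==> s \<in> {s. \<exists>t. t ~= s \<and> meet p s t}"
 by (intro CollectI exI[of _ t] conjI) auto

text \<open>At a cusp P' is a multiple of P, so the tangent direction is P'' and the branch has
  order 2.\<close>

lemma tangent_branch_cases:
 assumes r: "pev p r = x *s v" "x ~= 0"
 obtains "r \<notin> K" "tangent_branch p v (pev (pd p) r) r 1" "vcross v (pev (pd p) r) ~= 0"
 | "r \<in> K" "tangent_branch p v (pev (pd (pd p)) r) r 2" "vcross v (pev (pd (pd p)) r) ~= 0"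
proof -
 define q :: "nat => complex poly ^ 3" where "q = (%k. \<chi> i. ((%e. synthetic_div e r) ^^ k) (p $ i))"
 have q: "dvec k p r t = pev (q k) t" for k t by (simp add: q_def dvec_def dk_def vec_eq_iff)
 have q1: "pev (q 1) r = pev (pd p) r" using dvec_values(2)[of p r] by (simp add: q)
 have q2: "2 *s pev (q 2) r = pev (pd (pd p)) r" using dvec_values(3)[of p r] by (simp only: q)
 have s1: "pev p t = x *s v + (t - r) *s pev (q 1) t" for t
 proof -
  have "pev p t = pev p r + (t - r) *s dvec (Suc 0) p r t" using dvec_step[of 0 p r t] unfolding dvec_values(1) .
  thus ?thesis unfolding r(1) q One_nat_def .
 qed
 show ?thesis
 proof (cases "r \<in> K")
  case False
  have "tangent_branch p v (pev (pd p) r) r 1" unfolding tangent_branch_def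
   by (intro conjI exI[of _ "[:x:]"] exI[of _ "q 1"] exI[of _ 0] exI[of _ 1] allI) (use s1 r q1 in simp_all)
  moreover have "pev (chi p) r ~= 0" using False chi_zero by blast
  hence "vcross v (pev (pd p) r) ~= 0" using r by (auto simp: pev_chi vcross_bilinear)
  ultimately show ?thesis using that(1) False by blast
 next
  case True
  hence c: "vcross (pev p r) (pev (pd p) r) = 0" "cusp_det p r ~= 0"
   using cusp by (simp_all add: pev_chi)
  obtain l where l: "pev (pd p) r = l *s pev p r" using vcross_eq_0_iff[OF nz] c(1) by blast
  have s2: "pev (q 1) t = (l * x) *s v + (t - r) *s pev (q 2) t" for t
   using dvec_step[of 1 p r t] l r unfolding q q1 by (simp add: numeral_2_eq_2)
  have s3: "pev p t = poly [:x - r * (l * x), l * x:] t *s v + (t - r) ^ 2 *s pev (q 2) t" for t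
   unfolding s1 s2 by (simp add: vec_eq_iff power2_eq_square algebra_simps)
  have q2': "pev (q 2) r = 0 *s v + (1 / 2) *s pev (pd (pd p)) r" unfolding q2[symmetric] by simp
  have "tangent_branch p v (pev (pd (pd p)) r) r 2" unfolding tangent_branch_def
   by (intro conjI exI[of _ "[:x - r * (l * x), l * x:]"] exI[of _ "q 2"] exI[of _ 0] exI[of _ "1/2"] allI s3 q2')
    (use r in \<open>simp_all add: algebra_simps\<close>)
  moreover have "vcross v (pev (pd (pd p)) r) ~= 0" using c(2) r by (auto simp: vdet_alt vcross_bilinear vdot_bilinear)
  ultimately show ?thesis using that(2) True by blast
 qed
qed

definition TT :: "complex => (complex ^ 3) set" where "TT s = vec.span {pev p s, pev (pd p) s}"

text \<open>Every branch through the node has one of the two tangents, and each tangent belongs to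
  at most one branch, which is immersed. A single immersed branch would make the point smooth, so
  there are exactly two.\<close>

lemma node_structure:
 assumes odp: "ordinary_double_point X v"
 obtains s t where "s ~= t" "proj_pt v = proj_pt (pev p s)" "proj_pt v = proj_pt (pev p t)" "s \<notin> K" "t \<notin> K"
  "tangent_det p s t ~= 0" "tangent_lines X v = {TT s, TT t}"
  "\<forall>r. proj_pt v = proj_pt (pev p r) --> r = s \<or> r = t"
proof -
 have v: "v ~= 0" "proj_pt v \<in> X" "curve_mult X v = 2" "card (tangent_lines X v) = 2"
  using odp by (auto simp: ordinary_double_point_def)
 have low: "dir_deriv j G v w = 0" if "G \<in> vanishing_forms X" "j < 2" for G j w using curve_mult_low[of j v G w] that v by simp
 obtain G0 w0 where G0: "G0 \<in> vanishing_forms X" "dir_deriv 2 G0 v w0 ~= 0" using curve_mult_attained[of v] v by auto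
 obtain n0 where n0: "is_form n0 G0" using G0 by (auto simp: vanishing_iff)
 have TLi: "vec.span {v, u} \<in> tangent_lines X v" if br: "tangent_branch p v u r k" and u: "vcross v u ~= 0" for u r k
 proof -
  have "dir_deriv 2 G v u = 0" if G: "G \<in> vanishing_forms X" for G
  proof -
   obtain n where "is_form n G" using G by (auto simp: vanishing_iff)
   thus ?thesis using tangent_branch_deriv[OF br u] vanishing_p[OF G] low[OF G] by blast
  qed
  thus ?thesis unfolding tangent_lines_def v(3) using not_in_span[OF v(1)] u by blast
 qed
 have one: "s = t \<and> k < 2" if br: "tangent_branch p v u s k" "tangent_branch p v u t k'" and u: "vcross v u ~= 0" for u s t k k'
 proof (rule ccontr)
  assume n: "\<not> (s = t \<and> k < 2)"
  \<comment> \<open>The second tangent of the node supplies the direction \<open>w\<close> in which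
    the leading form vanishes besides \<open>u\<close>.\<close>
  have "\<exists>T\<in>tangent_lines X v. T ~= vec.span {v, u}" using v(4) TLi[OF br(1) u] by (metis card_2_iff' )
  then obtain w where w: "w \<notin> vec.span {v}" "\<And>G. G \<in> vanishing_forms X ==> dir_deriv 2 G v w = 0" "vec.span {v, w} ~= vec.span {v, u}"
   unfolding tangent_lines_def v(3) by blast
  have "vcross v w ~= 0" using w(1) not_in_span[OF v(1)] by blast
  hence D: "vdet v u w ~= 0" using span_pair_eq_if(2)[OF u] w(3) by blast
  have u2: "dir_deriv 2 G0 v u = 0" by (rule tangent_branch_deriv[OF br(1) u n0 vanishing_p[OF G0(1)] low[OF G0(1)]])
  show False
   by (rule ordinary_one_branch[OF br _ D n0 vanishing_p[OF G0(1)] low[OF G0(1)] u2 w(2)[OF G0(1)] G0(2) finite_N in_N])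
    (use n in auto)
 qed
 have par: "\<exists>x. pev p r = x *s v \<and> x ~= 0" if "proj_pt v = proj_pt (pev p r)" for r
  using that proj_pt_eq[OF v(1)] by blast
 have nK: "r \<notin> K \<and> tangent_branch p v (pev (pd p) r) r 1 \<and> vcross v (pev (pd p) r) ~= 0" if "proj_pt v = proj_pt (pev p r)" for r
 proof -
  obtain x where x: "pev p r = x *s v" "x ~= 0" using par[OF \<open>proj_pt v = proj_pt (pev p r)\<close>] by blast
  show ?thesis
  proof (rule tangent_branch_cases[OF x])
   assume "tangent_branch p v (pev (pd (pd p)) r) r 2" "vcross v (pev (pd (pd p)) r) ~= 0"
   thus ?thesis using one by blast
  qed simp
 qed
 have indep: "vdet v (pev (pd p) r) (pev (pd p) r') ~= 0"
  if r: "proj_pt v = proj_pt (pev p r)" and r': "proj_pt v = proj_pt (pev p r')" and "r ~= r'" for r r'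
 proof
  assume D: "vdet v (pev (pd p) r) (pev (pd p) r') = 0"
  note f = nK[OF r] and f' = nK[OF r']
  obtain e g where eg: "pev (pd p) r' = e *s v + g *s pev (pd p) r" "g ~= 0"
   using span_pair_eq_if(1)[OF _ _ D] f f' by blast
  obtain x q y z where t: "\<forall>t. pev p t = poly x t *s v + (t - r') ^ 1 *s pev q t" "poly x r' ~= 0"
    "pev q r' = y *s v + z *s pev (pd p) r'" "z ~= 0"
   using f' unfolding tangent_branch_def by blast
  have "pev q r' = (y + z * e) *s v + (z * g) *s pev (pd p) r" unfolding t(3) eg(1) by (simp add: vec_eq_iff algebra_simps)
  hence "tangent_branch p v (pev (pd p) r) r' 1" unfolding tangent_branch_def using t(1,2,4) eg(2)
   by (metis mult_eq_0_iff order_refl)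
  thus False using one f \<open>r ~= r'\<close> by blast
 qed
 obtain y where y: "y ~= 0" "proj_pt v = proj_pt (\<phi> y)" using v(2) by (auto simp: image_curve_def)
 \<comment> \<open>The image of infinity is a smooth point, so the node has a finite
   parameter.\<close>
 have "\<exists>s. proj_pt v = proj_pt (pev p s)"
 proof (rule cdet_cases[OF ab y(1)])
  fix k assume k: "k ~= 0" "y = k *s a"
  obtain l where l: "\<phi> y = l *s v" "l ~= 0" using proj_pt_eq[OF v(1)] y(2) by blast
  hence "v = (k ^ d / l) *s \<phi> a" using k by (simp add: c.phi_scale vec_eq_iff field_simps)
  then obtain G w where "G \<in> vanishing_forms X" "dir_deriv 1 G v w ~= 0" using smooth_at_infinity k l by (metis divide_eq_0_iff power_not_zero)
  thus ?thesis using low[of G 1 w] by simp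
 next
  fix k s assume k: "k ~= 0" "y = k *s (s *s a + b)"
  have "\<phi> y = k ^ d *s pev p s" unfolding k(2) c.phi_scale P ..
  hence "proj_pt (pev p s) = proj_pt (\<phi> y)" using proj_pt_eq[OF nz] k(1) by (auto intro!: exI[of _ "k ^ d"])
  thus ?thesis using y by auto
 qed
 then obtain s where s: "proj_pt v = proj_pt (pev p s)" by blast
 obtain x where x: "pev p s = x *s v" "x ~= 0" using par[OF s] by blast
 have "\<exists>t. t ~= s \<and> meet p s t"
 proof (rule ccontr)
  assume "\<not> ?thesis"
  then obtain G where G: "G \<in> vanishing_forms X" "\<And>k. k ~= 0 ==> \<exists>w. dir_deriv 1 G (k *s pev p s) w ~= 0"
   using smooth_at_finite[of s] nK[OF s] by metis
  have "\<exists>w. dir_deriv 1 G v w ~= 0" using G(2)[of "1 / x"] x by simp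
  thus False using low[OF G(1), of 1] by simp
 qed
 then obtain t where t: "t ~= s" "meet p s t" by blast
 hence pt: "proj_pt v = proj_pt (pev p t)" using s proj_pt_parallel[OF nz nz] by auto
 have TT: "TT r = vec.span {v, pev (pd p) r}" if "proj_pt v = proj_pt (pev p r)" for r
  using par[OF that] span_pair_shear[of 1 _ v 0 "pev (pd p) r"] by (auto simp: TT_def)
 have in_TL: "TT r \<in> tangent_lines X v" if "proj_pt v = proj_pt (pev p r)" for r
  unfolding TT[OF that] using TLi nK[OF that] by blast
 have TT_ne: "TT r ~= TT r'" if "proj_pt v = proj_pt (pev p r)" "proj_pt v = proj_pt (pev p r')" "r ~= r'" for r r'
  unfolding TT[OF that(1)] TT[OF that(2)] using indep[OF that] span_pair_eq_imp by blast
 have fin: "finite (tangent_lines X v)" using v(4) by (metis card.infinite zero_neq_numeral)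
 have TL: "tangent_lines X v = {TT s, TT t}"
 proof (rule card_subset_eq[OF fin, symmetric])
  show "{TT s, TT t} \<subseteq> tangent_lines X v" using in_TL s pt by blast
  show "card {TT s, TT t} = card (tangent_lines X v)" using v(4) TT_ne[OF s pt] t(1) by auto
 qed
 have "r = s \<or> r = t" if r: "proj_pt v = proj_pt (pev p r)" for r
  using in_TL[OF r] TT_ne[OF r s] TT_ne[OF r pt] TL by auto
 moreover have "tangent_det p s t ~= 0"
  using indep[OF s pt] t(1) x by (auto simp: vdet_scale)
 ultimately show ?thesis using that[of s t] t(1) s pt nK TL by blast
qed

text \<open>Two branches cannot satisfy an equation that is smooth at the point, so the point is
  singular. It is not a cusp of the image, as such a cusp has only one parameter; the assumption on
  the singularities leaves a node.\<close>

lemma pair_is_node: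
 assumes st: "s ~= t" "meet p s t"
 shows "\<exists>v. ordinary_double_point X v \<and> proj_pt v = proj_pt (pev p s)"
proof -
 let ?v = "pev p s"
 obtain x where x: "pev p t = x *s ?v" using vcross_eq_0_iff[OF nz] st(2) by blast
 hence x0: "x ~= 0" using nz[of t] by auto
 have "curve_mult X ?v \<ge> 2"
 proof (rule ccontr)
  assume "\<not> ?thesis"
  moreover obtain G w where G: "G \<in> vanishing_forms X" "dir_deriv (curve_mult X ?v) G ?v w ~= 0"
   using curve_mult_attained by blast
  moreover have "dir_deriv 0 G ?v w' = 0" for w' using vanishing_p[OF G(1), of 1 s] by (simp add: dir_deriv_def)
  ultimately have D1: "dir_deriv 1 G ?v w ~= 0" "\<And>w'. dir_deriv 0 G ?v w' = 0"
   by (auto simp: not_le less_2_cases_iff)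
  obtain n where n: "is_form n G" using G by (auto simp: vanishing_iff)
  have "vcross ?v w ~= 0"
  proof
   assume "vcross ?v w = 0"
   then obtain k where "w = k *s ?v" using vcross_eq_0_iff[OF nz] by blast
   hence "dir_deriv 1 G ?v w = 0" using dir_deriv_shift[OF n, of 1 ?v 0 k 0] D1(2) by simp
   thus False using D1(1) by simp
  qed
  then obtain i where "vcross ?v w $ i ~= 0" by (auto simp: vec_eq_iff)
  hence "vdet ?v w (axis i 1) ~= 0" using vdot_axis[of i "vcross ?v w"] by (simp add: vdet_alt vdot_commute)
  hence D: "vdet ?v (axis i 1) w ~= 0" using vdet_rotate(3)[of ?v w "axis i 1"] by simp
  \<comment> \<open>Otherwise the whole curve would lie on a line and its Wronskian would vanish
    identically.\<close>
  have "lincomb (vcross w ?v) p ~= 0"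
  proof
   assume z: "lincomb (vcross w ?v) p = 0"
   hence "lincomb (vcross w ?v) (pd p) = 0" "lincomb (vcross w ?v) (pd (pd p)) = 0"
    by (metis pderiv_lincomb pderiv_0)+
   hence o: "vdot (vcross w ?v) (pev p u) = 0" "vdot (vcross w ?v) (pev (pd p) u) = 0" "vdot (vcross w ?v) (pev (pd (pd p)) u) = 0" for u
    using z by (metis poly_lincomb poly_0)+
   have "poly W u = 0" for u
   proof (rule ccontr)
    assume "poly W u ~= 0"
    hence "vcross w ?v = 0"
     using vdot_all_eq_0[of "pev p u" "pev (pd p) u" "pev (pd (pd p)) u" "vcross w ?v"] o[of u] by (simp add: W_def vdot_commute)
    thus False using \<open>vcross ?v w ~= 0\<close> vcross_eq_0_commute by blast
   qed
   thus False using W_nz by (metis poly_all_0_iff_0)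
  qed
  thus False
   by (intro smooth_equation_one_branch[OF D n vanishing_p[OF G(1)] D1(1) finite_N in_N st(1), where x = 1 and x' = x])
    (use x x0 in simp_all)
 qed
 moreover have "proj_pt ?v \<in> X" unfolding image_curve_def P using c.chart_nonzero[OF ab] by blast
 ultimately have "proj_pt ?v \<in> singular_points X" unfolding singular_points_def using nz by blast
 then consider "proj_pt ?v \<in> image_cusps \<phi>" | "proj_pt ?v \<in> nodes X" using sing by blast
 thus ?thesis
 proof cases
  case 1
  then obtain y where "proj_pt ?v = proj_pt (\<phi> y) \<and> y ~= 0 \<and> proj_pt y \<in> cusps \<phi> \<and>
    (\<forall>z. z ~= 0 \<and> proj_pt (\<phi> z) = proj_pt (\<phi> y) --> proj_pt z = proj_pt y)"
   unfolding image_cusps_def mem_Collect_eq by (rule exE)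
  note y = conjunct1[OF this] conjunct2[OF conjunct2[OF conjunct2[OF this]]]
  have "proj_pt ?v = proj_pt (pev p t)" using proj_pt_parallel[OF nz nz, of s t] st(2) by blast
  hence "proj_pt (\<phi> (s *s a + b)) = proj_pt (\<phi> y)" "proj_pt (\<phi> (t *s a + b)) = proj_pt (\<phi> y)"
   using y(1) unfolding P by auto
  hence "proj_pt (s *s a + b) = proj_pt (t *s a + b)"
   using spec[OF y(2), of "s *s a + b"] spec[OF y(2), of "t *s a + b"] c.chart_nonzero[OF ab] by simp
  hence "s = t" using injD[OF c.inj_chart[OF ab]] by blast
  thus ?thesis using st(1) by simp
 next
  case 2 thus ?thesis by (auto simp: nodes_def)
 qed
qed

text \<open>The two parameters that the node supplies must be \<open>s\<close> and \<open>t\<close>,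
  in one order or the other; all claims are symmetric under the exchange.\<close>

lemma pair_facts:
 assumes st: "s ~= t" "meet p s t"
 shows "tangent_det p s t ~= 0" "\<And>r. r ~= s ==> meet p s r ==> r = t"
  "TT s ~= TT t" "ordinary_double_point X v ==> proj_pt v = proj_pt (pev p s) ==> tangent_lines X v = {TT s, TT t}"
proof -
 have key: "tangent_lines X v = {TT s, TT t} \<and> tangent_det p s t ~= 0 \<and>
   (\<forall>r. r ~= s --> meet p s r --> r = t)"
  if v: "ordinary_double_point X v" "proj_pt v = proj_pt (pev p s)" for v
 proof -
  obtain s' t' where n: "s' ~= t'" "proj_pt v = proj_pt (pev p s')" "proj_pt v = proj_pt (pev p t')"
   "tangent_det p s' t' ~= 0" "tangent_lines X v = {TT s', TT t'}"
   "\<forall>r. proj_pt v = proj_pt (pev p r) --> r = s' \<or> r = t'"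
   by (rule node_structure[OF v(1)], rule that, assumption+)
  have pp: "proj_pt v = proj_pt (pev p r) \<longleftrightarrow> meet p s r" for r
   unfolding v(2) by (rule proj_pt_parallel[OF nz nz])
  have "s = s' \<or> s = t'" "t = s' \<or> t = t'" using n(6) v(2) pp[of t] st(2) by auto
  then consider "s = s'" "t = t'" | "s = t'" "t = s'" using st(1) by blast
  thus ?thesis
  proof cases
   case 1
   have "r = t" if "r ~= s" "meet p s r" for r using n(6) pp[of r] that 1 by auto
   thus ?thesis using n(4,5) 1 by simp
  next
   case 2
   obtain x where x: "pev p s' = x *s pev p t'" using vcross_eq_0_iff[OF nz] pp[of s'] n(2) 2 by blast
   have "tangent_det p t' s' ~= 0"
    using n(4) vdet_rotate(3)[of "pev p t'" "pev (pd p) s'"] unfolding x vdet_scale by auto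
   moreover have "r = t" if "r ~= s" "meet p s r" for r using n(6) pp[of r] that 2 by auto
   ultimately show ?thesis using n(5) 2 by auto
  qed
 qed
 obtain v where "ordinary_double_point X v" "proj_pt v = proj_pt (pev p s)" using pair_is_node[OF st] by blast
 note k = key[OF this]
 show D: "tangent_det p s t ~= 0" using k by blast
 show "r = t" if "r ~= s" "meet p s r" for r using k that by blast
 show "TT s ~= TT t"
 proof
  assume e: "TT s = TT t"
  have "pev (pd p) t \<in> TT s" unfolding e unfolding TT_def by (rule vec.span_base) simp
  then obtain x y where "pev (pd p) t = x *s pev p s + y *s pev (pd p) s" unfolding TT_def span_pair by blast
  hence "tangent_det p s t = 0" by (simp add: v3_simps algebra_simps)
  thus False using D by simp
 qed
 show "tangent_lines X v = {TT s, TT t}" if "ordinary_double_point X v" "proj_pt v = proj_pt (pev p s)" for v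
  using key[OF that] by blast
qed

definition N where "N = {s. \<exists>t. t ~= s \<and> meet p s t}"

lemma nodes_eq: "nodes X = (%s. proj_pt (pev p s)) ` N"
proof
 show "nodes X \<subseteq> (%s. proj_pt (pev p s)) ` N"
 proof
  fix L assume "L \<in> nodes X"
  then obtain v where v: "L = proj_pt v" "ordinary_double_point X v" by (auto simp: nodes_def)
  obtain s t where "s ~= t" "proj_pt v = proj_pt (pev p s)" "proj_pt v = proj_pt (pev p t)"
   by (rule node_structure[OF v(2)], rule that, assumption+)
  hence "meet p s t" using proj_pt_parallel[OF nz nz, of s t] by simp
  hence "s \<in> N" "L = proj_pt (pev p s)"
   using \<open>s ~= t\<close> \<open>proj_pt v = proj_pt (pev p s)\<close> v(1) by (auto simp: N_def)
  thus "L \<in> (%s. proj_pt (pev p s)) ` N" by blast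
 qed
 show "(%s. proj_pt (pev p s)) ` N \<subseteq> nodes X"
 proof
  fix L assume "L \<in> (%s. proj_pt (pev p s)) ` N"
  then obtain s where s: "L = proj_pt (pev p s)" "s \<in> N" by blast
  then obtain t where "t ~= s" "meet p s t" by (auto simp: N_def)
  from pair_is_node[OF this(1)[symmetric] this(2)] show "L \<in> nodes X" unfolding nodes_def s(1) by auto
 qed
qed

lemma card_N: "card N + 2 * card K = (d - 1) * (d - 2)"
proof (rule pc.node_count_eq)
 have "pev (chi (rvec d p)) 0 = vcross (top_coeff d p) (\<chi> i. coeff (p $ i) (d - 1))"
 proof -
  have "pev (rvec d p) 0 = top_coeff d p" "pev (pd (rvec d p)) 0 = (\<chi> i. coeff (p $ i) (d - 1))"
   using d3 deg by (simp_all add: vec_eq_iff poly_0_coeff_0 coeff_pderiv coeff_rv)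
  thus ?thesis by (simp add: pev_chi)
 qed
 thus "vcross (top_coeff d p) (\<chi> i. coeff (p $ i) (d - 1)) ~= 0" using chi_R_0 by (simp add: R_def)
 show "finite N" "finite K" using finite_N fin by (simp_all add: N_def)
 show "\<exists>t. t ~= s \<and> meet p s t" if "s \<in> N" for s using that by (simp add: N_def)
 show "s \<in> N \<and> tangent_det p s t ~= 0" if "s ~= t" "meet p s t" for s t
  using pair_facts(1)[OF that] that by (auto simp: N_def)
 show "t = t'" if "s ~= t" "s ~= t'" "meet p s t" "meet p s t'" for s t t'
  using pair_facts(2)[OF that(2,4)] that by metis
 show "pev (chi p) s = 0" if "s \<in> K" for s using chi_zero that by blast
 show "s \<in> K \<and> cusp_det p s ~= 0" if "pev (chi p) s = 0" for s
  using that chi_zero cusp by blast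
qed

text \<open>Every node has exactly two parameters, so a set of parameters closed under passing to
  the partner covers its nodes twice.\<close>

lemma card_image:
 assumes "S \<subseteq> N" "\<And>s t. s \<in> S ==> t ~= s ==> meet p s t ==> t \<in> S"
 shows "card S = 2 * card ((%s. proj_pt (pev p s)) ` S)"
proof (rule card_double_cover)
 show "finite S" using finite_subset[OF assms(1)] finite_N by (simp add: N_def)
 fix s assume s: "s \<in> S"
 then obtain t where t: "t ~= s" "meet p s t" using assms(1) by (auto simp: N_def)
 have "{z \<in> S. proj_pt (pev p z) = proj_pt (pev p s)} = {s, t}"
 proof -
  have "proj_pt (pev p z) = proj_pt (pev p s) \<longleftrightarrow> meet p s z" for z
   using proj_pt_parallel[OF nz nz, of s z] by auto
  moreover have "meet p s z \<longleftrightarrow> z = s \<or> z = t" for z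
  proof -
   have "meet p s s" by (simp add: v3_simps)
   thus ?thesis using pair_facts(2)[OF t(1)[symmetric] t(2), of z] t by blast
  qed
  ultimately show ?thesis using assms(2)[OF s] t s by auto
 qed
 thus "\<exists>y. y ~= s \<and> {z \<in> S. proj_pt (pev p z) = proj_pt (pev p s)} = {s, y}" using t(1) by blast
qed

end

section \<open>Real nodes, solitary points and complex nodes\<close>

locale real_node_curve = node_curve +
 assumes real_coeffs: "\<And>i j. coeff (p $ i) j \<in> \<real>" and real_K: "K \<subseteq> \<real>" and real_F: "F \<subseteq> \<real>"
begin

sublocale real_inflected p d K F
proof
 show "tangent_det p s (cnj s) ~= 0" if "s \<notin> \<real>" "meet p s (cnj s)" for s
  using that pair_facts(1)[of s "cnj s"] Reals_cnj_iff[of s] by metis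
qed (use real_coeffs real_K real_F in auto)

lemma cvec_p: "cvec (pev p s) = pev p (cnj s)" "cvec (pev (pd p) s) = pev (pd p) (cnj s)"
 by (simp_all add: pev_cnj pev_pd_cnj cvec_def)

lemma conj_TT: "conj_subspace (TT s) = TT (cnj s)"
 by (simp add: TT_def conj_span cvec_p)

lemma conj_proj_pt: "conj_subspace (proj_pt (pev p s)) = proj_pt (pev p (cnj s))"
 by (simp add: proj_pt_def conj_span cvec_p)

lemma real_point: "real_subspace (proj_pt (pev p s)) \<longleftrightarrow> meet p s (cnj s)"
 using real_subspace_proj_pt[OF nz, of s] by (simp add: cvec_p)

lemma real_TT: assumes "s \<in> \<real>" shows "real_subspace (TT s)"
proof -
 have "cnj s = s" using assms cnj_real by blast
 hence "cvec (pev p s) = pev p s" "cvec (pev (pd p) s) = pev (pd p) s" by (simp_all add: cvec_p)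
 hence "cnj (pev p s $ i) = pev p s $ i" "cnj (pev (pd p) s $ i) = pev (pd p) s $ i" for i
  by (metis cvec_simps(5))+
 hence "pev p s $ i \<in> \<real>" "pev (pd p) s $ i \<in> \<real>" for i using Reals_cnj_iff by blast+
 thus ?thesis unfolding real_subspace_def TT_def by (intro exI[of _ "{pev p s, pev (pd p) s}"]) auto
qed

lemma par_cnj: "meet p s t ==> meet p (cnj s) (cnj t)"
 using vcross_cnj[of "pev p s" "pev p t"] by (simp add: pev_cnj vec_eq_iff)

lemma solitary_pair:
 assumes "s \<in> solitary" shows "s ~= cnj s" "meet p s (cnj s)" "cnj s \<in> solitary"
proof -
 show a: "s ~= cnj s" "meet p s (cnj s)" using assms by (auto simp: solitary_def cnj_real)
 thus "cnj s \<in> solitary" using vcross_eq_0_commute by (auto simp: solitary_def cnj_real)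
qed

text \<open>Conjugation permutes the two parameters of a real point: it fixes both or exchanges
  them.\<close>

lemma real_node_cases:
 assumes st: "s ~= t" "meet p s t" and re: "real_subspace (proj_pt (pev p s))"
 shows "s \<in> \<real> \<and> t \<in> \<real> \<or> s \<in> solitary \<and> t = cnj s"
proof -
 have a: "meet p s (cnj s)" using re by (simp add: real_point)
 show ?thesis
 proof (cases "cnj s = s")
  case True
  hence "meet p s (cnj t)" using par_cnj[OF st(2)] by simp
  moreover have "cnj t ~= s" using True st(1) by (metis complex_cnj_cnj)
  ultimately have "cnj t = t" using pair_facts(2)[OF st] by blast
  thus ?thesis using True by (simp add: cnj_real)
 next
  case False
  hence "t = cnj s" using pair_facts(2)[OF st, of "cnj s"] a by simp
  thus ?thesis using False a by (simp add: solitary_def cnj_real)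
 qed
qed

lemma node_obtain:
 assumes "L \<in> nodes X"
 obtains s t where "L = proj_pt (pev p s)" "s ~= t" "meet p s t"
proof -
 obtain s where s: "L = proj_pt (pev p s)" "s \<in> N" using assms unfolding nodes_eq by blast
 then obtain t where "t ~= s" "meet p s t" by (auto simp: N_def)
 thus ?thesis using that[of s t] s by auto
qed

text \<open>The tangents at the node are those of its two branches, and conjugation exchanges them
  exactly when it exchanges the parameters.\<close>

lemma solitary_points_eq: "solitary_points X = (%s. proj_pt (pev p s)) ` solitary"
proof (intro subset_antisym subsetI)
 fix L assume "L \<in> solitary_points X"
 then obtain v T where v: "L = proj_pt v" "ordinary_double_point X v" "real_subspace (proj_pt v)" "T ~= conj_subspace T"
  "tangent_lines X v = {T, conj_subspace T}"
  by (auto simp: solitary_points_def)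
 hence "L \<in> nodes X" by (auto simp: nodes_def)
 then obtain s t where s: "L = proj_pt (pev p s)" "s ~= t" "meet p s t" by (rule node_obtain)
 have TL: "tangent_lines X v = {TT s, TT t}" using pair_facts(4)[OF s(2,3) v(2)] v(1) s(1) by simp
 have "\<not> (s \<in> \<real> \<and> t \<in> \<real>)"
 proof
  assume "s \<in> \<real> \<and> t \<in> \<real>"
  hence "conj_subspace (TT s) = TT s" "conj_subspace (TT t) = TT t" using real_TT conj_real_subspace by blast+
  moreover have "T = TT s \<or> T = TT t" using TL v(5) by blast
  ultimately show False using v(4) by auto
 qed
 hence "s \<in> solitary" using real_node_cases[OF s(2,3)] v(1,3) s(1) by auto
 thus "L \<in> (%s. proj_pt (pev p s)) ` solitary" using s(1) by blast
next
 fix L assume "L \<in> (%s. proj_pt (pev p s)) ` solitary"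
 then obtain s where s: "s \<in> solitary" "L = proj_pt (pev p s)" by blast
 note sp = solitary_pair[OF s(1)]
 obtain v where v: "ordinary_double_point X v" "proj_pt v = proj_pt (pev p s)" using pair_is_node[OF sp(1,2)] by blast
 have "TT s ~= conj_subspace (TT s)" using pair_facts(3)[OF sp(1,2)] by (simp add: conj_TT)
 moreover have "tangent_lines X v = {TT s, conj_subspace (TT s)}" using pair_facts(4)[OF sp(1,2) v] by (simp add: conj_TT)
 moreover have "real_subspace (proj_pt v)" using sp(2) v(2) by (simp add: real_point)
 ultimately show "L \<in> solitary_points X" unfolding solitary_points_def s(2) v(2)[symmetric] using v(1) by blast
qed

lemma card_solitary: "card solitary = 2 * card (solitary_points X)"
 unfolding solitary_points_eq
proof (rule card_image)
 show "solitary \<subseteq> N"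
 proof
  fix s assume s: "s \<in> solitary"
  show "s \<in> N" unfolding N_def using solitary_pair[OF s] by (intro CollectI exI[of _ "cnj s"]) auto
 qed
 show "t \<in> solitary" if "s \<in> solitary" "t ~= s" "meet p s t" for s t
 proof -
  note sp = solitary_pair[OF that(1)]
  have "t = cnj s" by (rule pair_facts(2)[OF sp(1,2) that(2,3)])
  thus ?thesis using sp by simp
 qed
qed

lemma real_nodes_eq: "real_nodes X = nodes X - solitary_points X - complex_nodes X"
proof (intro subset_antisym subsetI)
 fix L assume "L \<in> real_nodes X"
 then obtain v where v: "L = proj_pt v" "ordinary_double_point X v" "real_subspace (proj_pt v)" "\<forall>T\<in>tangent_lines X v. real_subspace T"
  by (auto simp: real_nodes_def)
 have n: "L \<in> nodes X" "L \<notin> complex_nodes X" using v by (auto simp: nodes_def complex_nodes_def)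
 have "L \<notin> solitary_points X"
 proof
  assume "L \<in> solitary_points X"
  then obtain s where s: "s \<in> solitary" "L = proj_pt (pev p s)" by (auto simp: solitary_points_eq)
  note sp = solitary_pair[OF s(1)]
  have "TT s \<in> tangent_lines X v" using pair_facts(4)[OF sp(1,2) v(2)] v(1) s(2) by simp
  hence "conj_subspace (TT s) = TT s" using v(4) conj_real_subspace by blast
  thus False using pair_facts(3)[OF sp(1,2)] by (simp add: conj_TT)
 qed
 thus "L \<in> nodes X - solitary_points X - complex_nodes X" using n by blast
next
 fix L assume "L \<in> nodes X - solitary_points X - complex_nodes X"
 hence L: "L \<in> nodes X" "L \<notin> solitary_points X" "real_subspace L" by (auto simp: complex_nodes_def)
 obtain s t where s: "L = proj_pt (pev p s)" "s ~= t" "meet p s t" by (rule node_obtain[OF L(1)])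
 have "s \<notin> solitary" using L(2) s(1) by (auto simp: solitary_points_eq)
 hence re: "s \<in> \<real>" "t \<in> \<real>" using real_node_cases[OF s(2,3)] L(3) s(1) by auto
 obtain v where v: "ordinary_double_point X v" "proj_pt v = proj_pt (pev p s)" using pair_is_node[OF s(2,3)] by blast
 have "\<forall>T\<in>tangent_lines X v. real_subspace T" using pair_facts(4)[OF s(2,3) v] real_TT re by simp
 moreover have "real_subspace (proj_pt v)" using L(3) s(1) v(2) by simp
 ultimately show "L \<in> real_nodes X" unfolding real_nodes_def s(1) v(2)[symmetric] using v(1) by blast
qed

lemma finite_nodes: "finite (nodes X)"
 unfolding nodes_eq using finite_N by (simp add: N_def)

text \<open>Conjugation acts on the complex nodes without fixed points, since a fixed point would be
  real.\<close>

lemma card_complex_nodes: "card (complex_nodes X) = 2 * card (complex_node_pairs X)"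
proof -
 have cc: "conj_subspace L \<in> complex_nodes X \<and> conj_subspace L ~= L" if L: "L \<in> complex_nodes X" for L
 proof -
  have n: "L \<in> nodes X" "\<not> real_subspace L" using L by (auto simp: complex_nodes_def)
  obtain s t where s: "L = proj_pt (pev p s)" "s ~= t" "meet p s t" by (rule node_obtain[OF n(1)])
  have cL: "conj_subspace L = proj_pt (pev p (cnj s))" by (simp add: s(1) conj_proj_pt)
  have "cnj t ~= cnj s" using s(2) by simp
  hence "cnj s \<in> N" unfolding N_def using par_cnj[OF s(3)] by blast
  hence "conj_subspace L \<in> nodes X" unfolding cL nodes_eq by blast
  moreover have nz': "\<not> meet p s (cnj s)" using n(2) unfolding s(1) real_point .
  hence "\<not> real_subspace (conj_subspace L)"
   using vcross_eq_0_commute[of "pev p s" "pev p (cnj s)"] unfolding cL real_point complex_cnj_cnj by blast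
  moreover have "conj_subspace L ~= L"
   using nz' proj_pt_parallel[OF nz nz, of s "cnj s"] unfolding cL unfolding s(1) by metis
  ultimately show ?thesis by (simp add: complex_nodes_def)
 qed
 have "complex_node_pairs X = (%L. {L, conj_subspace L}) ` complex_nodes X" by (auto simp: complex_node_pairs_def)
 moreover have "card (complex_nodes X) = 2 * card ((%L. {L, conj_subspace L}) ` complex_nodes X)"
 proof (rule card_double_cover)
  show "finite (complex_nodes X)" using finite_nodes by (simp add: complex_nodes_def)
  show "\<exists>M. M ~= L \<and> {Z \<in> complex_nodes X. {Z, conj_subspace Z} = {L, conj_subspace L}} = {L, M}" if L: "L \<in> complex_nodes X" for L
   using cc[OF L] L by (intro exI[of _ "conj_subspace L"]) (auto simp: doubleton_eq_iff conj_subspace_twice)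
 qed
 ultimately show ?thesis by simp
qed

lemma card_nodes: "card (solitary_points X) + card (real_nodes X) + 2 * card (complex_node_pairs X) = card (nodes X)"
proof -
 have sub: "solitary_points X \<subseteq> nodes X" "complex_nodes X \<subseteq> nodes X" by (auto simp: solitary_points_def nodes_def complex_nodes_def)
 have dis: "solitary_points X \<inter> complex_nodes X = {}" by (auto simp: solitary_points_def complex_nodes_def)
 have "real_nodes X = nodes X - (solitary_points X \<union> complex_nodes X)" unfolding real_nodes_eq by blast
 hence "card (real_nodes X) = card (nodes X) - card (solitary_points X \<union> complex_nodes X)"
  using sub finite_nodes by (simp add: card_Diff_subset finite_subset)
 moreover have "card (solitary_points X \<union> complex_nodes X) = card (solitary_points X) + card (complex_nodes X)"
  using sub finite_nodes dis by (intro card_Un_disjoint) (auto intro: finite_subset)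
 moreover have "card (solitary_points X \<union> complex_nodes X) \<le> card (nodes X)" using sub finite_nodes by (intro card_mono) auto
 ultimately show ?thesis unfolding card_complex_nodes by linarith
qed

text \<open>Conjugation acts without fixed points on these nonreal parameters. Halving is what lets
  the dual bound be compared with the number of solitary points.\<close>

lemma even_bitangent: "\<exists>\<tau>. card bitangent = 2 * \<tau>"
proof -
 have "card bitangent = 2 * card ((%s. {s, cnj s}) ` bitangent)"
 proof (rule card_double_cover[OF bitangent_count(1)])
  fix s assume s: "s \<in> bitangent"
  hence "cnj s ~= s" by (auto simp: bitangent_def cnj_real)
  thus "\<exists>t. t ~= s \<and> {z \<in> bitangent. {z, cnj z} = {s, cnj s}} = {s, t}"
   using bitangent_facts(1)[OF s] s by (intro exI[of _ "cnj s"]) (auto simp: doubleton_eq_iff)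
 qed
 thus ?thesis by blast
qed

text \<open>The genus count gives the equation. Klein's formula with a nonnegative number of
  bitangents gives the lower bound for \<delta>, and with the bound from the dual curve the upper
  one.\<close>

lemma node_numbers:
 defines "\<delta> \<equiv> card (solitary_points X)" and "\<kappa> \<equiv> card K" and "\<mu> \<equiv> card (real_nodes X) + 2 * card (complex_node_pairs X)"
 shows "2 * (int \<delta> + int \<mu>) + 2 * int \<kappa> = (int d - 1) * (int d - 2)"
  "int d - 2 - int \<kappa> \<le> int \<delta>" "2 * int \<delta> \<le> (2 * int d - 4 - int \<kappa>) * (2 * int d - 5 - int \<kappa>)"
proof -
 have "card N = 2 * card (nodes X)" unfolding nodes_eq
 proof (rule card_image)
  fix s t assume "t ~= s" "meet p s t"
  thus "t \<in> N" unfolding N_def using vcross_eq_0_commute[of "pev p s" "pev p t"] by (intro CollectI exI[of _ s]) auto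
 qed simp
 hence "2 * (\<delta> + \<mu>) + 2 * \<kappa> = (d - 1) * (d - 2)" using card_N card_nodes by (simp add: \<delta>_def \<mu>_def \<kappa>_def)
 hence "int (2 * (\<delta> + \<mu>) + 2 * \<kappa>) = int ((d - 1) * (d - 2))" by (simp only:)
 thus "2 * (int \<delta> + int \<mu>) + 2 * int \<kappa> = (int d - 1) * (int d - 2)" using d3 by (simp add: of_nat_diff)
 obtain \<tau> where \<tau>: "card bitangent = 2 * \<tau>" using even_bitangent by blast
 have \<delta>: "int \<delta> = int \<tau> + (int d - 2) - int \<kappa>" using klein card_solitary \<tau> by (simp add: \<delta>_def \<kappa>_def)
 thus "int d - 2 - int \<kappa> \<le> int \<delta>" by simp
 have "2 * \<tau> + 2 * card F \<le> (m - 1) * (m - 2)" using bitangent_count(2) \<tau> by simp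
 hence "int (2 * \<tau> + 2 * card F) \<le> int ((m - 1) * (m - 2))" by (rule of_nat_mono)
 hence b: "2 * int \<tau> + 2 * int (card F) \<le> int (m - 1) * int (m - 2)"
  unfolding of_nat_add of_nat_mult of_nat_numeral .
 have mm: "int (m - 1) = 2 * int d - 3 - int \<kappa>" "int (m - 2) = 2 * int d - 4 - int \<kappa>"
  using m_def m_facts kappa_le d3 by (simp_all add: \<kappa>_def)
 have F: "int (card F) = 3 * (int d - 2) - 2 * int \<kappa>" using number d3 by (simp add: \<kappa>_def)
 \<comment> \<open>The excess 2 (2 d - 4 - \<kappa>) is precisely 2 \<iota> - 2 (d - 2 - \<kappa>),
   the amount by which twice the number of bitangents and flexes exceeds 2 \<delta>.\<close>
 have e: "(2 * int d - 3 - int \<kappa>) * (2 * int d - 4 - int \<kappa>)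
   = (2 * int d - 4 - int \<kappa>) * (2 * int d - 5 - int \<kappa>) + 2 * (2 * int d - 4 - int \<kappa>)" by (simp add: algebra_simps)
 show "2 * int \<delta> \<le> (2 * int d - 4 - int \<kappa>) * (2 * int d - 5 - int \<kappa>)"
  using b unfolding mm e F \<delta> by simp
qed

end

section \<open>Binomial coefficients and the final inequalities\<close>

lemma int_choose_two: "2 * int (n choose 2) = int n * (int n - 1)"
proof -
 have "2 * (n choose 2) = n * (n - 1)" unfolding choose_two by (rule dvd_mult_div_cancel) (cases n; simp)
 hence "2 * int (n choose 2) = int n * int (n - 1)" by (metis of_nat_mult of_nat_numeral)
 thus ?thesis by (cases n) simp_all
qed

theorem corollary3p3:
  fixes d \<kappa> \<iota> \<delta> \<eta> c :: nat and g\<^sub>\<kappa> :: int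
    and \<phi> :: "complex ^ 2 \<Rightarrow> complex ^ 3"
  assumes "d \<ge> 3"
    and "maximally_inflected d \<phi>"
    and "card (cusps \<phi>) = \<kappa>"
    and "card (flexes \<phi>) = \<iota>"
    and "int \<iota> = 3 * (int d - 2) - 2 * int \<kappa>"
    and "singular_points (image_curve \<phi>) \<subseteq> image_cusps \<phi> \<union> nodes (image_curve \<phi>)"
    and "\<delta> = card (solitary_points (image_curve \<phi>))"
    and "\<eta> = card (real_nodes (image_curve \<phi>))"
    and "c = card (complex_node_pairs (image_curve \<phi>))"
    and "g\<^sub>\<kappa> = int ((d - 1) choose 2) - int \<kappa>"
  shows "int \<delta> + int \<eta> + 2 * int c = g\<^sub>\<kappa> \<and>
    (\<kappa> \<le> d - 2 \<longrightarrow>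
       int d - 2 - int \<kappa> \<le> int \<delta> \<and> int \<delta> \<le> g\<^sub>\<kappa> \<and>
       0 \<le> int \<eta> + 2 * int c \<and> int \<eta> + 2 * int c \<le> int ((d - 2) choose 2)) \<and>
    (d - 2 \<le> \<kappa> \<and> 2 * \<kappa> \<le> 3 * (d - 2) \<longrightarrow>
       0 \<le> int \<delta> \<and> int \<delta> \<le> int ((2 * d - 4 - \<kappa>) choose 2) \<and>
       g\<^sub>\<kappa> - int ((2 * d - 4 - \<kappa>) choose 2) \<le> int \<eta> + 2 * int c \<and>
       int \<eta> + 2 * int c \<le> g\<^sub>\<kappa>)"
proof -
 interpret ic: inflected_curve d \<phi>
 proof
  have "int (2 * card (cusps \<phi>) + card (flexes \<phi>)) = int (3 * (d - 2))" using assms(1,3-5) by (simp add: of_nat_diff)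
  thus "2 * card (cusps \<phi>) + card (flexes \<phi>) = 3 * (d - 2)" by (simp only: of_nat_eq_iff)
 qed (use assms in auto)
 obtain a b p K F where ch: "cdet a b ~= 0" "\<And>i. degree (p $ i) \<le> d" "\<And>t. pev p t = \<phi> (t *s a + b)"
  "top_coeff d p = \<phi> a" "\<And>t. pev (rvec d p) t = \<phi> (t *s b + a)"
  "\<And>y. cdet a y ~= 0 ==> vcross (\<phi> a) (\<phi> y) ~= 0" "\<And>y. cdet b y ~= 0 ==> vcross (\<phi> b) (\<phi> y) ~= 0"
  "inflected p d K F" "K \<subseteq> \<real>" "F \<subseteq> \<real>" "card K = card (cusps \<phi>)" "card F = card (flexes \<phi>)"
  "K = {s. proj_pt (s *s a + b) \<in> cusps \<phi>}" "\<And>i j. coeff (p $ i) j \<in> \<real>"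
  by (rule ic.good_chart, rule that, assumption+)
 interpret inflected p d K F by (rule ch(8))
 interpret real_node_curve d \<phi> p K F a b
  by unfold_locales (fact ch assms(6))+
 define \<mu> where "\<mu> = int \<eta> + 2 * int c"
 have \<kappa>: "card K = \<kappa>" using ch(11) assms(3) by simp
 have n: "2 * (int \<delta> + \<mu>) + 2 * int \<kappa> = (int d - 1) * (int d - 2)"
  "int d - 2 - int \<kappa> \<le> int \<delta>" "2 * int \<delta> \<le> (2 * int d - 4 - int \<kappa>) * (2 * int d - 5 - int \<kappa>)"
  using node_numbers unfolding \<kappa> assms(7-9)[symmetric] by (simp_all add: \<mu>_def)
 have c1: "2 * int ((d - 1) choose 2) = (int d - 1) * (int d - 2)"
  using int_choose_two[of "d - 1"] assms(1) by (simp add: of_nat_diff)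
 have c2: "2 * int ((d - 2) choose 2) = (int d - 1) * (int d - 2) - 2 * (int d - 2)"
  using int_choose_two[of "d - 2"] assms(1) by (simp add: of_nat_diff algebra_simps)
 define Z where "Z = int ((d - 1) choose 2)"
 have g: "int \<delta> + \<mu> = g\<^sub>\<kappa>" using n(1) unfolding c1[symmetric] assms(10) Z_def[symmetric] by simp
 have \<mu>0: "0 \<le> \<mu>" by (simp add: \<mu>_def)
 define B where "B = (int d - 1) * (int d - 2)"
 define Z' where "Z' = int ((d - 2) choose 2)"
 have "\<mu> \<le> int ((d - 2) choose 2)" using n(1,2) c2 unfolding B_def[symmetric] Z'_def[symmetric] by presburger
 moreover have "int \<delta> \<le> int ((2 * d - 4 - \<kappa>) choose 2)" if h: "2 * \<kappa> \<le> 3 * (d - 2)"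
 proof -
  \<comment> \<open>This keeps the subtraction of natural numbers in the binomial coefficient from
    being truncated.\<close>
  have le: "\<kappa> \<le> 2 * d - 4" using h assms(1) by linarith
  have "int (2 * d - 4 - \<kappa>) = 2 * int d - 4 - int \<kappa>" using le assms(1) by (simp add: of_nat_diff)
  hence "2 * int ((2 * d - 4 - \<kappa>) choose 2) = (2 * int d - 4 - int \<kappa>) * (2 * int d - 5 - int \<kappa>)"
   using int_choose_two[of "2 * d - 4 - \<kappa>"] by (simp add: algebra_simps)
  thus ?thesis using n(3) by simp
 qed
 ultimately show ?thesis using g \<mu>0 n(2) unfolding \<mu>_def by auto
qed

end
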